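(* Let $\lambda$ be an uncountable regular cardinal, let $\mu>\lambda$ be an inaccessible cardinal, and let $G$ be $\mathrm{Col}(\lambda,{<}\mu)$-generic over $V$. Then in $V[G]$, every subset of ${}^{\lambda}\lambda$ that is definable from an element of ${}^{\lambda}V$ has the perfect set property. That is: for every first-order formula $\varphi(x,y)$ of set theory and every $z\in V[G]$ which is a function with domain $\lambda$ and values in $V$, the set $A=\{x\in({}^{\lambda}\lambda)^{V[G]}\mid V[G]\models\varphi(x,z)\}$ either has size at most $\lambda$ in $V[G]$ or contains a perfect subset in $V[G]$.
   Context: $\mathrm{Col}(\lambda,{<}\mu)$ is the Levy collapse: conditions are partial functions $p$ from $\mu\times\lambda$ to $\mu$ with $|p|<\lambda$ and $p(\alpha,\xi)<\alpha$ for all $(\alpha,\xi)\in\mathrm{dom}(p)$, ordered by reverse inclusion. For a regular uncountable $\lambda$: a subtree $T\subseteq{}^{<\lambda}\lambda$ (a downward closed set) is perfect if every strictly increasing sequence in $T$ of length ${<}\lambda$ has an upper bound in $T$, and above every node of $T$ there is a splitting node (a node with at least two immediate successors in $T$). A subset of ${}^{\lambda}\lambda$ is perfect if it equals $[T]=\{x\in{}^{\lambda}\lambda\mid\forall\alpha<\lambda\ x{\upharpoonright}\alpha\in T\}$ for some perfect tree $T$. A set $A\subseteq{}^\lambda\lambda$ has the perfect set property if $|A|\le\lambda$ or $A$ has a perfect subset. *)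

theory Defs
  imports Main
begin

text \<open>
  The universe \<open>V\<close> is rendered as an arbitrary, possibly ill-founded, model \<open>(M, E)\<close> of first-order
  ZFC, and \<open>V[G]\<close> as the generic extension of that model by an \<open>M\<close>-generic filter \<open>G\<close>. By the
  completeness theorem, a statement about all such models and all such \<open>G\<close> has the same content as
  the theorem scheme of ZFC about the forcing relation. In particular \<open>(M, E)\<close> may be a countable
  transitive model, where generic filters exist.
\<close>

section \<open>First-order formulas of set theory\<close>

datatype fm = Mem nat nat | Eq nat nat | Neg fm | Conj fm fm | All nat fm

primrec fv :: "fm \<Rightarrow> nat set" where
  "fv (Mem i j) = {i, j}"
| "fv (Eq i j) = {i, j}"
| "fv (Neg \<phi>) = fv \<phi>"
| "fv (Conj \<phi> \<psi>) = fv \<phi> \<union> fv \<psi>"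
| "fv (All i \<phi>) = fv \<phi> - {i}"

primrec sat :: "'a set \<Rightarrow> ('a \<Rightarrow> 'a \<Rightarrow> bool) \<Rightarrow> fm \<Rightarrow> (nat \<Rightarrow> 'a) \<Rightarrow> bool" where
  "sat M E (Mem i j) e \<longleftrightarrow> E (e i) (e j)"
| "sat M E (Eq i j) e \<longleftrightarrow> e i = e j"
| "sat M E (Neg \<phi>) e \<longleftrightarrow> \<not> sat M E \<phi> e"
| "sat M E (Conj \<phi> \<psi>) e \<longleftrightarrow> sat M E \<phi> e \<and> sat M E \<psi> e"
| "sat M E (All i \<phi>) e \<longleftrightarrow> (\<forall>a\<in>M. sat M E \<phi> (e(i := a)))"

section \<open>Set theory inside a structure\<close>

text \<open>
  \<open>E x y\<close> reads ``\<open>x\<close> is an element of \<open>y\<close>''. All notions below are relativized to \<open>(M, E)\<close>; their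
  arguments are meant to be members of \<open>M\<close>.
\<close>

locale membership =
  fixes M :: "'a set" and E :: "'a \<Rightarrow> 'a \<Rightarrow> bool"
begin

definition elts :: "'a \<Rightarrow> 'a set" where
  "elts x = {y \<in> M. E y x}"

definition ZFC :: bool where
  "ZFC \<longleftrightarrow>
     \<comment> \<open>extensionality\<close>
     (\<forall>x\<in>M. \<forall>y\<in>M. elts x = elts y \<longrightarrow> x = y) \<and>
     \<comment> \<open>foundation\<close>
     (\<forall>x\<in>M. elts x \<noteq> {} \<longrightarrow> (\<exists>y\<in>elts x. elts y \<inter> elts x = {})) \<and>
     \<comment> \<open>pairing\<close>
     (\<forall>a\<in>M. \<forall>b\<in>M. \<exists>c\<in>M. elts c = {a, b}) \<and>
     \<comment> \<open>union\<close>
     (\<forall>x\<in>M. \<exists>u\<in>M. elts u = (\<Union>y\<in>elts x. elts y)) \<and>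
     \<comment> \<open>power set\<close>
     (\<forall>x\<in>M. \<exists>s\<in>M. elts s = {y \<in> M. elts y \<subseteq> elts x}) \<and>
     \<comment> \<open>infinity\<close>
     (\<exists>w\<in>M. (\<exists>o'\<in>elts w. elts o' = {}) \<and>
             (\<forall>x\<in>elts w. \<exists>y\<in>elts w. elts y = insert x (elts x))) \<and>
     \<comment> \<open>choice\<close>
     (\<forall>x\<in>M. (\<forall>y\<in>elts x. elts y \<noteq> {}) \<and>
             (\<forall>y\<in>elts x. \<forall>z\<in>elts x. y \<noteq> z \<longrightarrow> elts y \<inter> elts z = {}) \<longrightarrow>
             (\<exists>c\<in>M. \<forall>y\<in>elts x. \<exists>!z. z \<in> elts c \<inter> elts y)) \<and>
     \<comment> \<open>separation scheme, with parameters\<close>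
     (\<forall>\<phi> e. range e \<subseteq> M \<longrightarrow>
        (\<forall>a\<in>M. \<exists>b\<in>M. elts b = {x \<in> elts a. sat M E \<phi> (e(0 := x))})) \<and>
     \<comment> \<open>replacement scheme, with parameters\<close>
     (\<forall>\<phi> e. range e \<subseteq> M \<longrightarrow>
        (\<forall>a\<in>M. (\<forall>x\<in>elts a. \<exists>!y. y \<in> M \<and> sat M E \<phi> (e(0 := x, 1 := y))) \<longrightarrow>
           (\<exists>b\<in>M. elts b = {y \<in> M. \<exists>x\<in>elts a. sat M E \<phi> (e(0 := x, 1 := y))})))"

text \<open>Kuratowski pairs: \<open>z\<close> is \<open>\<langle>x, y\<rangle>\<close>, and \<open>\<langle>x, y\<rangle>\<close> is an element of \<open>r\<close>.\<close>

definition opair :: "'a \<Rightarrow> 'a \<Rightarrow> 'a \<Rightarrow> bool" where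
  "opair z x y \<longleftrightarrow> (\<exists>u\<in>M. \<exists>v\<in>M. elts u = {x} \<and> elts v = {x, y} \<and> elts z = {u, v})"

definition pair_in :: "'a \<Rightarrow> 'a \<Rightarrow> 'a \<Rightarrow> bool" where
  "pair_in r x y \<longleftrightarrow> (\<exists>z\<in>elts r. opair z x y)"

definition func :: "'a \<Rightarrow> 'a \<Rightarrow> bool" where  \<comment> \<open>\<open>f\<close> is a function with domain \<open>d\<close>\<close>
  "func f d \<longleftrightarrow>
     (\<forall>z\<in>elts f. \<exists>x\<in>elts d. \<exists>y\<in>M. opair z x y) \<and>
     (\<forall>x\<in>elts d. \<exists>!y. y \<in> M \<and> pair_in f x y)"

definition func_into :: "'a \<Rightarrow> 'a \<Rightarrow> 'a \<Rightarrow> bool" where  \<comment> \<open>\<open>f : d \<rightarrow> c\<close>\<close>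
  "func_into f d c \<longleftrightarrow> func f d \<and> (\<forall>x\<in>M. \<forall>y\<in>M. pair_in f x y \<longrightarrow> y \<in> elts c)"

definition injection :: "'a \<Rightarrow> 'a \<Rightarrow> 'a \<Rightarrow> bool" where
  "injection f d c \<longleftrightarrow> func_into f d c \<and>
     (\<forall>x\<in>M. \<forall>x'\<in>M. \<forall>y\<in>M. pair_in f x y \<and> pair_in f x' y \<longrightarrow> x = x')"

definition bijection :: "'a \<Rightarrow> 'a \<Rightarrow> 'a \<Rightarrow> bool" where
  "bijection f d c \<longleftrightarrow> injection f d c \<and> (\<forall>y\<in>elts c. \<exists>x\<in>elts d. pair_in f x y)"

definition equipollent :: "'a \<Rightarrow> 'a \<Rightarrow> bool" where
  "equipollent a b \<longleftrightarrow> (\<exists>f\<in>M. bijection f a b)"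

definition card_le :: "'a \<Rightarrow> 'a \<Rightarrow> bool" where  \<comment> \<open>\<open>|a| \<le> |b|\<close>\<close>
  "card_le a b \<longleftrightarrow> (\<exists>f\<in>M. injection f a b)"

definition card_less :: "'a \<Rightarrow> 'a \<Rightarrow> bool" where  \<comment> \<open>\<open>|a| < \<kappa>\<close>, for a cardinal \<open>\<kappa>\<close>\<close>
  "card_less a \<kappa> \<longleftrightarrow> (\<exists>\<alpha>\<in>elts \<kappa>. equipollent a \<alpha>)"

definition transitive :: "'a \<Rightarrow> bool" where
  "transitive x \<longleftrightarrow> (\<forall>y\<in>elts x. elts y \<subseteq> elts x)"

definition ordinal :: "'a \<Rightarrow> bool" where
  "ordinal x \<longleftrightarrow> transitive x \<and> (\<forall>y\<in>elts x. transitive y)"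

definition limit_ordinal :: "'a \<Rightarrow> bool" where
  "limit_ordinal x \<longleftrightarrow> ordinal x \<and> elts x \<noteq> {} \<and> (\<forall>y\<in>elts x. \<exists>z\<in>elts x. y \<in> elts z)"

definition is_omega :: "'a \<Rightarrow> bool" where
  "is_omega w \<longleftrightarrow> limit_ordinal w \<and> (\<forall>y\<in>elts w. \<not> limit_ordinal y)"

definition cardinal :: "'a \<Rightarrow> bool" where
  "cardinal \<kappa> \<longleftrightarrow> ordinal \<kappa> \<and> (\<forall>\<alpha>\<in>elts \<kappa>. \<not> equipollent \<kappa> \<alpha>)"

definition uncountable :: "'a \<Rightarrow> bool" where
  "uncountable x \<longleftrightarrow> (\<exists>w\<in>M. is_omega w \<and> \<not> card_le x w)"

definition uncountable_regular_cardinal :: "'a \<Rightarrow> bool" where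
  "uncountable_regular_cardinal \<kappa> \<longleftrightarrow> cardinal \<kappa> \<and> uncountable \<kappa> \<and>
     \<comment> \<open>no map from a smaller ordinal is cofinal\<close>
     (\<forall>\<alpha>\<in>elts \<kappa>. \<forall>f\<in>M. func_into f \<alpha> \<kappa> \<longrightarrow>
        (\<exists>\<beta>\<in>elts \<kappa>. \<forall>\<xi>\<in>elts \<alpha>. \<forall>\<eta>\<in>M. pair_in f \<xi> \<eta> \<longrightarrow> \<eta> \<in> elts \<beta>))"

definition inaccessible :: "'a \<Rightarrow> bool" where
  "inaccessible \<kappa> \<longleftrightarrow> uncountable_regular_cardinal \<kappa> \<and>
     (\<forall>\<alpha>\<in>elts \<kappa>. \<exists>s\<in>M. elts s = {y \<in> M. elts y \<subseteq> elts \<alpha>} \<and> card_less s \<kappa>)"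


section \<open>Perfect trees and the perfect set property\<close>

text \<open>
  A node of \<open>\<^sup><\<^sup>\<lambda>\<lambda>\<close> is a function from some \<open>\<alpha> < \<lambda>\<close> to \<open>\<lambda>\<close>; the tree order, extension of functions, is
  inclusion of graphs.
\<close>

definition node :: "'a \<Rightarrow> 'a \<Rightarrow> bool" where
  "node lam s \<longleftrightarrow> (\<exists>\<alpha>\<in>elts lam. func_into s \<alpha> lam)"

definition subtree :: "'a \<Rightarrow> 'a \<Rightarrow> bool" where
  "subtree lam T \<longleftrightarrow> (\<forall>s\<in>elts T. node lam s) \<and>
     (\<forall>s\<in>elts T. \<forall>t\<in>M. node lam t \<and> elts t \<subseteq> elts s \<longrightarrow> t \<in> elts T)"

definition increasing_seq :: "'a \<Rightarrow> 'a \<Rightarrow> 'a \<Rightarrow> bool" where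
  "increasing_seq c \<delta> T \<longleftrightarrow> func_into c \<delta> T \<and>
     (\<forall>\<gamma>\<in>elts \<delta>. \<forall>\<beta>\<in>elts \<gamma>. \<forall>s\<in>M. \<forall>t\<in>M.
        pair_in c \<beta> s \<and> pair_in c \<gamma> t \<longrightarrow> elts s \<subset> elts t)"

definition immediate_successor :: "'a \<Rightarrow> 'a \<Rightarrow> 'a \<Rightarrow> bool" where
  "immediate_successor T t u \<longleftrightarrow> u \<in> elts T \<and> elts t \<subset> elts u \<and>
     \<not> (\<exists>v\<in>elts T. elts t \<subset> elts v \<and> elts v \<subset> elts u)"

definition splitting_node :: "'a \<Rightarrow> 'a \<Rightarrow> bool" where
  "splitting_node T t \<longleftrightarrow> t \<in> elts T \<and>
     (\<exists>u v. u \<noteq> v \<and> immediate_successor T t u \<and> immediate_successor T t v)"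

text \<open>
  The sequence of length \<open>0\<close> is a strictly increasing sequence in \<open>T\<close> of length \<open>< \<lambda>\<close>, so a perfect
  tree is nonempty.
\<close>

definition perfect_tree :: "'a \<Rightarrow> 'a \<Rightarrow> bool" where
  "perfect_tree lam T \<longleftrightarrow> subtree lam T \<and>
     (\<forall>\<delta>\<in>elts lam. \<forall>c\<in>M. increasing_seq c \<delta> T \<longrightarrow>
        (\<exists>t\<in>elts T. \<forall>\<beta>\<in>elts \<delta>. \<forall>s\<in>M. pair_in c \<beta> s \<longrightarrow> elts s \<subseteq> elts t)) \<and>
     (\<forall>s\<in>elts T. \<exists>t\<in>elts T. elts s \<subseteq> elts t \<and> splitting_node T t)"

definition branches :: "'a \<Rightarrow> 'a \<Rightarrow> 'a set" where  \<comment> \<open>\<open>[T]\<close>; the node \<open>s\<close> below is \<open>x \<restriction> \<alpha>\<close>\<close>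
  "branches lam T = {x \<in> M. func_into x lam lam \<and>
     (\<forall>\<alpha>\<in>elts lam. \<exists>s\<in>elts T. func s \<alpha> \<and> elts s \<subseteq> elts x)}"

definition perfect_set :: "'a \<Rightarrow> 'a \<Rightarrow> bool" where
  "perfect_set lam B \<longleftrightarrow> (\<exists>T\<in>M. perfect_tree lam T \<and> elts B = branches lam T)"

definition perfect_set_property :: "'a \<Rightarrow> 'a \<Rightarrow> bool" where
  "perfect_set_property lam A \<longleftrightarrow>
     card_le A lam \<or> (\<exists>B\<in>M. perfect_set lam B \<and> elts B \<subseteq> elts A)"


section \<open>Generic extensions\<close>

text \<open>
  A notion of forcing is given by its set \<open>P\<close> of conditions, its order (\<open>le q p\<close>: \<open>q\<close> is stronger than
  \<open>p\<close>) and its largest condition.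
\<close>

definition dense_below :: "'a set \<Rightarrow> ('a \<Rightarrow> 'a \<Rightarrow> bool) \<Rightarrow> 'a \<Rightarrow> 'a set \<Rightarrow> bool" where
  "dense_below P le p D \<longleftrightarrow> (\<forall>q\<in>P. le q p \<longrightarrow> (\<exists>r\<in>P. le r q \<and> r \<in> D))"

text \<open>The filter \<open>G\<close> need not be a member of \<open>M\<close>, but it meets only the dense sets lying in \<open>M\<close>.\<close>

definition generic :: "'a set \<Rightarrow> ('a \<Rightarrow> 'a \<Rightarrow> bool) \<Rightarrow> 'a set \<Rightarrow> bool" where
  "generic P le G \<longleftrightarrow> G \<subseteq> P \<and> G \<noteq> {} \<and>
     (\<forall>p\<in>G. \<forall>q\<in>P. le p q \<longrightarrow> q \<in> G) \<and>
     (\<forall>p\<in>G. \<forall>q\<in>G. \<exists>r\<in>G. le r p \<and> le r q) \<and>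
     (\<forall>D\<in>M. elts D \<subseteq> P \<and> (\<forall>p\<in>P. \<exists>q\<in>elts D. le q p) \<longrightarrow> elts D \<inter> G \<noteq> {})"

text \<open>
  Every member of \<open>M\<close> serves as a name: \<open>\<sigma>\<close> names the set of the values of those \<open>\<pi>\<close> for which
  \<open>\<langle>\<pi>, p\<rangle>\<close> is in \<open>\<sigma>\<close> for some \<open>p\<close> in \<open>G\<close>; elements of \<open>\<sigma>\<close> of any other kind are ignored.

  As \<open>E\<close> may be ill-founded, this cannot be read as a recursion outside of \<open>M\<close>. Which names have the
  same value is therefore given by the relation ``\<open>p\<close> forces \<open>\<sigma> = \<tau>\<close>'', which is defined by recursion
  inside \<open>M\<close>; \<open>forces_eq_step\<close> is the recursion clause (Kunen, ``Set Theory'', 1980, VII.3.3). As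
  always with class recursion, its solution is defined from the set approximations: here \<open>f\<close> in \<open>M\<close>
  solves the recursion on a transitive set \<open>t\<close> of names and codes the relation as a set of triples
  \<open>\<langle>p, \<langle>\<sigma>, \<tau>\<rangle>\<rangle>\<close>.
\<close>

definition forces_eq_step ::
  "'a set \<Rightarrow> ('a \<Rightarrow> 'a \<Rightarrow> bool) \<Rightarrow> ('a \<Rightarrow> 'a \<Rightarrow> 'a \<Rightarrow> bool) \<Rightarrow> 'a \<Rightarrow> 'a \<Rightarrow> 'a \<Rightarrow> bool" where
  "forces_eq_step P le F p \<sigma> \<tau> \<longleftrightarrow>
     (\<forall>\<pi>\<in>M. \<forall>s\<in>P. pair_in \<sigma> \<pi> s \<longrightarrow>
        dense_below P le p
          {q. le q s \<longrightarrow> (\<exists>\<rho>\<in>M. \<exists>r\<in>P. pair_in \<tau> \<rho> r \<and> le q r \<and> F q \<pi> \<rho>)}) \<and>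
     (\<forall>\<rho>\<in>M. \<forall>r\<in>P. pair_in \<tau> \<rho> r \<longrightarrow>
        dense_below P le p
          {q. le q r \<longrightarrow> (\<exists>\<pi>\<in>M. \<exists>s\<in>P. pair_in \<sigma> \<pi> s \<and> le q s \<and> F q \<pi> \<rho>)})"

definition coded_triple :: "'a \<Rightarrow> 'a \<Rightarrow> 'a \<Rightarrow> 'a \<Rightarrow> bool" where
  "coded_triple f p \<sigma> \<tau> \<longleftrightarrow> (\<exists>w\<in>M. opair w \<sigma> \<tau> \<and> pair_in f p w)"

definition forces_eq ::
  "'a set \<Rightarrow> ('a \<Rightarrow> 'a \<Rightarrow> bool) \<Rightarrow> 'a \<Rightarrow> 'a \<Rightarrow> 'a \<Rightarrow> bool" where
  "forces_eq P le p \<sigma> \<tau> \<longleftrightarrow>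
     (\<exists>t\<in>M. \<exists>f\<in>M. transitive t \<and> \<sigma> \<in> elts t \<and> \<tau> \<in> elts t \<and>
        (\<forall>q\<in>P. \<forall>\<sigma>'\<in>elts t. \<forall>\<tau>'\<in>elts t.
           coded_triple f q \<sigma>' \<tau>' \<longleftrightarrow> forces_eq_step P le (coded_triple f) q \<sigma>' \<tau>') \<and>
        coded_triple f p \<sigma> \<tau>)"

text \<open>
  \<open>V[G]\<close>: the value of a name is its class modulo having the same value, and the membership relation
  is the one prescribed by the evaluation of names. If \<open>(M, E)\<close> is well-founded then, for generic \<open>G\<close>,
  this is up to isomorphism the usual \<open>M[G]\<close>.
\<close>

definition same_value :: "'a set \<Rightarrow> ('a \<Rightarrow> 'a \<Rightarrow> bool) \<Rightarrow> 'a set \<Rightarrow> ('a \<times> 'a) set" where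
  "same_value P le G = {(\<sigma>, \<tau>) \<in> M \<times> M. \<exists>p\<in>G. forces_eq P le p \<sigma> \<tau>}"

definition val :: "'a set \<Rightarrow> ('a \<Rightarrow> 'a \<Rightarrow> bool) \<Rightarrow> 'a set \<Rightarrow> 'a \<Rightarrow> 'a set" where
  "val P le G \<sigma> = same_value P le G `` {\<sigma>}"

definition ext_carrier :: "'a set \<Rightarrow> ('a \<Rightarrow> 'a \<Rightarrow> bool) \<Rightarrow> 'a set \<Rightarrow> 'a set set" where
  "ext_carrier P le G = val P le G ` M"

definition ext_mem ::
  "'a set \<Rightarrow> ('a \<Rightarrow> 'a \<Rightarrow> bool) \<Rightarrow> 'a set \<Rightarrow> 'a set \<Rightarrow> 'a set \<Rightarrow> bool" where
  "ext_mem P le G a b \<longleftrightarrow>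
     (\<exists>\<pi>\<in>M. \<exists>\<tau>\<in>M. \<exists>p\<in>G. a = val P le G \<pi> \<and> b = val P le G \<tau> \<and> pair_in \<tau> \<pi> p)"

text \<open>
  The canonical name \<open>{\<langle>name of y, one\<rangle> | y \<in> x}\<close> of \<open>x\<close>, again by recursion inside \<open>M\<close>: the function
  \<open>f\<close> with transitive domain \<open>t\<close> is an approximation. \<open>ext_embed\<close> is the inclusion of \<open>V\<close> in \<open>V[G]\<close>.
\<close>

definition check_name :: "'a \<Rightarrow> 'a \<Rightarrow> 'a \<Rightarrow> bool" where
  "check_name one x c \<longleftrightarrow>
     (\<exists>t\<in>M. \<exists>f\<in>M. transitive t \<and> x \<in> elts t \<and> func f t \<and>
        (\<forall>y\<in>elts t. \<forall>n\<in>M. pair_in f y n \<longrightarrow>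
           elts n = {z \<in> M. \<exists>w\<in>elts y. \<exists>m\<in>M. pair_in f w m \<and> opair z m one}) \<and>
        pair_in f x c)"

definition ext_embed ::
  "'a set \<Rightarrow> ('a \<Rightarrow> 'a \<Rightarrow> bool) \<Rightarrow> 'a \<Rightarrow> 'a set \<Rightarrow> 'a \<Rightarrow> 'a set" where
  "ext_embed P le one G x = val P le G (THE c. c \<in> M \<and> check_name one x c)"


section \<open>The Levy collapse\<close>

definition Col :: "'a \<Rightarrow> 'a \<Rightarrow> 'a set" where
  "Col lam mu = {p \<in> M.
     (\<forall>z\<in>elts p. \<exists>\<alpha>\<in>elts mu. \<exists>\<xi>\<in>elts lam. \<exists>d\<in>M. \<exists>\<beta>\<in>elts mu.
        opair d \<alpha> \<xi> \<and> opair z d \<beta> \<and> \<beta> \<in> elts \<alpha>) \<and>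
     (\<forall>d\<in>M. \<forall>\<beta>\<in>M. \<forall>\<gamma>\<in>M. pair_in p d \<beta> \<and> pair_in p d \<gamma> \<longrightarrow> \<beta> = \<gamma>) \<and>
     card_less p lam}"

definition Col_le :: "'a \<Rightarrow> 'a \<Rightarrow> bool" where
  "Col_le q p \<longleftrightarrow> elts p \<subseteq> elts q"

definition Col_one :: 'a where  \<comment> \<open>the empty condition\<close>
  "Col_one = (THE x. x \<in> M \<and> elts x = {})"

end

end

theory Submission
 imports Defs
begin

text \<open>Choose \<open>al < mu\<close> such that \<open>z\<close> is read off the columns of the collapse below \<open>al\<close>. If all elements of the
 definable set are read off these columns as well, then a further column enumerates the candidates in type
 \<open>lam\<close>, and the set has size at most \<open>lam\<close>. Otherwise it has an element, with a name \<open>tx\<close> in the columns below some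
 \<open>be\<close>, such that the quotient over \<open>al\<close> keeps deciding \<open>tx\<close> in different ways. Reading one column \<open>gc\<close> as a list of
 instructions, we grow a tree of partial decisions about \<open>tx\<close>. Genericity makes it perfect, and a branch \<open>y\<close>
 runs through a filter for the columns below \<open>be\<close> that evaluates \<open>tx\<close> to \<open>y\<close> and agrees with the generic below \<open>al\<close>.
 The quotients of the collapse over this filter and over the given generic are both absorbed by a
 large column \<open>ka\<close>. The resulting isomorphism of dense suborders moves \<open>tx\<close> to a name of \<open>y\<close> and fixes the value of
 \<open>z\<close>, so that \<open>y\<close> satisfies the formula, too.\<close>

text \<open>Two obstacles shape the proof. First, \<open>(M, E)\<close> may be ill-founded and
  \<open>G\<close> need not be in \<open>M\<close>. Induction and recursion over names therefore
  cannot run in HOL, and every predicate to which separation, foundation or genericity is applied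
  has to be definable over \<open>M\<close>; hence the calculus of \<open>dfn\<close> and
  \<open>dft\<close>. Second, for uncountable \<open>lam\<close> an arbitrary filter for the columns
  below \<open>be\<close> may leave a quotient that is not \<open>lam\<close>-closed, and then a
  collapse column cannot be expected to absorb it. The tree must control the quotients of all its
  branches at once. For this reason each node carries along the conditions (states) that decide it.
  Triples of a condition, a node and its states form a \<open>lam\<close>-closed order; enlarged to
  \<open>EE\<close>, it projects continuously both to the collapse seen by the given generic and to
  the one seen by the branch. Closure of \<open>EE\<close>, and its size below \<open>mu\<close>,
  allow one column \<open>ka\<close> to code paths through \<open>EE\<close> for both projections,
  and comparing the two codes gives the isomorphism.\<close>

notation iff (infixr "<->" 25)

section \<open>Definability with parameters\<close>

primrec ren :: "(nat => nat) => fm => fm" where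
 "ren f (Mem i j) = Mem (f i) (f j)"
| "ren f (Eq i j) = Eq (f i) (f j)"
| "ren f (Neg p) = Neg (ren f p)"
| "ren f (Conj p q) = Conj (ren f p) (ren f q)"
| "ren f (All i p) = All (f i) (ren f p)"

lemma upd_o: "inj f ==> (e(f i := a)) o f = (e o f)(i := a)"
 by (rule ext) (simp add: inj_eq)

lemma sat_ren: "inj f ==> sat M E (ren f p) e = sat M E p (e o f)"
 by (induction p arbitrary: e) (simp_all add: upd_o)

definition mix :: "(nat => 'a) => (nat => 'a) => nat => 'a" where
 "mix e c i = (if even i then e (i div 2) else c (i div 2))"

lemma mix_simps [simp]: "mix e c (2*i) = e i" "mix e c (Suc (2*i)) = c i" "mix e c 0 = e 0"
 by (simp_all add: mix_def)

lemma par_cases: obtains k where "n = 2*k" | k where "n = Suc (2*k)"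
 by (metis evenE oddE Suc_eq_plus1)

lemma inj_par: assumes "!!j k. f (2*j) = f (2*k) ==> j = k" "!!j k. f (Suc (2*j)) = f (Suc (2*k)) ==> j = k"
  "!!j k. f (2*j) ~= f (Suc (2*k))" shows "inj f"
proof (rule injI)
 fix x y assume a: "f x = f y"
 show "x = y" by (rule par_cases[of x]; rule par_cases[of y])
   (use a assms(1,2) assms(3)[symmetric] assms(3) in \<open>auto dest: assms(1,2)\<close>)
qed

context membership begin

abbreviation el (infix "el" 55) where "x el y == x : elts y"
abbreviation sub (infix "sub" 55) where "x sub y == elts x <= elts y"

text \<open>Predicates of an environment that are first-order definable over the structure, parameters
 from \<open>M\<close> allowed. The introduction rules read off a definition from the HOL term: a quantifier
 binds the new variable \<open>e 0\<close> and shifts the others. In \<open>mix e c\<close> the variables have the even and the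
 parameters the odd indices.\<close>

definition dfn :: "((nat => 'a) => bool) => bool" where
 "dfn P = (EX p c. (ALL i. c i : M) & (ALL e. (ALL i. e i : M) --> P e = sat M E p (mix e c)))"

definition dft :: "((nat => 'a) => 'a) => bool" where
 "dft T = ((ALL e. (ALL i. e i : M) --> T e : M) & dfn (%e. e 0 = T (%i. e (Suc i))))"

named_theorems dfi

lemma el_M [simp, dest]: "x el y ==> x : M" by (simp add: elts_def)

lemma dfn_cong: "(!!e. ALL i. e i : M ==> P e = Q e) ==> dfn P ==> dfn Q"
 unfolding dfn_def by metis

lemma dfn_ren: assumes P: "dfn P" and f: "inj f" shows "dfn (%e. P (%i. e (f i)))"
proof -
 obtain p c where c: "ALL i. c i : M" and p: "!!e. ALL i. e i : M ==> P e = sat M E p (mix e c)"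
  using P unfolding dfn_def by metis
 define g where "g n = (if even n then 2 * f (n div 2) else n)" for n
 have g: "g (2*k) = 2 * f k" "g (Suc (2*k)) = Suc (2*k)" for k by (simp_all add: g_def)
 have ig: "inj g" by (rule inj_par; unfold g) (use f in \<open>auto simp: inj_eq, presburger\<close>)
 have "mix e c o g = mix (%i. e (f i)) c" for e
 proof
  fix n show "(mix e c o g) n = mix (%i. e (f i)) c n" by (rule par_cases[of n]) (simp_all add: g)
 qed
 then have "ALL e. (ALL i. e i : M) --> P (%i. e (f i)) = sat M E (ren g p) (mix e c)"
  by (simp add: sat_ren[OF ig] p)
 then show ?thesis unfolding dfn_def using c by metis
qed

lemma dfn_not [dfi]: "dfn P ==> dfn (%e. ~ P e)"
 unfolding dfn_def by (metis sat.simps(3))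

lemma dfn_conj [dfi]: assumes "dfn P" "dfn Q" shows "dfn (%e. P e & Q e)"
proof -
 obtain p c where c: "ALL i. c i : M" and p: "!!e. ALL i. e i : M ==> P e = sat M E p (mix e c)"
  using assms(1) unfolding dfn_def by metis
 obtain q d where d: "ALL i. d i : M" and q: "!!e. ALL i. e i : M ==> Q e = sat M E q (mix e d)"
  using assms(2) unfolding dfn_def by metis
 \<comment> \<open>The parameters of the two formulas are interleaved: those of \<open>P\<close> go
   to the even and those of \<open>Q\<close> to the odd places of \<open>mix c d\<close>.\<close>
 define f where "f n = (if even n then n else 2*n - Suc 0)" for n :: nat
 define g where "g n = (if even n then n else 2*n + Suc 0)" for n :: nat
 have f: "f (2*k) = 2*k" "f (Suc (2*k)) = Suc (2*(2*k))" for k by (simp_all add: f_def)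
 have g: "g (2*k) = 2*k" "g (Suc (2*k)) = Suc (2*Suc (2*k))" for k by (simp_all add: g_def)
 have i: "inj f" "inj g" by (rule inj_par; unfold f g; presburger)+
 have m: "mix e (mix c d) o f = mix e c" "mix e (mix c d) o g = mix e d" for e
 proof -
  show "mix e (mix c d) o f = mix e c"
  proof
   fix n show "(mix e (mix c d) o f) n = mix e c n"
    by (rule par_cases[of n]) (simp_all only: o_def f mix_simps)
  qed
  show "mix e (mix c d) o g = mix e d"
  proof
   fix n show "(mix e (mix c d) o g) n = mix e d n"
    by (rule par_cases[of n]) (simp_all only: o_def g mix_simps)
  qed
 qed
 have "ALL i. mix c d i : M" using c d by (simp add: mix_def)
 moreover have "ALL e. (ALL i. e i : M) --> (P e & Q e) =
   sat M E (Conj (ren f p) (ren g q)) (mix e (mix c d))"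
  by (simp add: sat_ren[OF i(1)] sat_ren[OF i(2)] m p q)
 ultimately show ?thesis unfolding dfn_def by metis
qed

text \<open>The free variables occupy all even indices, so the variable to be bound moves to index
  1. This is parameter slot 0, whose dummy content \<open>b\<close> is overwritten; the genuine
  parameters shift by one.\<close>

lemma dfn_shift: assumes "dfn (%e. Q (e 0) (%i. e (Suc i)))"
 obtains p c where "ALL i. c i : M"
  "!!e a b. ALL i. e i : M ==> a : M ==> Q a e = sat M E p ((mix e (case_nat b c))(1 := a))"
proof -
 obtain p c where c: "ALL i. c i : M" and
  p: "!!e. ALL i. e i : M ==> Q (e 0) (%i. e (Suc i)) = sat M E p (mix e c)"
  using assms unfolding dfn_def by metis
 define f where "f n = (if n = 0 then 1 else if even n then n - 2 else n + 2)" for n :: nat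
 have f: "f 0 = 1" "f (2*Suc k) = 2*k" "f (Suc (2*k)) = Suc (2*Suc k)" for k by (simp_all add: f_def)
 have f': "f (2*k) = (case k of 0 => 1 | Suc l => 2*l)" for k using f by (simp split: nat.split)
 have i: "inj f" by (rule inj_par; unfold f' f(3)) (auto split: nat.splits, presburger)
 have m: "(mix e (case_nat b c))(1 := a) o f = mix (case_nat a e) c" for e a b
 proof
  fix n show "((mix e (case_nat b c))(1 := a) o f) n = mix (case_nat a e) c n"
  proof (rule par_cases[of n])
   fix k assume n: "n = 2*k" show ?thesis
   proof (cases k)
    case 0 then show ?thesis by (simp add: n f)
   next
    case (Suc l)
    have "2*l ~= (1::nat)" by presburger
    then show ?thesis unfolding n Suc o_def f using mix_simps(1)[of "case_nat a e" c "Suc l"] by simp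
   qed
  next
   fix k assume n: "n = Suc (2*k)" show ?thesis unfolding n o_def f by (simp add: mix_def)
  qed
 qed
 have "Q a e = sat M E (ren f p) ((mix e (case_nat b c))(1 := a))" if "ALL i. e i : M" "a : M" for e a b
  using p[of "case_nat a e"] that unfolding sat_ren[OF i] m by (simp split: nat.split)
 then show ?thesis using that c by blast
qed

lemma dfn_all [dfi]: assumes "dfn (%e. Q (e 0) (%i. e (Suc i)))" shows "dfn (%e. ALL a:M. Q a e)"
proof (rule dfn_shift[OF assms])
 fix p c assume c: "ALL i. c i : M" and
  p: "!!e a b. ALL i. e i : M ==> a : M ==> Q a e = sat M E p ((mix e (case_nat b c))(1 := a))"
 have "ALL e. (ALL i. e i : M) --> (ALL a:M. Q a e) = sat M E (All 1 p) (mix e (case_nat (c 0) c))"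
  using p[where b="c 0"] by simp
 moreover have "ALL i. case_nat (c 0) c i : M" using c by (simp split: nat.split)
 ultimately show ?thesis unfolding dfn_def by blast
qed

text \<open>The slot that \<open>dfn_shift\<close> sets free holds the new parameter
  \<open>a\<close> itself.\<close>

lemma dfn_par: assumes "dfn (%e. Q (e 0) (%i. e (Suc i)))" "a : M" shows "dfn (Q a)"
proof (rule dfn_shift[OF assms(1)])
 fix p c assume c: "ALL i. c i : M" and
  p: "!!e a b. ALL i. e i : M ==> a : M ==> Q a e = sat M E p ((mix e (case_nat b c))(1 := a))"
 have "(mix e (case_nat a c))(1 := a) = mix e (case_nat a c)" for e
  by (rule ext) (simp add: mix_def)
 then have "ALL e. (ALL i. e i : M) --> Q a e = sat M E p (mix e (case_nat a c))"
  using p[where b=a and a=a] assms(2) by simp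
 moreover have "ALL i. case_nat a c i : M" using c assms(2) by (simp split: nat.split)
 ultimately show ?thesis unfolding dfn_def by blast
qed

lemma dfn_w1: "dfn (%e. Q (e 0) (%i. e (Suc i))) ==> dfn (%e. Q (e 0) (%i. e (Suc (Suc i))))"
 using dfn_ren[of "%e. Q (e 0) (%i. e (Suc i))" "case_nat 0 (%i. Suc (Suc i))"]
 by (auto simp: inj_def split: nat.splits)

lemma dft_w: assumes "dft T" shows "dft (%e. T (%i. e (Suc i)))"
 using assms dfn_w1[of "%a e. a = T e"] unfolding dft_def by simp

lemma dft_M: "dft T ==> ALL i. e i : M ==> T e : M" by (simp add: dft_def)

end

locale nonempty = membership + assumes M_ne: "M ~= {}"
begin

lemma dfn_vars: "dfn (%e. E (e i) (e j))" "dfn (%e. e i = e j)"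
proof -
 obtain m where m: "m : M" using M_ne by blast
 show "dfn (%e. E (e i) (e j))" unfolding dfn_def
  by (rule exI[of _ "Mem (2*i) (2*j)"], rule exI[of _ "%_. m"]) (simp add: m)
 show "dfn (%e. e i = e j)" unfolding dfn_def
  by (rule exI[of _ "Eq (2*i) (2*j)"], rule exI[of _ "%_. m"]) (simp add: m)
qed

lemma dft_var [dfi]: "dft (%e. e i)"
 unfolding dft_def using dfn_vars(2)[of 0 "Suc i"] by simp

lemma dft_const [dfi]: "a : M ==> dft (%e. a)"
 unfolding dft_def using dfn_par[of "%a e. e 0 = a"] dfn_vars(2)[of "Suc 0" 0] by simp

lemma dfn_const [dfi]: "dfn (%e. b)"
proof -
 have "dfn (%e. ~ (ALL a:M. ~ a = a))" "dfn (%e. ALL a:M. ~ a = a)" by (intro dfi dfn_vars)+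
 then show ?thesis using M_ne by (cases b) (auto elim!: dfn_cong[rotated])
qed

lemma dfn_imp [dfi]: "dfn P ==> dfn Q ==> dfn (%e. P e --> Q e)"
 and dfn_disj [dfi]: "dfn P ==> dfn Q ==> dfn (%e. P e | Q e)"
 and dfn_iff [dfi]: "dfn P ==> dfn Q ==> dfn (%e. P e = Q e)"
proof -
 assume P: "dfn P" and Q: "dfn Q"
 show "dfn (%e. P e --> Q e)" by (rule dfn_cong[where P="%e. ~ (P e & ~ Q e)"], blast) (intro dfi P Q)
 show "dfn (%e. P e | Q e)" by (rule dfn_cong[where P="%e. ~ (~ P e & ~ Q e)"], blast) (intro dfi P Q)
 show "dfn (%e. P e = Q e)" by (rule dfn_cong[where P="%e. ~ (P e & ~ Q e) & ~ (~ P e & Q e)"], blast) (intro dfi P Q)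
qed

lemma dfn_ex [dfi]: "dfn (%e. Q (e 0) (%i. e (Suc i))) ==> dfn (%e. EX a:M. Q a e)"
 by (rule dfn_cong[where P="%e. ~ (ALL a:M. ~ Q a e)"], blast) (intro dfi)

lemma dfn_sub: assumes Q: "dfn (%e. Q (e 0) (%i. e (Suc i)))" and T: "dft T" shows "dfn (%e. Q (T e) e)"
proof (rule dfn_cong[where P="%e. EX a:M. a = T e & Q a e"])
 show "dfn (%e. EX a:M. a = T e & Q a e)" using T[unfolded dft_def] by (intro dfi Q) auto
qed (use dft_M[OF T] in auto)

text \<open>This yields \<open>dfn1\<close> to \<open>dfn5\<close>: definability of a named
  predicate is checked once, at plain variables, and then holds at all definable terms.\<close>

lemma dfn_many: "dfn P ==> (!!i. dft (T i)) ==> dfn (%e. P (%i. if i < n then T i e else e (i - n)))"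
proof (induction n arbitrary: T)
 case 0 then show ?case by simp
next
 case (Suc n)
 have "dfn (%e. P (%i. if i < n then T i (%i. e (Suc i)) else e (i - n)))"
  by (rule Suc.IH[of "%i e. T i (%i. e (Suc i))"]) (use Suc.prems dft_w in auto)
 moreover have "(%i. if i < n then T i (%i. e (Suc i)) else e (i - n)) =
   (%i. if i < n then T i (%i. e (Suc i)) else if i = n then e 0 else e (Suc (i - Suc n)))" for e :: "nat => 'a"
  by (rule ext) (simp add: Suc_diff_Suc)
 ultimately have "dfn (%e. P (%i. if i < n then T i (%i. e (Suc i)) else if i = n then e 0 else e (Suc (i - Suc n))))"
  by simp
 then have "dfn (%e. P (%i. if i < n then T i e else if i = n then T n e else e (i - Suc n)))"
  by (rule dfn_sub[of "%a e. P (%i. if i < n then T i e else if i = n then a else e (i - Suc n))", OF _ Suc.prems(2)])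
 then show ?case by (rule dfn_cong[rotated]) (rule arg_cong[of _ _ P], auto simp: less_Suc_eq)
qed

lemma dfn1: "dfn (%e. P (e 0)) ==> dft A ==> dfn (%e. P (A e))"
 using dfn_many[of "%e. P (e 0)" "%_. A" 1] by simp

lemma dfn2: "dfn (%e. P (e 0) (e 1)) ==> dft A ==> dft B ==> dfn (%e. P (A e) (B e))"
 using dfn_many[of "%e. P (e 0) (e 1)" "%i. if i = 0 then A else B" 2] by simp

lemma dfn3: "dfn (%e. P (e 0) (e 1) (e 2)) ==> dft A ==> dft B ==> dft C ==> dfn (%e. P (A e) (B e) (C e))"
 using dfn_many[of "%e. P (e 0) (e 1) (e 2)" "%i. if i = 0 then A else if i = 1 then B else C" 3] by simp

lemma dfn4: "dfn (%e. P (e 0) (e 1) (e 2) (e 3)) ==> dft A ==> dft B ==> dft C ==> dft D ==>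
  dfn (%e. P (A e) (B e) (C e) (D e))"
 using dfn_many[of "%e. P (e 0) (e 1) (e 2) (e 3)"
  "%i. if i = 0 then A else if i = 1 then B else if i = 2 then C else D" 4] by simp

lemma dfn5: "dfn (%e. P (e 0) (e 1) (e 2) (e 3) (e 4)) ==> dft A ==> dft B ==> dft C ==> dft D ==> dft F ==>
  dfn (%e. P (A e) (B e) (C e) (D e) (F e))"
 using dfn_many[of "%e. P (e 0) (e 1) (e 2) (e 3) (e 4)"
  "%i. if i = 0 then A else if i = 1 then B else if i = 2 then C else if i = 3 then D else F" 5] by simp

lemma dft1: "dft (%e. T (e 0)) ==> dft A ==> dft (%e. T (A e))"
 unfolding dft_def[of "%e. T (A e)"]
proof (intro conjI)
 assume T: "dft (%e. T (e 0))" and A: "dft A"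
 show "ALL e. (ALL i. e i : M) --> T (A e) : M"
  using dft_M[OF A] dft_M[OF T, of "%_. A e" for e] by auto
 show "dfn (%e. e 0 = T (A (%i. e (Suc i))))"
  by (rule dfn2[of "%x a. x = T a"]) (use T in \<open>simp add: dft_def\<close>, auto intro: dft_var dft_w A)
qed

lemma dft2: "dft (%e. T (e 0) (e 1)) ==> dft A ==> dft B ==> dft (%e. T (A e) (B e))"
 unfolding dft_def[of "%e. T (A e) (B e)"]
proof (intro conjI)
 assume T: "dft (%e. T (e 0) (e 1))" and A: "dft A" and B: "dft B"
 show "ALL e. (ALL i. e i : M) --> T (A e) (B e) : M"
  using dft_M[OF A] dft_M[OF B] dft_M[OF T, of "case_nat (A e) (%_. B e)" for e] by (auto split: nat.split)
 show "dfn (%e. e 0 = T (A (%i. e (Suc i))) (B (%i. e (Suc i))))"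
  by (rule dfn3[of "%x a b. x = T a b"]) (use T in \<open>simp add: dft_def numeral_2_eq_2\<close>, auto intro: dft_var dft_w A B)
qed
lemma dfn_el [dfi]: "dft A ==> dft B ==> dfn (%e. A e el B e)"
proof (rule dfn2[of "%a b. a el b"])
 show "dfn (%e. e 0 el e 1)" by (rule dfn_cong[where P="%e. E (e 0) (e 1)"], simp add: elts_def del: el_M) (rule dfn_vars)
qed

lemma dfn_eq [dfi]: "dft A ==> dft B ==> dfn (%e. A e = B e)"
 by (rule dfn2[of "%a b. a = b"]) (rule dfn_vars(2))

lemma dfn_ball [dfi]: "dft A ==> dfn (%e. Q (e 0) (%i. e (Suc i))) ==> dfn (%e. ALL x:elts (A e). Q x e)"
 by (rule dfn_cong[where P="%e. ALL x:M. x el A e --> Q x e"], blast) (intro dfi dft_w)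

lemma dfn_bex [dfi]: "dft A ==> dfn (%e. Q (e 0) (%i. e (Suc i))) ==> dfn (%e. EX x:elts (A e). Q x e)"
 by (rule dfn_cong[where P="%e. EX x:M. x el A e & Q x e"], blast) (intro dfi dft_w)

lemma dfn_ex1 [dfi]: assumes "dfn (%e. Q (e 0) (%i. e (Suc i)))" shows "dfn (%e. EX! a. a : M & Q a e)"
 by (rule dfn_cong[where P="%e. EX a:M. Q a e & (ALL b:M. Q b e --> b = a)"], blast)
  (intro dfi dfn_w1 assms)

lemma dfn_sub_eq [dfi]: assumes "dft A" shows "dfn (%e. elts (A e) = {})"
  and "dft B ==> dfn (%e. A e sub B e)" and "dft B ==> dfn (%e. elts (A e) = elts (B e))"
proof -
 show "dfn (%e. elts (A e) = {})"
  by (rule dfn_cong[where P="%e. ALL x:elts (A e). x ~= x"], blast) (intro dfi dft_w assms)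
 assume B: "dft B"
 show "dfn (%e. A e sub B e)"
  by (rule dfn_cong[where P="%e. ALL x:elts (A e). x el B e"], blast) (intro dfi dft_w assms B)
 show "dfn (%e. elts (A e) = elts (B e))"
  by (rule dfn_cong[where P="%e. (ALL x:elts (A e). x el B e) & (ALL x:elts (B e). x el A e)"], blast)
   (intro dfi dft_w assms B)
qed

lemma dfn_enum [dfi]: assumes "dft A" "dft B" shows "dfn (%e. elts (A e) = {B e})"
  "dft C ==> dfn (%e. elts (A e) = {B e, C e})"
proof -
 show "dfn (%e. elts (A e) = {B e})"
  by (rule dfn_cong[where P="%e. B e el A e & (ALL x:elts (A e). x = B e)"], blast) (intro dfi dft_w assms)
 assume C: "dft C"
 show "dfn (%e. elts (A e) = {B e, C e})"
  by (rule dfn_cong[where P="%e. B e el A e & C e el A e & (ALL x:elts (A e). x = B e | x = C e)"], blast)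
   (intro dfi dft_w assms C)
qed

lemma dfn_opair [dfi]: assumes "dft A" "dft B" "dft C" shows "dfn (%e. opair (A e) (B e) (C e))"
 by (rule dfn3[of opair, OF _ assms]) (unfold opair_def, intro dfi)

lemma dfn_pair_in [dfi]: assumes "dft A" "dft B" "dft C" shows "dfn (%e. pair_in (A e) (B e) (C e))"
 by (rule dfn3[of pair_in, OF _ assms]) (unfold pair_in_def, intro dfi)

lemma dfn_func [dfi]: assumes "dft A" "dft B" shows "dfn (%e. func (A e) (B e))"
 by (rule dfn2[of func, OF _ assms]) (unfold func_def, intro dfi)

lemma dfn_func_into [dfi]: assumes "dft A" "dft B" "dft C" shows "dfn (%e. func_into (A e) (B e) (C e))"
 by (rule dfn3[of func_into, OF _ assms]) (unfold func_into_def, intro dfi)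

lemma dfn_transitive [dfi]: "dft A ==> dfn (%e. transitive (A e))"
 by (rule dfn1[of transitive]) (unfold transitive_def, intro dfi)

lemma dfn_ordinal [dfi]: "dft A ==> dfn (%e. ordinal (A e))"
 by (rule dfn1[of ordinal]) (unfold ordinal_def, intro dfi)

end

section \<open>The axioms of ZFC for definable predicates and terms\<close>

locale zfc = membership + assumes zfc: ZFC
begin

lemmas zfc_tail = zfc[unfolded ZFC_def, THEN conjunct2]
lemmas zfc_tail4 = zfc_tail[THEN conjunct2, THEN conjunct2, THEN conjunct2]

lemma zfc_ext: "x : M ==> y : M ==> elts x = elts y ==> x = y"
 using zfc[unfolded ZFC_def, THEN conjunct1] by blast
lemma foundation: "x : M ==> elts x ~= {} ==> EX y:elts x. elts y Int elts x = {}"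
 using zfc_tail[THEN conjunct1] by blast
lemma pairing: "a : M ==> b : M ==> EX c:M. elts c = {a, b}"
 using zfc_tail[THEN conjunct2, THEN conjunct1] by blast
lemma union: "x : M ==> EX u:M. elts u = (UN y:elts x. elts y)"
 using zfc_tail[THEN conjunct2, THEN conjunct2, THEN conjunct1] by blast
lemma powerset: "x : M ==> EX s:M. elts s = {y : M. elts y <= elts x}"
 using zfc_tail4[THEN conjunct1] by blast
lemmas infinity = zfc_tail4[THEN conjunct2, THEN conjunct1]
lemmas choice = zfc_tail4[THEN conjunct2, THEN conjunct2, THEN conjunct1, rule_format]
lemma separation: "range e <= M ==> a : M ==> EX b:M. elts b = {x : elts a. sat M E p (e(0 := x))}"
 using zfc_tail4[THEN conjunct2, THEN conjunct2, THEN conjunct2, THEN conjunct1] by blast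
lemma replacement: "range e <= M ==> a : M ==> ALL x:elts a. EX! y. y : M & sat M E p (e(0 := x, 1 := y)) ==>
  EX b:M. elts b = {y : M. EX x:elts a. sat M E p (e(0 := x, 1 := y))}"
 using zfc_tail4[THEN conjunct2, THEN conjunct2, THEN conjunct2, THEN conjunct2] by blast

end

sublocale zfc < nonempty
proof
 show "M ~= {}" using infinity by blast
qed

context zfc begin

text \<open>\<open>setp S\<close>: the HOL set \<open>S\<close> is the extension of a member of \<open>M\<close>, namely of \<open>mk S\<close>.\<close>

definition setp :: "'a set => bool" where "setp S = (EX x:M. elts x = S)"
definition mk :: "'a set => 'a" where "mk S = (SOME x. x : M & (setp S --> elts x = S))"

lemma mkp: "mk S : M & (setp S --> elts (mk S) = S)"
 unfolding mk_def by (rule someI_ex) (use M_ne in \<open>auto simp: setp_def\<close>)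
lemma mk_M [simp]: "mk S : M" using mkp by blast
lemma elts_mk: "setp S ==> elts (mk S) = S" using mkp by blast
lemma setp_elts [simp]: "x : M ==> setp (elts x)" by (auto simp: setp_def)
lemma mk_eq: "x : M ==> elts x = S ==> mk S = x" using mkp[of S] by (intro zfc_ext) (auto simp: setp_def)
lemma eqI: "x : M ==> y : M ==> (!!z. z : M ==> z el x = z el y) ==> x = y" by (rule zfc_ext) auto

lemma setp_sep: assumes S: "setp S" and Q: "dfn (%e. Q (e 0))" shows "setp {x : S. Q x}"
proof -
 obtain p c where c: "ALL i. c i : M" and p: "!!e. ALL i. e i : M ==> Q (e 0) = sat M E p (mix e c)"
  using Q unfolding dfn_def by metis
 obtain a where a: "a : M" "elts a = S" using S by (auto simp: setp_def)
 have m: "(mix (%_. a) c)(0 := x) = mix ((%_. a)(0 := x)) c" for x by (rule ext) (auto simp: mix_def)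
 have "range (mix (%_. a) c) <= M" using a c by (auto simp: mix_def)
 from separation[OF this a(1), of p] obtain b where
  b: "b : M" "elts b = {x : elts a. sat M E p (mix ((%_. a)(0 := x)) c)}" by (auto simp: m)
 have "elts b = {x : S. Q x}" unfolding b(2) a(2)[symmetric]
  using p[of "(%_. a)(0 := x)" for x] a by auto
 then show ?thesis using b(1) by (auto simp: setp_def)
qed

lemma setp_repl: assumes S: "setp S" and F: "dft (%e. F (e 0))" shows "setp (F ` S)"
proof -
 have FM: "x : M ==> F x : M" for x using dft_M[OF F, of "%_. x"] by simp
 have "dfn (%e. e 0 = F (e (Suc 0)))" using F by (simp add: dft_def)
 from dfn_ren[OF this, of "%i. if i = 0 then 1 else if i = 1 then 0 else i"]
 have "dfn (%e. e 1 = F (e 0))" by (simp add: inj_def)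
 then obtain p c where c: "ALL i. c i : M" and p: "!!e. ALL i. e i : M ==> (e 1 = F (e 0)) = sat M E p (mix e c)"
  unfolding dfn_def by blast
 obtain a where a: "a : M" "elts a = S" using S by (auto simp: setp_def)
 \<comment> \<open>Replacement speaks of the variables 0 and 1, whereas the value of the function
   sits at index 2 of \<open>mix\<close>. So \<open>s\<close> swaps 1 and 2, and the parameter
   \<open>c 0\<close> moves from index 1 to index 2.\<close>
 define s where "s n = (if n = 2 then 1 else if n = 1 then 2 else n)" for n :: nat
 define r where "r n = (if n = 2 then c 0 else mix (%_. a) c n)" for n
 have i: "inj s" by (auto simp: inj_def s_def)
 have m: "r(0 := x, 1 := y) o s = mix ((%_. a)(0 := x, 1 := y)) c" for x y
 proof
  fix n show "(r(0 := x, 1 := y) o s) n = mix ((%_. a)(0 := x, 1 := y)) c n"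
   by (cases "n = 0 | n = 1 | n = 2") (auto simp: mix_def s_def r_def)
 qed
 have r: "range r <= M" using a c by (auto simp: r_def mix_def)
 define q where "q = ren s p"
 have q: "(y = F x) = sat M E q (r(0 := x, 1 := y))" if "x : M" "y : M" for x y
  using p[of "(%_. a)(0 := x, 1 := y)"] that a unfolding q_def sat_ren[OF i] m by simp
 have "ALL x:elts a. EX! y. y : M & sat M E q (r(0 := x, 1 := y))"
  using FM q by (metis el_M)
 from replacement[OF r a(1) this] obtain b where
  b: "b : M" "elts b = {y : M. EX x:elts a. sat M E q (r(0 := x, 1 := y))}" by blast
 have "elts b = {y : M. EX x:elts a. y = F x}" unfolding b(2) using q by auto
 then have "elts b = F ` S" unfolding a(2)[symmetric] using FM by auto
 then show ?thesis using b(1) by (auto simp: setp_def)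
qed

lemma setp_pair: "a : M ==> b : M ==> setp {a, b}" using pairing by (auto simp: setp_def)

lemma setp_Union: assumes "setp S" shows "setp (UN x:S. elts x)"
proof -
 obtain x where "x : M" "elts x = S" using assms by (auto simp: setp_def)
 then show ?thesis using union[of x] unfolding setp_def by blast
qed

lemma setp_UN: assumes "setp S" "dft (%e. F (e 0))" shows "setp (UN x:S. elts (F x))"
 using setp_Union[OF setp_repl[OF assms]] by simp

lemma setp_Un [simp]: assumes "setp S" "setp T" shows "setp (S Un T)"
 using setp_Union[OF setp_pair[of "mk S" "mk T"]] assms by (simp add: elts_mk)

lemma setp_Pow: assumes "setp S" shows "setp {y : M. elts y <= S}"
proof -
 obtain x where "x : M" "elts x = S" using assms by (auto simp: setp_def)
 then show ?thesis using powerset[of x] by (auto simp: setp_def)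
qed

lemma setp_empty [simp]: "setp {}"
proof -
 obtain m where "m : M" using M_ne by blast
 then show ?thesis using setp_sep[OF setp_elts, of m "%_. False"] by (simp add: dfn_const)
qed

lemma setp_insert [simp]: "a : M ==> setp S ==> setp (insert a S)"
 using setp_Un[of "{a, a}" S] setp_pair[of a a] by simp

text \<open>By extensionality, equality with \<open>T e\<close> is a statement about elements, so a
  definition of membership in \<open>T e\<close> is enough.\<close>

lemma dfi_set: assumes "!!e. ALL i. e i : M ==> T e : M & (ALL x:M. x el T e = Q x e)"
  "dfn (%e. Q (e 0) (%i. e (Suc i)))" shows "dft T"
 unfolding dft_def
proof (intro conjI allI impI)
 show "dfn (%e. e 0 = T (%i. e (Suc i)))"
 proof (rule dfn_cong[where P="%e. ALL x:M. x el e 0 = Q x (%i. e (Suc i))"])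
  fix e :: "nat => 'a" assume e: "ALL i. e i : M"
  then show "(ALL x:M. x el e 0 = Q x (%i. e (Suc i))) = (e 0 = T (%i. e (Suc i)))"
   using assms(1)[of "%i. e (Suc i)"] by (auto intro: eqI)
 qed (intro dfi dfn_w1 assms)
qed (use assms in auto)

definition zero where "zero = mk {}"
lemma zero [simp]: "zero : M" "elts zero = {}" by (simp_all add: zero_def elts_mk)

definition sep :: "'a => ('a => bool) => 'a" where "sep a Q = mk {x : elts a. Q x}"
definition rep :: "'a => ('a => 'a) => 'a" where "rep a F = mk (F ` elts a)"
definition uni :: "'a => ('a => 'a) => 'a" where "uni a F = mk (UN x:elts a. elts (F x))"
definition un :: "'a => 'a => 'a" where "un a b = mk (elts a Un elts b)"
definition pow :: "'a => 'a" where "pow a = mk {y : M. elts y <= elts a}"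

lemma set_M [simp]: "sep a Q : M" "rep a F : M" "uni a F : M" "un a b : M" "pow a : M"
 by (simp_all add: sep_def rep_def uni_def un_def pow_def)

lemma elts_sep: "dfn (%e. Q (e 0)) ==> a : M ==> elts (sep a Q) = {x : elts a. Q x}"
 by (simp add: sep_def elts_mk setp_sep)
lemma elts_rep: "dft (%e. F (e 0)) ==> a : M ==> elts (rep a F) = F ` elts a"
 by (simp add: rep_def elts_mk setp_repl)
lemma elts_uni: "dft (%e. F (e 0)) ==> a : M ==> elts (uni a F) = (UN x:elts a. elts (F x))"
 by (simp add: uni_def elts_mk setp_UN)
lemma elts_un [simp]: "a : M ==> b : M ==> elts (un a b) = elts a Un elts b"
 by (simp add: un_def elts_mk)
lemma elts_pow [simp]: "a : M ==> elts (pow a) = {y : M. elts y <= elts a}"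
 by (simp add: pow_def elts_mk setp_Pow)

text \<open>Under a binder, predicates and terms still depend on the ambient environment
  \<open>e\<close>. All but the first \<open>n\<close> variables are frozen into parameters, so that
  separation and replacement apply for each fixed \<open>e\<close>.\<close>

lemma dfn_fix: assumes "dfn P" and e: "ALL i. e i : M" shows "dfn (%e'. P (%i. if i < n then e' i else e (i - n)))"
proof -
 obtain p c where c: "ALL i. c i : M" and p: "!!e. ALL i. e i : M ==> P e = sat M E p (mix e c)"
  using assms(1) unfolding dfn_def by metis
 define g where "g m = (if even m then if m div 2 < n then m else Suc (2*m) else Suc (2*m))" for m
 have g: "g (2*k) = (if k < n then 2*k else Suc (2*(2*k)))" "g (Suc (2*k)) = Suc (2*(Suc (2*k)))" for k
  by (simp_all add: g_def)
 have i: "inj g" by (rule inj_par; unfold g; auto split: if_splits; presburger)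
 have "mix e' (mix (%k. e (k - n)) c) o g = mix (%i. if i < n then e' i else e (i - n)) c" for e'
 proof
  fix m show "(mix e' (mix (%k. e (k - n)) c) o g) m = mix (%i. if i < n then e' i else e (i - n)) c m"
   by (rule par_cases[of m]) (simp_all only: o_def g mix_simps split: if_split, simp_all)
 qed
 then have "P (%i. if i < n then e' i else e (i - n)) = sat M E (ren g p) (mix e' (mix (%k. e (k - n)) c))" if "ALL i. e' i : M" for e'
  using p[of "%i. if i < n then e' i else e (i - n)"] that e by (simp add: sat_ren[OF i])
 moreover have "ALL i. mix (%k. e (k - n)) c i : M" using e c by (simp add: mix_def)
 ultimately show ?thesis unfolding dfn_def by blast
qed

lemma dfn_inst: "dfn (%e. Q (e 0) (%i. e (Suc i))) ==> ALL i. e i : M ==> dfn (%e'::nat=>'a. Q (e' 0) e)"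
 using dfn_fix[of "%e. Q (e 0) (%i. e (Suc i))" e 1] by simp

lemma dft_inst: assumes "dft (%e. F (e 0) (%i. e (Suc i)))" "ALL i. e i : M" shows "dft (%e'::nat=>'a. F (e' 0) e)"
 unfolding dft_def
proof (intro conjI allI impI)
 fix e' :: "nat => 'a" assume "ALL i. e' i : M" then show "F (e' 0) e : M"
  using dft_M[OF assms(1), of "case_nat (e' 0) e"] assms(2) by (simp split: nat.splits)
next
 show "dfn (%e'. e' 0 = F (e' (Suc 0)) e)"
  using dfn_fix[of "%e. e 0 = F (e (Suc 0)) (%i. e (Suc (Suc i)))" e 2] assms unfolding dft_def by simp
qed

lemma dft_w1: assumes "dft (%e. F (e 0) (%i. e (Suc i)))" shows "dft (%e. F (e 0) (%i. e (Suc (Suc i))))"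
 unfolding dft_def
proof (intro conjI allI impI)
 fix e :: "nat => 'a" assume "ALL i. e i : M" then show "F (e 0) (%i. e (Suc (Suc i))) : M"
  using dft_M[OF assms, of "case_nat (e 0) (%i. e (Suc (Suc i)))"] by (simp split: nat.splits)
next
 have "dfn (%e. e 0 = F (e (Suc 0)) (%i. e (Suc (Suc i))))" using assms by (simp add: dft_def)
 from dfn_ren[OF this, of "%i. if i < 2 then i else Suc i"]
 show "dfn (%e. e 0 = F (e (Suc 0)) (%i. e (Suc (Suc (Suc i)))))" by (simp add: inj_def)
qed

lemma dft_sep [dfi]: assumes "dft A" "dfn (%e. Q (e 0) (%i. e (Suc i)))" shows "dft (%e. sep (A e) (%x. Q x e))"
proof (rule dfi_set)
 show "dfn (%e. e 0 el A (%i. e (Suc i)) & Q (e 0) (%i. e (Suc i)))" by (intro dfi dft_w assms)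
qed (use elts_sep[OF dfn_inst[OF assms(2)] dft_M[OF assms(1)]] in auto)

lemma dft_rep [dfi]: assumes "dft A" "dft (%e. F (e 0) (%i. e (Suc i)))" shows "dft (%e. rep (A e) (%x. F x e))"
proof (rule dfi_set)
 show "dfn (%e. EX x:elts (A (%i. e (Suc i))). e 0 = F x (%i. e (Suc i)))"
  by (intro dfi dft_w assms dft_w1)
qed (use elts_rep[OF dft_inst[OF assms(2)] dft_M[OF assms(1)]] in auto)

lemma dft_uni [dfi]: assumes "dft A" "dft (%e. F (e 0) (%i. e (Suc i)))" shows "dft (%e. uni (A e) (%x. F x e))"
proof (rule dfi_set)
 show "dfn (%e. EX x:elts (A (%i. e (Suc i))). e 0 el F x (%i. e (Suc i)))"
  by (intro dfi dft_w assms dft_w1)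
qed (use elts_uni[OF dft_inst[OF assms(2)] dft_M[OF assms(1)]] in auto)

lemma dft_un [dfi]: assumes "dft A" "dft B" shows "dft (%e. un (A e) (B e))"
 by (rule dfi_set[of _ "%x e. x el A e | x el B e"]) (use dft_M[OF assms(1)] dft_M[OF assms(2)] in simp, intro dfi dft_w assms)

lemma dft_pow [dfi]: assumes "dft A" shows "dft (%e. pow (A e))"
 by (rule dfi_set[of _ "%x e. x sub A e"]) (use dft_M[OF assms(1)] in simp, intro dfi dft_w assms)

end

section \<open>Functions and recursion inside \<open>M\<close>\<close>

context zfc begin

definition opr :: "'a => 'a => 'a" where "opr x y = mk {mk {x}, mk {x, y}}"
lemma opr_M [simp]: "opr x y : M" by (simp add: opr_def)

lemma elts_opr: "x : M ==> y : M ==> elts (opr x y) = {mk {x}, mk {x, y}}"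
 by (simp add: opr_def elts_mk)

lemma opair_iff: assumes "z : M" "x : M" "y : M" shows "opair z x y = (z = opr x y)"
proof
 assume "opair z x y"
 then obtain u v where u: "u : M" "v : M" "elts u = {x}" "elts v = {x, y}" "elts z = {u, v}"
  unfolding opair_def by blast
 then show "z = opr x y" unfolding opr_def using mk_eq[of u "{x}"] mk_eq[of v "{x, y}"] mk_eq[of z] assms by simp
next
 assume "z = opr x y" then show "opair z x y" unfolding opair_def
  by (intro bexI[of _ "mk {x}"] bexI[of _ "mk {x, y}"]) (simp_all add: elts_opr elts_mk assms)
qed

lemma opr_inj [simp]: assumes "x : M" "y : M" "x' : M" "y' : M"
 shows "opr x y = opr x' y' <-> x = x' & y = y'"
proof -
 have i: "mk S = mk T <-> S = T" if "setp S" "setp T" for S T using that elts_mk by metis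
 have "opr x y = opr x' y' <-> {mk {x}, mk {x, y}} = {mk {x'}, mk {x', y'}}"
  unfolding opr_def by (rule i) (simp_all add: assms)
 then show ?thesis by (auto simp: doubleton_eq_iff i assms)
qed

lemma pair_in_iff: "r : M ==> x : M ==> y : M ==> pair_in r x y = (opr x y el r)"
 unfolding pair_in_def by (metis el_M opair_iff opr_M)

lemma dft_opr [dfi]: "dft A ==> dft B ==> dft (%e. opr (A e) (B e))"
proof (rule dft2[of opr])
 have "dfn (%e. e 0 = opr (e 1) (e 2))"
  by (rule dfn_cong[where P="%e. opair (e 0) (e 1) (e 2)"], simp add: opair_iff) (intro dfi)
 then show "dft (%e. opr (e 0) (e 1))" by (simp add: dft_def numeral_2_eq_2)
qed

text \<open>Projections and application are written as unions over a set of candidates. This makes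
  them total definable terms; \<open>app f x\<close> is empty where \<open>f\<close> has no
  value.\<close>

definition p1 :: "'a => 'a" where "p1 z = uni (sep (uni z (%x. x)) (%x. EX y:M. z = opr x y)) (%x. x)"
definition p2 :: "'a => 'a" where "p2 z = uni (sep (uni z (%x. x)) (%y. EX x:M. z = opr x y)) (%x. x)"
definition app :: "'a => 'a => 'a" where
 "app f x = uni (sep (uni (uni f (%x. x)) (%x. x)) (%y. opr x y el f)) (%x. x)"

lemma p12_M [simp]: "p1 z : M" "p2 z : M" "app f x : M" by (simp_all add: p1_def p2_def app_def)

lemma dft_p1 [dfi]: "dft A ==> dft (%e. p1 (A e))" by (rule dft1[of p1]) (unfold p1_def, intro dfi)
lemma dft_p2 [dfi]: "dft A ==> dft (%e. p2 (A e))" by (rule dft1[of p2]) (unfold p2_def, intro dfi)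
lemma dft_app [dfi]: "dft A ==> dft B ==> dft (%e. app (A e) (B e))"
 by (rule dft2[of app]) (unfold app_def, intro dfi)

lemma UN_opr: "x : M ==> y : M ==> (UN u:elts (opr x y). elts u) = {x, y}"
 by (auto simp: elts_opr elts_mk)

lemma uni_id: "z : M ==> elts (uni z (%x. x)) = (UN u:elts z. elts u)" by (rule elts_uni) (intro dfi)

lemma p12 [simp]: assumes "x : M" "y : M" shows "p1 (opr x y) = x" "p2 (opr x y) = y"
proof -
 have "elts (sep (uni (opr x y) (%x. x)) (%x'. EX y':M. opr x y = opr x' y')) = {x}"
  by (subst elts_sep, intro dfi) (use assms in \<open>auto simp: uni_id UN_opr\<close>)
 then show "p1 (opr x y) = x" unfolding p1_def using assms by (auto intro!: eqI simp: uni_id)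
 have "elts (sep (uni (opr x y) (%x. x)) (%y'. EX x':M. opr x y = opr x' y')) = {y}"
  by (subst elts_sep, intro dfi) (use assms in \<open>auto simp: uni_id UN_opr\<close>)
 then show "p2 (opr x y) = y" unfolding p2_def using assms by (auto intro!: eqI simp: uni_id)
qed

lemma app_el: "f : M ==> x : M ==> w el app f x <-> (EX y:M. opr x y el f & w el y)"
proof -
 assume a: "f : M" "x : M"
 have "y el uni (uni f (%x. x)) (%x. x)" if "opr x y el f" "y : M" for y
  using UN_opr[of x y] that a unfolding uni_id[OF set_M(3)] uni_id[OF a(1)] by blast
 then show ?thesis unfolding app_def uni_id[OF set_M(1)] using a
  by (subst elts_sep, intro dfi) auto
qed

lemma app_eq: "f : M ==> x : M ==> opr x y el f ==> y : M ==> (!!z. z : M ==> opr x z el f ==> z = y) ==> app f x = y"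
 by (rule eqI, simp, assumption, unfold app_el) metis

definition fn :: "'a => ('a => 'a) => 'a" where "fn a F = rep a (%x. opr x (F x))"
definition times :: "'a => 'a => 'a" where "times a b = uni a (%x. rep b (%y. opr x y))"

lemma fn_M [simp]: "fn a F : M" "times a b : M" by (simp_all add: fn_def times_def)

lemma dft_fn [dfi]: "dft A ==> dft (%e. F (e 0) (%i. e (Suc i))) ==> dft (%e. fn (A e) (%x. F x e))"
 unfolding fn_def by (intro dfi)
lemma dft_times [dfi]: "dft A ==> dft B ==> dft (%e. times (A e) (B e))"
 by (rule dft2[of times]) (unfold times_def, intro dfi)

lemma elts_fn: "dft (%e. F (e 0)) ==> a : M ==> elts (fn a F) = (%x. opr x (F x)) ` elts a"
 unfolding fn_def by (rule elts_rep) (intro dfi)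

lemma elts_times: assumes "a : M" "b : M" shows "elts (times a b) = {z. EX x y. x el a & y el b & z = opr x y}"
proof -
 have "elts (rep b (%y. opr x y)) = (%y. opr x y) ` elts b" if "x : M" for x
  by (rule elts_rep) (intro dfi that assms)+
 then show ?thesis unfolding times_def by (subst elts_uni, intro dfi) (use assms in auto)
qed

lemma el_times [simp]: "a : M ==> b : M ==> x : M ==> y : M ==> opr x y el times a b <-> x el a & y el b"
 by (auto simp: elts_times)

lemma fn_cong: "(!!x. x el a ==> F x = G x) ==> fn a F = fn a G"
 unfolding fn_def rep_def by (metis (no_types, lifting) image_cong)

lemma el_fn: assumes "dft (%e. F (e 0))" "a : M" "x : M" "y : M" shows "opr x y el fn a F <-> x el a & y = F x"
proof -
 have FM: "x : M ==> F x : M" for x using dft_M[OF assms(1), of "%_. x"] by simp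
 have "opr x y = opr z (F z) <-> x = z & y = F z" if "z el a" for z using FM that assms by (intro opr_inj) auto
 then show ?thesis unfolding elts_fn[OF assms(1,2)] by blast
qed

lemma app_fn: assumes "dft (%e. F (e 0))" "x el a" "a : M" shows "app (fn a F) x = F x"
proof -
 have FM: "F x : M" using dft_M[OF assms(1), of "%_. x"] assms(2) by simp
 show ?thesis using app_eq[of "fn a F" x "F x"] el_fn[OF assms(1,3)] assms FM el_M by (metis fn_M(1))
qed

lemma funcD: assumes "func f d" "f : M" "d : M"
 shows "x el d ==> opr x (app f x) el f" "x : M ==> y : M ==> opr x y el f ==> x el d & y = app f x"
  "z el f ==> EX x:elts d. z = opr x (app f x)"
proof -
 have a: "EX! y. y : M & opr x y el f" if "x el d" for x
  using assms that unfolding func_def by (metis el_M pair_in_iff)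
 have p: "EX x:elts d. EX y:M. opair z x y" if "z el f" for z using assms(1) that unfolding func_def by blast
 have b: "x el d" if xy: "opr x y el f" "x : M" "y : M" for x y
 proof -
  obtain x' y' where "x' el d" "y' : M" "opair (opr x y) x' y'" using p[OF xy(1)] by blast
  then show ?thesis using xy(2,3) opr_inj[of x y x' y'] opair_iff[of "opr x y" x' y'] by (metis el_M opr_M)
 qed
 have e: "app f x = y" if "opr x y el f" "y : M" "x : M" for x y
  by (rule app_eq) (use a b that assms in blast)+
 show "x el d ==> opr x (app f x) el f" using a e by (metis el_M)
 show "x : M ==> y : M ==> opr x y el f ==> x el d & y = app f x" using b e by metis
 show "EX x:elts d. z = opr x (app f x)" if z: "z el f"
 proof -
  obtain x y where "x el d" "y : M" "opair z x y" using assms(1) z unfolding func_def by blast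
  then show ?thesis using z e by (metis el_M opair_iff)
 qed
qed

lemma funcI: assumes "f : M" "d : M" "!!z. z el f ==> EX x:elts d. EX y:M. z = opr x y"
  "!!x. x el d ==> EX y:M. opr x y el f" "!!x y y'. x el d ==> y : M ==> y' : M ==> opr x y el f ==> opr x y' el f ==> y = y'"
 shows "func f d"
 unfolding func_def
proof (intro conjI ballI)
 fix z assume z: "z el f" then show "EX x:elts d. EX y:M. opair z x y" using assms(3)[OF z] by (metis el_M opair_iff)
next
 fix x assume x: "x el d" then show "EX! y. y : M & pair_in f x y" using assms(4,5)[OF x] assms(1) by (metis el_M pair_in_iff)
qed

lemma func_fn: assumes "dft (%e. F (e 0))" "d : M" shows "func (fn d F) d"
proof -
 have FM: "x : M ==> F x : M" for x using dft_M[OF assms(1), of "%_. x"] by simp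
 show ?thesis
 proof (rule funcI)
  show "EX x:elts d. EX y:M. z = opr x y" if "z el fn d F" for z
   using that FM unfolding elts_fn[OF assms] by blast
  show "EX y:M. opr x y el fn d F" if "x el d" for x
   using el_fn[OF assms, of x "F x"] FM[of x] that el_M by metis
  show "y = y'" if "y : M" "y' : M" "opr x y el fn d F" "opr x y' el fn d F" "x el d" for x y y'
   using el_fn[OF assms el_M[OF that(5)]] that by simp
 qed (use assms in simp_all)
qed

lemma func_elts: "func f d ==> f : M ==> d : M ==> elts f = (%x. opr x (app f x)) ` elts d"
 using funcD by blast

lemma func_eq: "func f d ==> func g d ==> f : M ==> g : M ==> d : M ==> (!!x. x el d ==> app f x = app g x) ==> f = g"
 by (rule zfc_ext, assumption, assumption) (simp only: func_elts cong: image_cong)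

lemma func_into_iff: assumes "f : M" "d : M" "c : M"
 shows "func_into f d c <-> func f d & (ALL x:elts d. app f x el c)"
 unfolding func_into_def using assms funcD[OF _ assms(1,2)] by (metis el_M pair_in_iff p12_M(3))

text \<open>Without transitive closures, recursion along \<open>E\<close> is first available on transitive sets.\<close>

lemma no_cycle: "x : M ==> ~ x el x" "x el y ==> ~ y el x"
proof -
 show 1: "x : M ==> ~ x el x" for x using foundation[of "mk {x}"] by (auto simp: elts_mk)
 show "x el y ==> ~ y el x"
  using foundation[of "mk {x, y}"] by (auto simp: elts_mk)
qed

definition attempt :: "('a => 'a => 'a) => 'a => 'a => bool" where
 "attempt H t f = (transitive t & (ALL y:elts t. app f y = H y (fn y (app f))))"
text \<open>Collecting the elements of the values of all attempts keeps \<open>rec H\<close> a total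
  definable term before attempts are known to exist.\<close>

definition rec :: "('a => 'a => 'a) => 'a => 'a" where
 "rec H x = mk {w : M. EX t:M. EX f:M. attempt H t f & x el t & w el app f x}"

lemma trD: "transitive t ==> y el t ==> z el y ==> z el t" by (auto simp: transitive_def)

lemma rec_M [simp]: "rec H x : M" by (simp add: rec_def)

lemma minimal_in: assumes "dfn (%e. Q (e 0))" "t : M" "x el t" "Q x"
 obtains y where "y el t" "Q y" "!!z. z el y ==> z el t ==> ~ Q z"
proof -
 have "elts (sep t Q) = {x : elts t. Q x}" using assms by (simp add: elts_sep)
 then show ?thesis using foundation[of "sep t Q"] that assms by auto
qed

context
 fixes H :: "'a => 'a => 'a"
 assumes H: "dft (%e. H (e 0) (e 1))"
begin

lemma H_dft: "dft A ==> dft B ==> dft (%e. H (A e) (B e))" by (rule dft2[OF H])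

lemma attempt_dfn: "dft A ==> dft B ==> dfn (%e. attempt H (A e) (B e))"
 by (rule dfn2[of "attempt H"]) (unfold attempt_def, intro dfi H_dft)

lemma attempt_unique: assumes "attempt H t f" "attempt H t' f'" "x el t" "x el t'" "t : M" "t' : M" "f : M" "f' : M"
 shows "app f x = app f' x"
proof (rule ccontr)
 assume n: "app f x ~= app f' x"
 have "dfn (%e. e 0 el t' & app f (e 0) ~= app f' (e 0))" by (intro dfi assms)
 from minimal_in[OF this assms(5,3)] n assms(4) obtain y where
  y: "y el t" "y el t'" "app f y ~= app f' y" and
  m: "!!z. z el y ==> z el t ==> ~ (z el t' & app f z ~= app f' z)" by metis
 have "app f z = app f' z" if "z el y" for z
  using m[OF that] trD[of t y z] trD[of t' y z] y that assms unfolding attempt_def by blast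
 then have "fn y (app f) = fn y (app f')" by (rule fn_cong)
 then show False using y assms unfolding attempt_def by metis
qed

lemma rec_val: assumes "attempt H t f" "t : M" "f : M" "x el t"
 shows "{w : M. EX t:M. EX f:M. attempt H t f & x el t & w el app f x} = elts (app f x)" (is "?S = _")
proof
 show "?S <= elts (app f x)"
 proof
  fix w assume "w : ?S"
  then obtain t' f' where "t' : M" "f' : M" "attempt H t' f'" "x el t'" "w el app f' x" by blast
  then show "w el app f x" using attempt_unique[of t' f' t f x] assms by simp
 qed
qed (use assms in blast)

lemma rec_eq: assumes "attempt H t f" "t : M" "f : M" "x el t" shows "rec H x = app f x"
 unfolding rec_def by (rule mk_eq) (simp, rule rec_val[OF assms, symmetric])

lemma rec_setp: "setp {w : M. EX t:M. EX f:M. attempt H t f & x el t & w el app f x}"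
proof (cases "EX t:M. EX f:M. attempt H t f & x el t")
 case True
 then obtain t f where a: "attempt H t f" "t : M" "f : M" "x el t" by blast
 show ?thesis unfolding rec_val[OF a] by simp
next
 case False
 then have e: "{w : M. EX t:M. EX f:M. attempt H t f & x el t & w el app f x} = {}" by blast
 show ?thesis unfolding e by simp
qed

lemma dft_rec: "dft A ==> dft (%e. rec H (A e))"
proof (rule dft1[of "rec H"], rule dfi_set)
 show "dfn (%e. EX t:M. EX f:M. attempt H t f & e (Suc 0) el t & e 0 el app f (e (Suc 0)))"
  by (intro dfi attempt_dfn)
qed (simp add: rec_def elts_mk[OF rec_setp])

lemma rec_local: assumes "transitive s" "s : M" "x el s" shows "rec H x = H x (fn x (rec H))"
proof -
 let ?Q = "%x. EX t:M. EX f:M. attempt H t f & x el t"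
 have dQ: "dfn (%e. ?Q (e 0))" by (intro dfi attempt_dfn)
 have st: "rec H y = H y (fn y (rec H))" if q: "?Q y" for y
 proof -
  obtain t f where a: "attempt H t f" "t : M" "f : M" "y el t" using q by blast
  have "rec H z = app f z" if "z el y" for z
   using rec_eq[OF a(1-3)] trD[of t y z] a that unfolding attempt_def by blast
  then have "fn y (rec H) = fn y (app f)" by (rule fn_cong)
  then show ?thesis using rec_eq[OF a] a unfolding attempt_def by metis
 qed
 have "?Q x"
 proof (rule ccontr)
  assume "~ ?Q x"
  then obtain x where x: "x el s" "~ ?Q x" and m: "!!z. z el x ==> z el s ==> ~ ~ ?Q z"
   using minimal_in[OF dfn_not[OF dQ] assms(2,3)] by blast
  \<comment> \<open>The minimal point \<open>x\<close> without an attempt, together with all points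
    of \<open>s\<close> that have one, forms a transitive set. The recursion clause defines an
    attempt on it, against the choice of \<open>x\<close>.\<close>
  define d where "d = un (sep s ?Q) (mk {x})"
  have d: "d : M" "elts d = insert x {y : elts s. ?Q y}"
   unfolding d_def elts_un[OF set_M(1) mk_M] elts_sep[OF dQ assms(2)] using x by (auto simp: elts_mk)
  have td: "transitive d" unfolding transitive_def
  proof
   fix y assume "y el d"
   show "y sub d"
   proof
    fix z assume z: "z el y"
    show "z el d"
    proof (cases "y = x")
     case True then show ?thesis using m z x trD[OF assms(1)] by (auto simp: d)
    next
     case False
     then obtain t f where "attempt H t f" "t : M" "f : M" "y el t" using \<open>y el d\<close> by (auto simp: d)
     then show ?thesis using z trD[of t y z] trD[OF assms(1), of y z] \<open>y el d\<close> False
      unfolding attempt_def by (auto simp: d attempt_def)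
    qed
   qed
  qed
  define f where "f = fn d (%y. H y (fn y (rec H)))"
  have f: "app f y = H y (fn y (rec H))" if "y el d" for y
   unfolding f_def by (rule app_fn[OF _ that d(1)]) (intro dfi H_dft dft_rec)
  have "attempt H d f" unfolding attempt_def
  proof (intro conjI ballI td)
   fix y assume y: "y el d"
   have "app f z = rec H z" if z: "z el y" for z
   proof -
    have zd: "z el d" using td y z trD by blast
    have "?Q z"
    proof (cases "z = x")
     case True
     then have "y ~= x" using z no_cycle by auto
     then obtain t f where "attempt H t f" "t : M" "f : M" "y el t" using y by (auto simp: d)
     then show ?thesis using z trD[of t y z] unfolding attempt_def by blast
    qed (use zd d in auto)
    then show ?thesis using st f[OF zd] by metis
   qed
   then have "fn y (app f) = fn y (rec H)" by (rule fn_cong)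
   then show "app f y = H y (fn y (app f))" using f[OF y] by simp
  qed
  moreover have "f : M" "x el d" by (simp_all add: f_def d(2))
  ultimately show False using x(2) d(1) by blast
 qed
 then show ?thesis by (rule st)
qed

end

definition suc :: "'a => 'a" where "suc n = un n (mk {n})"
lemma suc_M [simp]: "suc n : M" by (simp add: suc_def)
lemma elts_suc [simp]: "n : M ==> elts (suc n) = insert n (elts n)" by (simp add: suc_def elts_mk)
lemma dft_suc [dfi]: "dft A ==> dft (%e. suc (A e))"
 by (rule dfi_set[where Q="%x e. x el A e | x = A e"]) (auto simp: dft_M intro!: dfi dft_w)

text \<open>The union of the iterated unions of \<open>x\<close> over the natural numbers is
  transitive. The recursion runs on a transitive set \<open>s\<close> of numbers, where
  \<open>rec_local\<close> already applies.\<close>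

lemma ex_transitive: assumes x: "x : M" obtains t where "t : M" "transitive t" "x el t"
proof -
 obtain w where w: "w : M" "EX o':elts w. elts o' = {}" "ALL x:elts w. EX y:elts w. elts y = insert x (elts x)"
  using infinity by blast
 \<comment> \<open>The set given by infinity may contain junk. The conditions kept here make
   \<open>s\<close> transitive and closed under \<open>suc\<close>.\<close>
 define s where "s = sep w (%n. transitive n & n sub w & (ALL k:elts n. transitive k))"
 have s: "s : M" "elts s = {n : elts w. transitive n & n sub w & (ALL k:elts n. transitive k)}"
  unfolding s_def by (simp, subst elts_sep, intro dfi) (use w in auto)
 have ts: "transitive s" unfolding transitive_def s using trD unfolding transitive_def by blast
 obtain z where z: "z el s" using w(2) by (auto simp: s transitive_def)
 have sc: "suc n el s" if n: "n el s" for n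
 proof -
  obtain y where y: "y el w" "elts y = insert n (elts n)" using w(3) n s by blast
  then have "suc n = y" using n by (intro zfc_ext) auto
  then show ?thesis using n y unfolding s transitive_def by auto
 qed
 define H where "H n f = un x (uni n (%k. uni (app f k) (%u. u)))" for n f
 have H: "dft (%e. H (e 0) (e 1))" unfolding H_def by (intro dfi x)
 have r: "elts (rec H n) = elts x Un (UN k:elts n. UN u:elts (rec H k). elts u)" if n: "n el s" for n
 proof -
  have "dft (%e. uni (app (fn n (rec H)) (e 0)) (%u. u))" by (intro dfi dft_rec[OF H]) (use n in auto)
  from elts_uni[OF this] have "elts (rec H n) = elts x Un (UN k:elts n. UN u:elts (app (fn n (rec H)) k). elts u)"
   unfolding rec_local[OF H ts s(1) n] H_def using n x by (simp add: uni_id)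
  moreover have "app (fn n (rec H)) k = rec H k" if "k el n" for k
   using app_fn[of "rec H" k n] dft_rec[OF H dft_var] that n by simp
  ultimately show ?thesis by simp
 qed
 define t where "t = uni s (rec H)"
 have t: "elts t = (UN n:elts s. elts (rec H n))" unfolding t_def by (rule elts_uni) (intro dft_rec[OF H] dfi s)+
 have "x sub t" using r[OF z] z by (auto simp: t)
 have tt: "z el t" if "z el y" "y el t" for y z
 proof -
  obtain n where n: "n el s" "y el rec H n" using \<open>y el t\<close> by (auto simp: t)
  then have "z el rec H (suc n)" using \<open>z el y\<close> r[OF sc[OF n(1)]] by auto
  then show ?thesis using sc[OF n(1)] by (auto simp: t)
 qed
 have "transitive (un t (mk {x}))" using tt \<open>x sub t\<close> x by (auto simp: transitive_def t_def elts_mk)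
 then show thesis using that[of "un t (mk {x})"] x by (simp add: t_def elts_mk)
qed

text \<open>Transitive sets around each point turn foundation for sets into foundation for definable
  classes. Later inductions inside \<open>M\<close> rest on this.\<close>

lemma minimal: assumes "dfn (%e. Q (e 0))" "x : M" "Q x"
 obtains y where "y : M" "Q y" "!!z. z el y ==> ~ Q z"
proof -
 obtain t where t: "t : M" "transitive t" "x el t" using ex_transitive assms(2) by blast
 show thesis by (rule minimal_in[OF assms(1) t(1,3) assms(3)]) (use that trD[OF t(2)] in blast)
qed

lemma mem_induct: assumes "dfn (%e. Q (e 0))" "x : M" "!!x. x : M ==> (!!y. y el x ==> Q y) ==> Q x" shows "Q x"
 using minimal[OF dfn_not[OF assms(1)] assms(2)] assms(3) by metis

lemma rec_unfold: "dft (%e. H (e 0) (e 1)) ==> x : M ==> rec H x = H x (fn x (rec H))"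
 using ex_transitive[of x] rec_local[of H] by blast

section \<open>Ordinals\<close>

lemma ord_el: "ordinal x ==> y el x ==> ordinal y"
 unfolding ordinal_def transitive_def by blast

lemma ord_tr: "ordinal x ==> y el x ==> z el y ==> z el x" unfolding ordinal_def transitive_def by blast

lemma ord_tri: assumes "ordinal x" "ordinal y" "x : M" "y : M" shows "x el y | x = y | y el x"
proof -
 let ?Q = "%x. ordinal x --> (ALL y:M. ordinal y --> x el y | x = y | y el x)"
 have "?Q x"
 proof (rule mem_induct[of ?Q])
  show "dfn (%e. ?Q (e 0))" by (intro dfi)
  fix x assume x: "x : M" and IH: "!!y. y el x ==> ?Q y"
  have "y : M ==> ordinal x ==> ordinal y --> x el y | x = y | y el x" for y
  proof (rule mem_induct[of "%y. ordinal y --> x el y | x = y | y el x"], intro dfi x)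
   fix y assume y: "y : M" "ordinal x" and IH2: "!!z. z el y ==> ordinal z --> x el z | x = z | z el x"
   show "ordinal y --> x el y | x = y | y el x"
   proof (rule ccontr)
    assume "~ (ordinal y --> x el y | x = y | y el x)"
    then have n: "ordinal y" "~ x el y" "x ~= y" "~ y el x" by blast+
    have "z el y" if "z el x" for z using IH[OF that] n y that ord_el ord_tr by (metis el_M)
    moreover have "z el x" if "z el y" for z using IH2[OF that] n y that ord_el ord_tr by (metis el_M)
    ultimately show False using n(3) eqI x y(1) by blast
   qed
  qed
  then show "?Q x" by blast
 qed (rule assms)
 then show ?thesis using assms by blast
qed

lemma ord_sub: "ordinal x ==> ordinal y ==> x : M ==> y : M ==> x sub y <-> x el y | x = y"
 by (metis dual_order.refl no_cycle(1) ord_tr ord_tri subsetD subsetI)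

lemma ord_suc: "ordinal x ==> x : M ==> ordinal (suc x)" by (auto simp: ordinal_def transitive_def)

lemma ord_zero: "ordinal zero" by (simp add: ordinal_def transitive_def)

end

section \<open>Choice, chains and sets of size less than a regular cardinal\<close>

context zfc begin

definition sing :: "'a => 'a" where "sing a = mk {a}"
lemma sing [simp]: "sing a : M" "a : M ==> elts (sing a) = {a}" by (simp_all add: sing_def elts_mk)
lemma dft_sing [dfi]: "dft A ==> dft (%e. sing (A e))"
 by (rule dfi_set[where Q="%x e. x = A e"]) (auto simp: dft_M intro!: dfi dft_w)

text \<open>A description operator as a set term of \<open>M\<close>: the value is empty unless
  exactly one \<open>y\<close> qualifies, so it is total and stays definable.\<close>

definition the1 :: "('a => bool) => 'a" where
 "the1 Q = mk {w : M. (EX! y. y : M & Q y) & (EX y:M. Q y & w el y)}"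

lemma the1_M [simp]: "the1 Q : M" by (simp add: the1_def)

lemma the1_set: assumes "y : M" "Q y" "!!z. z : M ==> Q z ==> z = y"
 shows "{w : M. (EX! y. y : M & Q y) & (EX y:M. Q y & w el y)} = elts y"
proof -
 have "EX! y. y : M & Q y" using assms by blast
 moreover have "(EX y:M. Q y & w el y) = (w el y)" for w using assms by blast
 ultimately show ?thesis by auto
qed

lemma the1_eq: assumes "y : M" "Q y" "!!z. z : M ==> Q z ==> z = y" shows "the1 Q = y"
 unfolding the1_def by (rule mk_eq[OF assms(1)], rule the1_set[symmetric]) (use assms in blast)+

lemma the1_setp: "setp {w : M. (EX! y. y : M & Q y) & (EX y:M. Q y & w el y)}"
proof (cases "EX! y. y : M & Q y")
 case True
 then obtain y where y: "y : M" "Q y" "!!z. z : M ==> Q z ==> z = y" by blast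
 then have "{w : M. (EX! y. y : M & Q y) & (EX y:M. Q y & w el y)} = elts y" by (intro the1_set) blast+
 then show ?thesis using y(1) by simp
qed simp

lemma dft_the1 [dfi]: assumes "dfn (%e. Q (e 0) (%i. e (Suc i)))" shows "dft (%e. the1 (%y. Q y e))"
 by (rule dfi_set[where Q="%w e. (EX! y. y : M & Q y e) & (EX y:M. Q y e & w el y)"])
  (simp add: the1_def elts_mk[OF the1_setp], intro dfi dfn_w1 assms)

lemma app_undef: "func f d ==> f : M ==> d : M ==> x : M ==> ~ x el d ==> app f x = zero"
 using funcD(2)[of f d x] by (intro eqI) (auto simp: app_el)

lemma injection_iff: assumes "f : M" "d : M" "c : M"
 shows "injection f d c <-> func_into f d c & (ALL x:elts d. ALL y:elts d. app f x = app f y --> x = y)"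
proof -
 have "func f d ==> (ALL x:M. ALL x':M. ALL y:M. pair_in f x y & pair_in f x' y --> x = x') =
   (ALL x:elts d. ALL y:elts d. app f x = app f y --> x = y)"
  using funcD[of f d] assms by (metis (no_types, lifting) el_M p12_M(3) pair_in_iff)
 then show ?thesis unfolding injection_def func_into_def by blast
qed

lemma bijection_iff: assumes "f : M" "d : M" "c : M"
 shows "bijection f d c <-> func_into f d c & (ALL x:elts d. ALL y:elts d. app f x = app f y --> x = y)
  & (ALL y:elts c. EX x:elts d. app f x = y)"
proof -
 have "func f d ==> (EX x:elts d. pair_in f x y) = (EX x:elts d. app f x = y)" if "y el c" for y
  using funcD[of f d] assms that by (metis (no_types, lifting) el_M pair_in_iff)
 then show ?thesis unfolding bijection_def injection_iff[OF assms] func_into_def by blast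
qed

lemma choice_fun: assumes X: "X : M"
 obtains c where "c : M" "!!a. a : M ==> a sub X ==> elts a ~= {} ==> app c a el a"
proof -
 \<comment> \<open>The choice axiom is about disjoint families, so each nonempty \<open>a\<close> is
   replaced by the product of \<open>{a}\<close> with \<open>a\<close>.\<close>
 define F where "F = rep (sep (pow X) (%a. elts a ~= {})) (%a. times (sing a) a)"
 have P: "elts (sep (pow X) (%a. elts a ~= {})) = {a : M. a sub X & elts a ~= {}}"
  by (subst elts_sep, intro dfi) (use X in auto)
 have F: "elts F = (%a. times (sing a) a) ` {a : M. a sub X & elts a ~= {}}"
  unfolding F_def by (subst elts_rep, intro dfi) (simp_all add: P)
 have t: "elts (times (sing a) a) = opr a ` elts a" if "a : M" for a using that by (auto simp: elts_times)
 have "F : M" by (simp add: F_def)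
 moreover have "ALL y:elts F. elts y ~= {}" by (auto simp: F t)
 moreover have "ALL y:elts F. ALL z:elts F. y ~= z --> elts y Int elts z = {}"
  by (auto simp: F t)
 ultimately obtain c where c: "c : M" "ALL y:elts F. EX! z. z : elts c Int elts y" using choice by metis
 have s: "elts (sep c (%z. EX a:M. EX x:elts a. z = opr a x & a sub X)) = {z : elts c. EX a:M. EX x:elts a. z = opr a x & a sub X}"
  by (rule elts_sep) (intro dfi X c)+
 show thesis
 proof (rule that)
  show "sep c (%z. EX a:M. EX x:elts a. z = opr a x & a sub X) : M" (is "?c : M") by simp
  fix a assume a: "a : M" "a sub X" "elts a ~= {}"
  then have "times (sing a) a el F" by (auto simp: F)
  with c obtain z where z: "z el c" "z el times (sing a) a" "!!z'. z' el c ==> z' el times (sing a) a ==> z' = z" by blast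
  then obtain x where x: "x el a" "z = opr a x" using t[OF a(1)] by blast
  have u: "y = x" if "opr a y el ?c" "y : M" for y
  proof -
   have "opr a y el c" "y el a" using that a unfolding s by (auto dest: el_M)
   then show ?thesis using z(3)[of "opr a y"] x a that(2) t[of a] by auto
  qed
  have "opr a x el ?c" unfolding s using z(1) x a(1,2) by blast
  then have "app ?c a = x" by (intro app_eq[OF set_M(1) a(1)] el_M[OF x(1)] u)
  then show "app ?c a el a" using x by simp
 qed
qed

definition supr :: "'a => 'a => 'a => 'a" where "supr b c i = un b (uni i (app c))"

lemma supr_M [simp]: "supr b c i : M" by (simp add: supr_def)
lemma elts_supr [simp]: "b : M ==> c : M ==> i : M ==> elts (supr b c i) = elts b Un (UN j:elts i. elts (app c j))"
 unfolding supr_def by (subst elts_un, simp_all, subst elts_uni, intro dfi) auto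
lemma dft_supr [dfi]: "dft A ==> dft B ==> dft C ==> dft (%e. supr (A e) (B e) (C e))"
 unfolding supr_def by (intro dfi) (auto intro: dft_w1 dft_w dfi)

lemma supr_cong: "(!!j. j el i ==> app c j = app d j) ==> supr b c i = supr b d i"
 unfolding supr_def uni_def by (metis (no_types, lifting) image_cong)

text \<open>Transfinite recursion with a choice function at each step; limits are unions, since the
  orders in question are inclusion. \<open>supr b c i\<close> is the stage reached before step
  \<open>i\<close>, and \<open>app c i\<close> is the outcome of step \<open>i\<close>.\<close>

lemma chain: assumes X: "X : M" and eta: "eta : M" "ordinal eta" and b: "b : M"
 and St: "dfn (%e. St (e 0) (e 1) (e 2))"
 and step: "!!i p. i el eta ==> p el X ==> b sub p ==> EX q:elts X. p sub q & St i p q"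
 and lim: "!!i c. i el suc eta ==> c : M ==> (!!j. j el i ==> app c j el X & supr b c j el X &
   supr b c j sub app c j & St j (supr b c j) (app c j)) ==> supr b c i el X"
 obtains c where "c : M" "func c eta" "!!i. i el suc eta ==> supr b c i el X"
  "!!i. i el eta ==> app c i el X & supr b c i sub app c i & St i (supr b c i) (app c i)"
proof -
 obtain ch where ch: "ch : M" "!!a. a : M ==> a sub X ==> elts a ~= {} ==> app ch a el a"
  using choice_fun X by blast
 define H where "H i f = app ch (sep X (%q. supr b f i sub q & St i (supr b f i) q))" for i f
 have St': "dft A ==> dft B ==> dft C ==> dfn (%e. St (A e) (B e) (C e))" for A B C by (rule dfn3[OF St])
 have H: "dft (%e. H (e 0) (e 1))" unfolding H_def by (intro dfi St' ch X b)
 define c where "c = fn eta (rec H)"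
 have c: "c : M" "func c eta" unfolding c_def by (simp, intro func_fn dft_rec[OF H] dfi eta)
 have ap: "app c i = rec H i" if "i el eta" for i
  unfolding c_def by (intro app_fn dft_rec[OF H] dfi eta that)
 let ?Q = "%i. i el suc eta --> supr b c i el X & (i el eta --> app c i el X & supr b c i sub app c i & St i (supr b c i) (app c i))"
 have Q: "?Q i" if "i : M" for i
 proof (rule mem_induct[of ?Q])
  show "dfn (%e. ?Q (e 0))" by (intro dfi St' eta b c X)
  show "i : M" by (rule that)
  fix i assume i: "i : M" and IH: "!!j. j el i ==> ?Q j"
  show "?Q i"
  proof
   assume ie: "i el suc eta"
   have je: "j el eta" if "j el i" for j using ie that eta ord_tr by auto
   have s: "supr b c i el X" by (rule lim[OF ie c(1)]) (use IH je eta in auto)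
   have "app c i el X & supr b c i sub app c i & St i (supr b c i) (app c i)" if ie: "i el eta"
   proof -
    have "app (fn i (rec H)) j = app c j" if "j el i" for j
     using ap[OF je[OF that]] app_fn[of "rec H" j i] dft_rec[OF H dft_var] that i by simp
    then have e: "supr b (fn i (rec H)) i = supr b c i" by (rule supr_cong)
    define S where "S = sep X (%q. supr b c i sub q & St i (supr b c i) q)"
    have e: "app c i = app ch S" unfolding ap[OF ie] rec_unfold[OF H i] H_def e S_def ..
    have S: "elts S = {q : elts X. supr b c i sub q & St i (supr b c i) q}"
     unfolding S_def by (rule elts_sep) (intro dfi St' X | simp add: i)+
    have "elts S ~= {}" using step[OF ie s] b c i by (auto simp: S)
    moreover have "S : M" by (simp add: S_def)
    ultimately have "app ch S el S" using ch(2)[of S] by (auto simp: S)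
    then show ?thesis by (simp add: S e)
   qed
   then show "supr b c i el X & (i el eta --> app c i el X & supr b c i sub app c i & St i (supr b c i) (app c i))"
    using s by blast
  qed
 qed
 show thesis by (rule that[OF c]) (use Q eta in auto)
qed

text \<open>Zermelo's argument: \<open>?F i\<close> chooses an element that is not listed yet. If
  \<open>X\<close> were never exhausted, \<open>?F\<close> would inject all ordinals into
  \<open>X\<close>, and replacement would collect them in a set \<open>A\<close>, an ordinal that is
  an element of itself.\<close>

lemma enumerate: assumes X: "X : M"
 obtains a f where "ordinal a" "a : M" "f : M" "bijection f X a"
proof -
 obtain ch where ch: "ch : M" "!!a. a : M ==> a sub X ==> elts a ~= {} ==> app ch a el a"
  using choice_fun X by blast
 define H where "H i f = app ch (sep X (%x. ALL j:elts i. x ~= app f j))" for i f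
 have H: "dft (%e. H (e 0) (e 1))" unfolding H_def by (intro dfi ch X)
 note dr = dft_rec[OF H]
 let ?F = "rec H"
 have F: "?F i el X & (ALL j:elts i. ?F i ~= ?F j)" if i: "i : M" and x: "x el X" "ALL j:elts i. ?F j ~= x" for i x
 proof -
  define S where "S = sep X (%x. ALL j:elts i. x ~= app (fn i ?F) j)"
  have e: "?F i = app ch S" unfolding rec_unfold[OF H i] H_def S_def ..
  have a: "app (fn i ?F) j = ?F j" if "j el i" for j by (intro app_fn dr dfi that i)
  have S: "elts S = {x : elts X. ALL j:elts i. x ~= ?F j}"
   unfolding S_def by (subst elts_sep) (intro dfi X | simp add: i a)+
  have "S : M" by (simp add: S_def)
  then have "app ch S el S" using x by (intro ch(2)) (auto simp: S)
  then show ?thesis by (simp add: S e)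
 qed
 let ?P = "%i. ordinal i & (ALL x:elts X. EX j:elts i. ?F j = x)"
 have dP: "dfn (%e. ?P (e 0))" by (intro dfi dr X)
 have "EX i:M. ?P i"
 proof (rule ccontr)
  assume "~ (EX i:M. ?P i)"
  then have F': "?F i el X & (ALL j:elts i. ?F i ~= ?F j)" if "i : M" "ordinal i" for i using F that by metis
  have inj: "i = j" if "i : M" "ordinal i" "j : M" "ordinal j" "?F i = ?F j" for i j
   using F' that ord_tri by metis
  define A where "A = sep (rep X (%x. the1 (%i. ordinal i & ?F i = x))) ordinal"
  have A: "elts A = {i : (%x. the1 (%i. ordinal i & ?F i = x)) ` elts X. ordinal i}"
   unfolding A_def by (subst elts_sep, intro dfi, simp, subst elts_rep) (intro dfi dr X | simp)+
  have all: "i el A" if "i : M" "ordinal i" for i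
  proof -
   have "the1 (%k. ordinal k & ?F k = ?F i) = i" by (rule the1_eq) (use that inj in auto)
   then show ?thesis using F'[OF that] that unfolding A by (intro CollectI conjI image_eqI[of _ _ "?F i"]) auto
  qed
  have "A : M" by (simp add: A_def)
  moreover have "ordinal A" unfolding ordinal_def transitive_def
  proof (intro conjI ballI subsetI)
   show "z el A" if "y el A" "z el y" for y z using all[of z] that ord_el by (auto simp: A)
   show "u el y" if "y el A" "z el y" "u el z" for y z u using that ord_tr by (auto simp: A)
  qed
  ultimately show False using all no_cycle by blast
 qed
 then obtain i where "i : M" "?P i" by blast
 from minimal[OF dP this] obtain a where a: "a : M" "?P a" "!!b. b el a ==> ~ ?P b" by blast
 have aF: "?F i el X & (ALL j:elts i. ?F i ~= ?F j)" if "i el a" for i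
  using a(3)[OF that] F[of i] that a ord_el by blast
 have inj: "i = j" if "i el a" "j el a" "?F i = ?F j" for i j
  using aF that ord_tri[of i j] a ord_el by (metis el_M)
 define f where "f = sep (times X a) (%z. ?F (p2 z) = p1 z)"
 have f: "opr x i el f <-> x el X & i el a & ?F i = x" if "x : M" "i : M" for x i
  unfolding f_def by (subst elts_sep, intro dfi dr) (use that X a in auto)
 have fM: "f : M" by (simp add: f_def)
 have "func f X"
 proof (rule funcI[OF fM X])
  show "EX x:elts X. EX y:M. z = opr x y" if "z el f" for z
  proof -
   have "z el times X a" using that unfolding f_def by (subst (asm) elts_sep, intro dfi dr) auto
   then show ?thesis using X a by (auto simp: elts_times)
  qed
  show "EX y:M. opr x y el f" if "x el X" for x using a(2) that f el_M by metis
  show "y = y'" if "x el X" "y : M" "y' : M" "opr x y el f" "opr x y' el f" for x y y'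
   using f[of x y] f[of x y'] inj[of y y'] that el_M by metis
 qed
 moreover have ap: "app f x el a & ?F (app f x) = x" if "x el X" for x
  using funcD(1)[OF calculation fM X that] f[of x "app f x"] that by auto
 ultimately have "bijection f X a" unfolding bijection_iff[OF fM X a(1)] func_into_iff[OF fM X a(1)]
  using aF inj by metis
 then show thesis using that a fM by blast
qed

text \<open>For regular \<open>k\<close> this expresses that \<open>X\<close> has size less than
  \<open>k\<close> (\<open>bs_card\<close>). Stated as boundedness of all maps into
  \<open>k\<close>, it passes to images, products and small unions without cardinal
  arithmetic.\<close>

definition bs :: "'a => 'a => bool" where
 "bs k X = (X : M & (ALL f:M. func_into f X k --> (EX b:elts k. ALL x:elts X. app f x el b)))"
definition reg :: "'a => bool" where "reg k = (k : M & uncountable_regular_cardinal k)"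

lemma dfn_M [dfi]: "dft A ==> dfn (%e. A e : M)"
 by (rule dfn_cong[OF _ dfn_const[of True]]) (simp add: dft_M)

lemma dfn_bs [dfi]: "dft A ==> dft B ==> dfn (%e. bs (A e) (B e))"
 by (rule dfn2[of bs]) (unfold bs_def, intro dfi)

lemma bs_M: "bs k X ==> X : M" by (simp add: bs_def)
lemma reg_M: "reg k ==> k : M" by (simp add: reg_def)
lemma reg_ord: "reg k ==> ordinal k" by (simp add: reg_def uncountable_regular_cardinal_def cardinal_def)

lemma bs_el: assumes "reg k" "a el k" shows "bs k a"
proof -
 have "EX b:elts k. ALL x:elts a. app f x el b" if f: "f : M" "func_into f a k" for f
 proof -
  obtain b where b: "b el k" "ALL x:elts a. ALL y:M. pair_in f x y --> y el b"
   using assms f unfolding reg_def uncountable_regular_cardinal_def by blast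
  have "func f a" using f by (simp add: func_into_def)
  from funcD(1)[OF this f(1)] have "pair_in f x (app f x)" if "x el a" for x
   using that assms f(1) by (auto simp: pair_in_iff)
  then show ?thesis using b by (metis p12_M(3))
 qed
 then show ?thesis using assms by (auto simp: bs_def)
qed

text \<open>If \<open>k\<close> were contained in \<open>w\<close>, the identity would inject it
  into \<open>w\<close>; trichotomy then leaves \<open>w\<close> an element of
  \<open>k\<close>.\<close>

lemma reg_omega: assumes "reg k" obtains w where "w el k" "is_omega w"
proof -
 have k: "k : M" "ordinal k" using assms reg_M reg_ord by auto
 obtain w where w: "w : M" "is_omega w" "~ card_le k w"
  using assms by (auto simp: reg_def uncountable_regular_cardinal_def uncountable_def)
 have "~ k sub w"
 proof
  assume s: "k sub w"
  have a: "app (fn k (%x. x)) x = x" if "x el k" for x by (rule app_fn) (intro dfi that k)+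
  have "injection (fn k (%x. x)) k w" using w k s
   by (auto simp: injection_iff func_into_iff a intro!: func_fn dfi)
  then show False using w k fn_M unfolding card_le_def by blast
 qed
 moreover have "ordinal w" using w by (simp add: is_omega_def limit_ordinal_def)
 ultimately show thesis using that w ord_tri[of k w] ord_sub[of k w] k by blast
qed

lemma reg_bd: assumes "reg k" "bs k X" "dft (%e. F (e 0))" "!!x. x el X ==> F x el k"
 obtains b where "b el k" "!!x. x el X ==> F x el b"
proof -
 have X: "X : M" using assms bs_M by auto
 have a: "app (fn X F) x = F x" if "x el X" for x by (rule app_fn) (use assms that X in auto)
 have "func_into (fn X F) X k" using assms X reg_M by (simp add: func_into_iff func_fn a)
 then obtain b where "b el k" "ALL x:elts X. app (fn X F) x el b" using assms(2) unfolding bs_def by (metis fn_M(1))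
 then show thesis using that a by auto
qed

lemma omega_zero: assumes "is_omega w" "w : M" shows "zero el w"
 using assms ord_tri[of zero w] ord_zero unfolding is_omega_def limit_ordinal_def by auto

lemma omega_suc: assumes "is_omega w" "w : M" "n el w" shows "suc n el w"
proof -
 have o: "ordinal w" using assms by (simp add: is_omega_def limit_ordinal_def)
 obtain m where m: "m el w" "n el m" using assms unfolding is_omega_def limit_ordinal_def by blast
 have om: "ordinal m" using ord_el o m by blast
 have "suc n sub m" using m(2) ord_tr[OF om] el_M[OF assms(3)] by auto
 then show ?thesis using ord_sub[OF ord_suc om] ord_el[OF om m(2)] m ord_tr[OF o] by (metis el_M suc_M)
qed

lemma reg_suc: assumes "reg k" "a el k" shows "suc a el k"
proof -
 obtain w where w: "w el k" "is_omega w" by (rule reg_omega[OF assms(1)])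
 obtain x where "x el w" using w by (auto simp: is_omega_def limit_ordinal_def)
 moreover obtain b where b: "b el k" "!!x. x el w ==> a el b"
  by (rule reg_bd[OF assms(1) bs_el[OF assms(1) w(1)], of "%_. a"]) (use assms in \<open>auto intro: dfi\<close>)
 ultimately have "a el b" by blast
 have o: "ordinal b" "ordinal a" "ordinal k" using assms b reg_ord ord_el by blast+
 have "suc a sub b" using \<open>a el b\<close> o ord_tr[OF o(1)] by (auto dest: el_M)
 then show ?thesis using ord_sub[of "suc a" b] ord_suc[of a] o b ord_tr[OF o(3)] assms by (auto dest: el_M)
qed

lemma reg_zero: assumes "reg k" shows "zero el k"
proof -
 obtain w where w: "w el k" "is_omega w" by (rule reg_omega[OF assms(1)])
 have "ordinal w" "w : M" using w by (auto simp: is_omega_def limit_ordinal_def)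
 then show ?thesis using ord_sub[of zero w] ord_zero w ord_tr[OF reg_ord[OF assms]] by auto
qed

lemma bs_img: assumes k: "reg k" and X: "bs k X" "Y : M" "dft (%e. F (e 0))" "!!y. y el Y ==> EX x:elts X. y = F x" shows "bs k Y"
 unfolding bs_def
proof (intro conjI ballI impI X(2))
 fix g assume g: "g : M" "func_into g Y k"
 have FM: "F x : M" if "x : M" for x using dft_M[OF X(3), of "%_. x"] that by simp
 have "app g (F x) el k" if "x el X" for x
  using g reg_M[OF k] X(2) app_undef[OF _ g(1) X(2) FM] reg_zero[OF k] that el_M[OF that]
  by (cases "F x el Y") (auto simp: func_into_iff)
 then obtain b where "b el k" "!!x. x el X ==> app g (F x) el b"
  using reg_bd[OF k X(1), of "%x. app g (F x)"] dft_app[OF dft_const[OF g(1)] X(3)] by blast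
 then show "EX b:elts k. ALL y:elts Y. app g y el b" using X(4) by blast
qed

lemma bs_sub: "reg k ==> bs k X ==> Y : M ==> Y sub X ==> bs k Y" by (rule bs_img[of k X Y "%x. x"]) (auto intro: dfi)

lemma bs_uni: assumes k: "reg k" and X: "bs k X" "dft (%e. F (e 0))" "!!x. x el X ==> bs k (F x)" shows "bs k (uni X F)"
 unfolding bs_def
proof (intro conjI ballI impI)
 have kM: "k : M" "ordinal k" "X : M" using k reg_M reg_ord X bs_M by auto
 fix g assume g: "g : M" "func_into g (uni X F) k"
 have u: "elts (uni X F) = (UN x:elts X. elts (F x))" using elts_uni X(2) kM by blast
 \<comment> \<open>The bound on the piece \<open>F x\<close> is the union of the successors of the
   values there. It is an ordinal because it is a transitive subset of an ordinal \<open>b\<close>,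
   and these bounds are bounded in turn.\<close>
 define h where "h x = uni (F x) (%y. suc (app g y))" for x
 have dh: "dft (%e. h (e 0))" unfolding h_def by (intro dfi g X dft_w)
 have h: "elts (h x) = (UN y:elts (F x). elts (suc (app g y)))" if "x el X" for x
  unfolding h_def by (rule elts_uni) (intro dfi g, use X(3) that bs_M in auto)
 have gk: "app g y el k" if "x el X" "y el F x" for x y using g kM u that by (auto simp: func_into_iff)
 have "h x el k" if x: "x el X" for x
 proof -
  have "dft (%e. suc (app g (e 0)))" by (intro dfi g)
  then obtain b where b: "b el k" "!!y. y el F x ==> suc (app g y) el b"
   using reg_bd[OF k X(3)[OF x], of "%y. suc (app g y)"] reg_suc[OF k] gk x by blast
  have ob: "ordinal b" using b kM ord_el by blast
  have hs: "h x sub b" unfolding h[OF x] using b(2) ord_tr[OF ob] by blast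
  have "ordinal (h x)" unfolding ordinal_def transitive_def
  proof (intro conjI ballI subsetI)
   fix y z assume y: "y el h x"
   { assume "z el y"
    obtain t where t: "t el F x" "y el suc (app g t)" using y h[OF x] by blast
    have "ordinal (suc (app g t))" using b(2)[OF t(1)] ob ord_el by blast
    then show "z el h x" using t \<open>z el y\<close> ord_tr unfolding h[OF x] by blast }
   fix u assume "z el y" "u el z" then show "u el y" using ord_tr[OF ord_el[OF ob]] hs y by blast
  qed
  then show ?thesis using hs ord_sub[of "h x" b] ob b ord_tr[OF kM(2)] el_M by (metis h_def set_M(3))
 qed
 then obtain b where b: "b el k" "!!x. x el X ==> h x el b" using reg_bd[OF k X(1) dh] by blast
 have "app g y el b" if y: "y el uni X F" for y
 proof -
  obtain x where x: "x el X" "y el F x" using y u by auto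
  then have "app g y el h x" by (auto simp: h)
  then show ?thesis using b x ord_tr ord_el kM by metis
 qed
 then show "EX b:elts k. ALL y:elts (uni X F). app g y el b" using b by blast
qed simp

lemma bs_sing: assumes "reg k" "a : M" shows "bs k (sing a)"
 by (rule bs_img[OF assms(1) bs_el[OF assms(1) reg_suc[OF assms(1) reg_zero[OF assms(1)]]], of _ "%_. a"])
  (use assms in \<open>auto intro: dfi\<close>)

lemma bs_un: assumes "reg k" "bs k X" "bs k Y" shows "bs k (un X Y)"
 unfolding bs_def
proof (intro conjI ballI impI)
 have M: "X : M" "Y : M" "k : M" "ordinal k" using assms bs_M reg_M reg_ord by auto
 fix g assume g: "g : M" "func_into g (un X Y) k"
 have dg: "dft (%e. app g (e 0))" by (intro dfi g)
 obtain a where a: "a el k" "!!x. x el X ==> app g x el a"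
  by (rule reg_bd[OF assms(1,2) dg]) (use g M in \<open>auto simp: func_into_iff\<close>)
 obtain b where b: "b el k" "!!x. x el Y ==> app g x el b"
  by (rule reg_bd[OF assms(1,3) dg]) (use g M in \<open>auto simp: func_into_iff\<close>)
 have o: "ordinal a" "ordinal b" using M a b ord_el by blast+
 then consider "a sub b" | "b sub a" using ord_tri[OF o] ord_sub[of a b] ord_sub[of b a] a b by (metis el_M order_refl)
 then show "EX c:elts k. ALL x:elts (un X Y). app g x el c"
  by cases (use a b M in \<open>auto 4 3\<close>)
qed simp

lemma bs_rep: "reg k ==> bs k X ==> dft (%e. F (e 0)) ==> bs k (rep X F)"
 by (rule bs_img) (auto simp: elts_rep bs_M)

lemma bs_times: assumes "reg k" "bs k X" "bs k Y" shows "bs k (times X Y)"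
 unfolding times_def by (intro bs_uni bs_rep assms dfi bs_M[OF assms(3)]) auto

lemma bs_card: assumes k: "reg k" and X: "X : M" shows "bs k X = card_less X k"
proof
 have kM: "k : M" "ordinal k" using k reg_M reg_ord by auto
 assume b: "bs k X"
 obtain a f where a: "ordinal a" "a : M" "f : M" "bijection f X a" using enumerate X by blast
 note f = a(4)[unfolded bijection_iff[OF a(3) X a(2)] func_into_iff[OF a(3) X a(2)]]
 have "a el k"
 proof (rule ccontr)
  assume "~ a el k"
  then have ka: "k sub a" using ord_sub[of k a] ord_tri[of k a] a kM by blast
  \<comment> \<open>\<open>h\<close> is a total map into \<open>k\<close>: the value of the
    bijection if that lies in \<open>k\<close>, and 0 otherwise. If \<open>k\<close> were contained
    in \<open>a\<close>, all of \<open>k\<close> would be hit and \<open>h\<close> would be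
    unbounded.\<close>
  define h where "h x = sep (app f x) (%w. app f x el k)" for x
  have dh: "dft (%e. h (e 0))" unfolding h_def by (intro dfi a kM)
  have eh: "elts (h x) = {w : elts (app f x). app f x el k}" for x
   unfolding h_def by (cases "x : M"; subst elts_sep) (intro dfi | simp add: a kM)+
  have hM: "h x : M" for x by (simp add: h_def)
  have h1: "h x = app f x" if "app f x el k" for x using that by (intro zfc_ext) (auto simp: eh hM)
  have h2: "h x = zero" if "~ app f x el k" for x using that by (intro zfc_ext) (auto simp: eh hM)
  have "h x el k" for x using h1 h2 reg_zero[OF k] by metis
  then obtain c where c: "c el k" "!!x. x el X ==> h x el c" using reg_bd[OF k b dh] by blast
  then obtain x where "x el X" "app f x = c" using f ka by blast
  then show False using c h1 no_cycle by (metis el_M)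
 qed
 then show "card_less X k" using a unfolding card_less_def equipollent_def by blast
next
 assume "card_less X k"
 then obtain a f where a: "a el k" "f : M" "bijection f X a" unfolding card_less_def equipollent_def by blast
 note f = a(3)[unfolded bijection_iff[OF a(2) X el_M[OF a(1)]] func_into_iff[OF a(2) X el_M[OF a(1)]]]
 show "bs k X"
 proof (rule bs_img[OF k bs_el[OF k a(1)] X, of "%j. the1 (%x. x el X & app f x = j)"])
  show "dft (%e. the1 (%x. x el X & app f x = e 0))" by (intro dfi X a)
  fix y assume y: "y el X"
  have "the1 (%x. x el X & app f x = app f y) = y" by (rule the1_eq) (use y f in auto)
  then show "EX x:elts a. y = the1 (%xa. xa el X & app f xa = x)" using f y by metis
 qed
qed

lemma bs_bij: assumes "reg k" "bs k X" obtains a f where "a el k" "f : M" "bijection f X a"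
 using assms bs_card[OF assms(1) bs_M[OF assms(2)]] unfolding card_less_def equipollent_def by blast

lemma bs_mono: assumes "reg k" "reg m" "k el m" "bs k X" shows "bs m X"
proof -
 have "card_less X k" using assms bs_card bs_M by blast
 then have "card_less X m" unfolding card_less_def using ord_tr reg_ord assms by metis
 then show ?thesis using assms bs_card bs_M by blast
qed

text \<open>Inaccessibility bounds the power sets of ordinals below \<open>k\<close>; a bijection of
  \<open>X\<close> with such an ordinal transports the bound.\<close>

lemma bs_pow: assumes k: "k : M" "inaccessible k" and X: "bs k X" shows "bs k (pow X)"
proof -
 have r: "reg k" using k by (simp add: reg_def inaccessible_def)
 have XM: "X : M" using X bs_M by blast
 obtain a f where a: "a el k" "f : M" "bijection f X a" using bs_bij[OF r X] by blast
 note f = a(3)[unfolded bijection_iff[OF a(2) XM el_M[OF a(1)]] func_into_iff[OF a(2) XM el_M[OF a(1)]]]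
 obtain s where s: "s : M" "elts s = {y : M. elts y <= elts a}" "card_less s k" using k a unfolding inaccessible_def by blast
 show ?thesis
 proof (rule bs_img[OF r, of s _ "%u. sep X (%x. app f x el u)"])
  show "bs k s" using s r bs_card by blast
  show "dft (%e. sep X (%x. app f x el e 0))" by (intro dfi a XM)
  fix y assume y: "y el pow X"
  have ry: "elts (rep y (app f)) = app f ` elts y" by (rule elts_rep) (intro dfi a, use y in auto)
  have "elts (sep X (%x. app f x el rep y (app f))) = {x : elts X. app f x el rep y (app f)}"
   by (rule elts_sep) (intro dfi a | simp add: XM)+
  then have "y = sep X (%x. app f x el rep y (app f))"
   using y XM f ry by (intro zfc_ext) (simp_all, blast)
  moreover have "rep y (app f) el s" using y f XM by (auto simp: s ry)
  ultimately show "EX u:elts s. y = sep X (%x. app f x el u)" by blast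
 qed simp
qed

end

section \<open>Forcing\<close>

context zfc begin

text \<open>Recursion over names: the value at \<open>x\<close> may use the values at all members of the transitive
 closure of \<open>x\<close>, which \<open>tab K x\<close> collects.\<close>

definition tab :: "('a => 'a => 'a) => 'a => 'a" where
 "tab K = rec (%x f. uni x (%y. un (app f y) (sing (opr y (K y (app f y))))))"
definition rect :: "('a => 'a => 'a) => 'a => 'a" where "rect K x = K x (tab K x)"

context
 fixes K :: "'a => 'a => 'a"
 assumes K: "dft (%e. K (e 0) (e 1))"
begin

lemma tab_H: "dft (%e. (%x f. uni x (%y. un (app f y) (sing (opr y (K y (app f y)))))) (e 0) (e 1))"
 by (intro dfi dft2[OF K])

lemma dft_tab: "dft A ==> dft (%e. tab K (A e))" unfolding tab_def by (rule dft_rec[OF tab_H])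
lemma dft_rect: "dft A ==> dft (%e. rect K (A e))" unfolding rect_def by (intro dft2[OF K] dft_tab)
lemma tab_M [simp]: "tab K x : M" by (simp add: tab_def)

lemma elts_tab: assumes x: "x : M" shows "elts (tab K x) = (UN y:elts x. insert (opr y (rect K y)) (elts (tab K y)))"
proof -
 have a: "app (fn x (tab K)) y = tab K y" if "y el x" for y by (intro app_fn dft_tab dfi that x)
 have d: "dft (%e. un (app (fn x (tab K)) (e 0)) (sing (opr (e 0) (K (e 0) (app (fn x (tab K)) (e 0))))))"
  by (intro dfi dft2[OF K] dft_tab x) auto
 have "tab K x = uni x (%y. un (app (fn x (tab K)) y) (sing (opr y (K y (app (fn x (tab K)) y)))))"
  unfolding tab_def by (rule rec_unfold[OF tab_H x])
 then have "elts (tab K x) = (UN y:elts x. elts (un (app (fn x (tab K)) y) (sing (opr y (K y (app (fn x (tab K)) y))))))"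
  using elts_uni[OF d x] by simp
 then show ?thesis by (simp add: a rect_def)
qed

lemma tab_rect: assumes "x : M" "z el tab K x" shows "EX y:M. z = opr y (rect K y)"
proof -
 have "ALL z:elts (tab K x). EX y:M. z = opr y (rect K y)"
 proof (rule mem_induct[OF _ assms(1)])
  show "dfn (%e. ALL z:elts (tab K (e 0)). EX y:M. z = opr y (rect K y))" by (intro dfi dft_tab dft_rect)
  fix x assume "x : M" "!!y. y el x ==> ALL z:elts (tab K y). EX y:M. z = opr y (rect K y)"
  then show "ALL z:elts (tab K x). EX y:M. z = opr y (rect K y)" unfolding elts_tab[OF \<open>x : M\<close>] by blast
 qed
 then show ?thesis using assms by blast
qed

lemma app_tab: assumes x: "x : M" and y: "opr y (rect K y) el tab K x" "y : M" shows "app (tab K x) y = rect K y"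
proof (rule app_eq[OF tab_M y(2) y(1)])
 have RM: "z : M ==> rect K z : M" for z using dft_M[OF dft_rect[OF dft_var[of 0]], of "%_. z"] by simp
 then show "rect K y : M" using y by simp
 fix z assume "z : M" "opr y z el tab K x"
 then show "z = rect K y" using tab_rect[OF x] y(2) RM opr_inj by metis
qed

lemma rect_pair: assumes "opr y s el x" "y : M" "s : M" and xM: "x : M" shows "app (tab K x) y = rect K y"
proof (rule app_tab[OF _ _ assms(2)])
 have y: "y el mk {y}" "mk {y} el opr y s" using assms by (auto simp: elts_opr elts_mk)
 have m: "opr u (rect K u) el tab K v" "tab K u sub tab K v" if "u el v" "v : M" for u v
  using that(1) unfolding elts_tab[OF that(2)] by blast+
 show xM: "x : M" by (rule xM)
 show "opr y (rect K y) el tab K x"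
  using m[OF y(1) mk_M] m(2)[OF y(2) opr_M] m(2)[OF assms(1) xM] by blast
qed

end

text \<open>\<open>y\<close> lies in \<open>{y}\<close>, which lies in the pair of \<open>y\<close>
  and \<open>s\<close>, which lies in \<open>x\<close>. So the plain induction is run for a claim
  that also covers the members of \<open>x\<close> and their members.\<close>

lemma pair_induct: assumes d: "dfn (%e. Q (e 0))" and x: "x : M"
 and step: "!!x. x : M ==> (!!y s. y : M ==> s : M ==> opr y s el x ==> Q y) ==> Q x" shows "Q x"
proof -
 let ?R = "%x. Q x & (ALL y:elts x. Q y) & (ALL y:elts x. ALL z:elts y. Q z)"
 have "?R x"
 proof (rule mem_induct[of ?R])
  show "dfn (%e. ?R (e 0))" by (intro dfi dfn1[OF d])
  fix x assume x: "x : M" and IH: "!!y. y el x ==> ?R y"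
  have "Q x"
  proof (rule step[OF x])
   fix y s assume "y : M" "s : M" "opr y s el x"
   moreover have "mk {y} el opr y s" "y el mk {y}" using calculation by (auto simp: elts_opr elts_mk)
   ultimately show "Q y" using IH by blast
  qed
  then show "?R x" using IH by blast
 qed (rule x)
 then show ?thesis by blast
qed

end

text \<open>The forcing notions considered consist of sets ordered by reverse inclusion.\<close>

locale forcing = zfc + fixes PP :: 'a assumes PP: "PP : M" "zero el PP"
begin

definition dns :: "'a => ('a => bool) => bool" where
 "dns p X = (ALL q:elts PP. p sub q --> (EX r:elts PP. q sub r & X r))"

lemma dfn_dns [dfi]: "dft A ==> dfn (%e. X (e 0) (%i. e (Suc i))) ==> dfn (%e. dns (A e) (%r. X r e))"
 unfolding dns_def by (intro dfi dft_w PP dfn_w1)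

lemma dns_mono: "dns p X ==> p sub q ==> dns q X" unfolding dns_def by blast
lemma dns_imp: "dns p X ==> (!!r. r el PP ==> p sub r ==> X r ==> Y r) ==> dns p Y" unfolding dns_def by (meson subset_trans)
lemma dns_dns: "dns p (%r. dns r X) ==> dns p X" unfolding dns_def by (meson subset_trans subset_refl)
lemma dnsI: "(!!r. r el PP ==> p sub r ==> X r) ==> dns p X" unfolding dns_def by blast
lemma dnsE: "dns p X ==> p el PP ==> (!!r. r el PP ==> p sub r ==> X r ==> thesis) ==> thesis" unfolding dns_def by blast

abbreviation feq where "feq == forces_eq (elts PP) Col_le"
abbreviation stp where "stp == forces_eq_step (elts PP) Col_le"

text \<open>This is one conjunct of \<open>forces_eq_step\<close>. The condition and the first name
  are packed into one argument of \<open>F\<close>, so that recursion predicates have few variables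
  in the definability rules.\<close>

definition half :: "('a => 'a => bool) => 'a => 'a => 'a => bool" where
 "half F p a b = (ALL x:M. ALL s:elts PP. opr x s el a --> (ALL q:elts PP. p sub q & s sub q -->
   dns q (%r. EX y:M. EX t:elts PP. opr y t el b & t sub r & F (opr r x) y)))"

lemma db_iff: "dense_below (elts PP) Col_le p {q. Col_le q s --> X q} =
  (ALL q:elts PP. p sub q & s sub q --> dns q X)" (is "?L = ?R")
proof
 assume ?L then show ?R unfolding dense_below_def Col_le_def dns_def by (auto, meson order_trans)
next
 assume R: ?R
 show ?L unfolding dense_below_def Col_le_def
 proof (intro ballI impI)
  fix q assume q: "q el PP" "p sub q"
  show "EX r:elts PP. q sub r & r : {q. s sub q --> X q}"
  proof (cases "EX q':elts PP. q sub q' & s sub q'")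
   case True
   then obtain q' where q': "q' el PP" "q sub q'" "s sub q'" by blast
   then have "dns q' X" using R q by blast
   then obtain r where "r el PP" "q' sub r" "X r" using q' unfolding dns_def by blast
   then show ?thesis using q' by blast
  qed (use q in blast)
 qed
qed

lemma stp_iff: assumes "a : M" "b : M"
 shows "stp F p a b = (half (%z y. F (p1 z) (p2 z) y) p a b & half (%z x. F (p1 z) x (p2 z)) p b a)"
proof -
 have *: "(ALL x:M. ALL s:elts PP. pair_in a x s --> dense_below (elts PP) Col_le p
   {q. Col_le q s --> (EX y:M. EX r:elts PP. pair_in b y r & Col_le q r & F q x y)}) =
  half (%z y. F (p1 z) (p2 z) y) p a b" if "a : M" "b : M" for a b F
  unfolding db_iff half_def dns_def using that
  by (intro ball_cong refl imp_cong bex_cong conj_cong) (auto simp: pair_in_iff Col_le_def)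
 show ?thesis unfolding forces_eq_step_def using *[OF assms, of F] *[OF assms(2,1), of "%q y x. F q x y"] by simp
qed

lemma half_cong: "(!!x s r y t. x : M ==> opr x s el a ==> opr y t el b ==> y : M ==> s el PP ==> t el PP ==> r el PP ==>
  F (opr r x) y = F' (opr r x) y) ==> half F p a b = half F' p a b"
 unfolding half_def dns_def by (intro ball_cong bex_cong refl imp_cong conj_cong) (auto intro!: bex_cong)

lemma dfn_half1: assumes "dfn (%e. F (e 0) (e 1) (e 2))" "dft A" "dft B" "dft C" "dft D"
 shows "dfn (%e. half (%z y. F z y (D e)) (A e) (B e) (C e))"
 by (rule dfn4[of "%a b c d. half (%z y. F z y d) a b c", OF _ assms(2-5)]) (unfold half_def, intro dfi PP dfn3[OF assms(1)])

lemma coded_iff: "f : M ==> q : M ==> a : M ==> b : M ==> coded_triple f q a b <-> opr q (opr a b) el f"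
 unfolding coded_triple_def by (metis opair_iff opr_M pair_in_iff)

definition sol :: "'a => 'a => bool" where
 "sol t f = (transitive t & (ALL q:elts PP. ALL a:elts t. ALL b:elts t. (opr q (opr a b) el f) =
   (half (%z y. opr (p1 z) (opr (p2 z) y) el f) q a b & half (%z x. opr (p1 z) (opr x (p2 z)) el f) q b a)))"

lemma el3: "transitive t ==> opr x s el a ==> a el t ==> x : M ==> s : M ==> x el t"
proof -
 assume a: "transitive t" "opr x s el a" "a el t" "x : M" "s : M"
 then have "opr x s el t" using trD by blast
 moreover have "mk {x} el opr x s" "x el mk {x}" using a by (auto simp: elts_opr elts_mk)
 ultimately show "x el t" using a(1) trD by blast
qed

lemma feq_sol: assumes "p : M" "a : M" "b : M"
 shows "feq p a b = (EX t:M. EX f:M. sol t f & a el t & b el t & opr p (opr a b) el f)"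
proof -
 have h: "half (%z y. coded_triple f (p1 z) (p2 z) y) q a b = half (%z y. opr (p1 z) (opr (p2 z) y) el f) q a b"
  "half (%z x. coded_triple f (p1 z) x (p2 z)) q a b = half (%z x. opr (p1 z) (opr x (p2 z)) el f) q a b"
  if "f : M" for f q a b using that by (auto intro!: half_cong simp: coded_iff)
 have "(ALL q:elts PP. ALL a:elts t. ALL b:elts t. coded_triple f q a b = stp (coded_triple f) q a b) =
  (ALL q:elts PP. ALL a:elts t. ALL b:elts t. (opr q (opr a b) el f) =
   (half (%z y. opr (p1 z) (opr (p2 z) y) el f) q a b & half (%z x. opr (p1 z) (opr x (p2 z)) el f) q b a))"
  if "f : M" for t f
  using that by (intro ball_cong refl) (simp add: stp_iff h coded_iff)
 then show ?thesis unfolding forces_eq_def sol_def using assms by (auto simp: coded_iff cong: bex_cong conj_cong)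
qed

lemma dfn_sol: "dft A ==> dft B ==> dfn (%e. sol (A e) (B e))"
 by (rule dfn2[of sol]) (unfold sol_def, intro dfi PP
  dfn_half1[of "%z y f. opr (p1 z) (opr (p2 z) y) el f"] dfn_half1[of "%z x f. opr (p1 z) (opr x (p2 z)) el f"])

lemma dfn_feq [dfi]: assumes "dft A" "dft B" "dft C"
 shows "dfn (%e. feq (A e) (B e) (C e))"
proof (rule dfn_cong)
 show "dfn (%e. EX t:M. EX f:M. sol t f & B e el t & C e el t & opr (A e) (opr (B e) (C e)) el f)"
  by (intro dfi dfn_sol dft_w assms)
qed (use feq_sol assms dft_M in metis)

lemma solD: "sol t f ==> q el PP ==> a el t ==> b el t ==> (opr q (opr a b) el f) =
   (half (%z y. opr (p1 z) (opr (p2 z) y) el f) q a b & half (%z x. opr (p1 z) (opr x (p2 z)) el f) q b a)"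
 unfolding sol_def by blast

lemma sol_unique: assumes s: "sol t f" "sol t' f'" and M: "t : M" "f : M" "t' : M" "f' : M"
 and a: "a el t" "b el t" "a el t'" "b el t'" "q el PP"
 shows "(opr q (opr a b) el f) = (opr q (opr a b) el f')"
proof -
 let ?Q = "%a. a el t & a el t' --> (ALL b:elts t. ALL q:elts PP. b el t' --> (opr q (opr a b) el f) = (opr q (opr a b) el f'))"
 have "?Q a"
 proof (rule pair_induct[of ?Q])
  show "dfn (%e. ?Q (e 0))" by (intro dfi M PP)
  show "a : M" using a by auto
  fix a assume IH: "!!x s. x : M ==> s : M ==> opr x s el a ==> ?Q x"
  show "?Q a"
  proof (intro impI ballI)
   fix b q assume a: "a el t & a el t'" and b: "b el t" "b el t'" and q: "q el PP"
   have tr: "transitive t" "transitive t'" using s by (auto simp: sol_def)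
   have e: "(opr r (opr x y) el f) = (opr r (opr x y) el f')"
    if "x : M" "opr x u el a" "opr y v el b" "y : M" "u el PP" "v el PP" "r el PP" for x u r y v
    using IH[of x u] el3[OF tr(1)] el3[OF tr(2)] a b that by (metis el_M)
   have "half (%z y. opr (p1 z) (opr (p2 z) y) el f) q a b = half (%z y. opr (p1 z) (opr (p2 z) y) el f') q a b"
    by (rule half_cong) (use e in simp)
   moreover have "half (%z x. opr (p1 z) (opr x (p2 z)) el f) q b a = half (%z x. opr (p1 z) (opr x (p2 z)) el f') q b a"
    by (rule half_cong) (use e in simp)
   ultimately show "(opr q (opr a b) el f) = (opr q (opr a b) el f')" using solD[OF s(1) q] solD[OF s(2) q] a b by simp
  qed
 qed
 then show ?thesis using a by blast
qed

lemma sol_ex: assumes t: "transitive t" "t : M" obtains f where "f : M" "sol t f"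
proof -
 \<comment> \<open>Recursion on the first name alone: the value at \<open>a\<close> is the set of
   all pairs of a condition \<open>q\<close> and a name \<open>b\<close> in \<open>t\<close> such
   that \<open>q\<close> forces \<open>a\<close> and \<open>b\<close> equal. One function of one
   variable thus carries the whole relation.\<close>
 define K where "K a T = sep (times PP t) (%w. half (%z y. opr (p1 z) y el app T (p2 z)) (p1 w) a (p2 w) &
   half (%z x. opr (p1 z) (p2 z) el app T x) (p1 w) (p2 w) a)" for a T
 have K: "dft (%e. K (e 0) (e 1))" unfolding K_def by (intro dfi PP t
  dfn_half1[of "%z y T. opr (p1 z) y el app T (p2 z)"] dfn_half1[of "%z x T. opr (p1 z) (p2 z) el app T x"])
 have Kel: "opr q b el K a T <-> q el PP & b el t & half (%z y. opr (p1 z) y el app T (p2 z)) q a b &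
   half (%z x. opr (p1 z) (p2 z) el app T x) q b a" if "a : M" "T : M" "q : M" "b : M" for q b a T
  unfolding K_def by (subst elts_sep, intro dfi PP t that
   dfn_half1[of "%z y T. opr (p1 z) y el app T (p2 z)"] dfn_half1[of "%z x T. opr (p1 z) (p2 z) el app T x"])
   (use that PP t in auto)
 define f where "f = sep (times PP (times t t)) (%w. opr (p1 w) (p2 (p2 w)) el rect K (p1 (p2 w)))"
 have f: "opr q (opr a b) el f <-> q el PP & a el t & b el t & opr q b el rect K a" if "a : M" "q : M" "b : M" for q a b
  unfolding f_def by (subst elts_sep, intro dfi PP t dft_rect[OF K]) (use that PP t in auto)
 have "sol t f" unfolding sol_def
 proof (intro conjI t ballI)
  fix q a b assume q: "q el PP" and a: "a el t" and b: "b el t"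
  have e: "(opr r y el app (tab K a) x) = (opr r (opr x y) el f)"
   if "x : M" "opr x u el a" "opr y v el b" "y : M" "u el PP" "v el PP" "r el PP" for x u r y v
   using rect_pair[OF K that(2,1) el_M[OF that(5)] el_M[OF a]] el3[OF t(1) that(2) a] el3[OF t(1) that(3) b] f[of x r y] that el_M by metis
  have "opr q (opr a b) el f <-> opr q b el K a (tab K a)" using f[of a q b] q a b by (auto simp: rect_def)
  also have "\<dots> <-> half (%z y. opr (p1 z) y el app (tab K a) (p2 z)) q a b &
   half (%z x. opr (p1 z) (p2 z) el app (tab K a) x) q b a" using Kel[of a "tab K a" q b] q a b tab_M[OF K] by auto
  also have "half (%z y. opr (p1 z) y el app (tab K a) (p2 z)) q a b = half (%z y. opr (p1 z) (opr (p2 z) y) el f) q a b"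
   by (rule half_cong) (use e in simp)
  also have "half (%z x. opr (p1 z) (p2 z) el app (tab K a) x) q b a = half (%z x. opr (p1 z) (opr x (p2 z)) el f) q b a"
   by (rule half_cong) (use e in simp)
  finally show "(opr q (opr a b) el f) = (half (%z y. opr (p1 z) (opr (p2 z) y) el f) q a b &
   half (%z x. opr (p1 z) (opr x (p2 z)) el f) q b a)" .
 qed
 moreover have "f : M" by (simp add: f_def)
 ultimately show thesis using that by blast
qed

lemma feq_half: assumes p: "p el PP" and a: "a : M" "b : M"
 shows "feq p a b = (half (%z y. feq (p1 z) (p2 z) y) p a b & half (%z x. feq (p1 z) x (p2 z)) p b a)"
proof -
 obtain t1 where t1: "t1 : M" "transitive t1" "a el t1" using ex_transitive[OF a(1)] .
 obtain t2 where t2: "t2 : M" "transitive t2" "b el t2" using ex_transitive[OF a(2)] .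
 define t where "t = un t1 t2"
 have t: "transitive t" "t : M" "a el t" "b el t" using t1 t2 by (auto simp: t_def transitive_def)
 obtain f where f: "f : M" "sol t f" using sol_ex[OF t(1,2)] .
 have e: "feq q x y = (opr q (opr x y) el f)" if "q el PP" "x el t" "y el t" for q x y
  unfolding feq_sol[OF el_M[OF that(1)] el_M[OF that(2)] el_M[OF that(3)]]
  using sol_unique[of _ _ t f x y q] f t that by blast
 have e': "feq r x y = (opr r (opr x y) el f)"
   if "x : M" "opr x u el a" "opr y v el b" "y : M" "u el PP" "v el PP" "r el PP" for x u r y v
  using e[of r x y] el3[OF t(1) that(2) t(3)] el3[OF t(1) that(3) t(4)] that el_M by metis
 have "half (%z y. feq (p1 z) (p2 z) y) p a b = half (%z y. opr (p1 z) (opr (p2 z) y) el f) p a b"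
  "half (%z x. feq (p1 z) x (p2 z)) p b a = half (%z x. opr (p1 z) (opr x (p2 z)) el f) p b a"
  by (rule half_cong; use e' in simp)+
 then show ?thesis using f(2) p t e unfolding sol_def by simp
qed

definition fmem :: "'a => 'a => 'a => bool" where
 "fmem p x b = dns p (%r. EX y:M. EX t:elts PP. opr y t el b & t sub r & feq r x y)"

lemma dfn_fmem [dfi]: "dft A ==> dft B ==> dft C ==> dfn (%e. fmem (A e) (B e) (C e))"
 by (rule dfn3[of fmem]) (unfold fmem_def, intro dfi PP)

lemma feq_sym: assumes "p el PP" "a : M" "b : M" shows "feq p a b = feq p b a"
proof -
 let ?Q = "%a. ALL b:M. ALL p:M. p el PP --> (EX t:M. EX f:M. sol t f & a el t & b el t & opr p (opr a b) el f) =
   (EX t:M. EX f:M. sol t f & b el t & a el t & opr p (opr b a) el f)"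
 have "?Q a"
 proof (rule pair_induct[of ?Q])
  show "dfn (%e. ?Q (e 0))" by (intro dfi dfn_sol PP)
  fix a assume a: "a : M" and IH: "!!y s. y : M ==> s : M ==> opr y s el a ==> ?Q y"
  have i: "feq p y b = feq p b y" if "y : M" "s : M" "opr y s el a" "p el PP" "b : M" for y s p b
   using IH[OF that(1-3), rule_format, OF that(5) el_M[OF that(4)] that(4)] that
   unfolding feq_sol[OF el_M[OF that(4)] that(1,5)] feq_sol[OF el_M[OF that(4)] that(5,1)] by blast
  have "feq p a b = feq p b a" if "b : M" "p el PP" for b p
  proof -
   have "half (%z y. feq (p1 z) (p2 z) y) p a b = half (%z x. feq (p1 z) x (p2 z)) p a b"
    "half (%z x. feq (p1 z) x (p2 z)) p b a = half (%z y. feq (p1 z) (p2 z) y) p b a"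
    by (rule half_cong; use i that in \<open>simp, metis el_M\<close>)+
   then show ?thesis using feq_half that a by auto
  qed
  then show "?Q a" using feq_sol a by (metis el_M)
 qed (rule assms)
 then show ?thesis using assms el_M[OF assms(1)] unfolding feq_sol[OF el_M[OF assms(1)] assms(2,3)] feq_sol[OF el_M[OF assms(1)] assms(3,2)] by blast
qed

text \<open>By symmetry both conjuncts of the recursion become the same statement about
  \<open>fmem\<close>, which is the form used for the laws of equality.\<close>

lemma feq_iff: assumes p: "p el PP" and a: "a : M" "b : M"
 shows "feq p a b = ((ALL x:M. ALL s:elts PP. opr x s el a --> (ALL q:elts PP. p sub q & s sub q --> fmem q x b)) &
  (ALL x:M. ALL s:elts PP. opr x s el b --> (ALL q:elts PP. p sub q & s sub q --> fmem q x a)))"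
proof -
 have 1: "half (%z y. feq (p1 z) (p2 z) y) p a b = (ALL x:M. ALL s:elts PP. opr x s el a --> (ALL q:elts PP. p sub q & s sub q --> fmem q x b))" for a b
  unfolding half_def fmem_def dns_def by (intro ball_cong refl imp_cong bex_cong conj_cong) simp
 have "half (%z x. feq (p1 z) x (p2 z)) p b a = half (%z y. feq (p1 z) (p2 z) y) p b a"
  by (rule half_cong) (simp, rule feq_sym, auto)
 then show ?thesis using feq_half[OF p a] 1[of a b] 1[of b a] by simp
qed

lemma fmem_mono: "fmem p x b ==> p sub q ==> fmem q x b" unfolding fmem_def by (rule dns_mono)
lemma fmem_dns: "dns p (%r. fmem r x b) ==> fmem p x b" unfolding fmem_def by (rule dns_dns)

lemma feq_mono: "feq p a b ==> p sub q ==> p el PP ==> q el PP ==> a : M ==> b : M ==> feq q a b"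
 unfolding feq_iff by (meson subset_trans)

lemma feqD: "feq p a b ==> p el PP ==> a : M ==> b : M ==> opr x s el a ==> x : M ==> s el PP ==> p sub q ==> s sub q ==> q el PP ==> fmem q x b"
 unfolding feq_iff by blast

lemma feq_dns: assumes d: "dns p (%r. feq r a b)" and p: "p el PP" and a: "a : M" "b : M" shows "feq p a b"
proof -
 have "fmem q x b" if d: "dns p (%r. feq r a b)" and a: "a : M" "b : M" and x: "x : M" "s el PP" "opr x s el a" "q el PP" "p sub q" "s sub q" for a b x s q
 proof (rule fmem_dns, rule dns_imp[OF dns_mono[OF d x(5)]])
  fix r assume r: "r el PP" "q sub r" "feq r a b"
  show "fmem r x b" by (rule feqD[OF r(3,1) a x(3,1,2)]) (use r x in auto)
 qed
 moreover have "dns p (%r. feq r b a)" by (rule dns_imp[OF d]) (use feq_sym a in blast)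
 ultimately show ?thesis unfolding feq_iff[OF p a] using d a by blast
qed

lemma feq_refl: assumes "p el PP" "a : M" shows "feq p a a"
proof -
 let ?Q = "%a. ALL p:elts PP. feq p a a"
 have "?Q a"
 proof (rule pair_induct[of ?Q])
  show "dfn (%e. ?Q (e 0))" by (intro dfi PP)
  fix a assume a: "a : M" and IH: "!!y s. y : M ==> s : M ==> opr y s el a ==> ?Q y"
  have "fmem q x a" if "x : M" "s el PP" "opr x s el a" "q el PP" "s sub q" for x s q
   unfolding fmem_def using IH[OF that(1) el_M[OF that(2)] that(3)] that by (intro dnsI) blast
  then show "?Q a" using feq_iff a by blast
 qed (rule assms)
 then show ?thesis using assms by blast
qed

lemma feq_trans: assumes "feq p a b" "feq p b c" "p el PP" "a : M" "b : M" "c : M" shows "feq p a c"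
proof -
 let ?Q = "%a. ALL b:M. ALL c:M. ALL p:elts PP. feq p a b --> feq p b c --> feq p a c"
 have "?Q a"
 proof (rule pair_induct[of ?Q])
  show "dfn (%e. ?Q (e 0))" by (intro dfi PP)
  fix a assume a: "a : M" and IH: "!!y s. y : M ==> s : M ==> opr y s el a ==> ?Q y"
  show "?Q a"
  proof (intro ballI impI)
   fix b c p assume b: "b : M" and c: "c : M" and p: "p el PP" and e: "feq p a b" "feq p b c"
   show "feq p a c" unfolding feq_iff[OF p a c]
   proof (intro conjI ballI impI)
    fix x s q assume x: "x : M" and s: "s el PP" "opr x s el a" and q: "q el PP" "p sub q & s sub q"
    have "dns q (%r. EX y:M. EX t:elts PP. opr y t el b & t sub r & feq r x y)"
     using feqD[OF e(1) p a b s(2) x s(1) _ _ q(1)] q by (simp add: fmem_def)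
    then show "fmem q x c"
    proof (intro fmem_dns, elim dns_imp, elim bexE conjE)
     fix r y t assume r: "r el PP" "q sub r" and y: "y : M" "t el PP" "opr y t el b" "t sub r" "feq r x y"
     have "fmem r y c" by (rule feqD[OF e(2) p b c y(3,1,2) _ y(4) r(1)]) (use q r in blast)
     then show "fmem r x c" unfolding fmem_def
     proof (elim dns_imp bexE conjE)
      fix u z t assume u: "u el PP" "r sub u" and z: "z : M" "t el PP" "opr z t el c" "t sub u" "feq u y z"
      have "feq u x y" using feq_mono[OF y(5) u(2) r(1) u(1) x y(1)] .
      then have "feq u x z" using IH[OF x _ s(2)] s(1) y(1) z(1,5) u(1) by blast
      then show "EX z:M. EX t:elts PP. opr z t el c & t sub u & feq u x z" using z by blast
     qed
    qed
   next
    fix z s q assume z: "z : M" and s: "s el PP" "opr z s el c" and q: "q el PP" "p sub q & s sub q"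
    have "feq p c b" "feq p b a" using e feq_sym p a b c by blast+
    then have "dns q (%r. EX y:M. EX t:elts PP. opr y t el b & t sub r & feq r z y)"
     using feqD[OF _ p c b s(2) z s(1) _ _ q(1)] q by (simp add: fmem_def)
    then show "fmem q z a"
    proof (intro fmem_dns, elim dns_imp, elim bexE conjE)
     fix r y t assume r: "r el PP" "q sub r" and y: "y : M" "t el PP" "opr y t el b" "t sub r" "feq r z y"
     have "fmem r y a" by (rule feqD[OF \<open>feq p b a\<close> p b a y(3,1,2) _ y(4) r(1)]) (use q r in blast)
     then show "fmem r z a" unfolding fmem_def
     proof (elim dns_imp bexE conjE)
      fix u x t assume u: "u el PP" "r sub u" and x: "x : M" "t el PP" "opr x t el a" "t sub u" "feq u y x"
      have "feq u y z" "feq u x y" using feq_mono[OF y(5) u(2) r(1) u(1) z y(1)] x u y z feq_sym by blast+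
      then have "feq u x z" using IH[OF x(1) _ x(3)] x(2) y(1) z u(1) by blast
      then have "feq u z x" using feq_sym u x z by blast
      then show "EX x:M. EX t:elts PP. opr x t el a & t sub u & feq u z x" using x by blast
     qed
    qed
   qed
  qed
 qed (rule assms)
 then show ?thesis using assms by blast
qed

lemma fmem_feq: assumes "fmem p x b" "feq p b c" "p el PP" "x : M" "b : M" "c : M" shows "fmem p x c"
proof -
 have "dns p (%r. EX y:M. EX t:elts PP. opr y t el b & t sub r & feq r x y)" using assms(1) by (simp add: fmem_def)
 then show ?thesis
 proof (intro fmem_dns, elim dns_imp, elim bexE conjE)
  fix r y t assume r: "r el PP" "p sub r" and y: "y : M" "t el PP" "opr y t el b" "t sub r" "feq r x y"
  have "fmem r y c" by (rule feqD[OF assms(2,3,5,6) y(3,1,2) r(2) y(4) r(1)])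
  then show "fmem r x c" unfolding fmem_def
  proof (elim dns_imp bexE conjE)
   fix u z t assume u: "u el PP" "r sub u" and z: "z : M" "t el PP" "opr z t el c" "t sub u" "feq u y z"
   have "feq u x z" using feq_trans[OF feq_mono[OF y(5) u(2) r(1) u(1) assms(4) y(1)] z(5) u(1) assms(4) y(1) z(1)] .
   then show "EX z:M. EX t:elts PP. opr z t el c & t sub u & feq u x z" using z by blast
  qed
 qed
qed

lemma feq_fmem: assumes "feq p x x'" "fmem p x b" "p el PP" "x : M" "x' : M" "b : M" shows "fmem p x' b"
 using assms(2) unfolding fmem_def
proof (elim dns_imp bexE conjE)
 fix r y t assume r: "r el PP" "p sub r" and y: "y : M" "t el PP" "opr y t el b" "t sub r" "feq r x y"
 have "feq r x' x" using feq_mono[OF assms(1) r(2) assms(3) r(1) assms(4,5)] feq_sym r(1) assms(4,5) by blast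
 then have "feq r x' y" using feq_trans y r assms by blast
 then show "EX y:M. EX t:elts PP. opr y t el b & t sub r & feq r x' y" using y by blast
qed

lemma fmemI: "opr x s el b ==> s sub p ==> x : M ==> s el PP ==> fmem p x b"
 unfolding fmem_def by (intro dnsI) (use feq_refl in blast)

primrec forces :: "fm => 'a => (nat => 'a) => bool" where
 "forces (Mem i j) p e = fmem p (e i) (e j)"
| "forces (Eq i j) p e = feq p (e i) (e j)"
| "forces (Neg f) p e = (ALL q:elts PP. p sub q --> ~ forces f q e)"
| "forces (Conj f g) p e = (forces f p e & forces g p e)"
| "forces (All i f) p e = (ALL a:M. forces f p (e(i := a)))"

lemma forces_mono: "forces f p e ==> p sub q ==> p el PP ==> q el PP ==> ALL i. e i : M ==> forces f q e"
 by (induction f arbitrary: e) (auto intro: fmem_mono feq_mono)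

lemma forces_dns: "dns p (%r. forces f r e) ==> p el PP ==> ALL i. e i : M ==> forces f p e"
proof (induction f arbitrary: p e)
 case (Neg f)
 show ?case unfolding forces.simps
 proof (intro ballI impI notI)
  fix q assume q: "q el PP" "p sub q" "forces f q e"
  then obtain r where r: "r el PP" "q sub r" "forces (Neg f) r e" using Neg(2) unfolding dns_def by blast
  then show False using forces_mono[OF q(3) r(2) q(1) r(1) Neg(4)] by auto
 qed
next
 case (Conj f g)
 then show ?case by (auto intro: Conj.IH elim: dns_imp)
next
 case (All i f)
 have "forces f p (e(i := a))" if "a : M" for a
 proof (rule All.IH[OF dns_imp[OF All.prems(1)] All.prems(2)])
  show "forces f r (e(i := a))" if "forces (All i f) r e" for r using that \<open>a : M\<close> by simp
 qed (use All.prems(3) that in auto)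
 then show ?case by simp
qed (auto intro: fmem_dns feq_dns)

lemma dfn_upd: assumes "dfn (%e. Q (e 0) (%k. e (Suc k)))"
 shows "dfn (%e. Q (e (Suc 0)) ((%k. e (Suc (Suc k)))(i := e 0)))"
proof -
 define g where "g n = (case n of 0 => 1 | Suc k => if k = i then 0 else k + 2)" for n :: nat
 have "inj g" by (auto simp: inj_def g_def split: nat.splits if_splits)
 from dfn_ren[OF assms this] have "dfn (%e. Q (e (Suc 0)) (%k. e (g (Suc k))))" by (simp add: g_def)
 moreover have "(%k. e (g (Suc k))) = (%k. e (Suc (Suc k)))(i := e 0)" for e :: "nat => 'a"
  by (rule ext) (simp add: g_def)
 ultimately show ?thesis by (simp only:)
qed

text \<open>Formulas are HOL data, so this induction runs in HOL. It is the definability of forcing,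
  which \<open>truth\<close> needs in order to apply genericity.\<close>

lemma forces_dfn: "dfn (%e. forces f (e 0) (%i. e (Suc i)))"
proof (induction f)
 case (Neg f)
 then show ?case unfolding forces.simps by (intro dfi PP) (rule dfn_w1)
next
 case (All i f)
 show ?case unfolding forces.simps by (intro dfi dfn_upd All)
qed (auto intro!: dfi)

lemma dfn_forces: "ALL i. e i : M ==> dft A ==> dfn (%e'. forces f (A e') e)"
 by (rule dfn1[of "%p. forces f p e"]) (rule dfn_inst[of "forces f", OF forces_dfn])

end

section \<open>The generic extension\<close>

locale generic_ext = forcing + fixes G assumes G: "generic (elts PP) Col_le G"
begin

lemma G_PP: "p : G ==> p el PP" using G unfolding generic_def by blast
lemma G_M [simp, dest]: "p : G ==> p : M" using G_PP by blast
lemma G_ne: "EX p. p : G" using G unfolding generic_def by blast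
lemma G_up: "p : G ==> q el PP ==> q sub p ==> q : G" using G unfolding generic_def Col_le_def by blast
lemma G_dir: "p : G ==> q : G ==> EX r:G. p sub r & q sub r" using G unfolding generic_def Col_le_def by blast

lemma G_meets: assumes "dfn (%e. S (e 0))" "p : G" "dns p S" shows "EX q:G. p sub q & S q"
proof -
 \<comment> \<open>Genericity is assumed for sets dense in the whole order, so the conditions
   incompatible with \<open>p\<close> are added; directedness of \<open>G\<close> rules them out
   afterwards.\<close>
 define D where "D = sep PP (%q. p sub q & S q | (ALL r:elts PP. ~ (p sub r & q sub r)))"
 have D: "elts D = {q : elts PP. p sub q & S q | (ALL r:elts PP. ~ (p sub r & q sub r))}"
  unfolding D_def by (rule elts_sep) (intro dfi PP dfn1[OF assms(1)], use assms PP in auto)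
 have "EX q:elts D. p' sub q" if "p' el PP" for p'
 proof (cases "EX r:elts PP. p sub r & p' sub r")
  case True
  then obtain r where r: "r el PP" "p sub r" "p' sub r" by blast
  then obtain q where "q el PP" "r sub q" "S q" using assms(3) unfolding dns_def by blast
  then have "q el D" "p' sub q" using r unfolding D by blast+
  then show ?thesis by blast
 next
  case False then show ?thesis using that by (auto simp: D)
 qed
 moreover have "D : M" by (simp add: D_def)
 moreover have "elts D <= elts PP" by (auto simp: D)
 moreover have "ALL D:M. elts D <= elts PP & (ALL p:elts PP. EX q:elts D. p sub q) --> elts D Int G ~= {}"
  using G unfolding generic_def Col_le_def by blast
 ultimately have "elts D Int G ~= {}" by simp
 then obtain q where "q el D" "q : G" by blast
 then show ?thesis using G_dir[OF assms(2), of q] G_PP by (auto simp: D)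
qed

text \<open>Conditions that satisfy \<open>S\<close>, or have no extension that does, are dense. In
  this form genericity turns truth in \<open>V[G]\<close> into a statement about all extensions of
  one condition.\<close>

lemma dich: assumes "dfn (%e. S (e 0))" "p : G"
 obtains q where "q : G" "p sub q" "S q" | q where "q : G" "p sub q" "ALL r:elts PP. q sub r --> ~ S r"
proof -
 have "dfn (%e. S (e 0) | (ALL r:elts PP. e 0 sub r --> ~ S r))" by (intro dfi PP dfn1[OF assms(1)])
 then have "EX q:G. p sub q & (S q | (ALL r:elts PP. q sub r --> ~ S r))"
  using assms(2) by (rule G_meets) (auto simp: dns_def)
 then show thesis using that by blast
qed

definition V where "V = val (elts PP) Col_le G"
definition N where "N = ext_carrier (elts PP) Col_le G"
definition EN where "EN = ext_mem (elts PP) Col_le G"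

lemma same_iff: "(a, b) : same_value (elts PP) Col_le G <-> a : M & b : M & (EX p:G. feq p a b)"
 by (auto simp: same_value_def)

lemma V_eq: assumes "a : M" "b : M" shows "V a = V b <-> (EX p:G. feq p a b)"
proof -
 have refl: "EX p:G. feq p a a" if "a : M" for a using G_ne feq_refl G_PP that by blast
 have sm: "EX p:G. feq p b a" if "EX p:G. feq p a b" "a : M" "b : M" for a b using that feq_sym G_PP by blast
 have tr: "EX p:G. feq p a c" if ab: "EX p:G. feq p a b" "EX p:G. feq p b c" and "a : M" "b : M" "c : M" for a b c
 proof -
  obtain p q where "p : G" "feq p a b" "q : G" "feq q b c" using ab by blast
  moreover obtain r where "r : G" "p sub r" "q sub r" using G_dir calculation by blast
  ultimately show ?thesis using feq_trans feq_mono that G_PP by metis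
 qed
 have "sym (same_value (elts PP) Col_le G)" unfolding sym_def same_iff using sm by blast
 moreover have "trans (same_value (elts PP) Col_le G)" unfolding trans_def same_iff using tr by blast
 moreover have "same_value (elts PP) Col_le G <= M \<times> M" by (auto simp: same_value_def)
 ultimately have s: "equiv M (same_value (elts PP) Col_le G)" unfolding equiv_def refl_on_def
  using refl same_iff by blast
 show ?thesis unfolding V_def val_def using eq_equiv_class_iff[OF s assms] same_iff assms by simp
qed

lemma N_V: "N = V ` M" by (simp add: N_def V_def ext_carrier_def)
lemma V_N [simp]: "a : M ==> V a : N" by (simp add: N_V)

lemma fmem_G: assumes "p : G" "fmem p x b" "x : M" "b : M" shows "EX y:M. EX t:G. opr y t el b & V x = V y"
proof -
 have "dfn (%e. EX y:M. EX t:elts PP. opr y t el b & t sub e 0 & feq (e 0) x y)" by (intro dfi PP assms)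
 from G_meets[OF this assms(1) assms(2)[unfolded fmem_def]]
 obtain q y t where "q : G" "y : M" "t el PP" "opr y t el b" "t sub q" "feq q x y" by blast
 then show ?thesis using G_up V_eq assms by metis
qed

lemma EN_iff: assumes "x : M" "b : M" shows "EN (V x) (V b) <-> (EX p:G. fmem p x b)"
proof
 assume "EN (V x) (V b)"
 then obtain y c p where y: "y : M" "c : M" "p : G" "V x = V y" "V b = V c" "opr y p el c"
  unfolding EN_def ext_mem_def V_def by (auto simp: pair_in_iff)
 obtain q1 q2 where q: "q1 : G" "feq q1 y x" "q2 : G" "feq q2 c b" using V_eq y assms by metis
 obtain r where r: "r : G" "q1 sub r" "q2 sub r" using G_dir q by blast
 obtain u where u: "u : G" "r sub u" "p sub u" using G_dir r y by blast
 have "fmem u y c" using fmemI[OF y(6) u(3)] y G_PP by blast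
 moreover have "feq u y x" "feq u c b" using feq_mono[OF q(2) _ G_PP[OF q(1)] G_PP[OF u(1)]] feq_mono[OF q(4) _ G_PP[OF q(3)] G_PP[OF u(1)]] r u y assms by auto
 ultimately have "fmem u x b" using fmem_feq feq_fmem G_PP[OF u(1)] y assms by metis
 then show "EX p:G. fmem p x b" using u by blast
next
 assume "EX p:G. fmem p x b"
 then obtain y t where "y : M" "t : G" "opr y t el b" "V x = V y" using fmem_G assms by blast
 then show "EN (V x) (V b)" unfolding EN_def ext_mem_def V_def[symmetric] using assms by (metis G_M pair_in_iff)
qed

sublocale N: nonempty N EN
proof
 show "N ~= {}" using M_ne by (auto simp: N_V)
qed

lemma N_elts: assumes b: "b : M" shows "N.elts (V b) = {V y |y t. y : M & t : G & opr y t el b}"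
proof -
 have "EN (V x) (V b) <-> (EX y t. V x = V y & y : M & t : G & opr y t el b)" if "x : M" for x
 proof
  show "EN (V x) (V b) ==> EX y t. V x = V y & y : M & t : G & opr y t el b" using EN_iff fmem_G that b by blast
  assume "EX y t. V x = V y & y : M & t : G & opr y t el b"
  then obtain y t where "V x = V y" "y : M" "t : G" "opr y t el b" by blast
  then show "EN (V x) (V b)" using fmemI[of y t b t] EN_iff[of y b] G_PP b by auto
 qed
 then have "y : N.elts (V b) <-> y : {V y |y t. y : M & t : G & opr y t el b}" for y
  unfolding N.elts_def unfolding N_V by blast
 then show ?thesis by blast
qed

text \<open>If no condition in \<open>G\<close> forced the elements of \<open>s\<close> into
  \<open>t\<close>, then by \<open>dich\<close> some condition in \<open>G\<close> would point to a
  name listed in \<open>s\<close> whose membership in \<open>t\<close> no extension forces.\<close>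

lemma N_ext: assumes "a : N" "b : N" "N.elts a = N.elts b" shows "a = b"
proof -
 obtain s t where s: "s : M" "t : M" "a = V s" "b = V t" using assms by (auto simp: N_V)
 have *: "EX p:G. ALL q:elts PP. p sub q --> (ALL x:M. ALL u:elts PP. opr x u el s --> u sub q --> fmem q x t)"
  if s: "s : M" "t : M" and e: "N.elts (V s) <= N.elts (V t)" for s t
 proof -
  obtain p where p: "p : G" using G_ne by blast
  have "dfn (%e. EX x:M. EX u:elts PP. opr x u el s & u sub e 0 & (ALL r:elts PP. e 0 sub r --> ~ fmem r x t))"
   by (intro dfi PP s)
  then show ?thesis
  proof (rule dich[OF _ p])
   fix q assume q: "q : G" "EX x:M. EX u:elts PP. opr x u el s & u sub q & (ALL r:elts PP. q sub r --> ~ fmem r x t)"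
   then obtain x u where x: "x : M" "u el PP" "opr x u el s" "u sub q" "ALL r:elts PP. q sub r --> ~ fmem r x t" by blast
   then have "u : G" using G_up q by blast
   then have "V x : N.elts (V t)" using e x N_elts[OF s(1)] by blast
   then have "EN (V x) (V t)" unfolding N.elts_def by blast
   then obtain r where "r : G" "fmem r x t" using EN_iff x s by blast
   moreover obtain v where "v : G" "r sub v" "q sub v" using G_dir calculation q by blast
   ultimately show ?thesis using x(5) fmem_mono G_PP by blast
  next
   fix q assume q: "q : G" "ALL r:elts PP. q sub r --> ~ (EX x:M. EX u:elts PP. opr x u el s & u sub r & (ALL w:elts PP. r sub w --> ~ fmem w x t))"
   have "fmem r x t" if x: "x : M" "u el PP" "opr x u el s" "r el PP" "q sub r" "u sub r" for r x u
   proof (rule fmem_dns, unfold dns_def, intro ballI impI)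
    fix w assume "w el PP" "r sub w"
    then show "EX v:elts PP. w sub v & fmem v x t" using q(2) x by (meson subset_trans)
   qed
   then show ?thesis using q(1) by blast
  qed
 qed
 obtain p where p: "p : G" "ALL q:elts PP. p sub q --> (ALL x:M. ALL u:elts PP. opr x u el s --> u sub q --> fmem q x t)"
  using *[OF s(1,2)] assms s by blast
 obtain q where q: "q : G" "ALL r:elts PP. q sub r --> (ALL x:M. ALL u:elts PP. opr x u el t --> u sub r --> fmem r x s)"
  using *[OF s(2,1)] assms s by blast
 obtain r where r: "r : G" "p sub r" "q sub r" using G_dir p q by blast
 have "feq r s t" unfolding feq_iff[OF G_PP[OF r(1)] s(1,2)] using p(2) q(2) r(2,3) by (meson subset_trans)
 then show ?thesis using V_eq s r by blast
qed

theorem truth: "ALL i. e i : M ==> sat N EN f (%i. V (e i)) <-> (EX p:G. forces f p e)"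
proof (induction f arbitrary: e)
 case (Mem i j) then show ?case by (simp add: EN_iff)
next
 case (Eq i j) then show ?case by (simp add: V_eq)
next
 case (Neg f)
 obtain p where p: "p : G" using G_ne by blast
 have "(EX p:G. forces (Neg f) p e) <-> ~ (EX p:G. forces f p e)"
 proof
  assume "EX p:G. forces (Neg f) p e"
  then obtain p where p: "p : G" "forces (Neg f) p e" by blast
  { fix q assume q: "q : G" "forces f q e"
   obtain r where r: "r : G" "p sub r" "q sub r" using G_dir p q by blast
   then have "forces f r e" using forces_mono q G_PP Neg by blast
   then have False using p r G_PP by auto }
  then show "~ (EX p:G. forces f p e)" by blast
 next
  assume n: "~ (EX p:G. forces f p e)"
  have "dfn (%e'. forces f (e' 0) e)" by (intro dfn_forces dfi) (rule Neg)
  then show "EX p:G. forces (Neg f) p e" by (rule dich[OF _ p]) (use n in auto)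
 qed
 then show ?case using Neg.IH[OF Neg.prems] by simp
next
 case (Conj f g)
 have "(EX p:G. forces (Conj f g) p e) <-> (EX p:G. forces f p e) & (EX p:G. forces g p e)"
 proof
  assume "(EX p:G. forces f p e) & (EX p:G. forces g p e)"
  then obtain p q where p: "p : G" "forces f p e" "q : G" "forces g q e" by blast
  obtain r where "r : G" "p sub r" "q sub r" using G_dir p by blast
  then show "EX p:G. forces (Conj f g) p e" using p forces_mono G_PP Conj(3) by (metis forces.simps(4))
 qed auto
 then show ?case using Conj.IH[OF Conj.prems] by simp
next
 case (All i f)
 have "(%k. V (e k))(i := V a) = (%k. V ((e(i := a)) k))" for a by (rule ext) simp
 then have s: "sat N EN (All i f) (%i. V (e i)) <-> (ALL a:M. EX p:G. forces f p (e(i := a)))"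
  using All.IH[of "e(i := a)" for a] All.prems by (simp add: N_V del: fun_upd_apply) (simp add: fun_upd_def)
 show ?case unfolding s
 proof
  assume a: "ALL a:M. EX p:G. forces f p (e(i := a))"
  obtain p where p: "p : G" using G_ne by blast
  \<comment> \<open>Either a condition in \<open>G\<close> forces a counterexample, or below some
    condition in \<open>G\<close> none can be forced. In the second case each instance is forced
    densely, hence outright.\<close>
  have "dfn (%e. EX a:M. forces (Neg f) (e 0) ((%k. e (Suc k))(i := a)))"
   by (intro dfn_ex dfn_upd forces_dfn)
  then have "dfn (%e'. EX a:M. forces (Neg f) (e' 0) (e(i := a)))" using All.prems
   by (rule dfn_inst[of "%p e. EX a:M. forces (Neg f) p (e(i := a))"])
  then show "EX p:G. forces (All i f) p e"
  proof (rule dich[OF _ p])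
   fix q assume q: "q : G" "EX a:M. forces (Neg f) q (e(i := a))"
   then obtain b where b: "b : M" "forces (Neg f) q (e(i := b))" by blast
   obtain t where t: "t : G" "forces f t (e(i := b))" using a b by blast
   obtain r where r: "r : G" "q sub r" "t sub r" using G_dir q t by blast
   have "ALL k. (e(i := b)) k : M" using All.prems b by simp
   then have "forces f r (e(i := b))" using forces_mono t r G_PP by blast
   then show ?thesis using b(2) r G_PP by auto
  next
   fix q assume q: "q : G" "ALL r:elts PP. q sub r --> ~ (EX a:M. forces (Neg f) r (e(i := a)))"
   have "forces f q (e(i := b))" if "b : M" for b
   proof (rule forces_dns[OF _ G_PP[OF q(1)]])
    show "dns q (%r. forces f r (e(i := b)))" using q(2) that unfolding dns_def by simp
   qed (use All.prems that in simp)
   then show ?thesis using q(1) by auto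
  qed
 qed auto
qed

end

lemma sat_fv: "(!!i. i : fv p ==> e i = e' i) ==> sat M E p e = sat M E p e'"
proof (induction p arbitrary: e e')
 case (All i p)
 have "sat M E p (e(i := a)) = sat M E p (e'(i := a))" for a by (rule All.IH) (use All.prems in auto)
 then show ?case by simp
next
 case (Conj p q)
 have "sat M E p e = sat M E p e'" by (rule Conj.IH(1)) (use Conj.prems in auto)
 moreover have "sat M E q e = sat M E q e'" by (rule Conj.IH(2)) (use Conj.prems in auto)
 ultimately show ?case by simp
next
 case (Neg p)
 have "sat M E p e = sat M E p e'" by (rule Neg.IH) (use Neg.prems in auto)
 then show ?case by simp
qed simp_all

context membership begin

lemma dfn_sat: assumes "m : M" shows "dfn (%e. sat M E p e)"
proof -
 have i: "inj (%i::nat. 2*i)" by (auto simp: inj_def)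
 have "mix e (%_. m) o (%i. 2*i) = e" for e by (rule ext) simp
 then have "ALL e. (ALL i. e i : M) --> sat M E p e = sat M E (ren (%i. 2*i) p) (mix e (%_. m))"
  by (simp add: sat_ren[OF i])
 moreover have "ALL i::nat. (%_. m) i : M" using assms by simp
 ultimately show ?thesis unfolding dfn_def
  by (intro exI[of _ "ren (%i. 2*i) p"] exI[of _ "%_. m"] conjI)
qed

lemma opair_inj: "opair z x y ==> opair z x' y' ==> x = x' & y = y'"
 unfolding opair_def by (metis (no_types, opaque_lifting) doubleton_eq_iff insert_absorb2)

end

section \<open>Check names and names with prescribed elements\<close>

context forcing begin

definition chk :: "'a => 'a" where "chk = rec (%x f. rep x (%y. opr (app f y) zero))"

lemma chk_H: "dft (%e. (%x f. rep x (%y. opr (app f y) zero)) (e 0) (e 1))" by (intro dfi) simp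
lemma chk_M [simp]: "chk x : M" by (simp add: chk_def)
lemma dft_chk [dfi]: "dft A ==> dft (%e. chk (A e))" unfolding chk_def by (rule dft_rec[OF chk_H])

lemma elts_chk: assumes x: "x : M" shows "elts (chk x) = (%y. opr (chk y) zero) ` elts x"
proof -
 have a: "app (fn x chk) y = chk y" if "y el x" for y by (intro app_fn dfi that x)
 have "chk x = rep x (%y. opr (app (fn x chk) y) zero)" unfolding chk_def by (rule rec_unfold[OF chk_H x])
 then have "elts (chk x) = (%y. opr (app (fn x chk) y) zero) ` elts x"
  by (simp only:) (rule elts_rep, intro dfi, simp_all add: x)
 then show ?thesis using a by (simp cong: image_cong)
qed

lemma opr_chk: "x : M ==> k : M ==> s : M ==> opr k s el chk x <-> (EX y:elts x. k = chk y & s = zero)"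
 unfolding elts_chk by (auto 4 3)

lemma check_name_iff: assumes x: "x : M" and c: "c : M" shows "check_name zero x c <-> c = chk x"
proof
 assume "check_name zero x c"
 then obtain t f where t: "t : M" "f : M" "transitive t" "x el t" "func f t" "pair_in f x c" and
  e: "ALL y:elts t. ALL n:M. pair_in f y n --> elts n = {z : M. EX w:elts y. EX m:M. pair_in f w m & opair z m zero}"
  unfolding check_name_def by (elim bexE conjE)
 let ?Q = "%y. y el t --> app f y = chk y"
 have "?Q x"
 proof (rule mem_induct[of ?Q])
  show "dfn (%e. ?Q (e 0))" by (intro dfi t)
  fix y assume y: "y : M" and IH: "!!z. z el y ==> ?Q z"
  show "?Q y"
  proof
   assume yt: "y el t"
   have "pair_in f y (app f y)" using funcD(1)[OF t(5,2,1) yt] y t by (simp add: pair_in_iff)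
   from e[rule_format, OF yt p12_M(3) this]
   have E: "elts (app f y) = {z : M. EX w:elts y. EX m:M. pair_in f w m & opair z m zero}" .
   have m: "(EX m:M. pair_in f w m & opair z m zero) <-> z = opr (chk w) zero" if w: "w el y" and z: "z : M" for w z
   proof -
    have "w el t" using w yt t trD by blast
    then show ?thesis using IH[OF w] funcD(1)[OF t(5,2,1)] funcD(2)[OF t(5,2,1)] t z w
     by (metis el_M opair_iff pair_in_iff chk_M zero(1))
   qed
   have "z el app f y <-> (EX w:elts y. z = opr (chk w) zero)" if "z : M" for z
    unfolding E using m[OF _ that] that by blast
   then show "app f y = chk y" by (intro eqI) (auto simp: elts_chk[OF y])
  qed
 qed (rule x)
 then show "c = chk x" using t funcD(2)[OF t(5,2,1)] x c by (auto simp: pair_in_iff)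
next
 assume c: "c = chk x"
 obtain t where t: "t : M" "transitive t" "x el t" using ex_transitive x by blast
 define f where "f = fn t chk"
 have fM: "f : M" by (simp add: f_def)
 have f: "opr y n el f <-> y el t & n = chk y" if "y : M" "n : M" for y n
  unfolding f_def by (rule el_fn) (intro dfi that t)+
 have "elts n = {z : M. EX w:elts y. EX m:M. pair_in f w m & opair z m zero}" if y: "y el t" "n : M" "pair_in f y n" for y n
 proof -
  have n: "n = chk y" using y f fM by (auto simp: pair_in_iff)
  have "(EX m:M. pair_in f w m & opair z m zero) <-> z = opr (chk w) zero" if w: "w el y" "z : M" for w z
  proof -
   have "w el t" using w y t trD by blast
   then show ?thesis using f[of w] fM w by (auto simp: pair_in_iff opair_iff)
  qed
  then show ?thesis unfolding n elts_chk[OF el_M[OF y(1)]] by auto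
 qed
 moreover have "func f t" unfolding f_def by (rule func_fn) (intro dfi t)+
 moreover have "pair_in f x c" using f[OF x chk_M, of x] t c x fM by (simp add: pair_in_iff)
 ultimately show "check_name zero x c" unfolding check_name_def using t fM by blast
qed

lemma chk_feq: assumes "feq p (chk x) (chk y)" "p el PP" "x : M" "y : M" shows "x = y"
proof -
 let ?Q = "%x. ALL y:M. ALL p:elts PP. feq p (chk x) (chk y) --> x = y"
 have "?Q x"
 proof (rule mem_induct[of ?Q])
  show "dfn (%e. ?Q (e 0))" by (intro dfi PP)
  fix x assume x: "x : M" and IH: "!!z. z el x ==> ?Q z"
  show "?Q x"
  proof (intro ballI impI)
   fix y p assume y: "y : M" and p: "p el PP" and e: "feq p (chk x) (chk y)"
   have *: "EX r:elts PP. EX w:elts v. feq r (chk z) (chk w)" if "feq p (chk u) (chk v)" "z el u" "u : M" "v : M" for u v z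
   proof -
    have "fmem p (chk z) (chk v)" by (rule feqD[OF that(1) p]) (use that PP p in \<open>auto simp: opr_chk\<close>)
    then obtain r k t where "r el PP" "k : M" "t el PP" "opr k t el chk v" "feq r (chk z) k"
     unfolding fmem_def dns_def using p by blast
    then show ?thesis using that by (auto simp: opr_chk)
   qed
   have "z el y" if "z el x" for z using *[OF e that x y] IH[OF that] el_M by metis
   moreover have "z el x" if "z el y" for z
    using *[of y x z] e that x y IH feq_sym p chk_M el_M by metis
   ultimately show "x = y" using eqI x y by blast
  qed
 qed (rule assms)
 then show ?thesis using assms by blast
qed

text \<open>Names built from a set and a relation to conditions. Those of the form
  \<open>cn K R\<close> list check names only and hence name subsets of ground model sets.\<close>

definition nm :: "'a => ('a => 'a => bool) => 'a" where "nm A R = sep (times A PP) (%w. R (p1 w) (p2 w))"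
definition cn :: "'a => ('a => 'a => bool) => 'a" where
 "cn K R = rep (sep (times K PP) (%w. R (p1 w) (p2 w))) (%w. opr (chk (p1 w)) (p2 w))"

lemma nm_M [simp]: "nm A R : M" "cn A R : M" by (simp_all add: nm_def cn_def)

lemma opr_nm: assumes "dfn (%e. R (e 0) (e 1))" "A : M" "x : M" "s : M" shows "opr x s el nm A R <-> x el A & s el PP & R x s"
 unfolding nm_def by (subst elts_sep, intro dfi dfn2[OF assms(1)]) (use assms PP in auto)

lemma opr_cn: assumes "dfn (%e. R (e 0) (e 1))" "K : M" "x : M" "s : M"
 shows "opr x s el cn K R <-> (EX k:elts K. x = chk k & s el PP & R k s)"
proof -
 have e: "elts (sep (times K PP) (%w. R (p1 w) (p2 w))) = {w : elts (times K PP). R (p1 w) (p2 w)}"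
  by (rule elts_sep, intro dfi dfn2[OF assms(1)]) simp
 have "elts (cn K R) = (%w. opr (chk (p1 w)) (p2 w)) ` {w : elts (times K PP). R (p1 w) (p2 w)}"
  unfolding cn_def by (subst elts_rep, intro dfi) (simp_all add: e)
 also have "\<dots> = {opr (chk k) s |k s. k el K & s el PP & R k s}"
 proof (intro equalityI subsetI)
  fix z assume "z : {opr (chk k) s |k s. k el K & s el PP & R k s}"
  then obtain k s where "k el K" "s el PP" "R k s" "z = opr (chk k) s" by blast
  then show "z : (%w. opr (chk (p1 w)) (p2 w)) ` {w : elts (times K PP). R (p1 w) (p2 w)}"
   using assms PP by (intro image_eqI[of _ _ "opr k s"]) auto
 qed (use assms PP in \<open>auto simp: elts_times, blast\<close>)
 finally show ?thesis using assms by (auto 4 3)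
qed

end

section \<open>Ground model sets and functions inside the extension\<close>

context generic_ext begin

lemma el_V: "x : M ==> b : M ==> V x : N.elts (V b) <-> (EX p:G. fmem p x b)"
 using EN_iff[of x b] unfolding N.elts_def by simp

lemma zero_G: "zero : G" using G_ne G_up PP zero by (metis empty_subsetI)

definition j where "j x = V (chk x)"

lemma ext_embed_j: "x : M ==> ext_embed (elts PP) Col_le zero G x = j x"
proof -
 assume x: "x : M"
 have "(THE c. c : M & check_name zero x c) = chk x" by (rule the_equality) (use check_name_iff x in auto)
 then show ?thesis by (simp add: ext_embed_def j_def V_def)
qed

lemma j_N [simp]: "j x : N" by (simp add: j_def)

lemma N_elts_j: "x : M ==> N.elts (j x) = j ` elts x"
proof -
 assume x: "x : M"
 have "(y : M & t : G & opr y t el chk x) = (EX z:elts x. y = chk z & t = zero)" for y t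
  using opr_chk[OF x, of y t] zero_G by auto
 then show ?thesis unfolding j_def N_elts[OF chk_M] by auto
qed

lemma j_inj: "x : M ==> y : M ==> j x = j y <-> x = y"
 unfolding j_def using V_eq[of "chk x" "chk y"] chk_feq G_PP by auto

lemma j_el: "x : M ==> y : M ==> j x : N.elts (j y) <-> x el y" unfolding N_elts_j using j_inj by blast

lemma fmem_j: "k : M ==> b : M ==> j k : N.elts (V b) <-> (EX p:G. fmem p (chk k) b)"
 unfolding j_def using el_V by simp

lemma N_elts_nm: assumes "dfn (%e. R (e 0) (e 1))" "A : M" shows "N.elts (V (nm A R)) = {V x |x s. x el A & s : G & R x s}"
proof -
 have "(y : M & t : G & opr y t el nm A R) = (y el A & t : G & R y t)" for y t
  using opr_nm[OF assms] G_PP by auto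
 then show ?thesis unfolding N_elts[OF nm_M(1)] by simp
qed

lemma N_elts_cn: assumes "dfn (%e. R (e 0) (e 1))" "K : M" shows "N.elts (V (cn K R)) = {j k |k s. k el K & s : G & R k s}"
proof -
 have "(y : M & t : G & opr y t el cn K R) = (EX k:elts K. y = chk k & t : G & R k t)" for y t
  using opr_cn[OF assms, of y t] G_PP by auto
 then show ?thesis unfolding j_def N_elts[OF nm_M(2)] by auto
qed

lemma N_opair: assumes x: "x : M" "y : M" shows "N.opair (j (opr x y)) (j x) (j y)"
 unfolding N.opair_def by (rule bexI[of _ "j (mk {x})"], rule bexI[of _ "j (mk {x, y})"])
  (use x in \<open>simp_all add: N_elts_j elts_opr elts_mk\<close>)

lemma N_opair_iff: assumes "x : M" "y : M" "z : N" shows "N.opair z (j x) (j y) <-> z = j (opr x y)"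
proof
 assume "N.opair z (j x) (j y)"
 with N_opair[OF assms(1,2)] show "z = j (opr x y)" unfolding N.opair_def using assms(3) by (metis N_ext j_N)
qed (use N_opair assms in auto)

lemma N_pair_in: "x : M ==> y : M ==> N.pair_in r (j x) (j y) <-> j (opr x y) : N.elts r"
 unfolding N.pair_in_def using N_opair_iff by (metis N.el_M j_N)

text \<open>The graph of a HOL function, as an external set of pairs. A function of
  \<open>V[G]\<close> on \<open>j d\<close> with values in \<open>V\<close> consists of the images
  under \<open>j\<close> of such a graph, where \<open>X\<close> need not come from
  \<open>M\<close>.\<close>

definition gr :: "'a => ('a => 'a) => 'a set" where "gr d X = (%i. opr i (X i)) ` elts d"

lemma N_funcI: assumes x: "x : N" "N.elts x = j ` gr d X" and d: "d : M" "!!i. i el d ==> X i : M"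
 shows "N.func x (j d)" and "i el d ==> y : N ==> N.pair_in x (j i) y <-> y = j (X i)"
  and "N.pair_in x u y ==> u : N ==> y : N ==> EX i:elts d. u = j i & y = j (X i)"
proof -
 have p: "EX i:elts d. u = j i & y = j (X i)" if uy: "N.pair_in x u y" for u y
 proof -
  obtain z where "z : N.elts x" "N.opair z u y" using uy unfolding N.pair_in_def by blast
  then obtain i where "i el d" "N.opair (j (opr i (X i))) u y" using x by (auto simp: gr_def)
  then show ?thesis using N.opair_inj N_opair[of i "X i"] d by blast
 qed
 then show "N.pair_in x u y ==> u : N ==> y : N ==> EX i:elts d. u = j i & y = j (X i)" by blast
 have q: "N.pair_in x (j i) (j (X i))" if "i el d" for i using that x d N_pair_in[of i "X i"] by (auto simp: gr_def)
 have q2: "y = j (X i)" if "i el d" "N.pair_in x (j i) y" for i y using p[OF that(2)] j_inj that by auto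
 show "i el d ==> y : N ==> N.pair_in x (j i) y <-> y = j (X i)" using q q2 by blast
 show "N.func x (j d)" unfolding N.func_def
 proof (intro conjI ballI)
  fix z assume "z : N.elts x"
  then obtain i where "i el d" "z = j (opr i (X i))" using x by (auto simp: gr_def)
  then show "EX u:N.elts (j d). EX y:N. N.opair z u y" using d N_opair[of i "X i"]
   by (intro bexI[of _ "j i"] bexI[of _ "j (X i)"]) (auto simp: N_elts_j)
 next
  fix u assume "u : N.elts (j d)"
  then obtain i where "u = j i" "i el d" using d by (auto simp: N_elts_j)
  then show "EX! y. y : N & N.pair_in x u y" using q q2 by (intro ex1I[of _ "j (X i)"]) auto
 qed
qed

lemma N_funcE: assumes x: "x : N" "N.func x (j d)" and d: "d : M"
 and v: "!!u y. u : N ==> y : N ==> N.pair_in x u y ==> y : j ` M"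
 obtains X where "!!i. i el d ==> X i : M" "N.elts x = j ` gr d X" "!!i. i el d ==> N.pair_in x (j i) (j (X i))"
proof -
 have "EX v:M. N.pair_in x (j i) (j v)" if "i el d" for i
 proof -
  have "EX! y. y : N & N.pair_in x (j i) y" using x(2) that d unfolding N.func_def N_elts_j[OF d] by blast
  then show ?thesis using v by (metis imageE j_N)
 qed
 then obtain X where X: "!!i. i el d ==> X i : M & N.pair_in x (j i) (j (X i))" by metis
 have "N.elts x = j ` gr d X"
 proof (intro equalityI subsetI)
  fix z assume z: "z : N.elts x"
  then obtain u y where u: "u : N.elts (j d)" "y : N" "N.opair z u y" using x(2) unfolding N.func_def by blast
  then obtain i where i: "u = j i" "i el d" using d by (auto simp: N_elts_j)
  then have "N.pair_in x (j i) y" using u z unfolding N.pair_in_def by blast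
  moreover have "EX! y. y : N & N.pair_in x (j i) y" using x(2) i d unfolding N.func_def N_elts_j[OF d] by blast
  ultimately have "y = j (X i)" using X[OF i(2)] u j_N by metis
  then have "z = j (opr i (X i))" using N_opair_iff[of i "X i" z] X i u z by auto
  then show "z : j ` gr d X" using i by (auto simp: gr_def)
 next
  fix z assume "z : j ` gr d X"
  then obtain i where "i el d" "z = j (opr i (X i))" by (auto simp: gr_def)
  then show "z : N.elts x" using X[of i] N_pair_in[of i "X i" x] by auto
 qed
 then show thesis using that X by blast
qed

lemma N_func_intoI: assumes "x : N" "N.elts x = j ` gr d X" "d : M" "c : M" "!!i. i el d ==> X i el c"
 shows "N.func_into x (j d) (j c)"
 unfolding N.func_into_def
proof (intro conjI ballI impI)
 show "N.func x (j d)" by (rule N_funcI(1)[OF assms(1-3)]) (use assms in auto)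
 fix u y assume "u : N" "y : N" "N.pair_in x u y"
 then obtain i where "i el d" "y = j (X i)" using N_funcI(3)[OF assms(1-3)] assms(5) by blast
 then show "y : N.elts (j c)" using assms by (auto simp: N_elts_j)
qed

lemma N_func_intoE: assumes "x : N" "N.func_into x (j d) (j c)" "d : M" "c : M"
 obtains X where "!!i. i el d ==> X i el c" "N.elts x = j ` gr d X"
proof -
 have f: "N.func x (j d)" and v: "!!u y. u : N ==> y : N ==> N.pair_in x u y ==> y : j ` elts c"
  using assms unfolding N.func_into_def N_elts_j[OF assms(4)] by blast+
 obtain X where X: "!!i. i el d ==> X i : M" "N.elts x = j ` gr d X" "!!i. i el d ==> N.pair_in x (j i) (j (X i))"
  by (rule N_funcE[OF assms(1) f assms(3)]) (use v in blast)+
 have "X i el c" if i: "i el d" for i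
 proof -
  obtain u where "u el c" "j (X i) = j u" using v[OF _ _ X(3)[OF i]] by auto
  then show ?thesis using j_inj X(1)[OF i] by (metis el_M)
 qed
 then show thesis using that X by blast
qed

lemma N_sep: assumes Q: "N.dfn (%e. Q (e 0))" and a: "a : N" shows "EX b:N. N.elts b = {x : N.elts a. Q x}"
proof -
 obtain f c where c: "ALL i. c i : N" and f: "!!e. ALL i. e i : N ==> Q (e 0) = sat N EN f (mix e c)"
  using Q unfolding N.dfn_def by metis
 obtain t where t: "t : M" "a = V t" using a by (auto simp: N_V)
 have "ALL i. EX d:M. c i = V d" using c by (auto simp: N_V)
 then obtain d where d: "!!i. d i : M & c i = V (d i)" by metis
 \<comment> \<open>A name for the subset: a name \<open>x\<close> occurring in \<open>t\<close> is
   listed at the conditions that force it into \<open>t\<close> and force the formula of it.\<close>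
 define R where "R x p = (fmem p x t & forces f p ((mix (%_. t) d)(0 := x)))" for x p
 define A where "A = rep t p1"
 have A: "A : M" "elts A = p1 ` elts t" unfolding A_def by (simp, rule elts_rep) (intro dfi t)+
 have "dfn (%e. forces f (e (Suc 0)) ((%k. e (Suc (Suc k)))(0 := e 0)))" by (intro dfn_upd forces_dfn)
 from dfn_fix[OF this, of "mix (%_. t) d" 2] have "dfn (%e. forces f (e (Suc 0)) ((mix (%_. t) d)(0 := e 0)))"
  using t d by (simp add: mix_def fun_upd_def cong: if_cong)
 then have dR: "dfn (%e. R (e 0) (e 1))" unfolding R_def by (intro dfi t) simp
 have Qx: "Q (V x) <-> (EX p:G. forces f p ((mix (%_. t) d)(0 := x)))" if x: "x : M" for x
 proof -
  have "mix ((%_. V t)(0 := V x)) c = (%i. V (((mix (%_. t) d)(0 := x)) i))" by (rule ext) (auto simp: mix_def d elim!: evenE)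
  then have "Q (V x) = sat N EN f (%i. V (((mix (%_. t) d)(0 := x)) i))"
   using f[of "(%_. V t)(0 := V x)"] t x by simp
  also have "\<dots> <-> (EX p:G. forces f p ((mix (%_. t) d)(0 := x)))"
   by (rule truth) (use t x d in \<open>auto simp: mix_def\<close>)
  finally show ?thesis .
 qed
 have "N.elts (V (nm A R)) = {x : N.elts a. Q x}" unfolding N_elts_nm[OF dR A(1)]
 proof (intro equalityI subsetI)
  fix y assume "y : {V x |x s. x el A & s : G & R x s}"
  then obtain x s where x: "y = V x" "x : M" "s : G" "fmem s x t" "forces f s ((mix (%_. t) d)(0 := x))"
   unfolding R_def by blast
  then show "y : {x : N.elts a. Q x}" using Qx[of x] el_V[of x t] t by blast
 next
  fix y assume y: "y : {x : N.elts a. Q x}"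
  then obtain x s where x: "y = V x" "x : M" "s : G" "opr x s el t" using N_elts[OF t(1)] t by auto
  then have xA: "x el A" unfolding A by (intro image_eqI[of _ _ "opr x s"]) auto
  obtain p where p: "p : G" "forces f p ((mix (%_. t) d)(0 := x))" using Qx x y by blast
  obtain r where r: "r : G" "s sub r" "p sub r" using G_dir x p by blast
  have "forces f r ((mix (%_. t) d)(0 := x))"
   by (rule forces_mono[OF p(2) r(3)]) (use G_PP p r x t d in \<open>auto simp: mix_def\<close>)
  then have "R x r" unfolding R_def using fmemI[OF x(4) r(2) x(2)] x G_PP by blast
  then show "y : {V x |x s. x el A & s : G & R x s}" using x xA r by blast
 qed
 then show ?thesis by (metis V_N nm_M(1))
qed

text \<open>Let \<open>A\<close> be the set of names occurring in \<open>t\<close>. Each subset of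
  the value of \<open>t\<close> has a name among the subsets of \<open>times A PP\<close>, so
  listing all of these names a superset of the power set, which separation trims.\<close>

lemma N_pow: assumes a: "a : N" shows "EX b:N. N.elts b = {x : N. N.elts x <= N.elts a}"
proof -
 obtain t where t: "t : M" "a = V t" using a by (auto simp: N_V)
 define A where "A = rep t p1"
 have A: "A : M" "elts A = p1 ` elts t" unfolding A_def by (simp, rule elts_rep) (intro dfi t)+
 define B where "B = nm (pow (times A PP)) (%_ _. True)"
 have B: "N.elts (V B) = {V x |x s. x el pow (times A PP) & s : G}"
  unfolding B_def by (subst N_elts_nm, intro dfi) auto
 have "x : N.elts (V B)" if x: "x : N" "N.elts x <= N.elts a" for x
 proof -
  obtain u where u: "u : M" "x = V u" using x by (auto simp: N_V)
  have d: "dfn (%e. fmem (e 1) (e 0) u)" by (intro dfi u)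
  define w where "w = nm A (%y p. fmem p y u)"
  have "N.elts (V w) = N.elts x" unfolding w_def N_elts_nm[OF d A(1)]
  proof (intro equalityI subsetI)
   fix y assume "y : {V x |x s. x el A & s : G & fmem s x u}"
   then obtain z s where "y = V z" "z : M" "s : G" "fmem s z u" by blast
   then show "y : N.elts x" using el_V[of z u] u by blast
  next
   fix y assume y: "y : N.elts x"
   then obtain z s where z: "y = V z" "z : M" "s : G" "opr z s el t" using x N_elts[OF t(1)] t by auto
   then have "z el A" unfolding A by (intro image_eqI[of _ _ "opr z s"]) auto
   moreover obtain p where "p : G" "fmem p z u" using y z u el_V[of z u] by blast
   ultimately show "y : {V x |x s. x el A & s : G & fmem s x u}" using z by blast
  qed
  then have "V w = x" using N_ext x w_def by simp
  moreover have "w el pow (times A PP)" unfolding w_def nm_def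
   by (simp, subst elts_sep, intro dfi u) (use A PP in auto)
  ultimately show ?thesis unfolding B using zero_G by blast
 qed
 moreover obtain b where "b : N" "N.elts b = {x : N.elts (V B). N.elts x <= N.elts a}"
  using N_sep[of "%x. N.elts x <= N.elts a" "V B", OF N.dfn_sub_eq(2)[OF N.dft_var N.dft_const[OF a]]]
  by (auto simp: B_def)
 ultimately show ?thesis by (intro bexI[of _ b]) auto
qed

end

context zfc begin

definition least :: "('a => bool) => 'a" where "least Q = the1 (%i. ordinal i & Q i & (ALL k:elts i. ~ Q k))"

lemma least_M [simp]: "least Q : M" by (simp add: least_def)

lemma dft_least [dfi]: "dfn (%e. Q (e 0) (%i. e (Suc i))) ==> dft (%e. least (%i. Q i e))"
 unfolding least_def by (intro dfi dfn_w1)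

lemma least: assumes "dfn (%e. Q (e 0))" "ordinal i" "i : M" "Q i"
 shows "ordinal (least Q)" "Q (least Q)" "least Q el suc i" "k el least Q ==> ~ Q k"
proof -
 have "dfn (%e. ordinal (e 0) & Q (e 0))" by (intro dfi assms(1))
 from minimal[OF this assms(3)] assms(2,4) obtain y where y: "y : M" "ordinal y" "Q y" "!!z. z el y ==> ~ (ordinal z & Q z)" by blast
 have k: "~ Q k" if "k el y" for k using y(4)[OF that] ord_el[OF y(2) that] by blast
 have e: "least Q = y" unfolding least_def
 proof (rule the1_eq[OF y(1)])
  show "z = y" if "z : M" "ordinal z & Q z & (ALL k:elts z. ~ Q k)" for z
   using ord_tri[of z y] that y k by blast
 qed (use y k in blast)
 show "ordinal (least Q)" "Q (least Q)" "k el least Q ==> ~ Q k" unfolding e using y k by blast+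
 show "least Q el suc i" unfolding e using ord_tri[of y i] y k assms by auto
qed

lemma reg_join: assumes "reg k" "a el k" "b el k" obtains g where "g el k" "a sub g" "b sub g" "a el g" "b el g"
proof -
 have o: "ordinal a" "ordinal b" using assms reg_ord ord_el by blast+
 obtain m where m: "m el k" "a sub m" "b sub m" "m = a | m = b"
  using ord_tri[OF o] ord_sub[of a b] ord_sub[of b a] o assms by (metis el_M order_refl)
 have om: "ordinal m" using m o by blast
 have "a el suc m" "b el suc m" using m ord_sub[of a m] ord_sub[of b m] o om assms by (auto dest: el_M)
 then show thesis using that[of "suc m"] m reg_suc[OF assms(1) m(1)] by (auto dest: el_M)
qed

end

section \<open>The Levy collapse\<close>

locale levy_ground = zfc + fixes lam mu
 assumes lam: "reg lam" and mu: "mu : M" "inaccessible mu" and lam_mu: "lam el mu"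
begin

lemma mu_reg: "reg mu" using mu by (simp add: reg_def inaccessible_def)
lemma lam_M [simp]: "lam : M" "mu : M" using lam mu reg_M by auto
lemma ordl: "ordinal lam" "ordinal mu" using lam mu_reg reg_ord by auto
lemma lam_tr: "i el lam ==> k el i ==> k el lam" using ordl ord_tr by blast
lemma mu_tr: "i el mu ==> k el i ==> k el mu" using ordl ord_tr by blast
lemma bs_mu: "bs lam X ==> bs mu X" using bs_mono lam mu_reg lam_mu by blast
lemma mu_pow: "bs mu X ==> bs mu (pow X)" using bs_pow mu by blast

definition co :: "'a => 'a" where "co z = p1 (p1 z)"
text \<open>\<open>Col\<close> is only a HOL set. This is the same collection as a member of
  \<open>M\<close>, with the size bound expressed by \<open>bs\<close>; see
  \<open>elts_PC\<close>.\<close>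

definition PC :: 'a where
 "PC = sep (pow (times (times mu lam) mu)) (%p. (ALL z:elts p. p2 z el co z) & inj_on p1 (elts p) & bs lam p)"

lemma co_M [simp]: "co z : M" by (simp add: co_def)
lemma dft_co [dfi]: "dft A ==> dft (%e. co (A e))" unfolding co_def by (intro dfi)
lemma PC_M [simp]: "PC : M" by (simp add: PC_def)

lemma dfn_inj [dfi]: "dft A ==> dfn (%e. inj_on p1 (elts (A e)))"
 by (rule dfn1[of "%a. inj_on p1 (elts a)"]) (unfold inj_on_def, intro dfi)

lemma cond_z: "(z el times (times mu lam) mu & p2 z el co z) <->
  (EX a:elts mu. EX i:elts lam. EX b:elts a. z = opr (opr a i) b)"
proof
 assume "z el times (times mu lam) mu & p2 z el co z"
 moreover obtain a i b where "a el mu" "i el lam" "b el mu" "z = opr (opr a i) b"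
  using calculation by (auto simp: elts_times)
 ultimately show "EX a:elts mu. EX i:elts lam. EX b:elts a. z = opr (opr a i) b" by (auto simp: co_def)
next
 assume "EX a:elts mu. EX i:elts lam. EX b:elts a. z = opr (opr a i) b"
 then obtain a i b where "a el mu" "i el lam" "b el a" "z = opr (opr a i) b" by blast
 then show "z el times (times mu lam) mu & p2 z el co z" using mu_tr[of a b] by (auto simp: co_def)
qed

lemma el_PC: "p el PC <-> p : M & (ALL z:elts p. EX a:elts mu. EX i:elts lam. EX b:elts a. z = opr (opr a i) b) &
  inj_on p1 (elts p) & bs lam p"
proof -
 have "p el PC <-> p : M & (ALL z:elts p. z el times (times mu lam) mu & p2 z el co z) & inj_on p1 (elts p) & bs lam p"
  unfolding PC_def by (subst elts_sep, intro dfi lam_M) auto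
 then show ?thesis unfolding cond_z .
qed

lemma elts_PC: "elts PC = Col lam mu"
proof -
 have "p el PC <-> p : Col lam mu" if p: "p : M" for p
 proof -
  have sh: "(EX a:elts mu. EX i:elts lam. EX d:M. EX b:elts mu. opair d a i & opair z d b & b el a) <->
   (EX a:elts mu. EX i:elts lam. EX b:elts a. z = opr (opr a i) b)" if "z : M" for z
  proof
   assume "EX a:elts mu. EX i:elts lam. EX d:M. EX b:elts mu. opair d a i & opair z d b & b el a"
   then obtain a i d b where "a el mu" "i el lam" "d : M" "b el mu" "opair d a i" "opair z d b" "b el a" by blast
   moreover have "d = opr a i" "z = opr d b" using calculation that by (auto simp: opair_iff)
   ultimately show "EX a:elts mu. EX i:elts lam. EX b:elts a. z = opr (opr a i) b" by blast
  next
   assume "EX a:elts mu. EX i:elts lam. EX b:elts a. z = opr (opr a i) b"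
   then obtain a i b where "a el mu" "i el lam" "b el a" "z = opr (opr a i) b" by blast
   then show "EX a:elts mu. EX i:elts lam. EX d:M. EX b:elts mu. opair d a i & opair z d b & b el a"
    using mu_tr[of a b] by (intro bexI[of _ a] bexI[of _ i] bexI[of _ "opr a i"] bexI[of _ b]) (auto simp: opair_iff)
  qed
  have "(ALL d:M. ALL b:M. ALL g:M. pair_in p d b & pair_in p d g --> b = g) = inj_on p1 (elts p)"
   if sh: "ALL z:elts p. EX a:elts mu. EX i:elts lam. EX b:elts a. z = opr (opr a i) b"
  proof
   assume a: "ALL d:M. ALL b:M. ALL g:M. pair_in p d b & pair_in p d g --> b = g"
   show "inj_on p1 (elts p)"
   proof (rule inj_onI)
    fix z w assume z: "z el p" "w el p" "p1 z = p1 w"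
    obtain a i b where z2: "z = opr (opr a i) b" "b : M" using sh z by blast
    obtain a' i' b' where w2: "w = opr (opr a' i') b'" "b' : M" using sh z by blast
    have e: "opr a i = opr a' i'" using z z2 w2 by simp
    have "pair_in p (opr a i) b" "pair_in p (opr a i) b'" using z z2 w2 p e by (simp_all add: pair_in_iff)
    then show "z = w" using a z2 w2 e by (metis opr_M)
   qed
  next
   assume i: "inj_on p1 (elts p)"
   show "ALL d:M. ALL b:M. ALL g:M. pair_in p d b & pair_in p d g --> b = g"
    using inj_onD[OF i] p by (metis p12 pair_in_iff)
  qed
  then show ?thesis unfolding el_PC Col_def using p sh bs_card[OF lam p] by (auto simp: Ball_def)
 qed
 moreover have "p : M" if "p : Col lam mu" for p using that by (simp add: Col_def)
 ultimately show ?thesis using el_M by blast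
qed

lemma Col_one_zero: "Col_one = zero" unfolding Col_one_def by (rule the_equality) (auto intro: eqI)

lemma PC_zero: "zero el PC" unfolding el_PC using bs_el[OF lam reg_zero[OF lam]] by simp

end

sublocale levy_ground < forcing M E PC using PC_zero by unfold_locales simp_all

context levy_ground begin

lemma PC_z: assumes "p el PC" "z el p"
 obtains a i b where "a el mu" "i el lam" "b el a" "z = opr (opr a i) b" "co z = a" "p1 z = opr a i"
 using assms unfolding el_PC by (auto simp: co_def)

lemma PC_inj: "p el PC ==> z el p ==> w el p ==> p1 z = p1 w ==> z = w" unfolding el_PC inj_on_def by blast

lemma PC_sub: "p el PC ==> q : M ==> q sub p ==> q el PC"
 using bs_sub[OF lam, of p q] unfolding el_PC by (meson inj_on_subset subsetD)

lemma PC_un: assumes "p el PC" "q el PC" "!!z w. z el p ==> w el q ==> p1 z = p1 w ==> z = w" shows "un p q el PC"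
proof -
 have "inj_on p1 (elts p Un elts q)" using assms(3) PC_inj[OF assms(1)] PC_inj[OF assms(2)] unfolding inj_on_def by (metis Un_iff)
 then show ?thesis using assms(1,2) bs_un[OF lam] unfolding el_PC by auto
qed

text \<open>\<open>cs X\<close>: conditions with all columns in \<open>X\<close>; \<open>rst p X\<close>: the part of \<open>p\<close> in these columns.\<close>

definition rst :: "'a => 'a => 'a" where "rst p X = sep p (%z. co z el X)"
definition cs :: "'a => 'a" where "cs X = sep PC (%p. ALL z:elts p. co z el X)"

lemma rst_M [simp]: "rst p X : M" "cs X : M" by (simp_all add: rst_def cs_def)
lemma dft_rst [dfi]: "dft A ==> dft B ==> dft (%e. rst (A e) (B e))"
 by (rule dft2[of rst]) (unfold rst_def, intro dfi)
lemma dft_cs [dfi]: "dft A ==> dft (%e. cs (A e))"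
 by (rule dft1[of cs]) (unfold cs_def, intro dfi PC_M)

lemma elts_rst [simp]: "p : M ==> X : M ==> elts (rst p X) = {z : elts p. co z el X}"
 unfolding rst_def by (rule elts_sep) (intro dfi)
lemma el_cs: "X : M ==> p el cs X <-> p el PC & (ALL z:elts p. co z el X)"
 unfolding cs_def by (subst elts_sep, intro dfi) simp_all

lemma cs_PC: "X : M ==> p el cs X ==> p el PC" by (simp add: el_cs)
lemma cs_sub: "X : M ==> p el cs X ==> q : M ==> q sub p ==> q el cs X" using PC_sub by (auto simp: el_cs)
lemma cs_mono: "X : M ==> Y : M ==> X sub Y ==> p el cs X ==> p el cs Y" by (auto simp: el_cs)
lemma cs_zero: "X : M ==> zero el cs X" by (simp add: el_cs PC_zero)
lemma rst_cs: "p el PC ==> X : M ==> rst p X el cs X" using PC_sub[of p "rst p X"] by (auto simp: el_cs)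
lemma rst_mono: "p : M ==> q : M ==> X : M ==> p sub q ==> rst p X sub rst q X" by auto
lemma cs_rst: "X : M ==> p el cs X ==> q : M ==> p sub q ==> p sub rst q X" by (auto simp: el_cs)

text \<open>Entries of \<open>p\<close> outside the columns \<open>X\<close> cannot clash with
  \<open>b\<close>, and those inside are contained in \<open>b\<close>.\<close>

lemma amal: assumes "p el PC" "b el cs X" "X : M" "rst p X sub b" shows "un p b el PC" "rst (un p b) X = b"
proof -
 have b: "b el PC" "b : M" "p : M" "!!w. w el b ==> co w el X" using assms el_cs by auto
 show "un p b el PC"
 proof (rule PC_un[OF assms(1) b(1)])
  fix z w assume z: "z el p" "w el b" "p1 z = p1 w"
  then have "z el rst p X" using b assms(3) by (simp add: co_def)
  then show "z = w" using z assms(4) PC_inj[OF b(1)] by blast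
 qed
 show "rst (un p b) X = b" using assms b by (intro zfc_ext) auto
qed

lemma cs_un: "X : M ==> p el cs X ==> q el cs X ==> un p q el PC ==> un p q el cs X"
 by (auto simp: el_cs dest: el_M)

lemma single: "a el mu ==> i el lam ==> b el a ==> sing (opr (opr a i) b) el PC"
 unfolding el_PC using bs_sing[OF lam] by auto

lemma PC_support: assumes "p el PC" obtains d where "d el mu" "p el cs d"
proof -
 have "bs mu p" using assms bs_mu by (simp add: el_PC)
 moreover have "co z el mu" if z: "z el p" for z by (rule PC_z[OF assms z]) simp
 ultimately obtain d where "d el mu" "!!z. z el p ==> co z el d"
  using reg_bd[OF mu_reg, of p co] dft_co[OF dft_var[of 0]] by blast
 then show thesis using that assms el_cs by blast
qed

lemma PC_rows: assumes "p el PC" obtains n where "n el lam" "!!z. z el p ==> p2 (p1 z) el n"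
proof (rule reg_bd[OF lam, of p "%z. p2 (p1 z)"])
 show "bs lam p" using assms by (simp add: el_PC)
 show "p2 (p1 z) el lam" if "z el p" for z by (rule PC_z[OF assms that]) (use that in \<open>auto dest: el_M\<close>)
qed (intro dfi, blast)

lemma cs_bs: assumes "d el mu" shows "bs mu (cs d)"
proof -
 have "bs mu (pow (times (times d lam) d))"
  by (intro mu_pow bs_times mu_reg bs_el assms lam_mu)
 moreover have "p el pow (times (times d lam) d)" if "p el cs d" for p
 proof -
  have d: "d : M" "ordinal d" using assms ord_el ordl by auto
  have "z el times (times d lam) d" if z: "z el p" for z
   by (rule PC_z[OF cs_PC[OF d(1) \<open>p el cs d\<close>] z])
    (use d z \<open>p el cs d\<close> ord_tr[OF d(2)] in \<open>auto simp: el_cs\<close>)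
  then show ?thesis using that d by auto
 qed
 ultimately show ?thesis by (intro bs_sub[OF mu_reg, of _ "cs d"]) auto
qed

text \<open>Posets closed under unions of increasing sequences of length less than \<open>lam\<close>.\<close>

definition lcl :: "'a => bool" where
 "lcl X = (X : M & (ALL b:elts X. ALL c:M. ALL i:elts lam. (ALL k:elts i. app c k el X & supr b c k sub app c k) -->
   supr b c i el X))"

lemma lcl_M: "lcl X ==> X : M" by (simp add: lcl_def)
lemma lclD: "lcl X ==> b el X ==> c : M ==> i el lam ==> (!!k. k el i ==> app c k el X & supr b c k sub app c k) ==> supr b c i el X"
 unfolding lcl_def by blast

lemma supr_inc: assumes "supr b c k sub app c k" "i el k" "b : M" "c : M" "k : M" shows "app c i sub app c k"
 using assms by auto

text \<open>Any two entries of the union already occur in one member of the chain, so the union is a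
  function; regularity of \<open>lam\<close> bounds its size.\<close>

lemma lcl_PC: "lcl PC"
 unfolding lcl_def
proof (intro conjI ballI impI PC_M)
 fix b c i assume b: "b el PC" and c: "c : M" and i: "i el lam" and a: "ALL k:elts i. app c k el PC & supr b c k sub app c k"
 have M: "b : M" "i : M" using b i by auto
 have o: "ordinal k" if "k el i" for k using i that ordl ord_el by blast
 have inc: "app c k sub app c l" if "k el l" "l el i" for k l using a supr_inc that M c by blast
 have bk: "b sub app c k" if "k el i" for k using a that M c el_M[OF that] by auto
 have "bs lam (supr b c i)" unfolding supr_def
 proof (intro bs_un lam bs_uni)
  show "bs lam b" using b by (simp add: el_PC)
  show "bs lam i" using bs_el lam i by blast
  show "dft (%e. app c (e 0))" by (intro dfi c)
  show "bs lam (app c x)" if "x el i" for x using a that by (simp add: el_PC)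
 qed
 moreover have "EX k. z el k & w el k & k el PC" if z: "z el supr b c i" "w el supr b c i" for z w
 proof -
  have z': "z el b | (EX k:elts i. z el app c k)" "w el b | (EX k:elts i. w el app c k)" using z M c by auto
  have two: "EX k. z el k & w el k & k el PC" if kl: "k el i" "l el i" "z el app c k" "w el app c l" for k l
  proof -
   consider "k el l" | "k = l" | "l el k" using ord_tri[of k l] o[OF kl(1)] o[OF kl(2)] kl by blast
   then show ?thesis using inc kl a by cases blast+
  qed
  show ?thesis using z' two bk a b by blast
 qed
 then have "z = w" if "z el supr b c i" "w el supr b c i" "p1 z = p1 w" for z w using PC_inj that by metis
 ultimately show "supr b c i el PC" using a b M c unfolding el_PC inj_on_def by auto
qed

lemma lcl_cs: assumes X: "X : M" shows "lcl (cs X)"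
 unfolding lcl_def
proof (intro conjI ballI impI rst_M(2))
 fix b c i assume b: "b el cs X" and c: "c : M" and i: "i el lam" and a: "ALL k:elts i. app c k el cs X & supr b c k sub app c k"
 have "supr b c i el PC" by (rule lclD[OF lcl_PC _ c i]) (use b a X el_cs in auto)
 then show "supr b c i el cs X" using b a c i X by (auto simp: el_cs dest: el_M)
qed

lemma lcl_chain: assumes X: "lcl X" and eta: "eta el lam" and b: "b el X"
 and St: "dfn (%e. St (e 0) (e 1) (e 2))"
 and step: "!!i p. i el eta ==> p el X ==> b sub p ==> EX q:elts X. p sub q & St i p q"
 obtains c where "c : M" "func c eta" "!!i. i el suc eta ==> supr b c i el X"
  "!!i. i el eta ==> app c i el X & supr b c i sub app c i & St i (supr b c i) (app c i)"
proof (rule chain[of X eta b St])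
 fix i c assume i: "i el suc eta" "c : M" and h: "!!k. k el i ==> app c k el X & supr b c k el X & supr b c k sub app c k & St k (supr b c k) (app c k)"
 have "i el lam" using i eta lam_tr[OF eta] by auto
 then show "supr b c i el X" using lclD[OF X b i(2)] h by blast
qed (use assms lcl_M ordl ord_el that in blast)+

text \<open>Fewer than \<open>lam\<close> dense and persistent requirements are met one after
  another, and the union of the chain meets them all.\<close>

lemma lcl_all: assumes X: "lcl X" and eta: "eta el lam" and p: "p el X" and Q: "dfn (%e. Q (e 0) (e 1))"
 and mono: "!!i q r. i el eta ==> q el X ==> r el X ==> q sub r ==> Q i q ==> Q i r"
 and step: "!!i q. i el eta ==> q el X ==> p sub q ==> EX r:elts X. q sub r & Q i r"
 obtains q where "q el X" "p sub q" "!!i. i el eta ==> Q i q"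
proof -
 have "dfn (%e. Q (e 0) (e 2))" by (rule dfn2[OF Q]) (intro dfi)+
 then obtain c where c: "c : M" "func c eta" "!!i. i el suc eta ==> supr p c i el X"
  "!!i. i el eta ==> app c i el X & supr p c i sub app c i & Q i (app c i)"
  by (rule lcl_chain[OF X eta p, of "%i p q. Q i q"]) (use step in blast)+
 have e: "eta el suc eta" "eta : M" using eta by auto
 show thesis
 proof (rule that[OF c(3)[OF e(1)]])
  show "p sub supr p c eta" using p c e by auto
  show "Q i (supr p c eta)" if "i el eta" for i
   by (rule mono[OF that _ c(3)[OF e(1)], of "app c i"]) (use c(4)[OF that] p c(1) e that in auto)
 qed
qed

lemma supr_reg: assumes k: "reg k" and i: "bs k i" and b: "b el k" and c: "c : M" "!!l. l el i ==> app c l el k" shows "supr b c i el k"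
proof -
 have M: "i : M" "b : M" "k : M" "ordinal k" using i b bs_M reg_M[OF k] reg_ord[OF k] by auto
 obtain d where d: "d el k" "!!l. l el i ==> app c l el d"
  by (rule reg_bd[OF k i, of "app c"]) (use c in \<open>auto intro: dfi\<close>)
 have o: "ordinal b" "ordinal d" using b d M ord_el by blast+
 obtain m where m: "m el k" "b sub m" "d sub m"
  using ord_tri[OF o] ord_sub[of b d] ord_sub[of d b] o b d by (metis el_M order_refl)
 have om: "ordinal m" using m M ord_el by blast
 have cm: "app c l el m" if "l el i" for l using d(2)[OF that] m by blast
 have cm': "app c l sub m" if "l el i" for l using ord_tr[OF om cm[OF that]] by blast
 have s: "supr b c i sub m" unfolding elts_supr[OF M(2) c(1) M(1)] using m(2) cm' by blast
 have "ordinal (supr b c i)" unfolding ordinal_def transitive_def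
 proof (intro conjI ballI subsetI)
  fix y z assume y: "y el supr b c i"
  { assume "z el y"
   have ol: "ordinal (app c l)" if "l el i" for l using c(2)[OF that] M ord_el by blast
   show "z el supr b c i" using y \<open>z el y\<close> unfolding elts_supr[OF M(2) c(1) M(1)]
    by (elim UnE UN_E) (drule (1) ord_tr[OF o(1)], blast, frule ol, drule (2) ord_tr, blast) }
  fix u assume "z el y" "u el z" then show "u el y" using ord_tr[OF ord_el[OF om]] s y by blast
 qed
 then show ?thesis using s ord_sub[of "supr b c i" m] om m ord_tr[OF M(4)] by (metis el_M supr_M)
qed

abbreviation dec where "dec p t k == fmem p (chk k) t"

text \<open>\<open>good d t p\<close>: \<open>p\<close> forces that \<open>t\<close> contains a function on \<open>d\<close> into the ground model.\<close>

definition good :: "'a => 'a => 'a => bool" where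
 "good d t p = (ALL q:elts PC. p sub q --> (ALL i:elts d. (EX r:elts PC. q sub r & (EX v:M. dec r t (opr i v))) &
   (ALL v:M. ALL w:M. dec q t (opr i v) --> dec q t (opr i w) --> v = w)))"

lemma goodD: assumes "good d t p" "q el PC" "p sub q" "i el d"
 shows "EX r:elts PC. q sub r & (EX v:M. dec r t (opr i v))" "dec q t (opr i v) ==> dec q t (opr i w) ==> v : M ==> w : M ==> v = w"
 using assms unfolding good_def by blast+

lemma good_mono: "good d t p ==> p sub q ==> good d t q" unfolding good_def by (meson subset_trans)

lemma dec_mono: "dec p t k ==> p sub q ==> dec q t k" by (rule fmem_mono)

lemma good_compat: "good d t p ==> p sub q ==> i el d ==> dec q t (opr i v) ==> dec r t (opr i w) ==> v : M ==> w : M ==>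
  s el PC ==> q sub s ==> r sub s ==> v = w"
 using goodD(2)[of d t p s i v w] dec_mono by (meson subset_trans)

text \<open>Below \<open>p\<close>, the name \<open>t\<close> is in effect a name for the collapse
  in the columns \<open>b\<close>; \<open>dec_rst\<close> makes this precise.\<close>

definition bd :: "'a => 'a => 'a => bool" where
 "bd t p b = (p el cs b & good lam t p & (ALL q:elts (cs b). p sub q --> (ALL i:elts lam. EX r:elts (cs b). q sub r &
   (EX v:M. dec r t (opr i v)))))"

lemma bdD: "bd t p b ==> q el cs b ==> p sub q ==> i el lam ==> EX r:elts (cs b). q sub r & (EX v:M. dec r t (opr i v))"
 unfolding bd_def by blast

text \<open>Let \<open>r\<close> extend the restriction of \<open>q\<close>. Some \<open>s\<close>
  with columns in \<open>b\<close> extends the restriction of \<open>r\<close> and decides the value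
  at \<open>i\<close>. It is compatible with \<open>q\<close>, so the value is \<open>v\<close>; and
  it is compatible with \<open>r\<close>, so the decision \<open>v\<close> is dense.\<close>

lemma dec_rst: assumes b: "bd t p b" "b : M" and q: "q el PC" "p sub q" and i: "i el lam" "v : M" and d: "dec q t (opr i v)"
 shows "dec (rst q b) t (opr i v)"
proof -
 have p: "p el cs b" "good lam t p" using b by (auto simp: bd_def)
 have pr: "p sub rst q b" using cs_rst[OF b(2) p(1)] q by auto
 have "EX s:elts PC. r sub s & dec s t (opr i v)" if r: "r el PC" "rst q b sub r" for r
 proof -
  have "rst q b sub rst r b" using r q b(2) by auto
  obtain s w where s: "s el cs b" "rst r b sub s" "w : M" "dec s t (opr i w)"
   using bdD[OF b(1) rst_cs[OF r(1) b(2)] _ i(1)] pr \<open>rst q b sub rst r b\<close> by blast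
  have "un q s el PC" by (rule amal[OF q(1) s(1) b(2)]) (use s \<open>rst q b sub rst r b\<close> in blast)
  then have "v = w" by (rule good_compat[OF p(2) q(2) i(1) d s(4) i(2) s(3)]) (use q s in auto)
  moreover have "un r s el PC" by (rule amal[OF r(1) s(1) b(2) s(2)])
  ultimately show ?thesis using s r dec_mono[OF s(4), of "un r s"] by (intro bexI[of _ "un r s"]) auto
 qed
 then show ?thesis by (intro fmem_dns) (auto simp: dns_def)
qed

text \<open>There are fewer than \<open>mu\<close> pairs of a condition in \<open>cs b\<close> and
  an index. So the least column bounds under which each of them can be decided are bounded below
  \<open>mu\<close>.\<close>

lemma bound_step: assumes t: "t : M" "good lam t p" and p: "p : M" and b: "b el mu"
 obtains g where "g el mu" "b el g" "!!q i. q el cs b ==> p sub q ==> i el lam ==> EX r:elts (cs g). q sub r & (EX v:M. dec r t (opr i v))"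
proof -
 note pM = p
 let ?P = "%w e. e el mu & (EX r:elts (cs e). p1 w sub r & (EX v:M. dec r t (opr (p2 w) v)))"
 define X where "X = sep (times (cs b) lam) (%w. p sub p1 w)"
 have X: "elts X = {w : elts (times (cs b) lam). p sub p1 w}"
  unfolding X_def by (rule elts_sep) (intro dfi pM | simp)+
 have "bs mu (times (cs b) lam)" by (intro bs_times mu_reg cs_bs b bs_el lam_mu)
 then have bX: "bs mu X" by (rule bs_sub[OF mu_reg]) (simp add: X_def, use X in blast)
 have PP': "?P w (least (?P w))" if w: "w el X" for w
 proof -
  obtain q i where qi: "q el cs b" "i el lam" "w = opr q i" "p sub q" using w unfolding X by (auto simp: elts_times)
  have q: "q el PC" using qi cs_PC b by blast
  obtain r v where r: "r el PC" "q sub r" "v : M" "dec r t (opr i v)" using goodD(1)[OF t(2) q qi(4,2)] by blast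
  obtain e where "e el mu" "r el cs e" by (rule PC_support[OF r(1)])
  then have "?P w e" using qi r by auto
  moreover have "ordinal e" "e : M" using \<open>e el mu\<close> ordl ord_el by auto
  moreover have "dfn (%e. ?P w (e 0))" by (intro dfi t lam_M) (use w in auto)
  ultimately show ?thesis using least(2)[of "?P w" e] by blast
 qed
 have "dft (%e. least (?P (e 0)))" by (intro dfi t lam_M)
 then obtain g0 where g0: "g0 el mu" "!!w. w el X ==> least (?P w) el g0"
  by (rule reg_bd[OF mu_reg bX]) (use PP' in blast)+
 obtain g where g: "g el mu" "g0 sub g" "b el g" by (rule reg_join[OF mu_reg g0(1) b])
 show thesis
 proof (rule that[OF g(1,3)])
  fix q i assume q: "q el cs b" "p sub q" "i el lam"
  have w: "opr q i el X" unfolding X using q b by auto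
  have "least (?P (opr q i)) sub g" using g0(2)[OF w] g(2) ord_tr[OF ord_el[OF ordl(2) g(1)]] by blast
  then show "EX r:elts (cs g). q sub r & (EX v:M. dec r t (opr i v))"
   using PP'[OF w] cs_mono[of "least (?P (opr q i))" g] p12[OF el_M[OF q(1)] el_M[OF q(3)]] g(1) by auto
 qed
qed

text \<open>\<open>bound_step\<close> is iterated \<open>lam\<close> times. A condition with columns
  in the limit \<open>g\<close> has fewer than \<open>lam\<close> entries, so by regularity its
  columns lie in an earlier stage, and the next stage decides the value.\<close>

lemma bound_ex: assumes t: "t : M" "good lam t p" and p: "p el PC" and b: "b el mu"
 obtains g where "g el mu" "b el g" "bd t p g"
proof -
 obtain p0 where p0: "p0 el mu" "p el cs p0" by (rule PC_support[OF p])
 obtain b0 where b0: "b0 el mu" "p0 sub b0" "b el b0" by (rule reg_join[OF mu_reg p0(1) b])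
 have pM: "p : M" using p by auto
 let ?S = "%b g. ALL q:elts (cs b). p sub q --> (ALL i:elts lam. EX r:elts (cs g). q sub r & (EX v:M. dec r t (opr i v)))"
 have S: "dfn (%e. (%i b g. ?S b g) (e 0) (e 1) (e 2))" by (intro dfi pM lam_M t)
 obtain c where c: "c : M" "func c lam" "!!i. i el suc lam ==> supr b0 c i el mu"
  "!!i. i el lam ==> app c i el mu & supr b0 c i sub app c i & ?S (supr b0 c i) (app c i)"
 proof (rule chain[OF lam_M(2) lam_M(1) ordl(1) el_M[OF b0(1)] S])
  fix i q assume q: "q el mu"
  obtain g where "g el mu" "q el g" "!!r i. r el cs q ==> p sub r ==> i el lam ==> EX s:elts (cs g). r sub s & (EX v:M. dec s t (opr i v))"
   using bound_step[OF t pM q] by blast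
  moreover have "q sub g" using calculation ord_tr ordl ord_el by blast
  ultimately show "EX g:elts mu. q sub g & ?S q g" by blast
 next
  fix i c assume i: "i el suc lam" and c: "c : M" "!!k. k el i ==> app c k el mu & supr b0 c k el mu &
   supr b0 c k sub app c k & ?S (supr b0 c k) (app c k)"
  have "bs mu i" using i bs_el[OF mu_reg] lam_mu mu_tr[OF lam_mu] by auto
  then show "supr b0 c i el mu" by (rule supr_reg[OF mu_reg _ b0(1) c(1)]) (use c in blast)
 qed blast
 define g where "g = supr b0 c lam"
 have g: "g el mu" unfolding g_def by (rule c(3)) simp
 have b0g: "b0 sub g" using b0 c by (auto simp: g_def)
 have inc: "app c i sub app c k" if "i el k" "k el lam" for i k using supr_inc[of b0 c k i] c b0 that by auto
 have cg: "app c k sub g" if "k el lam" for k using c b0 that by (auto simp: g_def)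
 have bk: "b0 sub app c k" if "k el lam" for k
 proof -
  have "b0 sub supr b0 c k" using b0 c that by auto
  then show ?thesis using c(4)[OF that] by blast
 qed
 have "bd t p g" unfolding bd_def
 proof (intro conjI ballI impI t)
  show "p el cs g" using p0 b0 b0g g by (intro cs_mono[OF _ _ _ p0(2)]) auto
  fix q i assume q: "q el cs g" "p sub q" and i: "i el lam"
  let ?L = "%z l. l el lam & co z el app c l"
  have L: "?L z (least (?L z))" if z: "z el q" for z
  proof -
   have "co z el g" using q z g by (auto simp: el_cs)
   then have "co z el b0 | (EX l:elts lam. co z el app c l)" using c(1) b0 by (auto simp: g_def)
   then obtain l where "?L z l" using bk[OF reg_zero[OF lam]] reg_zero[OF lam] by blast
   moreover have "ordinal l" "l : M" using calculation ordl ord_el by auto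
   moreover have "dfn (%e. ?L z (e 0))" by (intro dfi c lam_M) (use z in auto)
   ultimately show ?thesis using least(2)[of "?L z" l] by blast
  qed
  have bq: "bs lam q" using q cs_PC g by (auto simp: el_PC)
  have "dft (%e. least (?L (e 0)))" by (intro dfi c lam_M)
  then obtain k where k: "k el lam" "!!z. z el q ==> least (?L z) el k"
   by (rule reg_bd[OF lam bq]) (use L in blast)+
  have "co z el app c k" if "z el q" for z using L[OF that] inc[OF k(2)[OF that] k(1)] by blast
  then have "q el cs (app c k)" using q g by (auto simp: el_cs)
  moreover have sk: "suc k el lam" using reg_suc lam k by blast
  moreover have "app c k sub supr b0 c (suc k)" using k c b0 by auto
  ultimately have "q el cs (supr b0 c (suc k))" using cs_mono by (metis p12_M(3) supr_M)
  then obtain r v where "r el cs (app c (suc k))" "q sub r" "v : M" "dec r t (opr i v)" using c(4)[OF sk] q i by blast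
  moreover have "r el cs g" using cs_mono[OF _ _ cg[OF sk]] calculation g by auto
  ultimately show "EX r:elts (cs g). q sub r & (EX v:M. dec r t (opr i v))" by blast
 qed
 then show thesis using that g b0 b0g by blast
qed

lemma decide_all: assumes X: "lcl X" "X sub PC" and th: "th el lam" and t: "t : M" and q: "q el X"
 and st: "!!i r. i el th ==> r el X ==> q sub r ==> EX s:elts X. r sub s & (EX v:M. dec s t (opr i v))"
 obtains r where "r el X" "q sub r" "!!i. i el th ==> EX v:M. dec r t (opr i v)"
proof (rule lcl_all[OF X(1) th q, of "%i r. EX v:M. dec r t (opr i v)"])
 show "dfn (%e. EX v:M. dec (e 1) t (opr (e 0) v))" by (intro dfi t)
 show "EX s:elts X. r sub s & (EX v:M. dec s t (opr i v))" if "i el th" "r el X" "q sub r" for i r using st that .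
 show "EX v:M. dec r' t (opr i v)" if "r sub r'" "EX v:M. dec r t (opr i v)" for i r r' using dec_mono that by blast
qed (use that in blast)

end

section \<open>Functions into the ground model, and no new ones of length below
  \<open>lam\<close>\<close>

locale levy = levy_ground + fixes G assumes gen: "generic (Col lam mu) Col_le G"

sublocale levy < generic_ext M E PC G using gen by unfold_locales (simp add: elts_PC)

context levy begin

text \<open>Otherwise \<open>dich\<close> gives a condition in \<open>G\<close> that blocks every
  value at some \<open>i\<close> or decides two of them, against the one value that
  \<open>V[G]\<close> has there.\<close>

lemma good_ex: assumes t: "t : M" and d: "d : M" and e: "!!i. i el d ==> EX! v. v : M & j (opr i v) : N.elts (V t)"
 obtains p where "p : G" "good d t p"
proof -
 obtain p where p: "p : G" using G_ne by blast
 let ?S = "%q. EX i:elts d. (ALL r:elts PC. q sub r --> ~ (EX v:M. dec r t (opr i v))) |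
   (EX v:M. EX w:M. v ~= w & dec q t (opr i v) & dec q t (opr i w))"
 have J: "j (opr i v) : N.elts (V t) <-> (EX p:G. dec p t (opr i v))" for i v using fmem_j t by simp
 have "dfn (%e. ?S (e 0))" by (intro dfi t d PC_M)
 then show thesis
 proof (rule dich[OF _ p])
  fix q assume q: "q : G" "?S q"
  then obtain i where i: "i el d" "(ALL r:elts PC. q sub r --> ~ (EX v:M. dec r t (opr i v))) |
   (EX v:M. EX w:M. v ~= w & dec q t (opr i v) & dec q t (opr i w))" by blast
  obtain v r where v: "v : M" "r : G" "dec r t (opr i v)" using e[OF i(1)] J by blast
  obtain s where s: "s : G" "q sub s" "r sub s" using G_dir q v by blast
  then have "dec s t (opr i v)" using dec_mono v by blast
  then have "EX v:M. EX w:M. v ~= w & dec q t (opr i v) & dec q t (opr i w)" using i s v G_PP by blast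
  then show thesis using e[OF i(1)] J q by blast
 next
  fix q assume q: "q : G" "ALL r:elts PC. q sub r --> ~ ?S r"
  have "good d t q" unfolding good_def
  proof (intro ballI impI conjI)
   fix r i assume r: "r el PC" "q sub r" and i: "i el d"
   show "EX s:elts PC. r sub s & (EX v:M. dec s t (opr i v))" using q(2) r i by blast
   fix v w assume "v : M" "w : M" "dec r t (opr i v)" "dec r t (opr i w)"
   then show "v = w" using q(2) r i by blast
  qed
  then show thesis using that q by blast
 qed
qed

text \<open>Closure lets a single condition decide all values, densely below \<open>p\<close> and
  hence in \<open>G\<close>; the function is then read off inside \<open>M\<close>.\<close>

lemma no_new: assumes f: "f : N" "N.func f (j d)" and d: "d el lam" and v: "!!u y. u : N ==> y : N ==> N.pair_in f u y ==> y : j ` M"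
 obtains g where "g : M" "func g d" "f = j g"
proof -
 have dM: "d : M" using d by auto
 obtain X where X: "!!i. i el d ==> X i : M" "N.elts f = j ` gr d X" by (rule N_funcE[OF f dM v]) blast+
 obtain t where t: "t : M" "f = V t" using f by (auto simp: N_V)
 have Xe: "j (opr i v) : N.elts f <-> v = X i" if i: "i el d" "v : M" for i v
 proof -
  have "j (opr i v) = j (opr k (X k)) <-> i = k & v = X k" if "k el d" for k using j_inj i that X(1) by auto
  then show ?thesis using i by (auto simp: X(2) gr_def)
 qed
 obtain p where p: "p : G" "good d t p"
 proof (rule good_ex[OF t(1) dM])
  show "EX! v. v : M & j (opr i v) : N.elts (V t)" if "i el d" for i
   using Xe[OF that] X(1)[OF that] t(2) by (intro ex1I[of _ "X i"]) auto
 qed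
 have "dns p (%r. ALL i:elts d. EX v:M. dec r t (opr i v))" unfolding dns_def
 proof (intro ballI impI)
  fix q assume q: "q el PC" "p sub q"
  obtain r where "r el PC" "q sub r" "!!i. i el d ==> EX v:M. dec r t (opr i v)"
  proof (rule decide_all[OF lcl_PC order_refl d t(1) q(1)])
   show "EX s:elts PC. r sub s & (EX v:M. dec s t (opr i v))" if "i el d" "r el PC" "q sub r" for i r
    using goodD(1)[OF p(2) that(2) _ that(1)] q(2) that(3) by blast
  qed blast
  then show "EX r:elts PC. q sub r & (ALL i:elts d. EX v:M. dec r t (opr i v))" by blast
 qed
 moreover have "dfn (%e. ALL i:elts d. EX v:M. dec (e 0) t (opr i v))" by (intro dfi dM t)
 ultimately obtain r where r: "r : G" "ALL i:elts d. EX v:M. dec r t (opr i v)"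
  using G_meets[OF _ p(1), of "%r. ALL i:elts d. EX v:M. dec r t (opr i v)"] by blast
 have rX: "dec r t (opr i v) <-> v = X i" if i: "i el d" "v : M" for i v
  using Xe[OF i(1)] r i fmem_j[of "opr i v" t for v] t by (metis opr_M)
 define g where "g = fn d (%i. the1 (%v. dec r t (opr i v)))"
 have df: "dft (%e. the1 (%v. dec r t (opr (e 0) v)))" by (intro dfi t) (use r in auto)
 have T: "the1 (%v. dec r t (opr i v)) = X i" if "i el d" for i
  by (rule the1_eq) (use rX that X in auto)
 have "elts g = gr d X" unfolding g_def elts_fn[OF df dM] gr_def using T by (auto cong: image_cong)
 then have "f = j g" using X f by (intro N_ext) (auto simp: N_elts_j g_def)
 then show thesis by (rule that[rotated 2]) (simp_all add: g_def func_fn[OF df dM])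
qed

end

section \<open>Tagged unions and a generic tree of conditions\<close>

context zfc begin

text \<open>The disjoint union turns pairs ordered coordinatewise into sets ordered by inclusion.
  Products and triples thus fall under the same notions \<open>supr\<close> and \<open>lcl\<close>
  as single conditions.\<close>

definition tg :: "'a => 'a => 'a" where "tg a b = un (rep a (%z. opr zero z)) (rep b (%z. opr (suc zero) z))"
definition pr0 :: "'a => 'a" where "pr0 t = rep (sep t (%w. p1 w = zero)) p2"
definition pr1 :: "'a => 'a" where "pr1 t = rep (sep t (%w. p1 w = suc zero)) p2"

lemma tg_M [simp]: "tg a b : M" "pr0 t : M" "pr1 t : M" by (simp_all add: tg_def pr0_def pr1_def)
lemma dft_tg [dfi]: "dft A ==> dft B ==> dft (%e. tg (A e) (B e))"
 by (rule dft2[of tg]) (unfold tg_def, intro dfi, simp_all)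
lemma dft_pr [dfi]: "dft A ==> dft (%e. pr0 (A e))" "dft A ==> dft (%e. pr1 (A e))"
proof -
 show "dft A ==> dft (%e. pr0 (A e))" by (rule dft1[of pr0]) (unfold pr0_def, intro dfi, simp_all)
 show "dft A ==> dft (%e. pr1 (A e))" by (rule dft1[of pr1]) (unfold pr1_def, intro dfi, simp_all)
qed

lemma zs: "zero ~= suc zero" "suc zero ~= zero" by (metis elts_suc insert_not_empty zero)+

lemma elts_tg: "a : M ==> b : M ==> elts (tg a b) = opr zero ` elts a Un opr (suc zero) ` elts b"
proof -
 have "elts (rep b (%z. opr s z)) = opr s ` elts b" if "b : M" "s : M" for b s
  by (rule elts_rep) (intro dfi, simp_all add: that)
 then show "a : M ==> b : M ==> ?thesis" by (simp add: tg_def)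
qed

lemma pr_tg [simp]: assumes "a : M" "b : M" shows "pr0 (tg a b) = a" "pr1 (tg a b) = b"
proof -
 have 0: "elts (pr0 t) = p2 ` {w : elts t. p1 w = zero}" if "t : M" for t
  unfolding pr0_def by (subst elts_rep, intro dfi, simp, subst elts_sep, intro dfi) (simp_all add: that)
 have 1: "elts (pr1 t) = p2 ` {w : elts t. p1 w = suc zero}" if "t : M" for t
  unfolding pr1_def by (subst elts_rep, intro dfi, simp, subst elts_sep, intro dfi) (simp_all add: that)
 have "{w : elts (tg a b). p1 w = zero} = opr zero ` elts a" "{w : elts (tg a b). p1 w = suc zero} = opr (suc zero) ` elts b"
  unfolding elts_tg[OF assms] using zs by auto
 then show "pr0 (tg a b) = a" "pr1 (tg a b) = b"
  using assms by (auto intro!: zfc_ext simp: 0 1 image_image cong: image_cong)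
qed

lemma tg_sub [simp]: assumes "a : M" "b : M" "a' : M" "b' : M" shows "tg a b sub tg a' b' <-> a sub a' & b sub b'"
proof
 have o: "opr zero z ~= opr (suc zero) w" if "z : M" "w : M" for z w using zs that by simp
 assume s: "tg a b sub tg a' b'"
 have "z el a'" if "z el a" for z
 proof -
  have "opr zero z el tg a' b'" using s that assms by (auto simp: elts_tg)
  then show ?thesis using that assms by (auto simp: elts_tg zs)
 qed
 moreover have "z el b'" if "z el b" for z
 proof -
  have "opr (suc zero) z el tg a' b'" using s that assms by (auto simp: elts_tg)
  then show ?thesis using that assms by (auto simp: elts_tg zs)
 qed
 ultimately show "a sub a' & b sub b'" by blast
qed (use assms in \<open>auto simp: elts_tg\<close>)

lemma tg_inj: "a : M ==> b : M ==> a' : M ==> b' : M ==> tg a b = tg a' b' <-> a = a' & b = b'" by (metis pr_tg)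

lemma app_fn': "dft (%e. F (e 0)) ==> c : M ==> i : M ==> k el i ==> app (fn i (%k. F (app c k))) k = F (app c k)"
 by (rule app_fn[of "%k. F (app c k)"]) (rule dft1[of F], simp, intro dfi, simp_all)

lemma supr_tg: assumes b: "b0 : M" "b1 : M" and c: "c : M" "i : M" and t: "!!k. k el i ==> app c k = tg (pr0 (app c k)) (pr1 (app c k))"
 shows "supr (tg b0 b1) c i = tg (supr b0 (fn i (%k. pr0 (app c k))) i) (supr b1 (fn i (%k. pr1 (app c k))) i)"
proof (rule zfc_ext)
 have 0: "app (fn i (%k. pr0 (app c k))) k = pr0 (app c k)" "app (fn i (%k. pr1 (app c k))) k = pr1 (app c k)" if "k el i" for k
  by (rule app_fn'[OF _ c that], intro dfi)+
 have "elts (app c k) = opr zero ` elts (pr0 (app c k)) Un opr (suc zero) ` elts (pr1 (app c k))" if "k el i" for k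
  using t[OF that] elts_tg tg_M by metis
 then show "elts (supr (tg b0 b1) c i) = elts (tg (supr b0 (fn i (%k. pr0 (app c k))) i) (supr b1 (fn i (%k. pr1 (app c k))) i))"
  using b c 0 by (simp add: elts_tg) blast
qed simp_all

definition rsq :: "'a => 'a => 'a" where "rsq f m = sep f (%z. p1 z el m)"
definition snoc :: "'a => 'a => 'a => 'a" where "snoc f n v = un f (sing (opr n v))"

lemma rsq_M [simp]: "rsq f m : M" "snoc f n v : M" by (simp_all add: rsq_def snoc_def)
lemma elts_rsq: "f : M ==> m : M ==> elts (rsq f m) = {z : elts f. p1 z el m}"
 unfolding rsq_def by (rule elts_sep) (intro dfi)

lemma app_func: "func f d ==> f : M ==> d : M ==> opr i v el f ==> i : M ==> v : M ==> app f i = v" using funcD(2) by metis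

lemma func_sub: assumes "func f d" "func g e" "f sub g" "f : M" "g : M" "d : M" "e : M"
 shows "d sub e" "i el d ==> app f i = app g i"
proof -
 have *: "i el e & app f i = app g i" if "i el d" for i
  using funcD(1)[OF assms(1,4,6) that] assms(3) funcD(2)[OF assms(2,5,7), of i "app f i"] that by auto
 then show "d sub e" "i el d ==> app f i = app g i" by blast+
qed

lemma func_subI: "func f d ==> func g e ==> f : M ==> g : M ==> d : M ==> e : M ==> d sub e ==> (!!i. i el d ==> app f i = app g i) ==> f sub g"
 by (auto simp: func_elts)

lemma func_rsq: assumes "func f d" "f : M" "d : M" "m : M" "m sub d" shows "func (rsq f m) m" "i el m ==> app (rsq f m) i = app f i"
proof -
 have e: "opr i v el rsq f m <-> i el m & v = app f i" if "i : M" "v : M" for i v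
  using that assms funcD[OF assms(1-3)] by (auto simp: elts_rsq)
 show f: "func (rsq f m) m"
 proof (rule funcI)
  show "EX x:elts m. EX y:M. z = opr x y" if "z el rsq f m" for z
   using that assms funcD(3)[OF assms(1-3), of z] unfolding elts_rsq[OF assms(2,4)] by fastforce
 qed (use e assms in auto)
 show "i el m ==> app (rsq f m) i = app f i" using app_func[OF f _ assms(4), of i "app f i"] e by auto
qed

lemma func_snoc: assumes "func f n" "f : M" "n : M" "v : M"
 shows "func (snoc f n v) (suc n)" "app (snoc f n v) n = v" "i el n ==> app (snoc f n v) i = app f i"
proof -
 have e: "opr i w el snoc f n v <-> i el n & w = app f i | i = n & w = v" if "i : M" "w : M" for i w
  using that assms funcD[OF assms(1-3)] by (auto simp: snoc_def)
 show f: "func (snoc f n v) (suc n)"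
 proof (rule funcI)
  show "EX x:elts (suc n). EX y:M. z = opr x y" if "z el snoc f n v" for z
   using that assms funcD(3)[OF assms(1-3), of z] by (auto simp: snoc_def)
  show "EX w:M. opr x w el snoc f n v" if "x el suc n" for x
   using that e[of x v] e[of x "app f x"] assms by (cases "x = n") auto
  show "y = y'" if "x el suc n" "y : M" "y' : M" "opr x y el snoc f n v" "opr x y' el snoc f n v" for x y y'
   using e[of x y] e[of x y'] that no_cycle(1)[OF assms(3)] by auto
 qed simp_all
 show "app (snoc f n v) n = v" using app_func[OF f _ _, of n v] e assms by auto
 show "i el n ==> app (snoc f n v) i = app f i" using app_func[OF f _ _, of i "app f i"] e[of i "app f i"] by auto
qed

definition dm :: "'a => 'a" where "dm f = rep f p1"
lemma dm_M [simp]: "dm f : M" by (simp add: dm_def)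
lemma dft_dm [dfi]: "dft A ==> dft (%e. dm (A e))" by (rule dft1[of dm]) (unfold dm_def, intro dfi)
lemma elts_dm: "f : M ==> elts (dm f) = p1 ` elts f" unfolding dm_def by (rule elts_rep) (intro dfi)
lemma dm_func: "func f d ==> f : M ==> d : M ==> dm f = d"
 by (rule zfc_ext) (auto simp: elts_dm func_elts image_image cong: image_cong)

lemma supr_dir: assumes i: "ordinal i" "i : M" and M: "b : M" "c : M" and inc: "!!k. k el i ==> supr b c k sub app c k"
 and z: "z el supr b c i" "w el supr b c i"
 obtains t where "t = b | (EX k:elts i. t = app c k)" "z el t" "w el t"
proof -
 have bk: "b sub app c k" if "k el i" for k using inc[OF that] M el_M[OF that] by auto
 have kl: "app c k sub app c l" if "k el l" "l el i" for k l using inc[OF that(2)] that M el_M[OF that(2)] by auto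
 have z': "z el b | (EX k:elts i. z el app c k)" "w el b | (EX k:elts i. w el app c k)" using z M i by auto
 have two: "EX m:elts i. z el app c m & w el app c m" if k: "k el i" "l el i" "z el app c k" "w el app c l" for k l
  using ord_tri[of k l] ord_el[OF i(1) k(1)] ord_el[OF i(1) k(2)] kl[of k l] kl[of l k] k by blast
 show thesis using z' two bk that by blast
qed

lemma func_supr: assumes i: "ordinal i" "i : M" and M: "b : M" "c : M" and inc: "!!k. k el i ==> supr b c k sub app c k"
 and f: "func b n" "n : M" "!!k. k el i ==> func (app c k) (dm (app c k))"
 shows "func (supr b c i) (dm (supr b c i))" "dm (supr b c i) = supr n (fn i (%k. dm (app c k))) i"
proof -
 have mem: "func t (dm t)" "t : M" "t sub supr b c i" if "t = b | (EX k:elts i. t = app c k)" for t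
  using that f M i dm_func[OF f(1) M(1) f(2)] by auto
 show "func (supr b c i) (dm (supr b c i))"
 proof (rule funcI)
  fix z assume z: "z el supr b c i"
  obtain t where t: "t = b | (EX k:elts i. t = app c k)" "z el t" by (rule supr_dir[OF i M inc z z]) auto
  then obtain x where "z = opr x (app t x)" "x el dm t" using funcD(3)[OF mem(1,2)[OF t(1)] dm_M] by blast
  moreover have "x el dm (supr b c i)" using calculation z by (auto simp: elts_dm intro!: image_eqI[of _ _ z])
  ultimately show "EX x:elts (dm (supr b c i)). EX y:M. z = opr x y" by auto
 next
  fix x assume "x el dm (supr b c i)"
  then obtain z where z: "z el supr b c i" "x = p1 z" by (auto simp: elts_dm)
  obtain t where t: "t = b | (EX k:elts i. t = app c k)" "z el t" by (rule supr_dir[OF i M inc z(1) z(1)]) auto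
  then obtain x' where "z = opr x' (app t x')" "x' el dm t" using funcD(3)[OF mem(1,2)[OF t(1)] dm_M] by blast
  then show "EX y:M. opr x y el supr b c i" using z by (intro bexI[of _ "app t x'"]) auto
 next
  fix x y y' assume a: "y : M" "y' : M" "opr x y el supr b c i" "opr x y' el supr b c i" "x el dm (supr b c i)"
  obtain t where t: "t = b | (EX k:elts i. t = app c k)" "opr x y el t" "opr x y' el t"
   by (rule supr_dir[OF i M inc a(3,4)]) auto
  then show "y = y'" using funcD(2)[OF mem(1,2)[OF t(1)] dm_M] a by (metis el_M)
 qed simp_all
 have "app (fn i (%k. dm (app c k))) k = dm (app c k)" if "k el i" for k by (rule app_fn'[OF _ M(2) i(2) that]) (intro dfi)
 moreover have "elts n = p1 ` elts b" using dm_func[OF f(1) M(1) f(2)] elts_dm[OF M(1)] by simp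
 ultimately show "dm (supr b c i) = supr n (fn i (%k. dm (app c k))) i"
  using M i f(2) by (intro zfc_ext) (simp_all add: elts_dm image_UN image_Un)
qed

end

context levy_ground begin

lemma lcl_all_el: assumes "lcl X" "dfn (%e. P (e 0))" shows "lcl (sep X (%r. ALL z:elts r. P z))"
proof -
 have e: "elts (sep X (%r. ALL z:elts r. P z)) = {r : elts X. ALL z:elts r. P z}"
  by (rule elts_sep) (intro dfi dfn1[OF assms(2)] lcl_M[OF assms(1)])+
 show ?thesis unfolding lcl_def e
 proof (intro conjI ballI impI set_M)
  fix b c i assume b: "b : {r : elts X. ALL z:elts r. P z}" and c: "c : M" and i: "i el lam"
   and a: "ALL k:elts i. app c k : {r : elts X. ALL z:elts r. P z} & supr b c k sub app c k"
  have "supr b c i el X" by (rule lclD[OF assms(1) _ c i]) (use a b in auto)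
  moreover have "elts (supr b c i) = elts b Un (UN k:elts i. elts (app c k))" using b c i by (intro elts_supr) auto
  ultimately show "supr b c i : {r : elts X. ALL z:elts r. P z}" using a b by auto
 qed
qed

end

section \<open>The tree of partial decisions coded by a column\<close>

locale tree = levy_ground +
 fixes al be gc tx b0 dW
 assumes al: "al el mu" "be el mu" "gc el mu" "al sub be" "be sub gc"
  and tx: "tx : M" "bd tx b0 be" "!!q i v. q el PC ==> b0 sub q ==> i el lam ==> v : M ==> dec q tx (opr i v) ==> v el lam"
  and dW: "dW : M" "!!W. W : M ==> W sub times (sep (cs be) (%r. ALL z:elts r. ~ co z el al))
   (times lam (sep (cs be) (%r. ALL z:elts r. ~ co z el al))) ==> EX z:elts gc. app dW z = W"
begin

text \<open>The conditions of the quotient. The second assumption on \<open>dW\<close> says that the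
  entries possible in column \<open>gc\<close> code every set of triples of a state, a value and a
  new state.\<close>

definition R where "R = sep (cs be) (%r. ALL z:elts r. ~ co z el al)"
definition rs :: "'a => 'a" where "rs r = sep r (%z. ~ co z el al)"
definition a0 where "a0 = rst b0 al"
definition r1 where "r1 = rs b0"

lemma al_M [simp]: "al : M" "be : M" "gc : M" "b0 : M" "R : M" "a0 : M" "r1 : M" "rs r : M" "tx : M" "dW : M"
 using al tx dW by (auto simp: bd_def R_def a0_def r1_def rs_def)

lemma dft_rs [dfi]: "dft A ==> dft (%e. rs (A e))" by (rule dft1[of rs]) (unfold rs_def, intro dfi al_M)
lemma elts_rs [simp]: "r : M ==> elts (rs r) = {z : elts r. ~ co z el al}" unfolding rs_def by (rule elts_sep) (intro dfi al_M)
lemma el_R: "r el R <-> r el cs be & (ALL z:elts r. ~ co z el al)"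
 unfolding R_def by (subst elts_sep, intro dfi al_M) simp_all
lemma R_PC: "r el R ==> r el PC" by (auto simp: el_R el_cs)
lemma lcl_R: "lcl R" unfolding R_def by (intro lcl_all_el lcl_cs al_M dfi)

lemma b0: "b0 el cs be" "good lam tx b0" using tx by (auto simp: bd_def)

lemma split_be: "r el cs be ==> rst r al el cs al & rs r el R & un (rst r al) (rs r) = r"
proof -
 assume r: "r el cs be"
 have "un (rst r al) (rs r) = r" using r by (intro zfc_ext) auto
 moreover have "rs r el cs be" by (rule cs_sub[OF _ r]) (use r in auto)
 ultimately show ?thesis using r rst_cs[OF cs_PC[OF _ r]] by (auto simp: el_R)
qed

lemma b0_split: "a0 el cs al" "r1 el R" "un a0 r1 = b0" using split_be[OF b0(1)] by (auto simp: a0_def r1_def)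

lemma un_aR: assumes "a el cs al" "u el R"
 shows "un a u el cs be" "rst (un a u) al = a" "rs (un a u) = u" "un a u el PC"
proof -
 have M: "a : M" "u : M" using assms by auto
 show p: "un a u el PC" by (rule PC_un) (use assms el_cs R_PC in \<open>auto simp: el_R co_def\<close>)
 show "un a u el cs be" using assms p M al(4) by (auto simp: el_R el_cs)
 show "rst (un a u) al = a" "rs (un a u) = u" using assms M by (intro zfc_ext; auto simp: el_R el_cs)+
qed

lemma un_mono: "a : M ==> b : M ==> c : M ==> d : M ==> a sub c ==> b sub d ==> un a b sub un c d" by auto

text \<open>The entry \<open>z\<close> of the column \<open>gc\<close> in row \<open>i\<close> codes a set of triples: being in state \<open>s\<close>, give \<open>v\<close> as the value
 at \<open>i\<close> and go to the state \<open>u\<close>. It is used if these data are coherent (\<open>ok\<close>); if it can never become so (\<open>nok\<close>),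
 it is replaced by the least code that can (\<open>sel\<close>). Thus \<open>run p n y c\<close>: by \<open>p\<close>, the node \<open>y\<close> of length \<open>n\<close> is
 on the tree, with states \<open>c\<close>.\<close>

abbreviation T3 where "T3 s v u == opr s (opr v u)"

definition ok :: "'a => 'a => 'a => 'a => bool" where
 "ok a i s z = ((EX v:elts lam. EX u:elts R. T3 s v u el app dW z) & (ALL v:elts lam. ALL u:elts R. T3 s v u el app dW z -->
   s sub u & dec (un a u) tx (opr i v) & (ALL u':elts R. T3 s v u' el app dW z --> u' = u)))"
definition nok :: "'a => 'a => 'a => 'a => bool" where "nok a i s z = (ALL a':elts (cs al). a sub a' --> ~ ok a' i s z)"
definition sel :: "'a => 'a => 'a => 'a => 'a => bool" where
 "sel a i s z z' = (z' el gc & ok a i s z' & (z' = z | nok a i s z & (ALL w:elts z'. nok a i s w)))"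
definition out :: "'a => 'a => 'a => 'a => 'a => bool" where
 "out p i s v u = (EX z:elts gc. EX z':elts gc. opr (opr gc i) z el p & sel (rst p al) i s z z' & v el lam & u el R & T3 s v u el app dW z')"
definition run :: "'a => 'a => 'a => 'a => bool" where
 "run p n y c = (n el lam & func y n & func c n & (ALL i:elts n. out p i (supr r1 c i) (app y i) (app c i)))"

lemma dfn_ok [dfi]: "dft A ==> dft B ==> dft C ==> dft D ==> dfn (%e. ok (A e) (B e) (C e) (D e))"
 by (rule dfn4[of ok]) (unfold ok_def, intro dfi al_M lam_M)
lemma dfn_nok [dfi]: "dft A ==> dft B ==> dft C ==> dft D ==> dfn (%e. nok (A e) (B e) (C e) (D e))"
 by (rule dfn4[of nok]) (unfold nok_def, intro dfi al_M lam_M)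
lemma dfn_sel [dfi]: "dft A ==> dft B ==> dft C ==> dft D ==> dft F ==> dfn (%e. sel (A e) (B e) (C e) (D e) (F e))"
 by (rule dfn5[of sel]) (unfold sel_def, intro dfi al_M lam_M)
lemma dfn_out [dfi]: "dft A ==> dft B ==> dft C ==> dft D ==> dft F ==> dfn (%e. out (A e) (B e) (C e) (D e) (F e))"
 by (rule dfn5[of out]) (unfold out_def, intro dfi al_M lam_M)
lemma dfn_run [dfi]: "dft A ==> dft B ==> dft C ==> dft D ==> dfn (%e. run (A e) (B e) (C e) (D e))"
 by (rule dfn4[of run]) (unfold run_def, intro dfi al_M lam_M)

lemma ok_mono: "ok a i s z ==> a sub a' ==> a : M ==> a' : M ==> ok a' i s z"
proof -
 assume a: "ok a i s z" "a sub a'" "a : M" "a' : M"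
 have "dec (un a' u) tx (opr i v)" if "u el R" "dec (un a u) tx (opr i v)" for u v
  by (rule dec_mono[OF that(2)]) (use a that in auto)
 then show ?thesis using a(1) unfolding ok_def by blast
qed

lemma nok_mono: "nok a i s z ==> a sub a' ==> nok a' i s z" unfolding nok_def by (meson subset_trans)

lemma sel_mono: "sel a i s z z' ==> a sub a' ==> a : M ==> a' : M ==> sel a' i s z z'"
 unfolding sel_def using ok_mono nok_mono by blast

lemma ok_nok: "ok a i s z ==> nok a i s z ==> a el cs al ==> False" unfolding nok_def by blast

lemma gc_ord: "z el gc ==> ordinal z" using al ordl ord_el by blast

text \<open>A code in use is never hopeless, and the replacement of a hopeless one is the least that
  is not. Uniqueness is what makes nodes determine their states in
  \<open>run_unique\<close>.\<close>

lemma sel_unique: assumes "sel a i s z w" "sel a i s z w'" "a el cs al" shows "w = w'"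
 using assms ok_nok[of a i s] ord_tri[of w w'] gc_ord el_M unfolding sel_def by metis

text \<open>Some code can always become coherent: extend to a condition \<open>r\<close> that
  decides the value at \<open>i\<close>, and take the code of the single triple read off
  \<open>r\<close>. The least code that is not hopeless is then made coherent by a suitable
  \<open>a'\<close>, and the smaller ones stay hopeless.\<close>

lemma sel_ex: assumes a: "a el cs al" "a0 sub a" and s: "s el R" "r1 sub s" and i: "i el lam" and z: "z el gc"
 shows "EX a':elts (cs al). a sub a' & (EX z'. sel a' i s z z')"
proof (cases "nok a i s z")
 case False
 then obtain a' where "a' el cs al" "a sub a'" "ok a' i s z" unfolding nok_def by blast
 then show ?thesis using z unfolding sel_def by blast
next
 case True
 let ?Q = "%z. z el gc & ~ nok a i s z"
 have q: "un a s el cs be" "b0 sub un a s"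
  using un_aR[OF a(1) s(1)] un_mono[of a0 r1 a s] a s b0_split by auto
 obtain r v where r: "r el cs be" "un a s sub r" "v : M" "dec r tx (opr i v)" using bdD[OF tx(2) q i] by blast
 define a1 where "a1 = rst r al"
 define u where "u = rs r"
 have au: "a1 el cs al" "u el R" "un a1 u = r" using split_be[OF r(1)] by (auto simp: a1_def u_def)
 have "a : M" "s : M" "r : M" using a(1) s(1) r(1) by auto
 then have sub: "a sub a1" "s sub u" using r(2) a(1) s(1) by (auto simp: a1_def u_def el_R el_cs)
 have vl: "v el lam" by (rule tx(3)[OF cs_PC[OF al_M(2) r(1)] _ i r(3,4)]) (use q r in blast)
 have "sing (T3 s v u) sub times R (times lam R)" using s au vl by auto
 then obtain z1 where z1: "z1 el gc" "app dW z1 = sing (T3 s v u)" using dW(2)[of "sing (T3 s v u)"] unfolding R_def by auto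
 have "T3 s v' u' el app dW z1 <-> v' = v & u' = u" if "v' el lam" "u' el R" for v' u'
  using z1 that r au s by (auto dest: el_M)
 then have "ok a1 i s z1" unfolding ok_def using au vl r sub by blast
 then have Q1: "?Q z1" using z1 au sub unfolding nok_def by blast
 have dQ: "dfn (%e. ?Q (e 0))" by (intro dfi al_M) (use a s i in auto)
 note L = least[OF dQ gc_ord[OF z1(1)] el_M[OF z1(1)] Q1]
 define z' where "z' = least ?Q"
 have z': "z' el gc" "~ nok a i s z'" "!!w. w el z' ==> nok a i s w"
  using L(2,4) ord_tr[OF ord_el[OF ordl(2) al(3)]] unfolding z'_def by blast+
 obtain a' where a': "a' el cs al" "a sub a'" "ok a' i s z'" using z'(2) unfolding nok_def by blast
 have "sel a' i s z z'" unfolding sel_def using z' a' nok_mono[OF _ a'(2)] True by blast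
 then show ?thesis using a' by blast
qed

lemma out_mono: assumes "out p i s v u" "p sub q" "p el PC" "q el PC" shows "out q i s v u"
proof -
 have "sel (rst q al) i s z z'" if "sel (rst p al) i s z z'" for z z'
  by (rule sel_mono[OF that]) (use assms in auto)
 then show ?thesis using assms unfolding out_def by blast
qed

lemma out_facts: assumes "out p i s v u" shows "v el lam" "u el R" "s sub u" "dec (un (rst p al) u) tx (opr i v)"
 using assms unfolding out_def sel_def ok_def by blast+

lemma out_unique: assumes "out p i s v u" "out p i s v u'" "p el PC" "i : M" shows "u = u'"
proof -
 obtain z w where z: "z el gc" "opr (opr gc i) z el p" "sel (rst p al) i s z w" "T3 s v u el app dW w" "u el R" "v el lam"
  using assms(1) unfolding out_def by blast
 obtain z2 w2 where z2: "z2 el gc" "opr (opr gc i) z2 el p" "sel (rst p al) i s z2 w2" "T3 s v u' el app dW w2" "u' el R"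
  using assms(2) unfolding out_def by blast
 have "p1 (opr (opr gc i) z) = p1 (opr (opr gc i) z2)" using z(1) z2(1) by (simp add: el_M[OF z(1)] el_M[OF z2(1)])
 then have "opr (opr gc i) z = opr (opr gc i) z2" by (rule PC_inj[OF assms(3) z(2) z2(2)])
 then have "z = z2" using z(1) z2(1) by (simp add: el_M[OF z(1)] el_M[OF z2(1)])
 then have "w = w2" using sel_unique[OF z(3) _ rst_cs[OF assms(3) al_M(1)]] z2(3) by blast
 then have "T3 s v u' el app dW w" "ok (rst p al) i s w" using z2(4) z(3) unfolding sel_def by simp_all
 then show ?thesis using z(4-6) z2(5) unfolding ok_def by metis
qed

lemma run_mono: "run p n y c ==> p sub q ==> p el PC ==> q el PC ==> run q n y c" unfolding run_def using out_mono by blast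

lemma run_inc: assumes "run p n y c" "c : M" "i el n" shows "supr r1 c i sub app c i" "app c i el R" "out p i (supr r1 c i) (app y i) (app c i)"
proof -
 show o: "out p i (supr r1 c i) (app y i) (app c i)" using assms unfolding run_def by blast
 show "supr r1 c i sub app c i" "app c i el R" using out_facts[OF o] by blast+
qed

lemma run_state: assumes r: "run p n y c" "c : M" and i: "i el suc n" shows "supr r1 c i el R" "r1 sub supr r1 c i" "supr r1 c i sub supr r1 c n"
proof -
 have n: "n el lam" "n : M" "ordinal n" using r ordl ord_el by (auto simp: run_def)
 have "i = n | i el n" using i n(2) by simp
 then have il: "i el lam" and k: "!!k. k el i ==> k el n" using n lam_tr[OF n(1)] ord_tr[OF n(3)] by blast+
 show "supr r1 c i el R" by (rule lclD[OF lcl_R b0_split(2) r(2) il]) (use run_inc[OF r] k in blast)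
 show "r1 sub supr r1 c i" "supr r1 c i sub supr r1 c n" using il r n k by auto
qed

lemma run_dec: assumes r: "run p n y c" "c : M" "p el PC" and i: "i el n"
 shows "dec (un (rst p al) (supr r1 c n)) tx (opr i (app y i))"
proof (rule dec_mono[OF out_facts(4)[OF run_inc(3)[OF r(1,2) i]]])
 have "n : M" using r by (auto simp: run_def)
 then show "un (rst p al) (app c i) sub un (rst p al) (supr r1 c n)" using r i by auto
qed

text \<open>At a first disagreement the earlier states agree; equal states and equal values then
  select the same triple, by the uniqueness clause of \<open>ok\<close>.\<close>

lemma run_unique: assumes r: "run p n y c" "run p n' y' c'" and M: "p el PC" "c : M" "c' : M" "y : M" "y' : M"
 and m: "m : M" "m sub n" "m sub n'" "transitive m" "!!i. i el m ==> app y i = app y' i" and i: "i el m"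
 shows "app c i = app c' i"
proof (rule ccontr)
 assume "app c i ~= app c' i"
 moreover have "dfn (%e. app c (e 0) ~= app c' (e 0))" by (intro dfi M)
 ultimately obtain k where k: "k el m" "app c k ~= app c' k" "!!l. l el k ==> l el m ==> ~ app c l ~= app c' l"
  using minimal_in[OF _ m(1) i, of "%i. app c i ~= app c' i"] by blast
 have "supr r1 c k = supr r1 c' k" by (rule supr_cong) (use k m trD in blast)
 then show False using out_unique run_inc(3)[OF r(1) M(2)] run_inc(3)[OF r(2) M(3)] k M m by (metis el_M subsetD)
qed

lemma run_snoc: assumes r: "run p n y c" "y : M" "c : M" and o: "out p n (supr r1 c n) v u"
 shows "run p (suc n) (snoc y n v) (snoc c n u)"
proof -
 have n: "n el lam" "func y n" "func c n" "n : M" using r by (auto simp: run_def)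
 have vu: "v : M" "u : M" using out_facts[OF o] by auto
 note sy = func_snoc[OF n(2) r(2) n(4) vu(1)] and sc = func_snoc[OF n(3) r(3) n(4) vu(2)]
 have s: "supr r1 (snoc c n u) i = supr r1 c i" if "i el suc n" for i
  by (rule supr_cong) (use sc(3) that n ord_tr[OF ord_el[OF ordl(1) n(1)]] in auto)
 have "out p i (supr r1 (snoc c n u) i) (app (snoc y n v) i) (app (snoc c n u) i)" if i: "i el suc n" for i
  using i n o sy sc s[OF i] run_inc(3)[OF r(1,3)] by (cases "i = n") auto
 then show ?thesis unfolding run_def using sy(1) sc(1) reg_suc[OF lam n(1)] by blast
qed

lemma run_rsq: assumes r: "run p n y c" "y : M" "c : M" and m: "m el suc n" shows "run p m (rsq y m) (rsq c m)"
proof -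
 have n: "n el lam" "func y n" "func c n" "n : M" "ordinal n" using r ordl ord_el by (auto simp: run_def)
 have "m = n | m el n" using m n(4) by simp
 then have mM: "m : M" "m sub n" "m el lam" using n lam_tr[OF n(1)] ord_tr[OF n(5)] by blast+
 note fy = func_rsq[OF n(2) r(2) n(4) mM(1,2)] and fc = func_rsq[OF n(3) r(3) n(4) mM(1,2)]
 have "supr r1 (rsq c m) i = supr r1 c i" if "i el m" for i
  by (rule supr_cong) (use fc(2) that m n ord_tr[of m] ord_el in \<open>metis elts_suc insertE\<close>)
 then show ?thesis unfolding run_def using fy fc mM run_inc(3)[OF r(1,3)] by auto
qed

lemma run_zero: "run p zero zero zero"
 unfolding run_def using reg_zero[OF lam] by (auto intro: funcI)

end

context zfc begin

lemma supr_sub_iff: "b : M ==> c : M ==> k : M ==> supr b c k sub x <-> b sub x & (ALL l:elts k. app c l sub x)" by auto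

lemma elts_pr: assumes "t : M" shows "elts (pr0 t) = p2 ` {w : elts t. p1 w = zero}" "elts (pr1 t) = p2 ` {w : elts t. p1 w = suc zero}"
 unfolding pr0_def pr1_def by (subst elts_rep, intro dfi, simp, subst elts_sep, intro dfi, simp_all add: assms)+

lemma pr_supr: assumes "b : M" "c : M" "i : M"
 shows "elts (pr0 (supr b c i)) = elts (pr0 b) Un (UN k:elts i. elts (pr0 (app c k)))"
  "elts (pr1 (supr b c i)) = elts (pr1 b) Un (UN k:elts i. elts (pr1 (app c k)))"
 using assms by (simp_all add: elts_pr) blast+

lemma pr_mono: "a : M ==> b : M ==> a sub b ==> pr0 a sub pr0 b & pr1 a sub pr1 b" by (auto simp: elts_pr)

lemma dm_mono: "a : M ==> b : M ==> a sub b ==> dm a sub dm b" by (auto simp: elts_dm)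

lemma ty_mono: "a : M ==> b : M ==> a sub b ==> dm (pr0 (pr1 a)) sub dm (pr0 (pr1 b))"
 using pr_mono dm_mono tg_M by metis

end

context levy_ground begin

lemma lcl_sepI: assumes "lcl X" "dfn (%e. Q (e 0))"
 and "!!b c i. b el X ==> Q b ==> c : M ==> i el lam ==>
  (!!k. k el i ==> app c k el X & Q (app c k) & b sub app c k & (ALL l:elts k. app c l sub app c k)) ==> Q (supr b c i)"
 shows "lcl (sep X Q)"
proof -
 have e: "elts (sep X Q) = {r : elts X. Q r}" by (rule elts_sep) (intro assms lcl_M)+
 show ?thesis unfolding lcl_def e
 proof (intro conjI ballI impI set_M)
  fix b c i assume b: "b : {r : elts X. Q r}" and c: "c : M" and i: "i el lam"
   and a: "ALL k:elts i. app c k : {r : elts X. Q r} & supr b c k sub app c k"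
  have "supr b c i el X" by (rule lclD[OF assms(1) _ c i]) (use a b in auto)
  moreover have "app c k el X & Q (app c k) & b sub app c k & (ALL l:elts k. app c l sub app c k)" if "k el i" for k
  proof -
   have "supr b c k sub app c k" using a that by blast
   then have "b sub app c k & (ALL l:elts k. app c l sub app c k)" using supr_sub_iff b c el_M[OF that] by blast
   then show ?thesis using a that by blast
  qed
  then have "Q (supr b c i)" using assms(3)[of b c i] b c i by blast
  ultimately show "supr b c i : {r : elts X. Q r}" by blast
 qed
qed

end

context tree begin

abbreviation tri where "tri p y c == tg p (tg y c)"
abbreviation ty where "ty t == pr0 (pr1 t)"
abbreviation tc where "tc t == pr1 (pr1 t)"
text \<open>Carrying the states in the triple makes the order closed: for a union of a chain, the
  union of the state sequences is the witness that the limit node is on the tree.\<close>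

definition RS where "RS = sep (rep (times PC (times (pow (times lam lam)) (pow (times lam R)))) (%w. tri (p1 w) (p1 (p2 w)) (p2 (p2 w))))
 (%t. run (pr0 t) (dm (ty t)) (ty t) (tc t))"

lemma RS_M [simp]: "RS : M" by (simp add: RS_def)

lemma run_dm: "run p n y c ==> y : M ==> dm y = n" unfolding run_def using dm_func by (metis el_M)

lemma elts_RS: "elts RS = {tri p y c |p y c. y : M & c : M & p el PC & run p (dm y) y c}"
proof -
 let ?A = "times PC (times (pow (times lam lam)) (pow (times lam R)))"
 have 1: "elts (rep ?A (%w. tri (p1 w) (p1 (p2 w)) (p2 (p2 w)))) = (%w. tri (p1 w) (p1 (p2 w)) (p2 (p2 w))) ` elts ?A"
  by (rule elts_rep) (intro dfi fn_M)+
 have 2: "elts RS = {t : elts (rep ?A (%w. tri (p1 w) (p1 (p2 w)) (p2 (p2 w)))). run (pr0 t) (dm (ty t)) (ty t) (tc t)}"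
  unfolding RS_def by (rule elts_sep, intro dfi) simp
 show ?thesis unfolding 2 1
 proof (intro equalityI subsetI)
  fix t assume "t : {tri p y c |p y c. y : M & c : M & p el PC & run p (dm y) y c}"
  then obtain p y c where t: "t = tri p y c" "y : M" "c : M" "p el PC" "run p (dm y) y c" by blast
  have n: "dm y el lam" "func y (dm y)" "func c (dm y)" using t by (auto simp: run_def)
  have "app y i el lam & app c i el R & i el lam" if "i el dm y" for i
   using out_facts[OF run_inc(3)[OF t(5,3) that]] lam_tr[OF n(1) that] by blast
  then have "y sub times lam lam" "c sub times lam R" unfolding func_elts[OF n(2) t(2) dm_M] func_elts[OF n(3) t(3) dm_M] by auto
  then have "opr p (opr y c) el ?A" using t by auto
  then show "t : {t : (%w. tri (p1 w) (p1 (p2 w)) (p2 (p2 w))) ` elts ?A. run (pr0 t) (dm (ty t)) (ty t) (tc t)}"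
   using t by (auto intro!: image_eqI[of _ _ "opr p (opr y c)"])
 qed (auto simp: elts_times, blast)
qed

lemma RS_tri: "y : M ==> c : M ==> p : M ==> tri p y c el RS <-> p el PC & run p (dm y) y c"
 unfolding elts_RS by (auto simp: tg_inj dest: el_M)

lemma RS_E: assumes "t el RS" obtains p y c where "t = tri p y c" "y : M" "c : M" "p el PC" "run p (dm y) y c"
 using assms unfolding elts_RS by blast

text \<open>The clause of \<open>run\<close> at \<open>m\<close> involves the node and the states
  only up to \<open>m\<close>, so it is inherited from a smaller run that reaches beyond
  \<open>m\<close>.\<close>

lemma run_glue: assumes p: "p el PC" and n: "n el lam" "func y n" "func c n" and M: "y : M" "c : M"
 and m: "!!m. m el n ==> EX q:elts PC. EX y':M. EX c':M. q sub p & run q (dm y') y' c' & y' sub y & c' sub c & m el dm y'"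
 shows "run p n y c"
 unfolding run_def
proof (intro conjI ballI n)
 fix m assume "m el n"
 then obtain q y' c' where q: "q el PC" "y' : M" "c' : M" "q sub p" "run q (dm y') y' c'" "y' sub y" "c' sub c" "m el dm y'" using assms(7) by blast
 have f: "func y' (dm y')" "func c' (dm y')" "dm y' el lam" using q(5) by (auto simp: run_def)
 have e: "app y' k = app y k & app c' k = app c k" if "k el dm y'" for k
  using func_sub(2)[OF f(1) n(2) q(6) q(2) M(1)] func_sub(2)[OF f(2) n(3) q(7) q(3) M(2)] that n by auto
 have "supr r1 c' m = supr r1 c m" by (rule supr_cong) (use e ord_tr[OF ord_el[OF ordl(1) f(3)] q(8)] in blast)
 then show "out p m (supr r1 c m) (app y m) (app c m)"
  using out_mono[OF run_inc(3)[OF q(5,3,8)] q(4,1) p] e[OF q(8)] by simp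
qed

text \<open>The tags split the chain into chains of conditions, nodes and states. The unions of
  nodes and of states have the same domain, which is below \<open>lam\<close> by regularity, and
  \<open>run_glue\<close> applies.\<close>

lemma lcl_RS: "lcl RS"
 unfolding lcl_def
proof (intro conjI ballI impI RS_M)
 fix b C i assume b: "b el RS" and C: "C : M" and i: "i el lam" and a: "ALL k:elts i. app C k el RS & supr b C k sub app C k"
 have iM: "i : M" "ordinal i" using i ordl ord_el by auto
 define D where "D = fn i (%k. pr1 (app C k))"
 define D1 where "D1 = fn i (%k. pr0 (app C k))"
 define D2 where "D2 = fn i (%k. pr0 (app D k))"
 define D3 where "D3 = fn i (%k. pr1 (app D k))"
 have DM: "D : M" "D1 : M" "D2 : M" "D3 : M" by (simp_all add: D_def D1_def D2_def D3_def)
 have aD: "app D k = pr1 (app C k)" "app D1 k = pr0 (app C k)" if "k el i" for k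
  unfolding D_def D1_def by (rule app_fn'[OF _ C iM(1) that], intro dfi)+
 have aD2: "app D2 k = ty (app C k)" "app D3 k = tc (app C k)" if "k el i" for k
  unfolding aD(1)[OF that, symmetric] D2_def D3_def by (rule app_fn'[OF _ DM(1) iM(1) that], intro dfi)+
 obtain pb yb cb where bb: "b = tri pb yb cb" "yb : M" "cb : M" "pb el PC" "run pb (dm yb) yb cb" by (rule RS_E[OF b])
 have ck: "app C k = tri (app D1 k) (app D2 k) (app D3 k) & app D1 k el PC & run (app D1 k) (dm (app D2 k)) (app D2 k) (app D3 k)" if k: "k el i" for k
 proof -
  obtain p y c where "app C k = tri p y c" "y : M" "c : M" "p el PC" "run p (dm y) y c" using RS_E a k by blast
  moreover have "p : M" using calculation by auto
  ultimately show ?thesis using aD[OF k] aD2[OF k] by simp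
 qed
 have pk: "pr1 (app C k) = tg (app D2 k) (app D3 k)" if "k el i" for k using ck[OF that] by (metis p12_M(3) pr_tg(2) tg_M(1))
 have eq: "supr b C i = tri (supr pb D1 i) (supr yb D2 i) (supr cb D3 i)"
 proof -
  have pM: "pb : M" using bb by auto
  have "supr (tg yb cb) D i = tg (supr yb D2 i) (supr cb D3 i)" unfolding D2_def D3_def
   by (rule supr_tg[OF bb(2,3) DM(1) iM(1)]) (use pk aD in simp)
  moreover have "supr b C i = tg (supr pb D1 i) (supr (tg yb cb) D i)" unfolding D1_def D_def bb(1)
   by (rule supr_tg[OF pM tg_M(1) C iM(1)]) (use ck pk aD in simp)
  ultimately show ?thesis by simp
 qed
 have s: "supr pb D1 k sub app D1 k" "supr yb D2 k sub app D2 k" "supr cb D3 k sub app D3 k" if k: "k el i" for k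
 proof -
  have kl: "app C l sub app C k" "l el i" if "l el k" for l using a k that b C supr_sub_iff[of b C k "app C k"] ord_tr[OF iM(2)] by auto
  have "b sub app C k" using a k b C supr_sub_iff[of b C k "app C k"] by auto
  then have "pb sub app D1 k & yb sub app D2 k & cb sub app D3 k" using ck[OF k] bb by auto
  moreover have "app D1 l sub app D1 k & app D2 l sub app D2 k & app D3 l sub app D3 k" if "l el k" for l
   using kl[OF that] ck[OF k] ck[OF kl(2)[OF that]] by auto
  ultimately show "supr pb D1 k sub app D1 k" "supr yb D2 k sub app D2 k" "supr cb D3 k sub app D3 k"
   using k bb DM by (auto simp: supr_sub_iff dest: el_M)
 qed
 have P: "supr pb D1 i el PC" by (rule lclD[OF lcl_PC bb(4) DM(2) i]) (use ck s in blast)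
 have f: "func yb (dm yb)" "func cb (dm yb)" "dm yb el lam" using bb(5) by (auto simp: run_def)
 have fk: "func (app D2 k) (dm (app D2 k))" "func (app D3 k) (dm (app D2 k))" "dm (app D2 k) el lam" if "k el i" for k
  using ck[OF that] by (auto simp: run_def)
 have dk: "dm (app D3 k) = dm (app D2 k)" if "k el i" for k by (rule dm_func[OF fk(2)[OF that]]) simp_all
 have Y: "func (supr yb D2 i) (dm (supr yb D2 i))" "dm (supr yb D2 i) = supr (dm yb) (fn i (%k. dm (app D2 k))) i"
  by (rule func_supr[OF iM(2,1) bb(2) DM(3) _ f(1) dm_M]; use s(2) fk(1) in blast)+
 have fk3: "func (app D3 k) (dm (app D3 k))" if "k el i" for k using fk(2)[OF that] dk[OF that] by simp
 have C3: "func (supr cb D3 i) (dm (supr cb D3 i))" "dm (supr cb D3 i) = supr (dm yb) (fn i (%k. dm (app D3 k))) i"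
  by (rule func_supr[OF iM(2,1) bb(3) DM(4) _ f(2) dm_M]; use s(3) fk3 in blast)+
 have d: "dm (supr cb D3 i) = dm (supr yb D2 i)" unfolding Y(2) C3(2)
  by (rule arg_cong[where f="%x. supr (dm yb) x i"], rule fn_cong) (rule dk)
 have n: "dm (supr yb D2 i) el lam" unfolding Y(2)
 proof (rule supr_reg[OF lam bs_el[OF lam i] f(3) fn_M(1)])
  fix l assume l: "l el i"
  have "app (fn i (%k. dm (app D2 k))) l = dm (app D2 l)" by (rule app_fn'[OF _ DM(3) iM(1) l]) (intro dfi)
  then show "app (fn i (%k. dm (app D2 k))) l el lam" using fk(3)[OF l] by simp
 qed
 have "run (supr pb D1 i) (dm (supr yb D2 i)) (supr yb D2 i) (supr cb D3 i)"
 proof (rule run_glue[OF P n Y(1)])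
  show "func (supr cb D3 i) (dm (supr yb D2 i))" using C3(1) d by simp
  fix m assume "m el dm (supr yb D2 i)"
  then have "m el dm yb | (EX k:elts i. m el dm (app D2 k))" using bb DM iM by (auto simp: elts_dm image_UN image_Un)
  then show "EX q:elts PC. EX y':M. EX c':M. q sub supr pb D1 i & run q (dm y') y' c' & y' sub supr yb D2 i & c' sub supr cb D3 i & m el dm y'"
  proof
   assume "m el dm yb"
   then show ?thesis using bb DM iM by (intro bexI[of _ pb] bexI[of _ yb] bexI[of _ cb]) (auto dest: el_M)
  next
   assume "EX k:elts i. m el dm (app D2 k)"
   then obtain k where k: "k el i" "m el dm (app D2 k)" by blast
   have M: "pb : M" using bb by auto
   show ?thesis using ck[OF k(1)] k bb(2,3) DM iM M by (intro bexI[of _ "app D1 k"] bexI[of _ "app D2 k"] bexI[of _ "app D3 k"]) auto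
  qed
 qed simp_all
 then show "supr b C i el RS" unfolding eq using P by (simp add: RS_tri)
qed

text \<open>Iterated extension by one value inside a closed set \<open>X\<close> of triples. The
  choice of \<open>X\<close> expresses the invariant to be kept on the way.\<close>

lemma run_chain: assumes X: "lcl X" "X sub RS" and t: "tri p y c el X" "p : M" "y : M" "c : M" and th: "th el lam"
 and step: "!!q y' c'. tri q y' c' el X ==> y' : M ==> c' : M ==> q el PC ==> run q (dm y') y' c' ==> p sub q ==> y sub y' ==> c sub c' ==>
  dm y' el th ==> EX q' v u. v : M & u : M & q sub q' & tri q' (snoc y' (dm y') v) (snoc c' (dm y') u) el X & q' : M"
 obtains q y' c' where "tri q y' c' el X" "y' : M" "c' : M" "q el PC" "run q (dm y') y' c'" "p sub q" "y sub y'" "c sub c'" "th sub dm y'"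
proof -
 \<comment> \<open>Step \<open>i\<close> has to leave a node longer than \<open>i\<close>. It acts
   only when the length is exactly \<open>i\<close>; otherwise the triple is kept.\<close>
 let ?St = "%i t t'. i sub dm (ty t) --> i el dm (ty t')"
 have dS: "dfn (%e. ?St (e 0) (e 1) (e 2))" by (intro dfi)
 obtain C where C: "C : M" "func C th" "!!i. i el suc th ==> supr (tri p y c) C i el X"
  "!!i. i el th ==> app C i el X & supr (tri p y c) C i sub app C i & ?St i (supr (tri p y c) C i) (app C i)"
 proof (rule lcl_chain[OF X(1) th t(1) dS])
  fix i s assume i: "i el th" and s: "s el X" "tri p y c sub s"
  show "EX s':elts X. s sub s' & (i sub dm (ty s) --> i el dm (ty s'))"
  proof (cases "i sub dm (ty s) & ~ i el dm (ty s)")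
   case True
   obtain q y' c' where q: "s = tri q y' c'" "y' : M" "c' : M" "q el PC" "run q (dm y') y' c'" using RS_E s X by blast
   have qM: "q : M" using q by auto
   have dl: "dm y' el lam" using q by (simp add: run_def)
   have "ordinal i" "ordinal (dm y')" using i th dl ordl ord_el by blast+
   then have e: "dm y' = i" using True ord_sub[of i "dm y'"] i q qM by auto
   have le: "p sub q & y sub y' & c sub c'" using s(2) q t qM by simp
   obtain q' v u where q': "v : M" "u : M" "q sub q'" "tri q' (snoc y' (dm y') v) (snoc c' (dm y') u) el X" "q' : M"
    using step[of q y' c'] s q le e i by blast
   have "y' sub snoc y' (dm y') v" "c' sub snoc c' (dm y') u" using q q' by (auto simp: snoc_def)
   then have "s sub tri q' (snoc y' (dm y') v) (snoc c' (dm y') u)" using q q' qM by simp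
   moreover have "i el dm (snoc y' (dm y') v)"
    using e q' q i by (auto simp: elts_dm snoc_def intro!: image_eqI[of _ _ "opr i v"])
   ultimately show ?thesis using q' by (intro bexI[OF _ q'(4)]) simp
  qed (use s in blast)
 qed blast
 have thM: "th : M" "ordinal th" using th ordl ord_el by auto
 define t' where "t' = supr (tri p y c) C th"
 have t': "t' el X" unfolding t'_def by (rule C(3)) (simp add: thM)
 obtain q y' c' where q: "t' = tri q y' c'" "y' : M" "c' : M" "q el PC" "run q (dm y') y' c'" using RS_E t' X by blast
 have qM: "q : M" using q by auto
 have cs': "app C l sub supr (tri p y c) C k" if "l el k" "k : M" for l k using that C(1) by auto
 let ?Q = "%k. k el th --> k el dm (ty (app C k))"
 have Q: "?Q k" if "k : M" for k
 proof (rule mem_induct[of ?Q])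
  show "dfn (%e. ?Q (e 0))" by (intro dfi C thM)
  show "k : M" by (rule that)
  fix k assume k: "k : M" and IH: "!!l. l el k ==> ?Q l"
  show "?Q k"
  proof
   assume kt: "k el th"
   have "l el dm (ty (supr (tri p y c) C k))" if l: "l el k" for l
   proof -
    have "l el dm (ty (app C l))" using IH[OF l] l kt ord_tr thM by blast
    then show ?thesis using ty_mono[OF p12_M(3) supr_M cs'[OF l k]] by blast
   qed
   then show "k el dm (ty (app C k))" using C(4)[OF kt] by blast
  qed
 qed
 have "i el dm (ty t')" if i: "i el th" for i
 proof -
  have "i el dm (ty (app C i))" using Q[OF el_M[OF i]] i by blast
  then show ?thesis using ty_mono[OF p12_M(3) supr_M cs'[OF i thM(1)]] unfolding t'_def by blast
 qed
 moreover have "tri p y c sub t'" using C(1) thM by (auto simp: t'_def)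
 ultimately show thesis using that[of q y' c'] q t' t qM by auto
qed

end

context zfc begin

lemma ty_supr: assumes "b : M" "c : M" "i : M"
 shows "elts (pr0 (pr1 (supr b c i))) = elts (pr0 (pr1 b)) Un (UN k:elts i. elts (pr0 (pr1 (app c k))))"
  "elts (pr1 (pr1 (supr b c i))) = elts (pr1 (pr1 b)) Un (UN k:elts i. elts (pr1 (pr1 (app c k))))"
  "elts (dm (pr0 (pr1 (supr b c i)))) = elts (dm (pr0 (pr1 b))) Un (UN k:elts i. elts (dm (pr0 (pr1 (app c k)))))"
proof -
 have *: "elts (pr1 (supr b c i)) = elts (pr1 b) Un (UN k:elts i. elts (pr1 (app c k)))" by (rule pr_supr[OF assms])
 show 1: "elts (pr0 (pr1 (supr b c i))) = elts (pr0 (pr1 b)) Un (UN k:elts i. elts (pr0 (pr1 (app c k))))"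
  and "elts (pr1 (pr1 (supr b c i))) = elts (pr1 (pr1 b)) Un (UN k:elts i. elts (pr1 (pr1 (app c k))))"
  unfolding elts_pr[OF tg_M(3)] * by blast+
 show "elts (dm (pr0 (pr1 (supr b c i)))) = elts (dm (pr0 (pr1 b))) Un (UN k:elts i. elts (dm (pr0 (pr1 (app c k)))))"
  unfolding elts_dm[OF tg_M(2)] 1 by blast
qed

end

context tree begin

text \<open>For a node of length \<open>n\<close> this leaves row \<open>n\<close> of the
  instruction column unwritten, so that any code can be put there (\<open>put\<close>).\<close>

definition fre :: "'a => 'a => bool" where "fre p n = (ALL w:elts p. co w = gc --> p2 (p1 w) el n)"
lemma dfn_fre [dfi]: "dft A ==> dft B ==> dfn (%e. fre (A e) (B e))"
 by (rule dfn2[of fre]) (unfold fre_def, intro dfi al_M)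

lemma fre_supr: assumes M: "b : M" "C : M" "k : M" and P: "fre (pr0 b) (dm (ty b))" "!!l. l el k ==> fre (pr0 (app C l)) (dm (ty (app C l)))"
 shows "fre (pr0 (supr b C k)) (dm (ty (supr b C k)))"
 unfolding fre_def ty_supr[OF M] pr_supr[OF M]
proof (intro ballI impI)
 fix w assume w: "w : elts (pr0 b) Un (UN l:elts k. elts (pr0 (app C l)))" "co w = gc"
 from w(1) show "p2 (p1 w) : elts (dm (ty b)) Un (UN l:elts k. elts (dm (ty (app C l))))"
 proof
  assume "w el pr0 b" then show ?thesis using P(1) w(2) unfolding fre_def by blast
 next
  assume "w : (UN l:elts k. elts (pr0 (app C l)))"
  then obtain l where "l el k" "w el pr0 (app C l)" by blast
  then show ?thesis using P(2) w(2) unfolding fre_def by blast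
 qed
qed

lemma gc_al: "a el cs al ==> w el a ==> co w ~= gc" using al(4,5) no_cycle(1)[of gc] by (auto simp: el_cs)

lemma put: assumes p: "p el PC" "n el lam" "fre p n" and a: "a el cs al" "rst p al sub a" and z: "z el gc"
 defines "q == un (un p a) (sing (opr (opr gc n) z))"
 shows "q el PC" "rst q al = a" "p sub q" "opr (opr gc n) z el q" "w el q ==> co w = gc ==> w el p | p1 w = opr gc n" "fre q (suc n)"
proof -
 have M: "p : M" "n : M" "a : M" "z : M" using assms by auto
 have pa: "un p a el PC" "rst (un p a) al = a" by (rule amal[OF p(1) a(1) al_M(1) a(2)])+
 have n: "p1 w ~= opr gc n" if "w el un p a" for w
 proof
  assume e: "p1 w = opr gc n"
  then have "co w = gc" using M by (simp add: co_def)
  then have "w el p" using that M gc_al[OF a(1)] by auto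
  then show False using p(3) e \<open>co w = gc\<close> M no_cycle(1)[OF M(2)] unfolding fre_def by auto
 qed
 show "q el PC" unfolding q_def using n M by (intro PC_un[OF pa(1) single[OF al(3) p(2) z]]) auto
 have "~ gc el al" using al(4,5) no_cycle(1)[of gc] by auto
 then have "rst q al = rst (un p a) al" unfolding q_def using M by (intro zfc_ext) (auto simp: co_def)
 then show "rst q al = a" using pa(2) by simp
 show "p sub q" "opr (opr gc n) z el q" unfolding q_def using M by auto
 show w: "w el p | p1 w = opr gc n" if "w el q" "co w = gc" for w
 proof -
  have "w el p | w el a | w = opr (opr gc n) z" using that(1) M unfolding q_def by auto
  moreover have "p1 (opr (opr gc n) z) = opr gc n" using M by simp
  ultimately show ?thesis using gc_al[OF a(1)] that(2) by metis
 qed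
 show "fre q (suc n)" using w p(3) M unfolding fre_def by fastforce
qed

lemma put_out: assumes p: "p el PC" "n el lam" "fre p n" and a: "a el cs al" "rst p al sub a" and z: "z el gc" "ok a n s z"
 and T: "v el lam" "u el R" "T3 s v u el app dW z"
 shows "out (un (un p a) (sing (opr (opr gc n) z))) n s v u"
 using put(2,4)[OF p a z(1)] z T unfolding out_def sel_def by metis

lemma code: assumes "W : M" "W sub times R (times lam R)" obtains z where "z el gc" "app dW z = W"
 using dW(2)[OF assms(1)] assms(2) unfolding R_def by blast

text \<open>If row \<open>n\<close> of column \<open>gc\<close> is empty, it is filled arbitrarily.
  Whatever code stands there, \<open>sel_ex\<close> extends the part below \<open>al\<close> so that
  some instruction is in force.\<close>

lemma ext1: assumes p: "p el PC" "a0 sub p" and r: "run p n y c" "y : M" "c : M"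
 obtains q v u where "q el PC" "p sub q" "out q n (supr r1 c n) v u" "!!w. w el q ==> co w = gc ==> w el p | p1 w = opr gc n"
proof -
 have n: "n el lam" "n : M" "p : M" using r p by (auto simp: run_def)
 let ?s = "supr r1 c n"
 have s: "?s el R" "r1 sub ?s" using run_state[OF r(1,3), of n] n by auto
 have main: "EX q v u. q el PC & p' sub q & out q n ?s v u & (ALL w:elts q. co w = gc --> w el p')"
  if p': "p' el PC" "a0 sub p'" "opr (opr gc n) z el p'" "z el gc" for p' z
 proof -
  have a0r: "a0 sub rst p' al" using cs_rst[OF al_M(1) b0_split(1)] p' by auto
  obtain a' z' where a': "a' el cs al" "rst p' al sub a'" "sel a' n ?s z z'"
   using sel_ex[OF rst_cs[OF p'(1) al_M(1)] a0r s n(1) p'(4)] by blast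
  obtain v u where vu: "v el lam" "u el R" "T3 ?s v u el app dW z'" using a'(3) unfolding sel_def ok_def by blast
  have q: "un p' a' el PC" "rst (un p' a') al = a'" by (rule amal[OF p'(1) a'(1) al_M(1) a'(2)])+
  have M: "p' : M" "a' : M" using p' a' by auto
  have "out (un p' a') n ?s v u" unfolding out_def
   using q(2) a'(3) vu p'(3,4) M by (intro bexI[of _ z] bexI[of _ z']) (auto simp: sel_def)
  then show ?thesis using q M gc_al[OF a'(1)] by (intro exI[of _ "un p' a'"] exI[of _ v] exI[of _ u]) auto
 qed
 show thesis
 proof (cases "EX w:elts p. p1 w = opr gc n")
  case True
  then obtain w where w: "w el p" "p1 w = opr gc n" by blast
  obtain a i b where "w = opr (opr a i) b" "b el a" "p1 w = opr a i" "a : M" "i : M" by (rule PC_z[OF p(1) w(1)]) auto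
  then have "opr (opr gc n) (p2 w) el p" "p2 w el gc" using w n by auto
  from main[OF p this] that show thesis by blast
 next
  case False
  obtain z where z: "z el gc" by (rule code[of zero]) auto
  let ?p = "un p (sing (opr (opr gc n) z))"
  have "?p el PC" using False n z by (intro PC_un[OF p(1) single[OF al(3) n(1) z]]) auto
  moreover have "a0 sub ?p" "opr (opr gc n) z el ?p" "p sub ?p" using p n by auto
  ultimately obtain q v u where q: "q el PC" "?p sub q" "out q n ?s v u" "ALL w:elts q. co w = gc --> w el ?p"
   using main z by blast
  moreover have "w el p | p1 w = opr gc n" if "w el q" "co w = gc" for w
  proof -
   have "w el p | w = opr (opr gc n) z" using q(4) that n by auto
   moreover have "p1 (opr (opr gc n) z) = opr gc n" using n z by simp
   ultimately show ?thesis by metis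
  qed
  ultimately show thesis using that[of q v u] \<open>p sub ?p\<close> by blast
 qed
qed

text \<open>The run is prolonged past all rows that \<open>p\<close> uses in column
  \<open>gc\<close>. Since \<open>ext1\<close> adds at most the current row to this column, every
  row used is below the length in the end.\<close>

lemma neat: assumes p: "p el PC" "a0 sub p" and r: "run p n y c" "y : M" "c : M" and th: "th el lam"
 obtains q y' c' where "q el PC" "y' : M" "c' : M" "p sub q" "y sub y'" "c sub c'" "run q (dm y') y' c'" "fre q (dm y')" "th sub dm y'"
proof -
 have pM: "p : M" and dn: "dm y = n" using p run_dm[OF r(1,2)] by auto
 obtain t0 where t0: "t0 el lam" "!!w. w el p ==> p2 (p1 w) el t0" by (rule PC_rows[OF p(1)]) blast
 obtain t where t: "t el lam" "t0 sub t" "th sub t" by (rule reg_join[OF lam t0(1) th])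
 have tM: "t : M" using t by auto
 have fp: "fre p t" using t0(2) t(2) unfolding fre_def by blast
 have dQ: "dfn (%e. fre (pr0 (e 0)) t)" by (intro dfi tM)
 define X where "X = sep RS (%s. fre (pr0 s) t)"
 have X: "elts X = {s : elts RS. fre (pr0 s) t}" unfolding X_def by (rule elts_sep[OF dQ RS_M])
 have lX: "lcl X" unfolding X_def
 proof (rule lcl_sepI[OF lcl_RS dQ])
  fix b C i assume "b el RS" "fre (pr0 b) t" "C : M" "i el lam" "!!k. k el i ==> app C k el RS & fre (pr0 (app C k)) t & b sub app C k & (ALL l:elts k. app C l sub app C k)"
  moreover have "b : M" "i : M" using calculation by auto
  ultimately show "fre (pr0 (supr b C i)) t" unfolding fre_def by (simp add: pr_supr) blast
 qed
 have tX: "tri p y c el X" unfolding X using r p fp pM dn by (simp add: RS_tri)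
 obtain q y' c' where q: "tri q y' c' el X" "y' : M" "c' : M" "q el PC" "run q (dm y') y' c'" "p sub q" "y sub y'" "c sub c'" "t sub dm y'"
 proof (rule run_chain[OF lX _ tX pM r(2,3) t(1)])
  show "X sub RS" unfolding X by blast
  fix q y' c' assume q: "tri q y' c' el X" "y' : M" "c' : M" "q el PC" "run q (dm y') y' c'" "p sub q" "dm y' el t"
  have a: "a0 sub q" using p q by blast
  obtain q' v u where q': "q' el PC" "q sub q'" "out q' (dm y') (supr r1 c' (dm y')) v u"
   "!!w. w el q' ==> co w = gc ==> w el q | p1 w = opr gc (dm y')" by (rule ext1[OF q(4) a q(5,2,3)]) blast
  have M: "v : M" "u : M" "q' : M" "q : M" using out_facts[OF q'(3)] q' q by auto
  have fq: "fre q t" using q(1,2,3) M unfolding X by simp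
  have rn: "run q' (suc (dm y')) (snoc y' (dm y') v) (snoc c' (dm y') u)"
   by (rule run_snoc[OF run_mono[OF q(5) q'(2) q(4) q'(1)] q(2,3) q'(3)])
  have "fre q' t" unfolding fre_def
  proof (intro ballI impI)
   fix w assume w: "w el q'" "co w = gc"
   show "p2 (p1 w) el t" using q'(4)[OF w] fq w(2) q(7) unfolding fre_def by auto
  qed
  then have "tri q' (snoc y' (dm y') v) (snoc c' (dm y') u) el X" unfolding X
   using rn q' M run_dm[OF rn] by (simp add: RS_tri)
  then show "EX q' v u. v : M & u : M & q sub q' & tri q' (snoc y' (dm y') v) (snoc c' (dm y') u) el X & q' : M" using M q' by blast
 qed blast
 have "fre q t" using q(1,2,3) q(4) unfolding X by (auto dest: el_M)
 then have "fre q (dm y')" using q(9) unfolding fre_def by blast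
 then show thesis using that[OF q(4,2,3,6,7,8,5)] q(9) t(3) by blast
qed

end

section \<open>Splitting nodes above every node\<close>

locale split_tree = tree +
 assumes Sp: "!!a s. a el cs al ==> a0 sub a ==> s el R ==> r1 sub s ==> EX a':elts (cs al). a sub a' & (EX u:elts R. EX u':elts R.
  s sub u & s sub u' & (EX i:elts lam. EX v:M. EX w:M. v ~= w & dec (un a' u) tx (opr i v) & dec (un a' u') tx (opr i w)))"
begin

definition Spl where "Spl a s i = (EX a':elts (cs al). a sub a' & (EX u:elts R. EX u':elts R.
  s sub u & s sub u' & (EX v:M. EX w:M. v ~= w & dec (un a' u) tx (opr i v) & dec (un a' u') tx (opr i w))))"

lemma dec_lam: "a el cs al ==> a0 sub a ==> u el R ==> r1 sub u ==> i el lam ==> v : M ==> dec (un a u) tx (opr i v) ==> v el lam"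
 using tx(3)[OF un_aR(4), of a u i v] b0_split un_mono[of a0 r1 a u] by (auto dest: el_M)

text \<open>If \<open>s\<close> does not split at \<open>i\<close>, it decides the value there by
  itself, over some \<open>a2\<close>. Otherwise an extension of \<open>un a2 s\<close> deciding
  another value would yield, over a common part below \<open>al\<close>, two disagreeing extensions
  of \<open>s\<close>.\<close>

lemma no_split_dec: assumes a: "a el cs al" "a0 sub a" and s: "s el R" "r1 sub s" and i: "i el lam" "~ Spl a s i"
 obtains a2 v where "a2 el cs al" "a sub a2" "v el lam" "dec (un a2 s) tx (opr i v)"
proof -
 have bs: "b0 sub un a s" using un_mono[of a0 r1 a s] a s b0_split by auto
 obtain r v where r: "r el cs be" "un a s sub r" "v : M" "dec r tx (opr i v)" using bdD[OF tx(2) un_aR(1)[OF a(1) s(1)] bs i(1)] by blast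
 define a2 where "a2 = rst r al"
 define u where "u = rs r"
 have au: "a2 el cs al" "u el R" "un a2 u = r" using split_be[OF r(1)] by (auto simp: a2_def u_def)
 have M: "a : M" "s : M" "r : M" "a2 : M" "u : M" using a s r au by auto
 have sub: "a sub a2" "s sub u" using r(2) a(1) s(1) M by (auto simp: a2_def u_def el_R el_cs)
 have "dec (un a2 s) tx (opr i v)"
 proof (rule fmem_dns, unfold dns_def, intro ballI impI)
  fix r' assume r': "r' el PC" "un a2 s sub r'"
  have M': "r' : M" using r' by auto
  have as: "un a2 s sub rst r' be" using cs_rst[OF al_M(2) un_aR(1)[OF au(1) s(1)] M' r'(2)] .
  then have "b0 sub rst r' be" using bs sub(1) M by auto
  then obtain t w where t: "t el cs be" "rst r' be sub t" "w : M" "dec t tx (opr i w)"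
   using bdD[OF tx(2) rst_cs[OF r'(1) al_M(2)] _ i(1)] by blast
  have tM: "t : M" using t by auto
  have t2: "rst t al el cs al" "rs t el R" "un (rst t al) (rs t) = t" using split_be[OF t(1)] by auto
  have ss: "a2 sub rst t al" "s sub rs t" using as t(2) M tM au(1) s(1) by (auto simp: el_R el_cs)
  have "dec (un (rst t al) u) tx (opr i v)" by (rule dec_mono[OF r(4)]) (use au(3) ss M tM in auto)
  moreover have "dec (un (rst t al) (rs t)) tx (opr i w)" using t(4) t2(3) by simp
  ultimately have "v = w" using i(2) t2 au(2) sub ss r(3) t(3) unfolding Spl_def by (meson subset_trans)
  moreover have "un r' t el PC" by (rule amal[OF r'(1) t(1) al_M(2) t(2)])
  ultimately show "EX q:elts PC. r' sub q & dec q tx (opr i v)"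
   using dec_mono[OF t(4), of "un r' t"] M' tM by (intro bexI[of _ "un r' t"]) auto
 qed
 moreover have "v el lam" by (rule dec_lam[OF au(1) _ s i(1) r(3) calculation]) (use a sub in blast)
 ultimately show thesis using that au sub by blast
qed

text \<open>Let \<open>i\<close> be the least index at which the current state \<open>s\<close>
  splits. Before \<open>i\<close> the state can be made to decide the values, so the node is
  prolonged to length \<open>i\<close> by instructions that keep \<open>s\<close>. At
  \<open>i\<close> a code with two triples is written.\<close>

theorem split: assumes p: "p el PC" "a0 sub p" and r: "run p n y c" "y : M" "c : M"
 obtains q y' c' v u w u' where "q el PC" "y' : M" "c' : M" "p sub q" "y sub y'" "run q (dm y') y' c'"
  "out q (dm y') (supr r1 c' (dm y')) v u" "out q (dm y') (supr r1 c' (dm y')) w u'" "v ~= w"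
proof -
 obtain q1 y1 c1 where q1: "q1 el PC" "y1 : M" "c1 : M" "p sub q1" "y sub y1" "c sub c1" "run q1 (dm y1) y1 c1" "fre q1 (dm y1)"
  by (rule neat[OF p r reg_zero[OF lam]]) blast
 define n1 where "n1 = dm y1"
 define s where "s = supr r1 c1 n1"
 have n1: "n1 el lam" "n1 : M" "ordinal n1" "q1 : M" using q1 ordl ord_el by (auto simp: run_def n1_def)
 have s: "s el R" "r1 sub s" "s : M" using run_state[OF q1(7,3), of n1] n1 by (auto simp: s_def n1_def)
 have a: "rst q1 al el cs al" "a0 sub rst q1 al" using rst_cs[OF q1(1) al_M(1)] cs_rst[OF al_M(1) b0_split(1)] p q1 by auto
 let ?Q = "%i. i el lam & Spl (rst q1 al) s i"
 obtain i0 where i0: "?Q i0" using Sp[OF a s(1,2)] unfolding Spl_def by blast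
 have dQ: "dfn (%e. ?Q (e 0))" unfolding Spl_def by (intro dfi al_M n1 s lam_M)
 have "ordinal i0" "i0 : M" using i0 ordl ord_el by auto
 note L = least[OF dQ this i0]
 define i where "i = least ?Q"
 have i: "i el lam" "Spl (rst q1 al) s i" "!!k. k el i ==> ~ Spl (rst q1 al) s k" "ordinal i" "i : M"
  using L lam_tr unfolding i_def by blast+
 obtain a1 u u' v w where a1: "a1 el cs al" "rst q1 al sub a1" "u el R" "u' el R" "s sub u" "s sub u'" "v : M" "w : M" "v ~= w"
  "dec (un a1 u) tx (opr i v)" "dec (un a1 u') tx (opr i w)" using i(2) unfolding Spl_def by blast
 have M: "a1 : M" "u : M" "u' : M" using a1 by auto
 have a01: "a0 sub a1" using a a1 by blast
 have vw: "v el lam" "w el lam" using dec_lam[OF a1(1) a01 _ _ i(1)] a1 s by (meson subset_trans)+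
 \<comment> \<open>The values at indices below \<open>n1\<close> are already decided by the state,
   so two extensions cannot disagree there.\<close>
 have "~ i el n1"
 proof
  assume "i el n1"
  then have d: "dec (un (rst q1 al) s) tx (opr i (app y1 i))" using run_dec[OF q1(7,3,1)] by (simp add: n1_def s_def)
  have "x = app y1 i" if x: "dec (un a1 t) tx (opr i x)" "t el R" "s sub t" "x : M" for x t
  proof (rule goodD(2)[OF b0(2) un_aR(4)[OF a1(1) x(2)] _ i(1) x(1)])
   show "b0 sub un a1 t" using un_mono[of a0 r1 a1 t] a01 s x b0_split M by auto
   show "dec (un a1 t) tx (opr i (app y1 i))" by (rule dec_mono[OF d]) (use a1 x M n1 s in auto)
  qed (use x in simp_all)
  then show False using a1 by blast
 qed
 then have ni: "n1 sub i" using ord_tri[OF n1(3) i(4) n1(2) i(5)] ord_tr[OF i(4)] by blast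
 define q2 where "q2 = un q1 a1"
 have q2: "q2 el PC" "rst q2 al = a1" unfolding q2_def by (rule amal[OF q1(1) a1(1) al_M(1) a1(2)])+
 have q2s: "q1 sub q2" "q2 : M" "a1 sub q2" unfolding q2_def using n1 M by auto
 have f2: "fre q2 n1" using q1(8) n1 M gc_al[OF a1(1)] unfolding fre_def q2_def n1_def by auto
 have r2: "run q2 n1 y1 c1" using run_mono[OF q1(7) q2s(1) q1(1) q2(1)] by (simp add: n1_def)
 \<comment> \<open>The invariant of the prolongation: the next row of \<open>gc\<close> is
   unwritten, the length does not exceed \<open>i\<close>, and all states from \<open>n1\<close> on
   equal \<open>s\<close>.\<close>
 let ?P = "%t. fre (pr0 t) (dm (ty t)) & dm (ty t) sub i & (ALL z:elts (tc t). p1 z el n1 | p2 z = s)"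
 have dP: "dfn (%e. ?P (e 0))" by (intro dfi n1 s i)
 define X where "X = sep RS ?P"
 have X: "elts X = {t : elts RS. ?P t}" unfolding X_def by (rule elts_sep[OF dP RS_M])
 have lX: "lcl X" unfolding X_def
 proof (rule lcl_sepI[OF lcl_RS dP])
  fix b C k assume a: "b el RS" "?P b" "C : M" "k el lam" "!!l. l el k ==> app C l el RS & ?P (app C l) & b sub app C l & (ALL l':elts l. app C l' sub app C l)"
  have bM: "b : M" "k : M" using a by auto
  have P: "fre (pr0 (app C l)) (dm (ty (app C l)))" "dm (ty (app C l)) sub i" "ALL z:elts (tc (app C l)). p1 z el n1 | p2 z = s"
   if "l el k" for l using a(5)[OF that] by blast+
  have "fre (pr0 (supr b C k)) (dm (ty (supr b C k)))" by (rule fre_supr[OF bM(1) a(3) bM(2)]) (use a(2) P(1) in blast)+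
  then show "?P (supr b C k)" unfolding ty_supr[OF bM(1) a(3) bM(2)] using a(2) P(2,3) by blast
 qed
 have c1: "p1 z el n1" if "z el c1" for z
  using that r2 q1(3) n1 func_elts[of c1 n1] by (auto simp: run_def)
 have tX: "tri q2 y1 c1 el X" unfolding X using r2 q2 q2s q1(2,3) f2 ni c1 by (simp add: RS_tri n1_def[symmetric])
 have st: "supr r1 c' (dm y') = s" if c': "tri q y' c' el X" "y' : M" "c' : M" "q : M" "run q (dm y') y' c'" "y1 sub y'" "c1 sub c'" for q y' c'
 proof (rule zfc_ext)
  have f: "func c' (dm y')" "func c1 n1" "n1 sub dm y'"
   using c' r2 dm_mono[OF q1(2) c'(2,6)] by (auto simp: run_def n1_def)
  have e1: "app c' k = app c1 k" if "k el n1" for k using func_sub(2)[OF f(2,1) c'(7) q1(3) c'(3)] that n1 by simp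
  have e2: "app c' k = s" if "k el dm y'" "~ k el n1" for k
  proof -
   have "opr k (app c' k) el c'" using funcD(1)[OF f(1) c'(3) dm_M that(1)] .
   moreover have "ALL z:elts c'. p1 z el n1 | p2 z = s" using c'(1,2,3,4) unfolding X by simp
   ultimately show ?thesis using that by fastforce
  qed
  have se: "elts s = elts r1 Un (UN k:elts n1. elts (app c1 k))" using q1(3) n1 by (simp add: s_def)
  have "elts (supr r1 c' (dm y')) = elts r1 Un (UN k:elts (dm y'). elts (app c' k))" using c' by simp
  also have "\<dots> = elts s"
  proof (intro equalityI subsetI)
   fix z assume "z : elts r1 Un (UN k:elts (dm y'). elts (app c' k))"
   then show "z el s"
   proof
    assume "z : (UN k:elts (dm y'). elts (app c' k))"
    then obtain k where k: "k el dm y'" "z el app c' k" by blast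
    show ?thesis using e1[of k] e2[OF k(1)] k(2) se by (cases "k el n1") auto
   qed (use se in blast)
  next
   fix z assume "z el s"
   then show "z : elts r1 Un (UN k:elts (dm y'). elts (app c' k))" unfolding se using e1 f(3) by fastforce
  qed
  finally show "elts (supr r1 c' (dm y')) = elts s" .
 qed (simp_all add: s)
 obtain q3 y3 c3 where q3: "tri q3 y3 c3 el X" "y3 : M" "c3 : M" "q3 el PC" "run q3 (dm y3) y3 c3" "q2 sub q3" "y1 sub y3" "c1 sub c3" "i sub dm y3"
 proof (rule run_chain[OF lX _ tX q2s(2) q1(2,3) i(1)])
  show "X sub RS" unfolding X by blast
  fix q y' c' assume q: "tri q y' c' el X" "y' : M" "c' : M" "q el PC" "run q (dm y') y' c'" "q2 sub q" "y1 sub y'" "c1 sub c'" "dm y' el i"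
  define n where "n = dm y'"
  have qM: "q : M" using q by auto
  have nl: "n el lam" "n : M" "~ Spl (rst q1 al) s n" using q(9) i lam_tr unfolding n_def by auto
  have S: "supr r1 c' n = s" unfolding n_def by (rule st[OF q(1,2,3) qM q(5,7,8)])
  have fq: "fre q n" "ALL z:elts c'. p1 z el n1 | p2 z = s" using q(1,2,3) qM unfolding X n_def by simp_all
  have aq: "rst q al el cs al" "a1 sub rst q al" "rst q al : M" using rst_cs[OF q(4) al_M(1)] cs_rst[OF al_M(1) a1(1) qM] q(6) q2s(3) by auto
  have nS: "~ Spl (rst q al) s n" using nl(3) aq(2) a1(2) unfolding Spl_def by (meson subset_trans)
  obtain a2 x where a2: "a2 el cs al" "rst q al sub a2" "x el lam" "dec (un a2 s) tx (opr n x)"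
   by (rule no_split_dec[OF aq(1) _ s(1,2) nl(1) nS]) (use aq a01 in blast)+
  have xM: "x : M" using a2 by auto
  have "sing (T3 s x s) sub times R (times lam R)" using s a2 xM by simp
  then obtain z where z: "z el gc" "app dW z = sing (T3 s x s)" using code by (metis sing(1))
  have T: "T3 s v' t el app dW z <-> v' = x & t = s" if "v' el lam" "t el R" for v' t using z that s xM by (auto dest: el_M)
  have okz: "ok a2 n s z" unfolding ok_def using T a2 s by blast
  note pu = put[OF q(4) nl(1) fq(1) a2(1,2) z(1)]
  define q' where "q' = un (un q a2) (sing (opr (opr gc n) z))"
  have o: "out q' n (supr r1 c' n) x s" unfolding S q'_def
   by (rule put_out[OF q(4) nl(1) fq(1) a2(1,2) z(1) okz a2(3) s(1)]) (use T a2 s in blast)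
  have q': "q' el PC" "q sub q'" "fre q' (suc n)" "q' : M" using pu unfolding q'_def by auto
  have rn: "run q' (suc n) (snoc y' n x) (snoc c' n s)"
   by (rule run_snoc[OF run_mono[OF _ q'(2) q(4) q'(1)] q(2,3) o]) (use q in \<open>simp add: n_def\<close>)
  have "tri q' (snoc y' n x) (snoc c' n s) el X" unfolding X
   using rn q' run_dm[OF rn] fq(2) q(3,9) i(4,5) ord_tr[OF i(4)] s nl xM by (auto simp: RS_tri n_def snoc_def)
  then show "EX q' v u. v : M & u : M & q sub q' & tri q' (snoc y' (dm y') v) (snoc c' (dm y') u) el X & q' : M"
   using xM s q' unfolding n_def by blast
 qed blast
 have q3M: "q3 : M" using q3 by auto
 have X3: "fre q3 (dm y3)" "dm y3 sub i" using q3(1,2,3) q3M unfolding X by simp_all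
 then have d3: "dm y3 = i" using q3(9) i by (intro zfc_ext) auto
 have S: "supr r1 c3 i = s" using st[OF q3(1,2,3) q3M q3(5,7,8)] d3 by simp
 have a3: "rst q3 al el cs al" "a1 sub rst q3 al" "rst q3 al : M" using rst_cs[OF q3(4) al_M(1)] cs_rst[OF al_M(1) a1(1) q3M] q3(6) q2s(3) by auto
 define W where "W = mk {T3 s v u, T3 s w u'}"
 have W: "W : M" "elts W = {T3 s v u, T3 s w u'}" by (simp_all add: W_def elts_mk)
 have "W sub times R (times lam R)" using W s vw a1 M by simp
 then obtain z where z: "z el gc" "app dW z = W" using code W by metis
 have T: "T3 s x t el app dW z <-> x = v & t = u | x = w & t = u'" if "x el lam" "t el R" for x t
  using z that s W a1 M by (auto dest: el_M)
 have de: "dec (un (rst q3 al) u) tx (opr i v)" "dec (un (rst q3 al) u') tx (opr i w)"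
  using dec_mono[OF a1(10), of "un (rst q3 al) u"] dec_mono[OF a1(11), of "un (rst q3 al) u'"] a3 M by auto
 have okz: "ok (rst q3 al) i s z" unfolding ok_def using T de a1 vw by blast
 define q where "q = un (un q3 (rst q3 al)) (sing (opr (opr gc i) z))"
 have f3: "fre q3 i" using X3 d3 by simp
 note pu = put[OF q3(4) i(1) f3 a3(1) order_refl z(1)]
 have "out q i s v u" "out q i s w u'" unfolding q_def
  by (rule put_out[OF q3(4) i(1) f3 a3(1) order_refl z(1) okz]; use T vw a1 in blast)+
 moreover have "q el PC" "q3 sub q" using pu unfolding q_def by auto
 moreover have "run q (dm y3) y3 c3" by (rule run_mono[OF q3(5)]) (use calculation q3 in auto)
 moreover have "p sub q" "y sub y3" using q1 q2s q3 calculation by blast+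
 ultimately show thesis using that[of q y3 c3 v u w u'] q3 S d3 a1(9) by simp
qed

end

context levy_ground begin

lemma elts_reptg: assumes M: "X : M" "Y : M" shows "elts (rep (times X Y) (%w. tg (p1 w) (p2 w))) = {tg x y |x y. x el X & y el Y}"
proof -
 have "elts (rep (times X Y) (%w. tg (p1 w) (p2 w))) = (%w. tg (p1 w) (p2 w)) ` elts (times X Y)"
  by (rule elts_rep) (intro dfi fn_M)+
 also have "\<dots> = {tg x y |x y. x el X & y el Y}" (is "?A = ?B")
 proof (intro equalityI subsetI)
  fix z assume "z : ?B"
  then obtain x y where "x el X" "y el Y" "z = tg x y" by blast
  then show "z : ?A" using M by (intro image_eqI[of _ _ "opr x y"]) auto
 qed (use M in \<open>auto simp: elts_times, blast\<close>)
 finally show ?thesis .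
qed

lemma lcl_tg: assumes X: "lcl X" and Y: "lcl Y" shows "lcl (rep (times X Y) (%w. tg (p1 w) (p2 w)))"
proof -
 have M: "X : M" "Y : M" using X Y lcl_M by auto
 note e = elts_reptg[OF M]
 show ?thesis unfolding lcl_def e
 proof (intro conjI ballI impI set_M)
  fix b C i assume b: "b : {tg x y |x y. x el X & y el Y}" and C: "C : M" and i: "i el lam"
   and a: "ALL k:elts i. app C k : {tg x y |x y. x el X & y el Y} & supr b C k sub app C k"
  obtain x y where xy: "b = tg x y" "x el X" "y el Y" using b by blast
  define C0 where "C0 = fn i (%k. pr0 (app C k))"
  define C1 where "C1 = fn i (%k. pr1 (app C k))"
  have iM: "i : M" "C0 : M" "C1 : M" using i by (auto simp: C0_def C1_def)
  have ap: "app C0 k = pr0 (app C k)" "app C1 k = pr1 (app C k)" if "k el i" for k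
   unfolding C0_def C1_def by (rule app_fn'[OF _ C iM(1) that], intro dfi)+
  have ck: "app C k = tg (app C0 k) (app C1 k) & app C0 k el X & app C1 k el Y" if k: "k el i" for k
  proof -
   obtain x y where "app C k = tg x y" "x el X" "y el Y" using a k by blast
   then show ?thesis using ap[OF k] by (auto dest: el_M)
  qed
  have s: "supr x C0 k sub app C0 k & supr y C1 k sub app C1 k" if k: "k el i" for k
  proof -
   have le: "b sub app C k" "!!l. l el k ==> app C l sub app C k" using a k supr_sub_iff[of b C k "app C k"] C xy el_M[OF k] by auto
   have li: "l el i" if "l el k" for l using ord_tr[OF ord_el[OF ordl(1) i]] k that by blast
   have "app C0 l sub app C0 k & app C1 l sub app C1 k" if "l el k" for l using le(2)[OF that] ck[OF k] ck[OF li[OF that]] by auto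
   moreover have "x sub app C0 k & y sub app C1 k" using le(1) ck[OF k] xy by auto
   ultimately show ?thesis using xy C k iM by (auto simp: supr_sub_iff dest: el_M)
  qed
  have "supr b C i = tg (supr x C0 i) (supr y C1 i)" unfolding xy C0_def C1_def
   by (rule supr_tg) (use xy C iM ck ap in auto)
  moreover have "supr x C0 i el X" by (rule lclD[OF X xy(2) iM(2) i]) (use ck s in blast)
  moreover have "supr y C1 i el Y" by (rule lclD[OF Y xy(3) iM(3) i]) (use ck s in blast)
  ultimately show "supr b C i : {tg x y |x y. x el X & y el Y}" by blast
 qed
qed

end

section \<open>A closed order projecting to the generic side and to the branch side\<close>

locale branch = tree +
 fixes yd de d0
 assumes de: "de el mu" "be sub de" "gc el de" and yd: "yd : M" "bd yd d0 de" and a0_d0: "a0 sub d0"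
  and H1: "!!d th. d el cs de ==> d0 sub d ==> th el lam ==> EX d':elts (cs de). d sub d' & (EX y:M. EX c:M. run d' th y c &
   (ALL i:elts th. dec d' yd (opr i (app y i))))"
begin

lemma de_M [simp]: "de : M" "yd : M" "d0 : M" using de yd by (auto simp: bd_def)
lemma d0: "d0 el cs de" "good lam yd d0" using yd by (auto simp: bd_def)
lemma al_de: "al sub de" using al(4) de(2) by blast

definition dcs where "dcs t = (ALL i:elts (dm (ty t)). dec (pr0 t) yd (opr i (app (ty t) i)))"
text \<open>The condition of such a triple forces the node to be an initial part of
  \<open>yd\<close>. In \<open>D\<close> the next row of the instruction column is free as well;
  this freedom is what allows an arbitrary extension on the branch side in
  \<open>f2_lift\<close>.\<close>

definition D0 where "D0 = sep RS (%t. pr0 t el cs de & d0 sub pr0 t & dcs t)"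
definition D where "D = sep D0 (%t. fre (pr0 t) (dm (ty t)))"

lemma dfn_dcs [dfi]: "dft A ==> dfn (%e. dcs (A e))" by (rule dfn1[of dcs]) (unfold dcs_def, intro dfi de_M)
lemma D_M [simp]: "D0 : M" "D : M" by (simp_all add: D0_def D_def)
lemma elts_D0: "elts D0 = {t : elts RS. pr0 t el cs de & d0 sub pr0 t & dcs t}"
 unfolding D0_def by (rule elts_sep) (intro dfi de_M RS_M)+
lemma elts_D: "elts D = {t : elts D0. fre (pr0 t) (dm (ty t))}" unfolding D_def by (rule elts_sep) (intro dfi D_M)+

lemma D0_tri: assumes "y : M" "c : M" "p : M" shows "tri p y c el D0 <-> p el cs de & run p (dm y) y c & d0 sub p & (ALL i:elts (dm y). dec p yd (opr i (app y i)))"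
 unfolding elts_D0 dcs_def using assms cs_PC[OF de_M(1)] by (auto simp: RS_tri)
lemma D_tri: assumes "y : M" "c : M" "p : M" shows "tri p y c el D <-> tri p y c el D0 & fre p (dm y)"
 unfolding elts_D using assms by simp

lemma D0_E: assumes "t el D0" obtains p y c where "t = tri p y c" "y : M" "c : M" "p : M" "p el cs de" "p el PC" "run p (dm y) y c" "d0 sub p"
  "!!i. i el dm y ==> dec p yd (opr i (app y i))"
proof -
 have "t el RS" using assms by (simp add: elts_D0)
 then obtain p y c where t: "t = tri p y c" "y : M" "c : M" "p el PC" by (rule RS_E)
 then have "p : M" by auto
 then show thesis using that[OF t(1-3) _ _ t(4)] assms D0_tri t by blast
qed

lemma lcl_D0: "lcl D0"
 unfolding D0_def
proof (rule lcl_sepI[OF lcl_RS])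
 show "dfn (%e. pr0 (e 0) el cs de & d0 sub pr0 (e 0) & dcs (e 0))" by (intro dfi de_M)
 fix b C i assume b: "b el RS" "pr0 b el cs de & d0 sub pr0 b & dcs b" and C: "C : M" and i: "i el lam"
  and a: "!!k. k el i ==> app C k el RS & (pr0 (app C k) el cs de & d0 sub pr0 (app C k) & dcs (app C k)) & b sub app C k & (ALL l:elts k. app C l sub app C k)"
 have M: "b : M" "i : M" using b i by auto
 have S: "supr b C i el RS" by (rule lclD[OF lcl_RS b(1) C i]) (use a M C in \<open>auto simp: supr_sub_iff dest: el_M\<close>)
 obtain p y c where t: "supr b C i = tri p y c" "y : M" "c : M" "p el PC" "run p (dm y) y c" by (rule RS_E[OF S])
 have pM: "p : M" using t by auto
 have sub: "dec p yd (opr m (app y m))" if u: "u el RS" "u sub supr b C i" "dcs u" "m el dm (ty u)" for u m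
 proof -
  obtain p' y' c' where t': "u = tri p' y' c'" "y' : M" "c' : M" "p' el PC" "run p' (dm y') y' c'" by (rule RS_E[OF u(1)])
  have pM': "p' : M" using t' by auto
  have le: "p' sub p" "y' sub y" using u(2) t t' pM pM' by auto
  have f: "func y' (dm y')" "func y (dm y)" using t t' by (auto simp: run_def)
  have "app y' m = app y m" by (rule func_sub(2)[OF f le(2) t'(2) t(2) dm_M dm_M]) (use u t' pM' in simp)
  moreover have "dec p' yd (opr m (app y' m))" using u(3,4) t' pM' by (auto simp: dcs_def)
  ultimately show ?thesis using dec_mono le(1) by metis
 qed
 have sp: "b sub supr b C i" "!!k. k el i ==> app C k sub supr b C i" using M C by auto
 have "dcs (supr b C i)" unfolding dcs_def ty_supr(3)[OF M(1) C M(2)]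
 proof
  fix m assume "m : elts (dm (ty b)) Un (UN k:elts i. elts (dm (ty (app C k))))"
  then have "dec p yd (opr m (app y m))" using sub[OF b(1) sp(1)] sub[OF _ sp(2)] a b(2) by blast
  then show "dec (pr0 (supr b C i)) yd (opr m (app (ty (supr b C i)) m))" using t pM by simp
 qed
 moreover have "pr0 (supr b C i) el PC" using t pM by simp
 then have "pr0 (supr b C i) el cs de" using b(2) a unfolding el_cs[OF de_M(1)] pr_supr[OF M(1) C M(2)] by blast
 moreover have "d0 sub pr0 (supr b C i)" using b(2) unfolding pr_supr[OF M(1) C M(2)] by blast
 ultimately show "pr0 (supr b C i) el cs de & d0 sub pr0 (supr b C i) & dcs (supr b C i)" by blast
qed

lemma lcl_D: "lcl D"
 unfolding D_def
proof (rule lcl_sepI[OF lcl_D0])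
 show "dfn (%e. fre (pr0 (e 0)) (dm (ty (e 0))))" by (intro dfi)
 fix b C i assume "b el D0" "C : M" "i el lam" "fre (pr0 b) (dm (ty b))"
  "!!k. k el i ==> app C k el D0 & fre (pr0 (app C k)) (dm (ty (app C k))) & b sub app C k & (ALL l:elts k. app C l sub app C k)"
 then show "fre (pr0 (supr b C i)) (dm (ty (supr b C i)))" by (intro fre_supr) (auto dest: el_M)
qed

text \<open>\<open>H1\<close> supplies a long node decided by \<open>yd\<close>. It extends
  \<open>y\<close> because \<open>yd\<close> is forced to be a function, and its states extend
  \<open>c\<close> because nodes determine states.\<close>

lemma D0_ext: assumes t: "tri p y c el D0" "y : M" "c : M" "p : M" and q: "q el cs de" "p sub q" and th: "th el lam"
 obtains q' y' c' where "tri q' y' c' el D0" "y' : M" "c' : M" "q' : M" "q sub q'" "y sub y'" "c sub c'" "th sub dm y'"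
proof -
 have T: "p el cs de" "run p (dm y) y c" "d0 sub p" "!!i. i el dm y ==> dec p yd (opr i (app y i))" using t by (auto simp: D0_tri)
 have n: "dm y el lam" "func y (dm y)" "func c (dm y)" using T by (auto simp: run_def)
 obtain th' where th': "th' el lam" "dm y sub th'" "th sub th'" by (rule reg_join[OF lam n(1) th])
 obtain q' y' c' where q': "q' el cs de" "q sub q'" "y' : M" "c' : M" "run q' th' y' c'" "ALL i:elts th'. dec q' yd (opr i (app y' i))"
  using H1[OF q(1) _ th'(1)] T(3) q(2) by blast
 have M: "q' : M" "th' : M" "q' el PC" "q el PC" "p el PC" using q' th' cs_PC[OF de_M(1)] q T by auto
 have dy: "dm y' = th'" by (rule run_dm[OF q'(5,3)])
 have f: "func y' th'" "func c' th'" using q' by (auto simp: run_def)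
 have e: "app y i = app y' i" if "i el dm y" for i
  by (rule goodD(2)[OF d0(2) M(3) _ _ dec_mono[OF T(4)[OF that]]]) (use T q q' th' that lam_tr[OF th'(1)] in auto)
 have tr: "transitive (dm y)" using ord_el[OF ordl(1) n(1)] by (simp add: ordinal_def)
 have "run q' (dm y) y c" by (rule run_mono[OF T(2)]) (use q q' M in auto)
 then have ec: "app c i = app c' i" if "i el dm y" for i
  by (rule run_unique[OF _ q'(5) M(3) t(3) q'(4) t(2) q'(3) dm_M order_refl th'(2) tr e that])
 have "y sub y'" "c sub c'" using func_subI[OF n(2) f(1) t(2) q'(3) dm_M M(2) th'(2)] func_subI[OF n(3) f(2) t(3) q'(4) dm_M M(2) th'(2)] e ec by blast+
 moreover have "tri q' y' c' el D0" using q' M T q unfolding D0_tri[OF q'(3,4) M(1)] dy by blast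
 ultimately show thesis using that[OF _ q'(3,4) M(1) q'(2)] th'(3) dy by blast
qed

text \<open>Each extension may write further rows of column \<open>gc\<close>, so it is repeated
  \<open>omega\<close> times, making the node longer than all rows used so far. The union has caught
  up with itself, and it exists in the closed order because \<open>omega\<close> is an element of
  \<open>lam\<close>.\<close>

lemma D_ext: assumes t: "tri p y c el D0" "y : M" "c : M" "p : M" and q: "q el cs de" "p sub q" and th: "th el lam"
 obtains q' y' c' where "tri q' y' c' el D" "y' : M" "c' : M" "q' : M" "q sub q'" "y sub y'" "c sub c'" "th sub dm y'"
proof -
 obtain q0 y0 c0 where z: "tri q0 y0 c0 el D0" "y0 : M" "c0 : M" "q0 : M" "q sub q0" "y sub y0" "c sub c0" "th sub dm y0"
  by (rule D0_ext[OF assms])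
 obtain w where w: "w el lam" "is_omega w" by (rule reg_omega[OF lam])
 have wM: "w : M" "ordinal w" using w by (auto simp: is_omega_def limit_ordinal_def)
 note ws = omega_suc[OF w(2) wM(1)] and w0 = omega_zero[OF w(2) wM(1)]
 let ?St = "%i t t'. fre (pr0 t) (dm (ty t'))"
 have dS: "dfn (%e. ?St (e 0) (e 1) (e 2))" by (intro dfi)
 obtain C where C: "C : M" "func C w" "!!i. i el suc w ==> supr (tri q0 y0 c0) C i el D0"
  "!!i. i el w ==> app C i el D0 & supr (tri q0 y0 c0) C i sub app C i & ?St i (supr (tri q0 y0 c0) C i) (app C i)"
 proof (rule lcl_chain[OF lcl_D0 w(1) z(1) dS])
  fix i s assume s: "s el D0"
  obtain p' y' c' where s': "s = tri p' y' c'" "y' : M" "c' : M" "p' : M" "p' el cs de" "p' el PC" by (rule D0_E[OF s]) blast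
  obtain t0 where t0: "t0 el lam" "!!w. w el p' ==> p2 (p1 w) el t0" by (rule PC_rows[OF s'(6)]) blast
  obtain q'' y'' c'' where e: "tri q'' y'' c'' el D0" "y'' : M" "c'' : M" "q'' : M" "p' sub q''" "y' sub y''" "c' sub c''" "t0 sub dm y''"
   by (rule D0_ext[OF s[unfolded s'(1)] s'(2,3,4,5) order_refl t0(1)])
  then have "s sub tri q'' y'' c''" "?St i s (tri q'' y'' c'')" using s' t0(2) unfolding fre_def by auto
  then show "EX q:elts D0. s sub q & fre (pr0 s) (dm (ty q))" using e by blast
 qed blast
 let ?t = "supr (tri q0 y0 c0) C w"
 have tM: "tri q0 y0 c0 : M" by simp
 have tD: "?t el D0" by (rule C(3)) (simp add: wM)
 have "fre (pr0 ?t) (dm (ty ?t))" unfolding fre_def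
 proof (intro ballI impI)
  fix u assume u: "u el pr0 ?t" "co u = gc"
  have "EX n:elts w. u el pr0 (supr (tri q0 y0 c0) C n)"
   using u(1) w0 unfolding pr_supr[OF tM C(1) wM(1)]
  proof (elim UnE UN_E)
   assume "u el pr0 (tri q0 y0 c0)" then show ?thesis using w0 pr_supr(1)[OF tM C(1) zero(1)] by blast
  next
   fix n assume n: "n el w" "u el pr0 (app C n)"
   then have "u el pr0 (supr (tri q0 y0 c0) C (suc n))" using pr_supr(1)[OF tM C(1) suc_M] by auto
   then show ?thesis using ws[OF n(1)] by blast
  qed
  then obtain n where n: "n el w" "u el pr0 (supr (tri q0 y0 c0) C n)" by blast
  then have "p2 (p1 u) el dm (ty (app C n))" using C(4) u(2) unfolding fre_def by blast
  then show "p2 (p1 u) el dm (ty ?t)" using n(1) unfolding ty_supr(3)[OF tM C(1) wM(1)] by blast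
 qed
 then have tD': "?t el D" using tD by (simp add: elts_D)
 obtain q' y' c' where t': "?t = tri q' y' c'" "y' : M" "c' : M" "q' : M" by (rule D0_E[OF tD]) blast
 have "tri q0 y0 c0 sub ?t" using C wM by auto
 then have le: "q0 sub q'" "y0 sub y'" "c0 sub c'" using t' z by auto
 show thesis by (rule that[OF tD'[unfolded t'(1)] t'(2,3,4)]) (use le z dm_mono[OF z(2) t'(2) le(2)] in blast)+
qed

text \<open>Elements \<open>tg t k\<close>: \<open>t\<close> from \<open>D\<close> and \<open>k\<close> a condition with columns in \<open>[be, de)\<close>. The first projection
 is dense in the conditions on \<open>de\<close>; the second maps to the generic of the collapse below \<open>be\<close> read off the branch.\<close>

definition K2 where "K2 = sep (cs de) (%k. ALL z:elts k. ~ co z el be)"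
definition EE where "EE = rep (times D K2) (%w. tg (p1 w) (p2 w))"
definition f1 where "f1 e = pr0 (pr0 e)"
definition f2 where "f2 e = un (un (rst (f1 e) al) (un r1 (uni (tc (pr0 e)) p2))) (pr1 e)"

lemma K2_M [simp]: "K2 : M" "EE : M" "f1 e : M" "f2 e : M" by (simp_all add: K2_def EE_def f1_def f2_def)
lemma dft_f [dfi]: "dft A ==> dft (%e. f1 (A e))" "dft A ==> dft (%e. f2 (A e))"
proof -
 have 1: "dft (%e. f1 (e 0))" unfolding f1_def by (intro dfi)
 show "dft A ==> dft (%e. f1 (A e))" for A by (rule dft1[OF 1])
 have "dft (%e. f2 (e 0))" unfolding f2_def by (intro dfi dft1[OF 1] al_M)
 then show "dft A ==> dft (%e. f2 (A e))" by (rule dft1)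
qed

lemma el_K2: "k el K2 <-> k el cs de & (ALL z:elts k. ~ co z el be)"
 unfolding K2_def by (subst elts_sep, intro dfi al_M) simp_all

lemma lcl_EE: "lcl EE"
 unfolding EE_def by (rule lcl_tg[OF lcl_D]) (unfold K2_def, intro lcl_all_el lcl_cs de_M dfi al_M)

lemma EE_iff: "e el EE <-> (EX p y c k. e = tg (tri p y c) k & y : M & c : M & p : M & tri p y c el D & k el K2)"
proof
 assume "e el EE"
 then obtain t k where t: "t el D" "k el K2" "e = tg t k" unfolding EE_def elts_reptg[OF D_M(2) K2_M(1)] by blast
 then have "t el D0" by (simp add: elts_D)
 then obtain p y c where "t = tri p y c" "y : M" "c : M" "p : M" by (rule D0_E) blast
 then show "EX p y c k. e = tg (tri p y c) k & y : M & c : M & p : M & tri p y c el D & k el K2" using t by blast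
qed (unfold EE_def elts_reptg[OF D_M(2) K2_M(1)], blast)

lemma EE_E: assumes "e el EE" obtains p y c k where "e = tg (tri p y c) k" "y : M" "c : M" "p : M" "tri p y c el D" "k el K2" "k : M"
 using assms unfolding EE_iff by blast

lemma state_eq: "func c n ==> c : M ==> n : M ==> un r1 (uni c p2) = supr r1 c n"
 by (rule zfc_ext, simp_all, subst elts_uni, intro dfi, simp_all add: func_elts)

lemma f_tg: assumes "y : M" "c : M" "p : M" "k : M" "tri p y c el D0"
 shows "f1 (tg (tri p y c) k) = p" "f2 (tg (tri p y c) k) = un (un (rst p al) (supr r1 c (dm y))) k"
proof -
 show 1: "f1 (tg (tri p y c) k) = p" using assms by (simp add: f1_def)
 have "func c (dm y)" using assms by (simp add: D0_tri run_def)
 then show "f2 (tg (tri p y c) k) = un (un (rst p al) (supr r1 c (dm y))) k"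
  using assms 1 by (simp add: f2_def state_eq)
qed

lemma elts_f2: "e : M ==> elts (f2 e) = {z : elts (f1 e). co z el al} Un elts r1 Un (UN w:elts (tc (pr0 e)). elts (p2 w)) Un elts (pr1 e)"
 unfolding f2_def by (subst elts_un, simp_all, subst elts_uni, intro dfi) auto

lemma f_mono: "e : M ==> e' : M ==> e sub e' ==> f1 e sub f1 e' & f2 e sub f2 e'"
proof -
 assume a: "e : M" "e' : M" "e sub e'"
 then have s: "pr0 e sub pr0 e'" "pr1 e sub pr1 e'" using pr_mono by blast+
 then have 1: "f1 e sub f1 e'" "tc (pr0 e) sub tc (pr0 e')" unfolding f1_def using pr_mono tg_M by metis+
 then show ?thesis using s unfolding elts_f2[OF a(1)] elts_f2[OF a(2)] by blast
qed

lemma f_cont: assumes "e : M" "C : M" "i : M"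
 shows "elts (f1 (supr e C i)) = elts (f1 e) Un (UN k:elts i. elts (f1 (app C k)))"
  "elts (f2 (supr e C i)) = elts (f2 e) Un (UN k:elts i. elts (f2 (app C k)))"
proof -
 have s: "elts (pr0 (supr e C i)) = elts (pr0 e) Un (UN k:elts i. elts (pr0 (app C k)))"
  "elts (pr1 (supr e C i)) = elts (pr1 e) Un (UN k:elts i. elts (pr1 (app C k)))" using pr_supr[OF assms] by blast+
 have s2: "elts (pr1 (pr0 (supr e C i))) = elts (pr1 (pr0 e)) Un (UN k:elts i. elts (pr1 (pr0 (app C k))))"
  unfolding elts_pr[OF tg_M(2)] s by blast
 have s3: "elts (tc (pr0 (supr e C i))) = elts (tc (pr0 e)) Un (UN k:elts i. elts (tc (pr0 (app C k))))"
  unfolding elts_pr[OF tg_M(3)] s2 by blast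
 show 1: "elts (f1 (supr e C i)) = elts (f1 e) Un (UN k:elts i. elts (f1 (app C k)))"
  unfolding f1_def elts_pr[OF tg_M(2)] s by blast
 show "elts (f2 (supr e C i)) = elts (f2 e) Un (UN k:elts i. elts (f2 (app C k)))"
  unfolding elts_f2[OF supr_M] elts_f2[OF assms(1)] elts_f2[OF p12_M(3)] 1 s s3 by blast
qed

lemma f2_parts: assumes "tri p y c el D0" "y : M" "c : M" "p : M" "k el K2"
 defines "q == un (un (rst p al) (supr r1 c (dm y))) k"
 shows "q el cs de" "rst q be = un (rst p al) (supr r1 c (dm y))" "b0 sub q"
  "rst p al el cs al" "supr r1 c (dm y) el R"
proof -
 have T: "p el cs de" "run p (dm y) y c" "d0 sub p" using assms by (auto simp: D0_tri)
 show s: "rst p al el cs al" "supr r1 c (dm y) el R" using rst_cs[OF cs_PC[OF de_M(1) T(1)] al_M(1)] run_state[OF T(2) assms(3), of "dm y"] by auto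
 note u = un_aR[OF s]
 have k: "k : M" "k el PC" "k el cs de" using assms(5) cs_PC[OF de_M(1)] by (auto simp: el_K2)
 have "q el PC" unfolding q_def
 proof (rule PC_un[OF u(4) k(2)])
  fix z w assume z: "z el un (rst p al) (supr r1 c (dm y))" "w el k" "p1 z = p1 w"
  then have "co z el be" "co z = co w" using u(1) unfolding el_cs[OF al_M(2)] by (blast, simp add: co_def)
  then show "z = w" using assms(5) z(2) unfolding el_K2 by auto
 qed
 moreover have "un (rst p al) (supr r1 c (dm y)) el cs de" by (rule cs_mono[OF al_M(2) de_M(1) de(2) u(1)])
 ultimately show "q el cs de" unfolding q_def by (intro cs_un[OF de_M(1) _ k(3)])
 show "rst q be = un (rst p al) (supr r1 c (dm y))" unfolding q_def using u(1) assms(5) k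
  by (intro zfc_ext) (auto simp: el_K2 el_cs)
 have "a0 sub rst p al" using cs_rst[OF al_M(1) b0_split(1) assms(4)] a0_d0 T(3) by blast
 then have "un a0 r1 sub q" unfolding q_def using run_state(2)[OF T(2) assms(3), of "dm y"] assms k by auto
 then show "b0 sub q" using b0_split(3) by simp
qed

lemma f_cs: "e el EE ==> f1 e el cs de & f2 e el cs de & b0 sub f2 e"
 by (elim EE_E) (use f_tg f2_parts D0_tri elts_D in auto)

lemma f1_lift: assumes e: "e el EE" and q: "q el cs de" "f1 e sub q" shows "EX e':elts EE. e sub e' & q sub f1 e'"
proof -
 obtain p y c k where t: "e = tg (tri p y c) k" "y : M" "c : M" "p : M" "tri p y c el D" "k el K2" "k : M" by (rule EE_E[OF e])
 then have tD: "tri p y c el D0" by (simp add: elts_D)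
 obtain q' y' c' where q': "tri q' y' c' el D" "y' : M" "c' : M" "q' : M" "q sub q'" "y sub y'" "c sub c'"
  by (rule D_ext[OF tD t(2-4) q(1) _ reg_zero[OF lam]]) (use q f_tg(1) t tD in auto)
 have pq: "p sub q'" using q(2) q'(5) f_tg(1)[OF t(2-4,7) tD] t(1) by auto
 have "tg (tri q' y' c') k el EE" using q' t unfolding EE_iff by blast
 moreover have "f1 (tg (tri q' y' c') k) = q'" using q' t by (intro f_tg(1)) (auto simp: elts_D)
 moreover have "e sub tg (tri q' y' c') k" using t q' pq by simp
 ultimately show ?thesis using q'(5) by (intro bexI[of _ "tg (tri q' y' c') k"]) simp_all
qed

lemma out_sel: assumes "out p n s v u" "opr (opr gc n) z el p" "sel (rst p al) n s z z'" "p el PC" "z el gc" "n : M"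
 shows "T3 s v u el app dW z'"
proof -
 obtain z2 w where z2: "z2 el gc" "opr (opr gc n) z2 el p" "sel (rst p al) n s z2 w" "T3 s v u el app dW w" using assms(1) unfolding out_def by blast
 have M: "z : M" "z2 : M" using assms z2 by auto
 have "opr (opr gc n) z = opr (opr gc n) z2" by (rule PC_inj[OF assms(4,2) z2(2)]) (use M assms in simp)
 then have "z = z2" using M assms by simp
 then show ?thesis using sel_unique[OF assms(3) _ rst_cs[OF assms(4) al_M(1)]] z2 by blast
qed

text \<open>Extend \<open>q\<close> within the columns \<open>be\<close> so as to decide
  \<open>tx\<close> at \<open>n\<close>, the length of the node, and let \<open>a2\<close> and
  \<open>u\<close> be the two parts of the result. The code of the single triple leading from
  \<open>s\<close> to \<open>u\<close> is written in the free row \<open>n\<close>, so the longer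
  run has state \<open>u\<close> after step \<open>n\<close> and \<open>f2\<close> of the new
  element contains \<open>q\<close>.\<close>

lemma f2_lift: assumes e: "e el EE" and q: "q el cs de" "f2 e sub q" shows "EX e':elts EE. e sub e' & q sub f2 e'"
proof -
 obtain p y c k where t: "e = tg (tri p y c) k" "y : M" "c : M" "p : M" "tri p y c el D" "k el K2" "k : M" by (rule EE_E[OF e])
 then have tD: "tri p y c el D0" and fp: "fre p (dm y)" by (auto simp: D_tri)
 have T: "p el cs de" "run p (dm y) y c" "p el PC" using tD t cs_PC[OF de_M(1)] by (auto simp: D0_tri)
 define n where "n = dm y"
 define s where "s = supr r1 c n"
 note P = f2_parts[OF tD t(2-4,6), folded n_def, folded s_def]
 have nl: "n el lam" "n : M" using T by (auto simp: run_def n_def)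
 have qM: "q : M" "q el PC" using q cs_PC[OF de_M(1)] by auto
 have f2q: "un (un (rst p al) s) k sub q" using q(2) f_tg(2)[OF t(2-4,7) tD] t(1) by (simp add: n_def s_def)
 have sM: "s : M" "rst p al : M" by (simp_all add: s_def)
 have sq: "un (rst p al) s sub rst q be" using rst_mono[OF _ qM(1) al_M(2) f2q] P(2) by simp
 have "b0 sub rst q be" using cs_rst[OF al_M(2) b0(1) qM(1)] P(3) f2q by blast
 then obtain u' v where u': "u' el cs be" "rst q be sub u'" "v : M" "dec u' tx (opr n v)"
  using bdD[OF tx(2) rst_cs[OF qM(2) al_M(2)] _ nl(1)] by blast
 have uM: "u' : M" using u' by auto
 define a2 where "a2 = rst u' al"
 define u where "u = rs u'"
 have au: "a2 el cs al" "u el R" "un a2 u = u'" using split_be[OF u'(1)] by (auto simp: a2_def u_def)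
 have aM: "a2 : M" "u : M" using au by auto
 have le: "rst p al sub a2" "s sub u" using sq u'(2) P(4,5) sM uM qM unfolding a2_def u_def by (auto simp: el_R el_cs)
 have vl: "v el lam" by (rule tx(3)[OF cs_PC[OF al_M(2) u'(1)] _ nl(1) u'(3,4)]) (use \<open>b0 sub rst q be\<close> u' in blast)
 have "sing (T3 s v u) sub times R (times lam R)" using P(5) vl au aM sM by auto
 then obtain z where z: "z el gc" "app dW z = sing (T3 s v u)" using code by (metis sing(1))
 have Tz: "T3 s v' t el app dW z <-> v' = v & t = u" if "v' el lam" "t el R" for v' t
  using z that sM aM u'(3) by (auto dest: el_M)
 have okz: "ok a2 n s z" unfolding ok_def using Tz au vl le u' by simp
 define d' where "d' = un (un p a2) (sing (opr (opr gc n) z))"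
 note pu = put[OF T(3) nl(1) fp[folded n_def] au(1) le(1) z(1), folded d'_def]
 have d'M: "d' : M" using pu by auto
 have zM: "z : M" using z by auto
 have "d' el cs de" unfolding el_cs[OF de_M(1)]
 proof (intro conjI ballI pu(1))
  fix w assume "w el d'"
  then have "w el p | w el a2 | w = opr (opr gc n) z" using t(4) aM unfolding d'_def by auto
  then show "co w el de" using T(1) au(1) al_de de(3) zM nl by (auto simp: el_cs co_def)
 qed
 then obtain q' y' c' where q': "tri q' y' c' el D" "y' : M" "c' : M" "q' : M" "d' sub q'" "y sub y'" "c sub c'" "suc n sub dm y'"
  using D_ext[OF tD t(2-4) _ pu(3) reg_suc[OF lam nl(1)]] by blast
 have T': "q' el cs de" "run q' (dm y') y' c'" "q' el PC" "tri q' y' c' el D0" using q' cs_PC[OF de_M(1)] by (auto simp: D_tri D0_tri)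
 have n': "n el dm y'" using q'(8) nl by auto
 have "sel a2 n s z z" unfolding sel_def using okz z by blast
 then have sl: "sel (rst q' al) n s z z" by (rule sel_mono) (use rst_mono[OF d'M q'(4) al_M(1) q'(5)] pu(2) aM in auto)
 have fc: "func c n" "func c' (dm y')" using T T' by (auto simp: run_def n_def)
 have "n sub dm y'" using n' ord_tr[OF ord_el[OF ordl(1)]] T'(2) unfolding run_def by blast
 then have "supr r1 c' n = s" unfolding s_def by (intro supr_cong) (use func_sub(2)[OF fc q'(7) t(3) q'(3) nl(2) dm_M] in simp)
 then have o: "out q' n s (app y' n) (app c' n)" using run_inc(3)[OF T'(2) q'(3) n'] by simp
 have "T3 s (app y' n) (app c' n) el app dW z" by (rule out_sel[OF o _ sl T'(3) z(1) nl(2)]) (use pu(4) q'(5) in blast)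
 then have cu: "app c' n = u" using Tz out_facts[OF o] by blast
 \<comment> \<open>The entries of \<open>q\<close> in columns outside \<open>be\<close> become the
   second component of the new element.\<close>
 define kq where "kq = sep q (%z. ~ co z el be)"
 have kq: "elts kq = {z : elts q. ~ co z el be}" "kq : M" unfolding kq_def by (subst elts_sep, intro dfi al_M) (simp_all add: qM)
 have kK: "kq el K2" using cs_sub[OF de_M(1) q(1) kq(2)] kq by (auto simp: el_K2)
 have ksub: "k sub kq" using f2q t(6,7) sM kq(1) by (auto simp: el_K2)
 have eE: "tg (tri q' y' c') kq el EE" unfolding EE_iff using q' kK by blast
 have "e sub tg (tri q' y' c') kq" using t q' pu(3) ksub kq(2) by auto
 moreover have "q sub f2 (tg (tri q' y' c') kq)"
 proof
  fix w assume w: "w el q"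
  have "a2 sub rst q' al" using rst_mono[OF d'M q'(4) al_M(1) q'(5)] pu(2) by simp
  moreover have "u sub supr r1 c' (dm y')" using cu n' q'(3) by auto
  moreover have "w el a2 | w el u | w el kq"
  proof (cases "co w el be")
   case True then have "w el u'" using u'(2) w qM by auto
   then show ?thesis using au(3) aM by auto
  qed (use w kq in simp)
  ultimately show "w el f2 (tg (tri q' y' c') kq)" unfolding f_tg(2)[OF q'(2-4) kq(2) T'(4)] using q' kq(2) by auto
 qed
 ultimately show ?thesis using eE by blast
qed

text \<open>Nodes and states are subsets of sets of size less than \<open>mu\<close>, whose power
  sets are small as well. A column below \<open>mu\<close> therefore has room for codes of all of
  \<open>EE\<close>.\<close>

lemma bs_EE: "bs mu EE"
proof (rule bs_img[OF mu_reg])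
 have "r el R ==> r el cs be" for r by (simp add: el_R)
 then have "bs mu R" by (intro bs_sub[OF mu_reg cs_bs[OF al(2)]]) auto
 moreover have "bs mu K2" by (rule bs_sub[OF mu_reg cs_bs[OF de(1)]]) (auto simp: el_K2)
 ultimately show "bs mu (times (times (cs de) (times (pow (times lam lam)) (pow (times lam R)))) K2)"
  by (intro bs_times mu_reg mu_pow cs_bs[OF de(1)] bs_el[OF mu_reg lam_mu])
 show "dft (%e. tg (tri (p1 (p1 (e 0))) (p1 (p2 (p1 (e 0)))) (p2 (p2 (p1 (e 0))))) (p2 (e 0)))" by (intro dfi)
 fix e assume "e el EE"
 then obtain p y c k where t: "e = tg (tri p y c) k" "y : M" "c : M" "p : M" "tri p y c el D" "k el K2" "k : M" by (rule EE_E)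
 then have tD: "p el cs de" "run p (dm y) y c" by (auto simp: D_tri D0_tri)
 have n: "dm y el lam" "func y (dm y)" "func c (dm y)" using tD by (auto simp: run_def)
 have "app y i el lam & app c i el R & i el lam" if "i el dm y" for i
  using out_facts[OF run_inc(3)[OF tD(2) t(3) that]] lam_tr[OF n(1) that] by blast
 then have "y sub times lam lam" "c sub times lam R" unfolding func_elts[OF n(2) t(2) dm_M] func_elts[OF n(3) t(3) dm_M] by auto
 then show "EX x:elts (times (times (cs de) (times (pow (times lam lam)) (pow (times lam R)))) K2).
   e = tg (tri (p1 (p1 x)) (p1 (p2 (p1 x))) (p2 (p2 (p1 x)))) (p2 x)"
  using t tD by (intro bexI[of _ "opr (opr p (opr y c)) k"]) auto
qed simp

lemma EE_ne: assumes q: "q el cs de" "d0 sub q" obtains e where "e el EE" "q sub f1 e"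
proof -
 have "tri d0 zero zero el D0" using d0 run_zero by (auto simp: D0_tri run_dm[OF run_zero])
 then obtain q' y c where q': "tri q' y c el D" "y : M" "c : M" "q' : M" "q sub q'" using D_ext[OF _ zero(1) zero(1) de_M(3) q reg_zero[OF lam]] by metis
 have "zero el K2" using cs_zero by (simp add: el_K2)
 then have "tg (tri q' y c) zero el EE" unfolding EE_iff using q' by blast
 moreover have "f1 (tg (tri q' y c) zero) = q'" using q' by (intro f_tg(1)) (auto simp: elts_D)
 ultimately show thesis using that q' by metis
qed

end

section \<open>Absorbing a closed quotient into a collapse column\<close>

text \<open>The two projections \<open>f True\<close> and \<open>f False\<close> have the same
  properties, so each argument is made for an arbitrary side \<open>b\<close>. The injection
  \<open>io\<close> codes pairs of a number and an element of \<open>EE\<close> in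
  \<open>ka\<close>; the numbers provide the room for shifting.\<close>

locale absorb = levy_ground +
 fixes EE de ka w io e0 and f :: "bool => 'a => 'a"
 assumes E: "lcl EE" "e0 el EE" and f_dft: "!!b. dft (%e. f b (e 0))"
  and f_cs: "!!b e. e el EE ==> f b e el cs de"
  and f_mono: "!!b e e'. e el EE ==> e' el EE ==> e sub e' ==> f b e sub f b e'"
  and f_cont: "!!b e C i. e el EE ==> C : M ==> i : M ==> elts (f b (supr e C i)) = elts (f b e) Un (UN k:elts i. elts (f b (app C k)))"
  and f_lift: "!!b e q. e el EE ==> q el cs de ==> f b e sub q ==> EX e':elts EE. e sub e' & q sub f b e'"
  and de: "de el mu" "ka el mu" "de sub ka" and w: "is_omega w" "w : M" and io: "io : M"
   "!!n x. n el w ==> x el EE ==> app io (opr n x) el ka"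
   "!!n x n' x'. n el w ==> x el EE ==> n' el w ==> x' el EE ==> app io (opr n x) = app io (opr n' x') ==> n = n' & x = x'"
begin

abbreviation I where "I n x == app io (opr n x)"

lemma EM [simp]: "EE : M" "e0 : M" "de : M" "ka : M" "w : M" "io : M" using E de w io lcl_M by auto
lemma f_M: "x : M ==> f b x : M" using dft_M[OF f_dft, of "%_. x"] by simp
lemma dft_f [dfi]: "dft A ==> dft (%e. f b (A e))" by (rule dft1[OF f_dft])
lemma f_PC: "e el EE ==> f b e el PC" using f_cs cs_PC EM by blast

lemma w_ord: "ordinal w" using w by (simp add: is_omega_def limit_ordinal_def)
lemma w0: "zero el w" and w_suc: "n el w ==> suc n el w" using omega_zero omega_suc w by blast+
lemma w_cases: assumes "n el w" obtains "n = zero" | k where "k el w" "n = suc k"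
proof -
 have o: "ordinal n" "n : M" using assms w_ord ord_el by auto
 have "~ limit_ordinal n" using w assms unfolding is_omega_def by blast
 then consider "elts n = {}" | y where "y el n" "!!z. z el n ==> ~ y el z" using o unfolding limit_ordinal_def by blast
 then show thesis
 proof cases
  case 1
  then have "n = zero" using o by (intro zfc_ext) simp_all
  then show thesis by (rule that(1))
 next
  case 2
  have oy: "ordinal y" "y : M" using ord_el[OF o(1) 2(1)] 2 by auto
  have "z el n <-> z el suc y" if "z : M" for z
   using 2 ord_tri[of z y] ord_el[OF o(1), of z] ord_tr[OF o(1)] oy that by auto
  then have "n = suc y" using o by (intro eqI) auto
  then show thesis using that(2) ord_tr[OF w_ord assms] 2(1) by blast
 qed
qed

lemma suc_inj: "n : M ==> k : M ==> suc n = suc k ==> n = k" by (metis elts_suc insert_iff no_cycle)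
lemma I_inj: "n el w ==> x el EE ==> n' el w ==> x' el EE ==> I n x = I n' x' <-> n = n' & x = x'" using io(3) by blast
lemma I_ka: "n el w ==> x el EE ==> I n x ~= ka" using io(2) no_cycle(1) by (metis EM(4))

text \<open>The state is an element \<open>s\<close> of \<open>EE\<close>. A step \<open>a = \<langle>x, ka\<rangle>\<close> moves to \<open>x\<close>; a step \<open>\<langle>s, z\<rangle>\<close> with
 \<open>z\<close> in \<open>ka\<close> stays. On side \<open>b\<close>, where \<open>g\<close> is the eventual condition, the entry of the column \<open>ka\<close>
 is \<open>I 0 x\<close> for a move; to make room, stays with a legal code \<open>I n x\<close> are shifted to \<open>I (n+1) x\<close>.\<close>

definition leg :: "bool => 'a => 'a => 'a => 'a => 'a => bool" where
 "leg b g s z n x = (n el w & x el EE & s sub x & f b x sub g & z = I n x)"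
definition cdr :: "bool => 'a => 'a => 'a => 'a => bool" where
 "cdr b g s a t = ((p2 a = ka & t = I zero (p1 a)) | (p2 a ~= ka & (EX n:elts w. EX x:elts EE. leg b g s (p2 a) n x & t = I (suc n) x)) |
   (p2 a ~= ka & ~ (EX n:elts w. EX x:elts EE. leg b g s (p2 a) n x) & t = p2 a))"
definition cf :: "bool => 'a => 'a => 'a => 'a" where "cf b g s a = the1 (cdr b g s a)"
definition dcr :: "bool => 'a => 'a => 'a => 'a => bool" where
 "dcr b g s z a = ((EX x:elts EE. leg b g s z zero x & a = opr x ka) | (EX n:elts w. EX x:elts EE. leg b g s z (suc n) x & a = opr s (I n x)) |
   (~ (EX n:elts w. EX x:elts EE. leg b g s z n x) & a = opr s z))"
text \<open>\<open>g\<close> settles the legality of the code \<open>z\<close>: a candidate is legal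
  already, or excluded by incompatibility, so extending \<open>g\<close> makes no further
  difference.\<close>

definition dz :: "bool => 'a => 'a => 'a => bool" where
 "dz b g s z = (ALL n:elts w. ALL x:elts EE. s sub x --> z = I n x --> f b x sub g | ~ (EX r:elts PC. f b x sub r & g sub r))"

lemma dfn_leg: "dft A ==> dft B ==> dft C ==> dft D ==> dft X ==> dfn (%e. leg b (A e) (B e) (C e) (D e) (X e))"
 by (rule dfn5[of "leg b"]) (unfold leg_def, intro dfi EM)
lemma dfn_cdr: "dft A ==> dft B ==> dft C ==> dft D ==> dfn (%e. cdr b (A e) (B e) (C e) (D e))"
 by (rule dfn4[of "cdr b"]) (unfold cdr_def, intro dfi EM dfn_leg zero)
lemma dfn_dcr: "dft A ==> dft B ==> dft C ==> dft D ==> dfn (%e. dcr b (A e) (B e) (C e) (D e))"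
 by (rule dfn4[of "dcr b"]) (unfold dcr_def, intro dfi EM dfn_leg zero)
lemma dfn_dz [dfi]: "dft A ==> dft B ==> dft C ==> dfn (%e. dz b (A e) (B e) (C e))"
 by (rule dfn3[of "dz b"]) (unfold dz_def, intro dfi EM PC_M)
lemma dft_cf [dfi]: assumes "dft A" "dft B" "dft C" shows "dft (%e. cf b (A e) (B e) (C e))"
 unfolding cf_def by (intro dft_the1 dfn_cdr dft_w dft_var assms)

lemma leg_unique: "leg b g s z n x ==> leg b g s z n' x' ==> n = n' & x = x'" unfolding leg_def using I_inj by metis

lemma cdr_unique: "cdr b g s a t ==> cdr b g s a t' ==> t = t'"
 unfolding cdr_def using leg_unique by metis

lemma cf_eq: assumes "cdr b g s a t" "t : M" shows "cf b g s a = t"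
 unfolding cf_def by (rule the1_eq[of t "cdr b g s a", OF assms(2,1)]) (rule cdr_unique[OF _ assms(1)])

lemma cdr_ex: "EX t:M. cdr b g s a t"
proof (cases "p2 a = ka")
 case False
 then show ?thesis
 proof (cases "EX n:elts w. EX x:elts EE. leg b g s (p2 a) n x")
  case True
  then obtain n x where "n el w" "x el EE" "leg b g s (p2 a) n x" by blast
  then show ?thesis using False unfolding cdr_def by (intro bexI[of _ "I (suc n) x"]) auto
 qed (use False in \<open>auto simp: cdr_def intro!: bexI[of _ "p2 a"]\<close>)
qed (auto simp: cdr_def)

lemma cf_cdr: "cdr b g s a (cf b g s a)" using cdr_ex cf_eq by metis

definition vs :: "'a => 'a => bool" where "vs s a = ((EX x:elts EE. s sub x & a = opr x ka) | (EX z:elts ka. a = opr s z))"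

lemma dfn_vs [dfi]: "dft A ==> dft B ==> dfn (%e. vs (A e) (B e))"
 by (rule dfn2[of vs]) (unfold vs_def, intro dfi EM)

lemma vsD: "vs s a ==> s el EE ==> p1 a el EE & s sub p1 a & a = opr (p1 a) (p2 a) & (p2 a = ka | p2 a el ka & p1 a = s)"
 unfolding vs_def by (auto dest: el_M)

lemma cdr_ka: "cdr b g s a t ==> vs s a ==> s el EE ==> t el ka"
 using vsD io(2) w0 w_suc unfolding cdr_def by (metis no_cycle(1) EM(4))

text \<open>Moves get index 0 and shifted stays a successor index, and both kinds of codes are
  legal, whereas an unshifted stay has no legal code. So the three clauses have disjoint ranges, and
  \<open>io\<close> is injective on the first two.\<close>

lemma cdr_inj: assumes "cdr b g s a t" "cdr b g s a' t" and v: "vs s a" "vs s a'" "s el EE" and l: "f b (p1 a) sub g" "f b (p1 a') sub g"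
 shows "a = a'"
proof -
 note d = vsD[OF v(1,3)] and d' = vsD[OF v(2,3)]
 have mv: "leg b g s (I zero (p1 c)) zero (p1 c)" if "vs s c" "f b (p1 c) sub g" for c
  using vsD[OF that(1) v(3)] that w0 by (simp add: leg_def)
 have sh: "leg b g s (I (suc n) x) (suc n) x" if "leg b g s z n x" for z n x using that w_suc by (simp add: leg_def)
 have zs: "zero ~= suc n" if "n : M" for n using elts_suc[OF that] by (metis empty_not_insert zero(2))
 have 1: False if A: "p2 a = ka" "p2 a' ~= ka" "cdr b g s a t" "cdr b g s a' t" "vs s a" "vs s a'" "f b (p1 a) sub g" for a a'
 proof -
  have t: "t = I zero (p1 a)" using A(1,3) unfolding cdr_def by blast
  have x: "p1 a el EE" using vsD[OF A(5) v(3)] by blast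
  consider n x where "n el w" "x el EE" "t = I (suc n) x" | "~ (EX n:elts w. EX x:elts EE. leg b g s (p2 a') n x)" "t = p2 a'"
   using A(2,4) unfolding cdr_def by blast
  then show False
  proof cases
   case (1 n x')
   then show False using I_inj[OF w0 x w_suc[OF 1(1)] 1(2)] t zs[OF el_M[OF 1(1)]] by simp
  next
   case 2
   then show False using mv[OF A(5,7)] t w0 x by metis
  qed
 qed
 show ?thesis
 proof (cases "p2 a = ka")
  case True
  then have "p2 a' = ka" using 1 assms by blast
  then have "I zero (p1 a) = I zero (p1 a')" using True assms(1,2) unfolding cdr_def by metis
  then have "p1 a = p1 a'" using I_inj[of zero "p1 a" zero "p1 a'"] w0 d d' by blast
  then show ?thesis using d d' True \<open>p2 a' = ka\<close> by metis
 next
  case False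
  then have F': "p2 a' ~= ka" using 1[of a' a] assms by blast
  have "p2 a = p2 a'"
  proof (cases "EX n:elts w. EX x:elts EE. leg b g s (p2 a) n x")
   case True
   then obtain n x where n: "n el w" "leg b g s (p2 a) n x" "t = I (suc n) x" using assms(1) False unfolding cdr_def by blast
   have "EX n:elts w. EX x:elts EE. leg b g s t n x" using sh[OF n(2)] n w_suc unfolding leg_def by blast
   then obtain n' x' where n': "n' el w" "leg b g s (p2 a') n' x'" "t = I (suc n') x'" using assms(2) F' unfolding cdr_def by blast
   have "n = n'" "x = x'" using n n' I_inj[of "suc n" x "suc n'" x'] w_suc suc_inj unfolding leg_def by (metis el_M)+
   then show ?thesis using n n' unfolding leg_def by metis
  next
   case F: False
   then have t: "t = p2 a" using assms(1) False unfolding cdr_def by blast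
   then have "~ (EX n:elts w. EX x:elts EE. leg b g s (p2 a') n x & t = I (suc n) x)"
   proof (intro notI, elim bexE conjE)
    fix n x assume "n el w" "x el EE" "leg b g s (p2 a') n x" "t = I (suc n) x"
    then show False using F sh w_suc t by metis
   qed
   then show ?thesis using t assms(2) F' unfolding cdr_def by blast
  qed
  then show ?thesis using d d' False F' by metis
 qed
qed

lemma dcr_unique: "dcr b g s z a ==> dcr b g s z a' ==> a = a'"
proof -
 have zs: "zero ~= suc n" if "n el w" for n using elts_suc[of n] that by (metis empty_not_insert zero(2) el_M)
 have l: "n = n' & x = x'" if "leg b g s z n x" "leg b g s z n' x'" for n x n' x' using leg_unique that by blast
 show "dcr b g s z a ==> dcr b g s z a' ==> a = a'"
  unfolding dcr_def by (elim disjE bexE conjE; use l zs w0 w_suc suc_inj in \<open>metis el_M\<close>)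
qed

lemma dcr_ex: "EX a:M. dcr b g s z a"
proof (cases "EX n:elts w. EX x:elts EE. leg b g s z n x")
 case True
 then obtain n x where n: "n el w" "x el EE" "leg b g s z n x" by blast
 show ?thesis using n(1)
 proof (cases rule: w_cases)
  case 1 then show ?thesis using n unfolding dcr_def by (intro bexI[of _ "opr x ka"]) auto
 next
  case (2 k) then show ?thesis using n unfolding dcr_def by (intro bexI[of _ "opr s (I k x)"]) auto
 qed
qed (auto simp: dcr_def intro!: bexI[of _ "opr s z"])

text \<open>Decoding undoes the shift: index 0 is a move, a successor index goes down by one, an
  illegal code is a stay. The element \<open>x\<close> does not change, so legality stays settled
  for a decoded stay.\<close>

lemma dcr_cdr: assumes "dcr b g s z a" "z el ka" "s el EE" shows "cdr b g s a z" "vs s a" "f b s sub g ==> f b (p1 a) sub g" "dz b g s z ==> p2 a ~= ka ==> dz b g s (p2 a)"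
proof -
 have sM: "s : M" "z : M" using assms by auto
 consider (1) x where "x el EE" "leg b g s z zero x" "a = opr x ka" | (2) n x where "n el w" "x el EE" "leg b g s z (suc n) x" "a = opr s (I n x)"
  | (3) "~ (EX n:elts w. EX x:elts EE. leg b g s z n x)" "a = opr s z" using assms(1) unfolding dcr_def by blast
 then have "cdr b g s a z & vs s a & (f b s sub g --> f b (p1 a) sub g) & (dz b g s z --> p2 a ~= ka --> dz b g s (p2 a))"
 proof cases
  case 1
  then show ?thesis unfolding cdr_def vs_def leg_def by (auto dest: el_M)
 next
  case 2
  have L: "leg b g s (I n x) n x" using 2 unfolding leg_def by blast
  have p: "p1 a = s" "p2 a = I n x" using 2 sM by auto
  have "cdr b g s a z" unfolding cdr_def p using L 2 I_ka[of n x] unfolding leg_def by blast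
  moreover have "vs s a" unfolding vs_def using 2 io(2) by blast
  moreover have "dz b g s (p2 a)" unfolding dz_def p using I_inj 2 L unfolding leg_def by metis
  ultimately show ?thesis using p by simp
 next
  case 3
  have p: "p1 a = s" "p2 a = z" using 3 sM by auto
  have "z ~= ka" using assms(2) no_cycle(1) EM by blast
  then show ?thesis unfolding cdr_def vs_def p using 3 assms(2) by blast
 qed
 then show "cdr b g s a z" "vs s a" "f b s sub g ==> f b (p1 a) sub g" "dz b g s z ==> p2 a ~= ka ==> dz b g s (p2 a)" by blast+
qed

definition st :: "'a => 'a => 'a" where "st m i = un e0 (uni i (%k. p1 (app m k)))"
definition path :: "'a => 'a => bool" where "path m n = (n el lam & func m n & (ALL i:elts n. vs (st m i) (app m i)))"

lemma st_M [simp]: "st m i : M" by (simp add: st_def)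
lemma dft_st [dfi]: "dft A ==> dft B ==> dft (%e. st (A e) (B e))" by (rule dft2[of st]) (unfold st_def, intro dfi EM)
lemma elts_st: "m : M ==> i : M ==> elts (st m i) = elts e0 Un (UN k:elts i. elts (p1 (app m k)))"
 unfolding st_def by (subst elts_un, simp_all, subst elts_uni, intro dfi) auto

lemma st_cong: "(!!k. k el i ==> app m k = app m' k) ==> st m i = st m' i"
 unfolding st_def uni_def by (metis (no_types, lifting) image_cong)

text \<open>Closure of \<open>EE\<close> gives the limit state. Continuity of \<open>f b\<close>
  computes its image, so it stays inside any condition that contains the earlier images.\<close>

lemma st_lim: assumes m: "m : M" and i: "i el lam" and k: "!!k. k el i ==> p1 (app m k) el EE & st m k sub p1 (app m k)"
 shows "st m i el EE" "elts (f b (st m i)) = elts (f b e0) Un (UN k:elts i. elts (f b (p1 (app m k))))"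
proof -
 define c where "c = fn i (%k. p1 (app m k))"
 have M: "i : M" "c : M" "ordinal i" using i ordl ord_el by (auto simp: c_def)
 have c: "app c k = p1 (app m k)" if "k el i" for k unfolding c_def by (rule app_fn'[OF _ m M(1) that]) (intro dfi)
 have s: "st m k = supr e0 c k" if "k el suc i" for k
 proof -
  have kM: "k : M" using that M by auto
  have "l el i" if "l el k" for l using \<open>k el suc i\<close> that M ord_tr by auto
  then show ?thesis using c kM M m by (intro zfc_ext) (simp_all add: elts_st)
 qed
 have "supr e0 c i el EE" by (rule lclD[OF E(1,2) M(2) i]) (use k c s M in auto)
 then show "st m i el EE" using s[of i] M by simp
 have "elts (f b (supr e0 c i)) = elts (f b e0) Un (UN k:elts i. elts (f b (app c k)))" by (rule f_cont[OF E(2) M(2,1)])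
 then show "elts (f b (st m i)) = elts (f b e0) Un (UN k:elts i. elts (f b (p1 (app m k))))" using s[of i] c M by simp
qed

lemma st_EE: assumes p: "path m n" "m : M" and i: "i el suc n" shows "st m i el EE"
proof -
 have n: "n el lam" "n : M" "ordinal n" using p ordl ord_el by (auto simp: path_def)
 let ?Q = "%i. i el suc n --> st m i el EE"
 have "?Q i"
 proof (rule mem_induct[of ?Q])
  show "dfn (%e. ?Q (e 0))" by (intro dfi p EM) (use n in auto)
  show "i : M" using i n by auto
  fix i assume IH: "!!k. k el i ==> ?Q k" and iM: "i : M"
  show "?Q i"
  proof
   assume i: "i el suc n"
   have kn: "k el n" if k: "k el i" for k
   proof -
    have "i el n | i = n" using i n(2) by auto
    then show ?thesis using k ord_tr[OF n(3)] by blast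
   qed
   have "i el n | i = n" using i n(2) by auto
   then have il: "i el lam" using n(1) lam_tr[OF n(1)] by blast
   have "vs (st m k) (app m k) & st m k el EE" if "k el i" for k using p kn[OF that] IH[OF that] n unfolding path_def by auto
   then show "st m i el EE" by (intro st_lim(1)[OF p(2) il]) (use vsD in blast)
  qed
 qed
 then show ?thesis using i by blast
qed

lemma path_step: assumes p: "path m n" "m : M" and i: "i el n"
 shows "p1 (app m i) el EE" "st m i sub p1 (app m i)" "p1 (app m i) sub st m n" "vs (st m i) (app m i)" "st m i el EE" "st m n el EE"
proof -
 have n: "n : M" using p by (auto simp: path_def)
 show v: "vs (st m i) (app m i)" using p i unfolding path_def by blast
 show s: "st m i el EE" "st m n el EE" using st_EE[OF p] i n by auto
 show "p1 (app m i) el EE" "st m i sub p1 (app m i)" using vsD[OF v s(1)] by blast+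
 show "p1 (app m i) sub st m n" using i by (auto simp: elts_st p n)
qed

text \<open>\<open>gd m n\<close>: the eventual conditions of both sides decide which stays of the path are shifted.\<close>

definition gd :: "'a => 'a => bool" where
 "gd m n = (path m n & (ALL i:elts n. p2 (app m i) ~= ka --> dz True (f True (st m n)) (st m i) (p2 (app m i)) & dz False (f False (st m n)) (st m i) (p2 (app m i))))"
definition col :: "bool => 'a => 'a => 'a" where "col b m n = rep n (%i. opr (opr ka i) (cf b (f b (st m n)) (st m i) (app m i)))"
text \<open>The three parts live in the columns \<open>de\<close>, in the column \<open>ka\<close>
  and in all remaining columns; the last part \<open>u\<close> is shared by both sides.\<close>

definition img :: "bool => 'a => 'a => 'a => 'a" where "img b m n u = un (un (f b (st m n)) (col b m n)) u"
definition U where "U = sep PC (%u. ALL z:elts u. ~ co z el de & co z ~= ka)"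

lemma M2 [simp]: "col b m n : M" "img b m n u : M" "U : M" by (simp_all add: col_def img_def U_def)
lemma el_U: "u el U <-> u el PC & (ALL z:elts u. ~ co z el de & co z ~= ka)"
 unfolding U_def by (subst elts_sep, intro dfi EM) simp_all
lemma elts_col: "m : M ==> n : M ==> elts (col b m n) = (%i. opr (opr ka i) (cf b (f b (st m n)) (st m i) (app m i))) ` elts n"
 unfolding col_def by (rule elts_rep) (intro dfi EM st_M)+

lemma dfn_gd: "dft A ==> dft B ==> dfn (%e. gd (A e) (B e))"
 by (rule dfn2[of gd]) (unfold gd_def path_def, intro dfi EM lam_M)
lemma dft_img: assumes "dft A" "dft B" "dft C" shows "dft (%e. img b (A e) (B e) (C e))"
proof -
 have 1: "dft (%e. col b (e 0) (e 1))" unfolding col_def by (intro dfi EM)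
 show ?thesis unfolding img_def by (intro dft_un dft_f dft_st dft2[OF 1] assms)
qed

lemma gd_dz: "gd m n ==> i el n ==> p2 (app m i) ~= ka ==> dz b (f b (st m n)) (st m i) (p2 (app m i))"
 unfolding gd_def by (cases b) auto

lemma gd_M: "gd m n ==> n el lam & n : M & ordinal n" unfolding gd_def path_def using ordl ord_el by auto

lemma cf_ka: "gd m n ==> m : M ==> i el n ==> cf b g (st m i) (app m i) el ka"
 using cdr_ka[OF cf_cdr] path_step(4,5) unfolding gd_def by blast

lemma col_PC: assumes "gd m n" "m : M" shows "col b m n el PC"
proof -
 have n: "n el lam" "n : M" using gd_M[OF assms(1)] by auto
 have c: "cf b (f b (st m n)) (st m i) (app m i) : M" "cf b (f b (st m n)) (st m i) (app m i) el ka" if "i el n" for i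
  using cf_ka[OF assms that] by auto
 show ?thesis unfolding el_PC elts_col[OF assms(2) n(2)]
 proof (intro conjI ballI M2)
  show "bs lam (col b m n)" unfolding col_def by (rule bs_rep[OF lam bs_el[OF lam n(1)]]) (intro dfi EM assms n)
  show "inj_on p1 ((%i. opr (opr ka i) (cf b (f b (st m n)) (st m i) (app m i))) ` elts n)"
   unfolding inj_on_def using c by (auto dest: el_M)
 qed (use c de(2) lam_tr[OF n(1)] in blast)
qed

lemma img_facts: assumes g: "gd m n" "m : M" and u: "u el U"
 shows "img b m n u el PC" "rst (img b m n u) de = f b (st m n)"
  "i : M ==> t : M ==> opr (opr ka i) t el img b m n u <-> i el n & t = cf b (f b (st m n)) (st m i) (app m i)"
  "z el u <-> z el img b m n u & ~ co z el de & co z ~= ka"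
proof -
 have n: "n el lam" "n : M" using gd_M[OF g(1)] by auto
 have s: "st m n el EE" using st_EE[of m n n] g n by (auto simp: gd_def)
 have F: "f b (st m n) el cs de" "f b (st m n) : M" "!!z. z el f b (st m n) ==> co z el de" using f_cs[OF s] by (auto simp: el_cs)
 have uM: "u : M" "u el PC" "!!z. z el u ==> ~ co z el de & co z ~= ka" using u by (auto simp: el_U)
 have kd: "~ ka el de" using de(3) no_cycle(1)[of ka] by auto
 have c: "co z = ka" if z: "z el col b m n" for z
 proof -
  obtain i where i: "i el n" "z = opr (opr ka i) (cf b (f b (st m n)) (st m i) (app m i))" using z unfolding elts_col[OF g(2) n(2)] by blast
  have "i : M" "cf b (f b (st m n)) (st m i) (app m i) : M" using i(1) cf_ka[OF g i(1)] by (blast dest: el_M)+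
  then show ?thesis unfolding i(2) co_def by simp
 qed
 have e: "elts (img b m n u) = elts (f b (st m n)) Un elts (col b m n) Un elts u" using F uM by (simp add: img_def)
 have fc: "un (f b (st m n)) (col b m n) el PC"
 proof (rule PC_un[OF cs_PC[OF EM(3) F(1)] col_PC[OF g]])
  fix z v assume "z el f b (st m n)" "v el col b m n" "p1 z = p1 v"
  then show "z = v" using c F(3) kd by (metis co_def)
 qed
 show "img b m n u el PC" unfolding img_def
 proof (rule PC_un[OF fc uM(2)])
  fix z v assume z: "z el un (f b (st m n)) (col b m n)" "v el u" "p1 z = p1 v"
  then have "z el f b (st m n) | z el col b m n" using F by simp
  then show "z = v" using z c F(3) uM(3) by (metis co_def)
 qed
 show "rst (img b m n u) de = f b (st m n)"
  by (rule zfc_ext) (use F uM c kd e in auto)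
 show "z el u <-> z el img b m n u & ~ co z el de & co z ~= ka" unfolding e using F uM c by blast
 assume i: "i : M" "t : M"
 then have "co (opr (opr ka i) t) = ka" by (simp add: co_def)
 then have "~ opr (opr ka i) t el f b (st m n)" "~ opr (opr ka i) t el u"
  using F(3)[of "opr (opr ka i) t"] uM(3)[of "opr (opr ka i) t"] kd by auto
 then have "opr (opr ka i) t el img b m n u <-> opr (opr ka i) t el col b m n" unfolding e by blast
 also have "\<dots> <-> i el n & t = cf b (f b (st m n)) (st m i) (app m i)"
 proof
  assume "opr (opr ka i) t el col b m n"
  then obtain k where k: "k el n" "opr (opr ka i) t = opr (opr ka k) (cf b (f b (st m n)) (st m k) (app m k))"
   unfolding elts_col[OF g(2) n(2)] by blast
  then show "i el n & t = cf b (f b (st m n)) (st m i) (app m i)" using i el_M[OF k(1)] el_M[OF cf_ka[OF g k(1)]] by simp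
 qed (auto simp: elts_col[OF g(2) n(2)])
 finally show "opr (opr ka i) t el img b m n u <-> i el n & t = cf b (f b (st m n)) (st m i) (app m i)" .
qed

lemma leg_dz: assumes "dz b g s z" "g sub g'" "g' el PC" shows "leg b g s z n x <-> leg b g' s z n x"
proof
 assume l: "leg b g' s z n x"
 then have "f b x sub g | ~ (EX r:elts PC. f b x sub r & g sub r)" using assms(1) unfolding leg_def dz_def by blast
 then show "leg b g s z n x" using l assms unfolding leg_def by blast
qed (use assms in \<open>unfold leg_def, blast\<close>)

text \<open>Once legality is settled, the code of a step no longer changes when the eventual
  condition grows. This makes \<open>col\<close> grow with the path in
  \<open>img_mono\<close>.\<close>

lemma cf_dz: assumes "p2 a ~= ka ==> dz b g s (p2 a)" "g sub g'" "g' el PC" shows "cf b g s a = cf b g' s a"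
proof -
 have "cdr b g s a t = cdr b g' s a t" for t
 proof (cases "p2 a = ka")
  case False then show ?thesis unfolding cdr_def using leg_dz[OF assms(1)[OF False] assms(2,3)] by simp
 qed (simp add: cdr_def)
 then have "cdr b g s a = cdr b g' s a" by blast
 then show ?thesis by (simp add: cf_def)
qed

lemma img_mono: assumes g: "gd m n" "m : M" "u el U" "gd m' n'" "m' : M" "u' el U" and s: "m sub m'" "u sub u'"
 shows "img b m n u sub img b m' n' u'"
proof -
 have n: "n : M" "n' : M" "ordinal n" "ordinal n'" using gd_M g by auto
 have fm: "func m n" "func m' n'" using g by (auto simp: gd_def path_def)
 have a: "app m i = app m' i" "n sub n'" if "i el n" for i using func_sub[OF fm s(1) g(2,5) n(1,2)] that by auto
 have nn: "n sub n'" using func_sub(1)[OF fm s(1) g(2,5) n(1,2)] .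
 have ss: "st m i = st m' i" if "i sub n" for i by (rule st_cong) (use a that in blast)
 have E': "st m n el EE" "st m' n' el EE" using st_EE[of m n n] st_EE[of m' n' n'] g n by (auto simp: gd_def)
 have "st m n sub st m' n'" unfolding ss[OF order_refl] using nn g(5) n by (auto simp: elts_st)
 then have fs: "f b (st m n) sub f b (st m' n')" using f_mono E' by blast
 have "cf b (f b (st m n)) (st m i) (app m i) = cf b (f b (st m' n')) (st m' i) (app m' i)" if i: "i el n" for i
 proof -
  have "i sub n" using ord_tr[OF n(3) i] by blast
  then show ?thesis using cf_dz[of "app m i" b "f b (st m n)" "st m i", OF gd_dz[OF g(1) i] fs f_PC[OF E'(2)]] ss a[OF i] by simp
 qed
 then have "col b m n sub col b m' n'" unfolding elts_col[OF g(2) n(1)] elts_col[OF g(5) n(2)] using nn by auto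
 then show ?thesis using fs s(2) g f_M by (auto simp: img_def)
qed

text \<open>At a first disagreement of the two paths the states agree. Both codes can be computed
  with the larger condition, and injectivity of the coding makes the steps equal.\<close>

lemma img_refl: assumes g: "gd m n" "m : M" "u el U" "gd m' n'" "m' : M" "u' el U" and s: "img b m n u sub img b m' n' u'"
 shows "m sub m'" "u sub u'"
proof -
 note i1 = img_facts[OF g(1-3), where b=b] and i2 = img_facts[OF g(4-6), where b=b]
 have n: "n : M" "n' : M" "ordinal n" "ordinal n'" using gd_M g by auto
 show "u sub u'" using i1(4) i2(4) s by blast
 have E': "st m n el EE" "st m' n' el EE" using st_EE[of m n n] st_EE[of m' n' n'] g n by (auto simp: gd_def)
 have fs: "f b (st m n) sub f b (st m' n')" using rst_mono[OF _ _ EM(3) s] i1(2) i2(2) by simp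
 have c: "i el n' & cf b (f b (st m n)) (st m i) (app m i) = cf b (f b (st m' n')) (st m' i) (app m' i)" if i: "i el n" for i
  using i1(3)[of i "cf b (f b (st m n)) (st m i) (app m i)"] i2(3)[of i "cf b (f b (st m n)) (st m i) (app m i)"] s i cf_ka[OF g(1,2) i]
  by (auto dest: el_M)
 have nn: "n sub n'" using c by blast
 have p: "path m n" "path m' n'" using g by (auto simp: gd_def)
 have eq: "app m i = app m' i" if i: "i el n" for i
 proof (rule ccontr)
  assume "app m i ~= app m' i"
  moreover have "dfn (%e. app m (e 0) ~= app m' (e 0))" by (intro dfi g)
  ultimately obtain k where k: "k el n" "app m k ~= app m' k" "!!l. l el k ==> l el n ==> ~ app m l ~= app m' l"
   using minimal_in[OF _ n(1) i, of "%i. app m i ~= app m' i"] by blast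
  have s': "st m k = st m' k" by (rule st_cong) (use k ord_tr[OF n(3)] in blast)
  have kn': "k el n'" using nn k by blast
  note q = path_step[OF p(1) g(2) k(1)] and q' = path_step[OF p(2) g(5) kn']
  have "cf b (f b (st m n)) (st m k) (app m k) = cf b (f b (st m' n')) (st m k) (app m k)"
   by (rule cf_dz[OF gd_dz[OF g(1) k(1)] fs f_PC[OF E'(2)]])
  then have "cf b (f b (st m' n')) (st m k) (app m k) = cf b (f b (st m' n')) (st m k) (app m' k)" using c[OF k(1)] s' by simp
  then have "app m k = app m' k"
   using cdr_inj[OF cf_cdr, of b "f b (st m' n')" "st m k" "app m k" "app m' k"] cf_cdr q q' s' f_mono[OF q(1,6,3)] f_mono[OF q'(1,6,3)] fs by (metis subset_trans)
  then show False using k by blast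
 qed
 have "func m n" "func m' n'" using p by (auto simp: path_def)
 then show "m sub m'" by (rule func_subI[OF _ _ g(2,5) n(1,2) nn eq])
qed

lemma dz_mono: "dz b g s z ==> g sub g' ==> dz b g' s z" unfolding dz_def by (meson subset_trans)

text \<open>A code \<open>z\<close> is \<open>I n x\<close> for at most one \<open>x\<close>. Either
  \<open>f b x\<close> is compatible with \<open>g\<close> and can be added, or it is excluded
  already.\<close>

lemma dz_dec: assumes g: "g el cs de" shows "EX g':elts (cs de). g sub g' & dz b g' s z"
proof (cases "EX n:elts w. EX x:elts EE. s sub x & z = I n x & (EX r:elts PC. f b x sub r & g sub r)")
 case True
 then obtain n x r where n: "n el w" "x el EE" "z = I n x" "r el PC" "f b x sub r" "g sub r" by blast
 have r: "f b x sub rst r de" "g sub rst r de" using cs_rst[OF EM(3) f_cs[OF n(2)]] cs_rst[OF EM(3) g] n el_M[OF n(4)] by blast+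
 have "dz b (rst r de) s z" unfolding dz_def using n r I_inj by metis
 then show ?thesis using r rst_cs[OF n(4) EM(3)] by blast
next
 case False
 then show ?thesis using g unfolding dz_def by blast
qed

text \<open>The path of length \<open>n\<close> that on side \<open>b\<close> produces the column \<open>H\<close>.\<close>
definition mm where "mm b g H n m = (func m n & (ALL i:elts n. dcr b g (st m i) (app H i) (app m i)))"

lemma dfn_mm: "dft A ==> dft B ==> dft C ==> dft D ==> dfn (%e. mm b (A e) (B e) (C e) (D e))"
 by (rule dfn4[of "mm b"]) (unfold mm_def, intro dfi dfn_dcr)

lemma mm_ex: assumes g: "g : M" "H : M" "n : M" "ordinal n" shows "EX m:M. mm b g H n m"
proof -
 define K where "K i m = the1 (dcr b g (st m i) (app H i))" for i m
 have K: "dft (%e. K (e 0) (e 1))" unfolding K_def by (intro dft_the1 dfn_dcr dfi dft_w dft_var g)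
 have dr: "dft (%e. rec K (e 0))" by (rule dft_rec[OF K]) (intro dfi)
 define m where "m = fn n (rec K)"
 have m: "m : M" "func m n" unfolding m_def by (simp, rule func_fn[OF dr g(3)])
 have a: "app m i = rec K i" if "i el n" for i unfolding m_def by (rule app_fn[OF dr that g(3)])
 have "dcr b g (st m i) (app H i) (app m i)" if i: "i el n" for i
 proof -
  have s: "st (fn i (rec K)) i = st m i"
   by (rule st_cong) (use a ord_tr[OF g(4) i] app_fn[OF dr _ el_M[OF i]] in auto)
  have "rec K i = K i (fn i (rec K))" by (rule rec_unfold[OF K el_M[OF i]])
  then have "app m i = the1 (dcr b g (st m i) (app H i))" unfolding a[OF i] K_def[of i "fn i (rec K)"] s .
  moreover obtain t where "t : M" "dcr b g (st m i) (app H i) t" using dcr_ex by blast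
  ultimately show ?thesis using the1_eq[of t "dcr b g (st m i) (app H i)"] dcr_unique by metis
 qed
 then show ?thesis using m unfolding mm_def by blast
qed

lemma mm_facts: assumes m: "mm b g H n m" "m : M" "n el lam" and H: "!!i. i el n ==> app H i el ka" and g: "f b e0 sub g" "g : M"
 and i: "i el suc n" shows "st m i el EE & f b (st m i) sub g"
proof -
 have n: "n : M" "ordinal n" using m(3) ordl ord_el by auto
 let ?Q = "%i. i el suc n --> st m i el EE & f b (st m i) sub g"
 have "?Q i"
 proof (rule mem_induct[of ?Q])
  show "dfn (%e. ?Q (e 0))" by (intro dfi m EM g n suc_M)
  show "i : M" using i n(1) by auto
  fix i assume IH: "!!k. k el i ==> ?Q k" and iM: "i : M"
  show "?Q i"
  proof
   assume i: "i el suc n"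
   have i': "i el n | i = n" using i n(1) by auto
   have il: "i el lam" using i' m(3) lam_tr[OF m(3)] by blast
   have k: "p1 (app m k) el EE & st m k sub p1 (app m k) & f b (p1 (app m k)) sub g" if k: "k el i" for k
   proof -
    have kn: "k el n" using i' k ord_tr[OF n(2)] by blast
    have s: "st m k el EE" "f b (st m k) sub g" using IH[OF k] kn n(1) by auto
    have d: "dcr b g (st m k) (app H k) (app m k)" using m(1) kn unfolding mm_def by blast
    show ?thesis using dcr_cdr(2,3)[OF d H[OF kn] s(1)] vsD s by blast
   qed
   then have A: "!!k. k el i ==> p1 (app m k) el EE & st m k sub p1 (app m k)" by blast
   show "st m i el EE & f b (st m i) sub g"
    using st_lim(1)[OF m(2) il A] st_lim(2)[OF m(2) il A, of b] g(1) k by blast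
  qed
 qed
 then show ?thesis using i by blast
qed

lemma mm_path: assumes m: "mm b g H n m" "m : M" "n el lam" and H: "!!i. i el n ==> app H i el ka" and g: "f b e0 sub g" "g : M"
 shows "path m n"
 unfolding path_def
proof (intro conjI ballI m(3))
 show "func m n" using m(1) unfolding mm_def by blast
 fix i assume i: "i el n"
 have "st m i el EE" using mm_facts[OF m H g, of i] i m(3) by auto
 moreover have "dcr b g (st m i) (app H i) (app m i)" using m(1) i unfolding mm_def by blast
 ultimately show "vs (st m i) (app m i)" using dcr_cdr(2) H[OF i] by blast
qed

lemma mm_eq: assumes m: "mm b g H n m" "mm b g' H n m'" "m : M" "m' : M" "g sub g'" "g' el PC" and n: "ordinal n" "n : M"
 and d: "!!k. k el i ==> dz b g (st m' k) (app H k)" and i: "i el suc n" "k el i"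
 shows "app m k = app m' k"
proof -
 have sub: "k el n" if "k el i" for k using i(1) that n ord_tr[OF n(1)] by auto
 let ?Q = "%k. k el i --> app m k = app m' k"
 have "?Q k"
 proof (rule mem_induct[of ?Q])
  show "dfn (%e. ?Q (e 0))" using i by (intro dfi m) auto
  show "k : M" using i by auto
  fix k assume IH: "!!l. l el k ==> ?Q l" and kM: "k : M"
  show "?Q k"
  proof
   assume k: "k el i"
   have o: "l el i" if "l el k" for l using k that i(1) n ord_el[of n i] ord_tr[of i k l] ord_tr[OF n(1)] by auto
   have s: "st m k = st m' k" by (rule st_cong) (use IH o in blast)
   note kn = sub[OF k]
   have "dcr b g (st m k) (app H k) (app m k)" "dcr b g' (st m k) (app H k) (app m' k)" using m kn s unfolding mm_def by auto
   moreover have "leg b g (st m k) (app H k) n x <-> leg b g' (st m k) (app H k) n x" for n x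
    using leg_dz[OF d[OF k] m(5,6)] s by simp
   ultimately have "dcr b g (st m k) (app H k) (app m' k)" by (simp add: dcr_def)
   then show "app m k = app m' k" using dcr_unique \<open>dcr b g (st m k) (app H k) (app m k)\<close> by blast
  qed
 qed
 then show ?thesis using i by blast
qed

text \<open>There is a circle: the decoded path depends on \<open>g\<close>, and which codes
  \<open>g\<close> has to settle depends on the path. It is broken by settling code \<open>i\<close>
  along the path decoded at stage \<open>i\<close>; by \<open>mm_eq\<close>, later stages do not
  change that path below \<open>i\<close>.\<close>

lemma mm_dz: assumes n: "n el lam" and g0: "g0 el cs de" "f b e0 sub g0" and H: "H : M" "!!i. i el n ==> app H i el ka"
 obtains g m where "g el cs de" "g0 sub g" "m : M" "mm b g H n m" "!!i. i el n ==> dz b g (st m i) (app H i)"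
proof -
 have nM: "n : M" "ordinal n" using n ordl ord_el by auto
 define St where "St i g g' = (EX m:M. mm b g H n m & dz b g' (st m i) (app H i))" for i g g'
 have dSt: "dfn (%e. St (e 0) (e 1) (e 2))" unfolding St_def by (intro dfi dfn_mm nM H)
 have step: "EX g':elts (cs de). g sub g' & St i g g'" if g: "g el cs de" for i g
 proof -
  obtain m where "m : M" "mm b g H n m" using mm_ex[OF el_M[OF g] H(1) nM] by blast
  moreover obtain g' where "g' el cs de" "g sub g'" "dz b g' (st m i) (app H i)" using dz_dec[OF g] by blast
  ultimately show ?thesis unfolding St_def by blast
 qed
 obtain C where C: "C : M" "func C n" "!!i. i el suc n ==> supr g0 C i el cs de"
  "!!i. i el n ==> app C i el cs de & supr g0 C i sub app C i & St i (supr g0 C i) (app C i)"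
  by (rule lcl_chain[OF lcl_cs[OF EM(3)] n g0(1) dSt]) (use step in blast)+
 define g where "g = supr g0 C n"
 have g: "g el cs de" unfolding g_def using C(3) nM by auto
 have gM: "g : M" "g el PC" "g0 : M" using g g0 cs_PC[OF EM(3)] by auto
 obtain m where m: "m : M" "mm b g H n m" using mm_ex[OF gM(1) H(1) nM] by blast
 have ig: "app C k sub g" if "k el n" for k unfolding g_def using that C(1) gM nM by auto
 let ?Q = "%i. i el n --> dz b (app C i) (st m i) (app H i)"
 have q: "?Q i" if "i : M" for i
 proof (rule mem_induct[of ?Q])
  show "dfn (%e. ?Q (e 0))" by (intro dfi m H C nM)
  fix i assume IH: "!!k. k el i ==> ?Q k" and iM: "i : M"
  show "?Q i"
  proof
   assume i: "i el n"
   define s where "s = supr g0 C i"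
   have s: "s el cs de" "s : M" unfolding s_def using C(3)[of i] i nM by auto
   have sg: "s sub g" using C(4)[OF i] ig[OF i] unfolding s_def by blast
   have cs: "app C k sub s" if "k el i" for k unfolding s_def using that C(1) gM iM by auto
   obtain ms where ms: "ms : M" "mm b s H n ms" "dz b (app C i) (st ms i) (app H i)"
    using C(4)[OF i] unfolding St_def s_def by blast
   have ieq: "app ms k = app m k" if "k el i" for k
   proof (rule mm_eq[OF ms(2) m(2) ms(1) m(1) sg gM(2) nM(2,1) _ _ that])
    show "i el suc n" using i nM by simp
    fix l assume l: "l el i"
    have "dz b (app C l) (st m l) (app H l)" using IH[OF l] ord_tr[OF nM(2) i l] by blast
    then show "dz b s (st m l) (app H l)" using dz_mono cs[OF l] by blast
   qed
   have "st ms i = st m i" by (rule st_cong) (use ieq in blast)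
   then show "dz b (app C i) (st m i) (app H i)" using ms(3) by simp
  qed
 qed (use that in blast)
 have "dz b g (st m i) (app H i)" if i: "i el n" for i using q[OF el_M[OF i]] dz_mono[OF _ ig[OF i]] i by blast
 moreover have "g0 sub g" unfolding g_def using C(1) gM nM by auto
 ultimately show thesis using that[of g m] g m by blast
qed

text \<open>Column \<open>ka\<close> of \<open>p\<close> is decoded to a path after its codes have
  been settled on side \<open>b\<close>. Then the stays are settled on the other side, too, and a
  last move leads to an element \<open>e''\<close> whose image on side \<open>b\<close> contains all
  that was used. The resulting path is good, and its image contains \<open>p\<close>.\<close>

lemma dense: assumes p: "p el PC" "f b e0 sub p"
 obtains m n u where "m : M" "gd m n" "u el U" "p sub img b m n u"
proof -
 have pM: "p : M" using p by auto
 define g0 where "g0 = rst p de"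
 define u where "u = sep p (%z. ~ co z el de & co z ~= ka)"
 have u: "elts u = {z : elts p. ~ co z el de & co z ~= ka}" "u : M"
  unfolding u_def by (subst elts_sep, intro dfi EM) (simp_all add: pM)
 have uU: "u el U" unfolding el_U using PC_sub[OF p(1) u(2)] u(1) by blast
 have g0: "g0 el cs de" "f b e0 sub g0" unfolding g0_def using rst_cs[OF p(1)] cs_rst[OF EM(3) f_cs[OF E(2)] pM p(2)] by auto
 obtain n where n: "n el lam" "!!z. z el p ==> p2 (p1 z) el n" by (rule PC_rows[OF p(1)]) blast
 have nM: "n : M" "ordinal n" using n(1) ordl ord_el by auto
 have k0: "zero el ka"
 proof -
  have o: "ordinal ka" using reg_ord[OF mu_reg] ord_el de(2) by blast
  have "I zero e0 el ka" by (rule io(2)[OF w0 E(2)])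
  then have "elts ka ~= {}" by blast
  then show ?thesis using ord_tri[OF ord_zero o] by auto
 qed
 \<comment> \<open>Rows of column \<open>ka\<close> that are missing in \<open>p\<close> are filled
   with 0, so that \<open>H\<close> is total on \<open>n\<close>.\<close>
 define hh where "hh i = the1 (%t. opr (opr ka i) t el p | ~ (EX t:elts ka. opr (opr ka i) t el p) & t = zero)" for i
 define H where "H = fn n hh"
 have hd: "dft (%e. hh (e 0))" unfolding hh_def by (intro dft_the1 dfi EM zero dft_w dft_var pM)
 have un1: "t = t'" if "opr (opr ka i) t el p" "opr (opr ka i) t' el p" "i : M" "t : M" "t' : M" for i t t'
  using PC_inj[OF p(1) that(1,2)] that by simp
 have inka: "t el ka" if "opr (opr ka i) t el p" "i : M" "t : M" for i t
  by (rule PC_z[OF p(1) that(1)]) (use that in \<open>auto dest: el_M\<close>)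
 have hh1: "hh i = t" if "opr (opr ka i) t el p" "i : M" "t : M" for i t unfolding hh_def
  by (rule the1_eq[OF that(3)]) (use that un1 inka in blast)+
 have hh2: "hh i el ka" if "i : M" for i
 proof (cases "EX t:elts ka. opr (opr ka i) t el p")
  case True then show ?thesis using hh1[OF _ that] by (metis el_M)
 next
  case False
  have "hh i = zero" unfolding hh_def
   by (rule the1_eq) (use that False inka in \<open>simp, blast+\<close>)
  then show ?thesis using k0 by simp
 qed
 have H: "H : M" "!!i. i el n ==> app H i = hh i" unfolding H_def using app_fn[OF hd _ nM(1)] by simp_all
 have Hka: "app H i el ka" if "i el n" for i using hh2[OF el_M[OF that]] H(2)[OF that] by simp
 obtain g m where g: "g el cs de" "g0 sub g" "m : M" "mm b g H n m" "!!i. i el n ==> dz b g (st m i) (app H i)"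
  by (rule mm_dz[OF n(1) g0 H(1) Hka]) (assumption, rule that)
 have gM: "g : M" "f b e0 sub g" using g g0 by auto
 have F: "st m i el EE & f b (st m i) sub g" if "i el suc n" for i by (rule mm_facts[OF g(4,3) n(1) _ gM(2,1) that]) (rule Hka)
 have P: "path m n" by (rule mm_path[OF g(4,3) n(1) _ gM(2,1)]) (rule Hka)
 have S: "st m i el EE" "f b (st m i) sub g" "st m i sub st m n" if i: "i el suc n" for i
 proof -
  show "st m i el EE" "f b (st m i) sub g" using F[OF i] by auto
  have "i = n | i el n" using i nM(1) by auto
  then have "i sub n" using ord_tr[OF nM(2)] by blast
  then show "st m i sub st m n" using g(3) nM el_M[OF i] by (auto simp: elts_st)
 qed
 have nn: "n el suc n" using nM by simp
 obtain e' where e': "e' el EE" "st m n sub e'" "g sub f b e'" using f_lift[OF S(1)[OF nn] g(1) S(2)[OF nn]] by blast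
 \<comment> \<open>The decoded stays have to be settled on the side \<open>~ b\<close> as well.
   There are fewer than \<open>lam\<close> such requirements, and each persists.\<close>
 define Q where "Q i e = (p2 (app m i) ~= ka --> dz (~ b) (f (~ b) e) (st m i) (p2 (app m i)))" for i e
 obtain e'' where e: "e'' el EE" "e' sub e''" "!!i. i el n ==> Q i e''"
 proof (rule lcl_all[OF E(1) n(1) e'(1), of Q])
  show "dfn (%e. Q (e 0) (e 1))" unfolding Q_def by (intro dfi g EM)
  show "Q i r" if "q el EE" "r el EE" "q sub r" "Q i q" for i q r
   using that f_mono[of q r "~ b"] dz_mono unfolding Q_def by blast
  show "EX r:elts EE. q sub r & Q i r" if q: "q el EE" for i q
  proof -
   obtain g' where g': "g' el cs de" "f (~ b) q sub g'" "dz (~ b) g' (st m i) (p2 (app m i))" using dz_dec[OF f_cs[OF q]] by blast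
   obtain r where "r el EE" "q sub r" "g' sub f (~ b) r" using f_lift[OF q g'(1,2)] by blast
   then show ?thesis using dz_mono[OF g'(3)] unfolding Q_def by blast
  qed
 qed blast
 have eM: "e'' : M" using e by auto
 have ge: "g sub f b e''" using f_mono[OF e'(1) e(1,2)] e'(3) by blast
 \<comment> \<open>The additional step \<open>n\<close> moves to \<open>e''\<close>, which is thus
   the final state of the path of length \<open>suc n\<close>.\<close>
 define a where "a = opr e'' ka"
 define m' where "m' = snoc m n a"
 have a: "a : M" "p1 a = e''" "p2 a = ka" using eM by (auto simp: a_def)
 have fm: "func m n" using P by (simp add: path_def)
 note sn = func_snoc[OF fm g(3) nM(1) a(1), folded m'_def]
 have m'M: "m' : M" by (simp add: m'_def snoc_def)
 have st': "st m' i = st m i" if "i el suc n" for i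
 proof (rule st_cong)
  fix k assume k: "k el i"
  have "i = n | i el n" using that nM(1) by auto
  then have "k el n" using k ord_tr[OF nM(2)] by blast
  then show "app m' k = app m k" by (rule sn(3))
 qed
 have "elts (st m' (suc n)) = elts (st m n) Un elts e''"
 proof -
  have "elts (st m' (suc n)) = elts (st m' n) Un elts (p1 (app m' n))" using m'M nM by (auto simp: elts_st)
  then show ?thesis using st'[OF nn] sn(2) a by simp
 qed
 then have st2: "st m' (suc n) = e''" using e(2) e'(2) eM by (intro zfc_ext) auto
 have nl: "suc n el lam" by (rule reg_suc[OF lam n(1)])
 have se: "st m n sub e''" using e(2) e'(2) by blast
 have dzb: "dz b (f b e'') (st m i) (p2 (app m i))" if i: "i el n" "p2 (app m i) ~= ka" for i
 proof -
  have d: "dcr b g (st m i) (app H i) (app m i)" using g(4) i unfolding mm_def by blast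
  show ?thesis by (rule dz_mono[OF dcr_cdr(4)[OF d Hka[OF i(1)] S(1) g(5)[OF i(1)] i(2)] ge]) (use i nM in simp)
 qed
 have G: "gd m' (suc n)" unfolding gd_def st2
 proof (intro conjI ballI impI)
  show "path m' (suc n)" unfolding path_def
  proof (intro conjI ballI nl sn(1))
   fix i assume i: "i el suc n"
   show "vs (st m' i) (app m' i)"
   proof (cases "i = n")
    case True then show ?thesis using st'[OF i] sn(2) e(1) se unfolding vs_def a_def by auto
   next
    case False
    then have "i el n" using i nM by auto
    then show ?thesis using st'[OF i] sn(3) P unfolding path_def by auto
   qed
  qed
  fix i assume i: "i el suc n" "p2 (app m' i) ~= ka"
  then have "i ~= n" using sn(2) a by auto
  then have i': "i el n" using i nM by auto
  have "dz b' (f b' e'') (st m i) (p2 (app m i))" for b'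
  proof (cases "b' = b")
   case True then show ?thesis using dzb[OF i'] i(2) sn(3)[OF i'] by simp
  next
   case False
   then have "b' = (~ b)" by auto
   then show ?thesis using e(3)[OF i'] i(2) sn(3)[OF i'] unfolding Q_def by simp
  qed
  then show "dz True (f True e'') (st m' i) (p2 (app m' i))" "dz False (f False e'') (st m' i) (p2 (app m' i))"
   using st'[OF i(1)] sn(3)[OF i'] by auto
 qed
 have cfH: "cf b (f b e'') (st m i) (app m i) = app H i" if i: "i el n" for i
 proof -
  have d: "dcr b g (st m i) (app H i) (app m i)" using g(4) i unfolding mm_def by blast
  have s: "st m i el EE" using S(1) i nM by simp
  note D = dcr_cdr[OF d Hka[OF i] s]
  have "cf b g (st m i) (app m i) = cf b (f b e'') (st m i) (app m i)"
   by (rule cf_dz[OF D(4)[OF g(5)[OF i]] ge f_PC[OF e(1)]])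
  moreover have "cf b g (st m i) (app m i) = app H i" by (rule cf_eq[OF D(1)]) (simp add: H)
  ultimately show ?thesis by simp
 qed
 have "p sub img b m' (suc n) u"
 proof
  fix z assume z: "z el p"
  obtain c i t where zz: "c el mu" "i el lam" "t el c" "z = opr (opr c i) t" "co z = c" by (rule PC_z[OF p(1) z])
  have M: "i : M" "t : M" "c : M" using zz by auto
  have e: "elts (img b m' (suc n) u) = elts (f b e'') Un elts (col b m' (suc n)) Un elts u"
   using f_M[OF eM] u by (simp add: img_def st2)
  consider "c el de" | "c = ka" | "~ c el de" "c ~= ka" by blast
  then show "z el img b m' (suc n) u"
  proof cases
   case 1
   then have "z el g0" using z zz pM by (simp add: g0_def)
   then show ?thesis unfolding e using g(2) ge by blast
  next
   case 2
   have "i el n" using n(2)[OF z] zz M by simp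
   moreover have "t = app H i" using hh1[of i t] z zz 2 M H(2)[OF calculation] by simp
   ultimately have "z = opr (opr ka i) (cf b (f b (st m' (suc n))) (st m' i) (app m' i))"
    using cfH st'[of i] sn(3) nM zz 2 by (simp add: st2)
   then show ?thesis unfolding e elts_col[OF m'M suc_M] using \<open>i el n\<close> nM by auto
  next
   case 3 then show ?thesis unfolding e using u z zz by auto
  qed
 qed
 then show thesis using that[OF m'M G uU] by blast
qed

end

section \<open>Isomorphisms of dense suborders\<close>

context forcing begin

lemma forces_feq: "forces f p e ==> p el PP ==> ALL i. e i : M & e' i : M & feq p (e i) (e' i) ==> forces f p e'"
proof (induction f arbitrary: p e e')
 case (Mem i k)
 then have "fmem p (e' i) (e k)" using feq_fmem[of p "e i" "e' i" "e k"] by auto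
 then show ?case using fmem_feq[of p "e' i" "e k" "e' k"] Mem by auto
next
 case (Eq i k)
 then have "feq p (e' i) (e i)" using feq_sym by auto
 then have "feq p (e' i) (e k)" using feq_trans[of p "e' i" "e i" "e k"] Eq by auto
 then show ?case using feq_trans[of p "e' i" "e k" "e' k"] Eq by auto
next
 case (Neg f)
 show ?case unfolding forces.simps
 proof (intro ballI impI notI)
  fix q assume q: "q el PP" "p sub q" "forces f q e'"
  have "feq q (e' i) (e i)" for i using feq_mono[OF _ q(2) Neg.prems(2) q(1)] feq_sym[OF q(1)] Neg.prems(3) by blast
  then have "forces f q e" using Neg.IH[OF q(3,1)] Neg.prems(3) by blast
  then show False using Neg.prems(1) q by auto
 qed
next
 case (Conj f g)
 then show ?case by (metis forces.simps(4))
next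
 case (All i f)
 show ?case unfolding forces.simps
 proof
  fix a assume a: "a : M"
  have "forces f p (e(i := a))" using All.prems(1) a by simp
  then show "forces f p (e'(i := a))" by (rule All.IH[OF _ All.prems(2)]) (use All.prems a feq_refl in simp)
 qed
qed

text \<open>\<open>Z\<close> is an isomorphism between dense suborders of two cones; \<open>trn Z\<close> carries names along it.\<close>

definition iso :: "('a => 'a => bool) => bool" where
 "iso Z = (dfn (%e. Z (e 0) (e 1)) & (ALL p q. Z p q --> p el PP & q el PP) &
   (ALL p q p' q'. Z p q --> Z p' q' --> (p sub p') = (q sub q')) &
   (ALL p q. Z p q --> (ALL r:elts PP. p sub r --> (EX p' q'. Z p' q' & r sub p'))) &
   (ALL p q. Z p q --> (ALL r:elts PP. q sub r --> (EX p' q'. Z p' q' & r sub q'))))"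

lemma fmemE: assumes "fmem p x b" "p el PP"
 obtains r y t where "r el PP" "p sub r" "y : M" "t el PP" "opr y t el b" "t sub r" "feq r x y"
 by (rule dnsE[OF assms(1)[unfolded fmem_def] assms(2)]) (elim bexE conjE, rule that)

lemma iso_flip: "iso Z ==> iso (%q p. Z p q)"
 unfolding iso_def using dfn2[of Z "%e. e 1" "%e. e 0"] dft_var by meson

text \<open>Conditions in a name need not be matched by \<open>Z\<close>. So \<open>t\<close> is
  replaced by all \<open>s\<close> that extend the partner \<open>p\<close> of some matched
  \<open>q\<close> extending \<open>t\<close>.\<close>

definition tro :: "('a => 'a => bool) => 'a => 'a => bool" where "tro Z s t = (EX p:M. EX q:M. Z p q & p sub s & t sub q)"
definition tK :: "('a => 'a => bool) => 'a => 'a => 'a" where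
 "tK Z x T = rep (sep (times x PP) (%w. EX y:M. EX t:elts PP. p1 w = opr y t & tro Z (p2 w) t)) (%w. opr (app T (p1 (p1 w))) (p2 w))"
definition trn :: "('a => 'a => bool) => 'a => 'a" where "trn Z = rect (tK Z)"

context
 fixes Z assumes Z: "iso Z"
begin

lemma Z_dfn: "dft A ==> dft B ==> dfn (%e. Z (A e) (B e))" by (rule dfn2[OF conjunct1[OF Z[unfolded iso_def]]])
lemma Z_PP: "Z p q ==> p el PP" "Z p q ==> q el PP" using conjunct1[OF conjunct2[OF Z[unfolded iso_def]]] by blast+
lemma Z_M: "Z p q ==> p : M & q : M" using Z_PP by blast
lemma Z_ord: "Z p q ==> Z p' q' ==> (p sub p') = (q sub q')"
 using conjunct1[OF conjunct2[OF conjunct2[OF Z[unfolded iso_def]]]] by blast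
lemma Z_1: assumes "Z p q" "r el PP" "p sub r" obtains p' q' where "Z p' q'" "r sub p'" "p sub p'" "q sub q'" "p' el PP" "q' el PP"
proof -
 obtain p' q' where "Z p' q'" "r sub p'" using conjunct1[OF conjunct2[OF conjunct2[OF conjunct2[OF Z[unfolded iso_def]]]]] assms by blast
 then show thesis using that[of p' q'] Z_ord[OF assms(1)] Z_PP assms(3) by blast
qed
lemma Z_2: assumes "Z p q" "r el PP" "q sub r" obtains p' q' where "Z p' q'" "r sub q'" "p sub p'" "q sub q'" "p' el PP" "q' el PP"
proof -
 obtain p' q' where "Z p' q'" "r sub q'" using conjunct2[OF conjunct2[OF conjunct2[OF conjunct2[OF Z[unfolded iso_def]]]]] assms by blast
 then show thesis using that[of p' q'] Z_ord[OF assms(1)] Z_PP assms(3) by blast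
qed

lemma tro_dfn: "dft A ==> dft B ==> dfn (%e. tro Z (A e) (B e))"
 by (rule dfn2[of "tro Z"]) (unfold tro_def, intro dfi Z_dfn)

lemma troI: "Z p q ==> t sub q ==> tro Z p t" unfolding tro_def using Z_M by blast
lemma troD: "tro Z s t ==> Z p q ==> s sub p ==> t sub q" unfolding tro_def using Z_ord by blast

lemma tK_dft: "dft (%e. tK Z (e 0) (e 1))" unfolding tK_def by (intro dfi tro_dfn PP)

lemma dft_trn: "dft A ==> dft (%e. trn Z (A e))" unfolding trn_def using dft_rect[of "tK Z", OF tK_dft] .
lemma trn_M: "x : M ==> trn Z x : M" using dft_M[OF dft_trn[OF dft_var[of 0]], of "%_. x"] by simp

lemma opr_trn: assumes a: "a : M" and "x : M" "s : M"
 shows "opr x s el trn Z a <-> (EX y:M. EX t:elts PP. x = trn Z y & opr y t el a & s el PP & tro Z s t)"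
proof -
 let ?T = "tab (tK Z) a"
 have T: "?T : M" by (rule tab_M[of "tK Z", OF tK_dft])
 have e: "elts (sep (times a PP) (%w. EX y:M. EX t:elts PP. p1 w = opr y t & tro Z (p2 w) t)) =
   {w : elts (times a PP). EX y:M. EX t:elts PP. p1 w = opr y t & tro Z (p2 w) t}"
  by (rule elts_sep, intro dfi tro_dfn PP) simp
 have "elts (trn Z a) = (%w. opr (app ?T (p1 (p1 w))) (p2 w)) ` {w : elts (times a PP). EX y:M. EX t:elts PP. p1 w = opr y t & tro Z (p2 w) t}"
  unfolding trn_def rect_def[of _ a] tK_def[of Z a ?T] e[symmetric] by (rule elts_rep, intro dfi T) simp
 also have "\<dots> = {opr (app ?T y) s |y t s. y : M & t el PP & opr y t el a & s el PP & tro Z s t}" (is "?A = ?B")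
 proof
  show "?A <= ?B"
  proof (rule image_subsetI)
   fix w assume w: "w : {w : elts (times a PP). EX y:M. EX t:elts PP. p1 w = opr y t & tro Z (p2 w) t}"
   then have "w el times a PP" by blast
   then obtain z s where zs: "z el a" "s el PP" "w = opr z s" using a PP(1) by (auto simp: elts_times)
   obtain y t where y: "p1 w = opr y t" "y : M" "t el PP" "tro Z (p2 w) t" using w by blast
   have e: "z = opr y t" "p2 w = s" "p1 (p1 w) = y" using zs y el_M[OF zs(1)] el_M[OF zs(2)] el_M[OF y(3)] by auto
   show "opr (app ?T (p1 (p1 w))) (p2 w) : ?B" unfolding e(2,3) mem_Collect_eq
    by (intro exI[of _ y] exI[of _ t] exI[of _ s] conjI refl) (use zs(1,2) y(2-4) e(1,2) in simp_all)
  qed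
  show "?B <= ?A"
  proof
   fix u assume "u : ?B"
   then obtain y t s where u: "u = opr (app ?T y) s" "y : M" "t el PP" "opr y t el a" "s el PP" "tro Z s t" by blast
   then have "opr (opr y t) s : {w : elts (times a PP). EX y:M. EX t:elts PP. p1 w = opr y t & tro Z (p2 w) t}" using a PP by auto
   moreover have "u = opr (app ?T (p1 (p1 (opr (opr y t) s)))) (p2 (opr (opr y t) s))" using u by auto
   ultimately show "u : ?A" by blast
  qed
 qed
 also have "\<dots> = {opr (trn Z y) s |y t s. y : M & t el PP & opr y t el a & s el PP & tro Z s t}"
  unfolding trn_def using rect_pair[OF tK_dft _ _ _ a] el_M by (metis (no_types, lifting))
 finally have E: "elts (trn Z a) = {opr (trn Z y) s |y t s. y : M & t el PP & opr y t el a & s el PP & tro Z s t}" .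
 have "opr x s el trn Z a <-> (EX y t s'. opr x s = opr (trn Z y) s' & y : M & t el PP & opr y t el a & s' el PP & tro Z s' t)"
  unfolding E by blast
 also have "\<dots> <-> (EX y:M. EX t:elts PP. x = trn Z y & opr y t el a & s el PP & tro Z s t)"
 proof
  assume "EX y t s'. opr x s = opr (trn Z y) s' & y : M & t el PP & opr y t el a & s' el PP & tro Z s' t"
  then obtain y t s' where *: "opr x s = opr (trn Z y) s'" "y : M" "t el PP" "opr y t el a" "s' el PP" "tro Z s' t" by blast
  have "x = trn Z y & s = s'" using *(1) opr_inj[OF assms(2,3) trn_M[OF *(2)] el_M[OF *(5)]] by simp
  then show "EX y:M. EX t:elts PP. x = trn Z y & opr y t el a & s el PP & tro Z s t" using * by blast
 qed blast
 finally show ?thesis .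
qed

lemma trn_fmem: assumes H: "!!p q y t. Z p q ==> y : M ==> t el PP ==> opr y t el b ==> feq p (trn Z x) (trn Z y) = feq q x y"
 and Zp: "Z p q" and M: "x : M" "b : M"
 shows "fmem p (trn Z x) (trn Z b) = fmem q x b"
proof
 assume f: "fmem q x b"
 show "fmem p (trn Z x) (trn Z b)" unfolding fmem_def dns_def
 proof (intro ballI impI)
  fix r assume r: "r el PP" "p sub r"
  obtain p' q' where z': "Z p' q'" "r sub p'" "p sub p'" "q sub q'" "p' el PP" "q' el PP" by (rule Z_1[OF Zp r])
  obtain r2 y t where r2: "r2 el PP" "q' sub r2" "y : M" "t el PP" "opr y t el b" "t sub r2" "feq r2 x y"
   by (rule fmemE[OF fmem_mono[OF f z'(4)] z'(6)])
  obtain p2 q2 where z2: "Z p2 q2" "r2 sub q2" "p' sub p2" "q' sub q2" "p2 el PP" "q2 el PP" by (rule Z_2[OF z'(1) r2(1,2)])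
  have "feq q2 x y" by (rule feq_mono[OF r2(7) z2(2) r2(1) z2(6) M(1) r2(3)])
  then have "feq p2 (trn Z x) (trn Z y)" using H[OF z2(1) r2(3-5)] by simp
  moreover have "opr (trn Z y) p2 el trn Z b"
   using opr_trn[OF M(2) trn_M[OF r2(3)] el_M[OF z2(5)]] r2 z2 troI[OF z2(1), of t] by blast
  ultimately show "EX r':elts PP. r sub r' & (EX y:M. EX t:elts PP. opr y t el trn Z b & t sub r' & feq r' (trn Z x) y)"
   using z' z2 trn_M[OF r2(3)] by blast
 qed
next
 assume f: "fmem p (trn Z x) (trn Z b)"
 show "fmem q x b" unfolding fmem_def dns_def
 proof (intro ballI impI)
  fix r assume r: "r el PP" "q sub r"
  obtain p' q' where z': "Z p' q'" "r sub q'" "p sub p'" "q sub q'" "p' el PP" "q' el PP" by (rule Z_2[OF Zp r])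
  obtain r2 v s where r2: "r2 el PP" "p' sub r2" "v : M" "s el PP" "opr v s el trn Z b" "s sub r2" "feq r2 (trn Z x) v"
   by (rule fmemE[OF fmem_mono[OF f z'(3)] z'(5)])
  obtain y t where y: "y : M" "t el PP" "v = trn Z y" "opr y t el b" "tro Z s t" using opr_trn[OF M(2) r2(3) el_M[OF r2(4)]] r2(5) by blast
  obtain p2 q2 where z2: "Z p2 q2" "r2 sub p2" "p' sub p2" "q' sub q2" "p2 el PP" "q2 el PP" by (rule Z_1[OF z'(1) r2(1,2)])
  have "feq p2 (trn Z x) (trn Z y)" using feq_mono[OF r2(7) z2(2) r2(1) z2(5) trn_M[OF M(1)] r2(3)] y(3) by simp
  then have "feq q2 x y" using H[OF z2(1) y(1,2,4)] by simp
  moreover have "t sub q2" using troD[OF y(5) z2(1)] r2 z2 by blast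
  ultimately show "EX r':elts PP. r sub r' & (EX y:M. EX t:elts PP. opr y t el b & t sub r' & feq r' x y)"
   using y z' z2 by blast
 qed
qed

lemma trn_half1: assumes H: "!!p q x t. Z p q ==> x : M ==> t el PP ==> opr x t el a ==> fmem p (trn Z x) (trn Z b) = fmem q x b"
 and Zp: "Z p q" and M: "a : M" "b : M"
 shows "(ALL x:M. ALL s:elts PP. opr x s el trn Z a --> (ALL r:elts PP. p sub r & s sub r --> fmem r x (trn Z b))) =
  (ALL x:M. ALL s:elts PP. opr x s el a --> (ALL r:elts PP. q sub r & s sub r --> fmem r x b))" (is "?A = ?B")
proof
 assume B: ?B
 show ?A
 proof (intro ballI impI, elim conjE)
  fix v s r assume v: "v : M" "s el PP" "opr v s el trn Z a" and r: "r el PP" "p sub r" "s sub r"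
  obtain x t where x: "x : M" "t el PP" "v = trn Z x" "opr x t el a" "tro Z s t" using opr_trn[OF M(1) v(1) el_M[OF v(2)]] v(3) by blast
  show "fmem r v (trn Z b)"
  proof (rule fmem_dns, unfold dns_def, intro ballI impI)
   fix r' assume r': "r' el PP" "r sub r'"
   obtain p' q' where z': "Z p' q'" "r' sub p'" "p sub p'" "q sub q'" "p' el PP" "q' el PP" by (rule Z_1[OF Zp r'(1)]) (use r r' in blast)
   have "t sub q'" using troD[OF x(5) z'(1)] r r' z'(2) by blast
   then have "fmem q' x b" using B x z' by blast
   then have "fmem p' v (trn Z b)" using H[OF z'(1) x(1,2,4)] x(3) by simp
   then show "EX r2:elts PP. r' sub r2 & fmem r2 v (trn Z b)" using z' by blast
  qed
 qed
next
 assume A: ?A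
 show ?B
 proof (intro ballI impI, elim conjE)
  fix x t r assume x: "x : M" "t el PP" "opr x t el a" and r: "r el PP" "q sub r" "t sub r"
  show "fmem r x b"
  proof (rule fmem_dns, unfold dns_def, intro ballI impI)
   fix r' assume r': "r' el PP" "r sub r'"
   obtain p' q' where z': "Z p' q'" "r' sub q'" "p sub p'" "q sub q'" "p' el PP" "q' el PP" by (rule Z_2[OF Zp r'(1)]) (use r r' in blast)
   have "opr (trn Z x) p' el trn Z a" using opr_trn[OF M(1) trn_M[OF x(1)] el_M[OF z'(5)]] x z' r r' troI[OF z'(1), of t] by blast
   then have "fmem p' (trn Z x) (trn Z b)" using A trn_M[OF x(1)] z' by blast
   then have "fmem q' x b" using H[OF z'(1) x] by simp
   then show "EX r2:elts PP. r' sub r2 & fmem r2 x b" using z' by blast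
  qed
 qed
qed

text \<open>Induction on the first name. Equality reduces to equality of listed names by
  \<open>trn_half1\<close> and \<open>trn_fmem\<close>, where density of the matched conditions on
  both sides moves the witnesses across.\<close>

lemma trn_feq: assumes "Z p q" "a : M" "b : M" shows "feq p (trn Z a) (trn Z b) = feq q a b"
proof -
 let ?Q = "%a. ALL b:M. ALL p:M. ALL q:M. Z p q --> feq p (trn Z a) (trn Z b) = feq q a b"
 have "?Q a"
 proof (rule pair_induct[of ?Q])
  show "dfn (%e. ?Q (e 0))" by (intro dfi Z_dfn dft_trn PP)
  fix a assume a: "a : M" and IH: "!!y s. y : M ==> s : M ==> opr y s el a ==> ?Q y"
  have I: "feq p (trn Z x) (trn Z y) = feq q x y" if "Z p q" "x : M" "y : M" "t el PP" "opr x t el a" for p q x y t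
   using IH[of x t] that Z_M by blast
  have I': "feq p (trn Z y) (trn Z x) = feq q y x" if "Z p q" "x : M" "y : M" "t el PP" "opr x t el a" for p q x y t
   using I[OF that] feq_sym trn_M that Z_PP by metis
  have "feq p (trn Z a) (trn Z b) = feq q a b" if b: "b : M" and z: "Z p q" for p q b
  proof -
   have 1: "fmem p (trn Z x) (trn Z b) = fmem q x b" if "Z p q" "x : M" "t el PP" "opr x t el a" for p q x t
    by (rule trn_fmem) (use I that b in blast)+
   have 2: "fmem p (trn Z x) (trn Z a) = fmem q x a" if "Z p q" "x : M" "t el PP" "opr x t el b" for p q x t
    by (rule trn_fmem) (use I' that a in blast)+
   show ?thesis unfolding feq_iff[OF Z_PP(1)[OF z] trn_M[OF a] trn_M[OF b]] feq_iff[OF Z_PP(2)[OF z] a b]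
    by (intro arg_cong2[where f="(&)"] trn_half1 z a b) (rule 1 2; assumption)+
  qed
  then show "?Q a" by blast
 qed (rule assms)
 then show ?thesis using assms Z_M by blast
qed

lemma trn_mem: "Z p q ==> a : M ==> b : M ==> fmem p (trn Z a) (trn Z b) = fmem q a b"
 by (rule trn_fmem) (use trn_feq in blast)+

lemma trn_chk: assumes "Z p q" "x : M" shows "feq p (trn Z (chk x)) (chk x)"
proof -
 let ?Q = "%x. ALL p:M. ALL q:M. Z p q --> feq p (trn Z (chk x)) (chk x)"
 have "?Q x"
 proof (rule mem_induct[of ?Q])
  show "dfn (%e. ?Q (e 0))" by (intro dfi Z_dfn dft_trn PP)
  fix x assume x: "x : M" and IH: "!!y. y el x ==> ?Q y"
  have I: "feq p (trn Z (chk y)) (chk y)" if "Z p q" "y el x" for p q y using IH[of y] that Z_M by blast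
  have "feq p (trn Z (chk x)) (chk x)" if z: "Z p q" for p q
   unfolding feq_iff[OF Z_PP(1)[OF z] trn_M[OF chk_M] chk_M]
  proof (intro conjI ballI impI; elim conjE)
   fix v s r assume v: "v : M" "s el PP" "opr v s el trn Z (chk x)" and r: "r el PP" "p sub r" "s sub r"
   obtain k t where "k : M" "t el PP" "v = trn Z k" "opr k t el chk x" using opr_trn[OF chk_M v(1) el_M[OF v(2)]] v(3) by blast
   then obtain y where y: "y el x" "v = trn Z (chk y)" using opr_chk[OF x] by blast
   show "fmem r v (chk x)"
   proof (rule fmem_dns, unfold dns_def, intro ballI impI)
    fix r' assume r': "r' el PP" "r sub r'"
    obtain p' q' where z': "Z p' q'" "r' sub p'" "p' el PP" by (rule Z_1[OF z r'(1)]) (use r r' in blast)+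
    have "fmem p' (chk y) (chk x)" by (rule fmemI[of _ zero]) (use y x PP in \<open>auto simp: opr_chk\<close>)
    moreover have "feq p' (chk y) v" using I[OF z'(1) y(1)] feq_sym[OF z'(3)] y(2) trn_M by auto
    ultimately have "fmem p' v (chk x)" using feq_fmem[of p' "chk y" v] v z' by auto
    then show "EX r2:elts PP. r' sub r2 & fmem r2 v (chk x)" using z' by blast
   qed
  next
   fix v s r assume v: "v : M" "s el PP" "opr v s el chk x" and r: "r el PP" "p sub r" "s sub r"
   then obtain y where y: "y el x" "v = chk y" "s = zero" using opr_chk[OF x] by blast
   show "fmem r v (trn Z (chk x))"
   proof (rule fmem_dns, unfold dns_def, intro ballI impI)
    fix r' assume r': "r' el PP" "r sub r'"
    obtain p' q' where z': "Z p' q'" "r' sub p'" "p' el PP" by (rule Z_1[OF z r'(1)]) (use r r' in blast)+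
    have "opr (trn Z (chk y)) p' el trn Z (chk x)"
     using opr_trn[OF chk_M[of x] trn_M[OF chk_M[of y]] el_M[OF z'(3)]] v y z' troI[OF z'(1), of zero] zero(2) by blast
    then have "fmem p' (trn Z (chk y)) (trn Z (chk x))" by (rule fmemI) (use z' trn_M in auto)
    then have "fmem p' v (trn Z (chk x))" using feq_fmem[OF I[OF z'(1) y(1)]] y(2) z'(3) trn_M chk_M by blast
    then show "EX r2:elts PP. r' sub r2 & fmem r2 v (trn Z (chk x))" using z' by blast
   qed
  qed
  then show "?Q x" by blast
 qed (rule assms)
 then show ?thesis using assms Z_M by blast
qed

end

text \<open>Carrying a name back and forth changes the name but not its value. So
  \<open>trn Z\<close> is surjective up to forced equality, as the quantifier step of
  \<open>trn_forces\<close> requires.\<close>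

lemma trn_trn: assumes Z: "iso Z" and z: "Z p q" and a: "a : M" shows "feq p (trn Z (trn (%q p. Z p q) a)) a"
proof -
 let ?Z = "%q p. Z p q"
 note Z' = iso_flip[OF Z]
 note M = trn_M[OF Z] trn_M[OF Z']
 let ?Q = "%a. ALL p:M. ALL q:M. Z p q --> feq p (trn Z (trn ?Z a)) a"
 have "?Q a"
 proof (rule pair_induct[of ?Q])
  show "dfn (%e. ?Q (e 0))" by (intro dfi Z_dfn[OF Z] dft_trn[OF Z] dft_trn[OF Z'] PP)
  fix a assume a: "a : M" and IH: "!!y s. y : M ==> s : M ==> opr y s el a ==> ?Q y"
  have I: "feq p (trn Z (trn ?Z y)) y" if "Z p q" "y : M" "s el PP" "opr y s el a" for p q y s
   using IH[of y s] that Z_M[OF Z] by blast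
  have "feq p (trn Z (trn ?Z a)) a" if z: "Z p q" for p q
   unfolding feq_iff[OF Z_PP(1)[OF Z z] M(1)[OF M(2)[OF a]] a]
  proof (intro conjI ballI impI; elim conjE)
   fix v s r assume v: "v : M" "s el PP" "opr v s el trn Z (trn ?Z a)" and r: "r el PP" "p sub r" "s sub r"
   obtain k t' where k: "k : M" "t' el PP" "v = trn Z k" "opr k t' el trn ?Z a" "tro Z s t'"
    using opr_trn[OF Z M(2)[OF a] v(1) el_M[OF v(2)]] v(3) by blast
   obtain y t where y: "y : M" "t el PP" "k = trn ?Z y" "opr y t el a" "tro ?Z t' t"
    using opr_trn[OF Z' a k(1) el_M[OF k(2)]] k(4) by blast
   show "fmem r v a"
   proof (rule fmem_dns, unfold dns_def, intro ballI impI)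
    fix r' assume r': "r' el PP" "r sub r'"
    obtain p' q' where z': "Z p' q'" "r' sub p'" "p' el PP" by (rule Z_1[OF Z z r'(1)]) (use r r' in blast)+
    have "t' sub q'" using troD[OF Z k(5) z'(1)] r r' z'(2) by blast
    then have "t sub p'" using troD[OF Z' y(5) z'(1)] by blast
    then have "fmem p' y a" using fmemI[OF y(4) _ y(1,2)] by blast
    moreover have "feq p' y v" using I[OF z'(1) y(1,2,4)] feq_sym[OF z'(3)] k y v by auto
    ultimately have "fmem p' v a" using feq_fmem[of p' y v] v y z' a by auto
    then show "EX r2:elts PP. r' sub r2 & fmem r2 v a" using z' by blast
   qed
  next
   fix y t r assume y: "y : M" "t el PP" "opr y t el a" and r: "r el PP" "p sub r" "t sub r"
   show "fmem r y (trn Z (trn ?Z a))"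
   proof (rule fmem_dns, unfold dns_def, intro ballI impI)
    fix r' assume r': "r' el PP" "r sub r'"
    obtain p' q' where z': "Z p' q'" "r' sub p'" "p' el PP" "q' el PP" by (rule Z_1[OF Z z r'(1)]) (use r r' in blast)+
    have "tro ?Z q' t" by (rule troI[OF Z' z'(1)]) (use r r' z' in blast)
    then have "opr (trn ?Z y) q' el trn ?Z a" using opr_trn[OF Z' a M(2)[OF y(1)] el_M[OF z'(4)]] y z' by blast
    then have "opr (trn Z (trn ?Z y)) p' el trn Z (trn ?Z a)"
     using opr_trn[OF Z M(2)[OF a] M(1)[OF M(2)[OF y(1)]] el_M[OF z'(3)]] z' M(2)[OF y(1)] troI[OF Z z'(1) order_refl] by blast
    then have "fmem p' (trn Z (trn ?Z y)) (trn Z (trn ?Z a))" by (rule fmemI) (use z' M y in auto)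
    then have "fmem p' y (trn Z (trn ?Z a))" using feq_fmem[OF I[OF z'(1) y]] z'(3) M y a by blast
    then show "EX r2:elts PP. r' sub r2 & fmem r2 y (trn Z (trn ?Z a))" using z' by blast
   qed
  qed
  then show "?Q a" by blast
 qed (rule a)
 then show ?thesis using z Z_M[OF Z] by blast
qed

lemma trn_forces: assumes Z: "iso Z" shows "Z p q ==> ALL i. e i : M ==> forces f p (%i. trn Z (e i)) = forces f q e"
proof (induction f arbitrary: p q e)
 case (Neg f)
 show ?case unfolding forces.simps
 proof (intro iffI ballI impI notI)
  fix r assume h: "ALL r:elts PP. p sub r --> ~ forces f r (%i. trn Z (e i))" and r: "r el PP" "q sub r" "forces f r e"
  obtain p' q' where z': "Z p' q'" "r sub q'" "p sub p'" "p' el PP" "q' el PP" by (rule Z_2[OF Z Neg.prems(1) r(1,2)])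
  show False using h Neg.IH[OF z'(1) Neg.prems(2)] forces_mono[OF r(3) z'(2) r(1) z'(5) Neg.prems(2)] z' by blast
 next
  fix r assume h: "ALL r:elts PP. q sub r --> ~ forces f r e" and r: "r el PP" "p sub r" "forces f r (%i. trn Z (e i))"
  obtain p' q' where z': "Z p' q'" "r sub p'" "q sub q'" "p' el PP" "q' el PP" by (rule Z_1[OF Z Neg.prems(1) r(1,2)])
  have "forces f p' (%i. trn Z (e i))" by (rule forces_mono[OF r(3) z'(2) r(1) z'(4)]) (use Neg.prems(2) trn_M[OF Z] in blast)
  then show False using h Neg.IH[OF z'(1) Neg.prems(2)] z' by blast
 qed
next
 case (All i f)
 have u: "(%k. trn Z ((e(i := b)) k)) = (%k. trn Z (e k))(i := trn Z b)" for b by auto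
 have I: "forces f p ((%k. trn Z (e k))(i := trn Z b)) = forces f q (e(i := b))" if "b : M" for b
 proof -
  have "ALL k. (e(i := b)) k : M" using All.prems(2) that by simp
  from All.IH[OF All.prems(1) this] show ?thesis unfolding u .
 qed
 show ?case unfolding forces.simps
 proof (intro iffI ballI)
  fix b assume "ALL a:M. forces f p ((%k. trn Z (e k))(i := a))" "b : M"
  then show "forces f q (e(i := b))" using I trn_M[OF Z] by blast
 next
  fix a assume h: "ALL b:M. forces f q (e(i := b))" and a: "a : M"
  define b where "b = trn (%q p. Z p q) a"
  have b: "b : M" unfolding b_def by (rule trn_M[OF iso_flip[OF Z] a])
  have "forces f p ((%k. trn Z (e k))(i := trn Z b))" using I[OF b] h b by blast
  then show "forces f p ((%k. trn Z (e k))(i := a))"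
  proof (rule forces_feq[OF _ Z_PP(1)[OF Z All.prems(1)]])
   show "ALL k. ((%k. trn Z (e k))(i := trn Z b)) k : M & ((%k. trn Z (e k))(i := a)) k : M &
     feq p (((%k. trn Z (e k))(i := trn Z b)) k) (((%k. trn Z (e k))(i := a)) k)"
    using trn_trn[OF Z All.prems(1) a] trn_M[OF Z] All.prems(2) a b feq_refl[OF Z_PP(1)[OF Z All.prems(1)]] by (simp add: b_def)
  qed
 qed
qed (use trn_feq[OF Z] trn_mem[OF Z] in auto)

end

section \<open>The perfect tree\<close>

context levy begin

text \<open>The witnesses in \<open>G\<close> need not form a sequence in \<open>M\<close>. But by
  closure it is dense either to satisfy all \<open>S i\<close> or to exclude one of them for good,
  and a condition in \<open>G\<close> cannot do the latter.\<close>

lemma G_all: assumes S: "dfn (%e. S (e 0) (e 1))" and mono: "!!i p q. S i p ==> p sub q ==> p el PC ==> q el PC ==> S i q"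
 and th: "th el lam" and ex: "!!i. i el th ==> EX p:G. S i p"
 obtains p where "p : G" "!!i. i el th ==> S i p"
proof -
 obtain p0 where p0: "p0 : G" using G_ne by blast
 have S': "dft A ==> dft B ==> dfn (%e. S (A e) (B e))" for A B :: "(nat => 'a) => 'a" by (rule dfn2[OF S])
 let ?D = "%r. (ALL i:elts th. S i r) | (EX i:elts th. ALL s:elts PC. r sub s --> ~ S i s)"
 have "dns p0 ?D" unfolding dns_def
 proof (intro ballI impI)
  fix q assume q: "q el PC" "p0 sub q"
  show "EX r:elts PC. q sub r & ?D r"
  proof (cases "EX i:elts th. EX r:elts PC. q sub r & (ALL s:elts PC. r sub s --> ~ S i s)")
   case False
   obtain r where "r el PC" "q sub r" "!!i. i el th ==> S i r"
   proof (rule lcl_all[OF lcl_PC th q(1) S])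
    show "EX s:elts PC. r sub s & S i s" if "i el th" "r el PC" "q sub r" for i r using False that by blast
   qed (use mono in blast)+
   then show ?thesis by blast
  qed blast
 qed
 moreover have "dfn (%e. ?D (e 0))" by (intro dfi S' PC_M) (use th in auto)
 ultimately obtain r where r: "r : G" "?D r" using G_meets[OF _ p0, of ?D] by blast
 have "~ (EX i:elts th. ALL s:elts PC. r sub s --> ~ S i s)"
 proof
  assume "EX i:elts th. ALL s:elts PC. r sub s --> ~ S i s"
  then obtain i where i: "i el th" "!!s. s el PC ==> r sub s ==> ~ S i s" by blast
  obtain p where p: "p : G" "S i p" using ex[OF i(1)] by blast
  obtain s where s: "s : G" "p sub s" "r sub s" using G_dir p(1) r(1) by blast
  show False using i(2)[OF G_PP[OF s(1)] s(3)] mono[OF p(2) s(2) G_PP[OF p(1)] G_PP[OF s(1)]] by blast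
 qed
 then show thesis using that r by blast
qed

lemma j_sub: "x : M ==> y : M ==> N.elts (j x) <= N.elts (j y) <-> x sub y"
 unfolding N_elts_j using j_inj by (auto simp: image_subset_iff)

lemma j_psub: "x : M ==> y : M ==> N.elts (j x) < N.elts (j y) <-> elts x < elts y"
 using j_sub[of x y] j_sub[of y x] by blast

lemma N_func_j: assumes "f : M" "d : M" "func f d" shows "N.func (j f) (j d)" "i el d ==> y : N ==> N.pair_in (j f) (j i) y <-> y = j (app f i)"
  "N.pair_in (j f) u y ==> u : N ==> y : N ==> EX i:elts d. u = j i & y = j (app f i)"
proof -
 have e: "N.elts (j f) = j ` gr d (app f)" using func_elts[OF assms(3,1,2)] by (simp add: N_elts_j assms gr_def)
 note F = N_funcI[OF j_N e assms(2) p12_M(3)]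
 show "N.func (j f) (j d)" "i el d ==> y : N ==> N.pair_in (j f) (j i) y <-> y = j (app f i)"
  "N.pair_in (j f) u y ==> u : N ==> y : N ==> EX i:elts d. u = j i & y = j (app f i)"
  using F by blast+
qed

end

locale levy_tree = levy M E lam mu G + split_tree M E lam mu al be gc tx b0 dW
 for M E lam mu G al be gc tx b0 dW +
 assumes b0G: "b0 : G"
begin

lemma a0G: "a0 : G"
proof (rule G_up[OF b0G])
 show "a0 el PC" using cs_PC[OF al_M(1)] b0_split(1) by blast
 show "a0 sub b0" unfolding a0_def by simp
qed

definition on_tree where "on_tree y = (y : M & (EX p:G. EX c:M. run p (dm y) y c))"
text \<open>Each node has length below \<open>lam\<close> and hence lies in the ground model by
  \<open>no_new\<close>, so a name listing check names is enough.\<close>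

definition TT where "TT = V (cn (pow (times lam lam)) (%y p. EX c:M. run p (dm y) y c))"

lemma TT_N [simp]: "TT : N" by (simp add: TT_def)

lemma on_treeD: assumes "on_tree y" shows "y : M" "dm y el lam" "func y (dm y)" "!!i. i el dm y ==> app y i el lam" "y el pow (times lam lam)"
proof -
 obtain p c where p: "p : G" "c : M" "run p (dm y) y c" "y : M" using assms unfolding on_tree_def by blast
 show n: "y : M" "dm y el lam" "func y (dm y)" using p by (auto simp: run_def)
 show a: "app y i el lam" if "i el dm y" for i using out_facts(1)[OF run_inc(3)[OF p(3,2) that]] .
 have "y sub times lam lam" unfolding func_elts[OF n(3,1) dm_M] using a lam_tr[OF n(2)] by auto
 then show "y el pow (times lam lam)" using n by simp
qed

lemma elts_TT: "N.elts TT = j ` {y. on_tree y}"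
proof -
 have "dfn (%e. EX c:M. run (e 1) (dm (e 0)) (e 0) c)" by (intro dfi)
 then have "N.elts TT = {j k |k s. k el pow (times lam lam) & s : G & (EX c:M. run s (dm k) k c)}"
  unfolding TT_def by (rule N_elts_cn) simp
 also have "\<dots> = j ` {y. on_tree y}" using on_treeD(5) unfolding on_tree_def by (auto dest: el_M)
 finally show ?thesis .
qed

lemma TT_iff: "y : M ==> j y : N.elts TT <-> on_tree y"
 unfolding elts_TT using on_treeD(1) j_inj by blast

lemma on_tree_rsq: assumes y: "on_tree y" and m: "m el suc (dm y)" shows "on_tree (rsq y m)" "dm (rsq y m) = m"
proof -
 obtain p c where p: "p : G" "c : M" "run p (dm y) y c" "y : M" using y unfolding on_tree_def by blast
 note r = run_rsq[OF p(3,4,2) m]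
 show "dm (rsq y m) = m" by (rule run_dm[OF r rsq_M(1)])
 then show "on_tree (rsq y m)" unfolding on_tree_def using r p(1) rsq_M(1) by metis
qed

lemma sub_rsq: assumes "func g a" "g : M" "a : M" "g sub y" "on_tree y" "ordinal a" shows "g = rsq y a" "a el suc (dm y)"
proof -
 note y = on_treeD[OF assms(5)]
 have s: "a sub dm y" by (rule func_sub(1)[OF assms(1) y(3) assms(4,2) y(1) assms(3) dm_M])
 have a: "app g i = app y i" if "i el a" for i by (rule func_sub(2)[OF assms(1) y(3) assms(4,2) y(1) assms(3) dm_M that])
 note r = func_rsq[OF y(3,1) dm_M assms(3) s]
 show "g = rsq y a" by (rule func_eq[OF assms(1) r(1) assms(2) rsq_M(1) assms(3)]) (use a r(2) in simp)
 have "ordinal (dm y)" using y(2) ordl ord_el by blast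
 then show "a el suc (dm y)" using ord_sub[of a "dm y"] s assms(3,6) by auto
qed

text \<open>An initial segment taken in \<open>V[G]\<close> is in the ground model by
  \<open>no_new\<close>, and restricting the run keeps it on the tree.\<close>

lemma TT_subtree: "N.subtree (j lam) TT"
 unfolding N.subtree_def
proof (intro conjI ballI impI)
 fix s assume "s : N.elts TT"
 then obtain y where y: "on_tree y" "s = j y" unfolding elts_TT by blast
 note Y = on_treeD[OF y(1)]
 have "N.elts (j y) = j ` gr (dm y) (app y)" using func_elts[OF Y(3,1) dm_M] Y by (simp add: N_elts_j gr_def)
 then have "N.func_into (j y) (j (dm y)) (j lam)" by (rule N_func_intoI[OF j_N]) (use Y in auto)
 moreover have "j (dm y) : N.elts (j lam)" using Y j_el by simp
 ultimately show "N.node (j lam) s" unfolding N.node_def y(2) by blast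
next
 fix s t assume s: "s : N.elts TT" and t: "t : N" "N.node (j lam) t & N.elts t <= N.elts s"
 obtain y where y: "on_tree y" "s = j y" using s unfolding elts_TT by blast
 note Y = on_treeD[OF y(1)]
 obtain a where a: "a el lam" "N.func_into t (j a) (j lam)" using t unfolding N.node_def N_elts_j[OF lam_M(1)] by blast
 have "N.func t (j a)" and v: "!!u y. u : N ==> y : N ==> N.pair_in t u y ==> y : j ` M"
  using a(2) unfolding N.func_into_def N_elts_j[OF lam_M(1)] by (blast, blast dest: el_M)
 then obtain g where g: "g : M" "func g a" "t = j g" using no_new[OF t(1) _ a(1)] by blast
 have "g sub y" using t(2) y g Y j_sub by blast
 then have "g = rsq y a" "a el suc (dm y)" using sub_rsq[OF g(2,1) el_M[OF a(1)] _ y(1) ord_el[OF ordl(1) a(1)]] by blast+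
 then show "t : N.elts TT" using on_tree_rsq(1)[OF y(1), of a] g TT_iff by simp
qed

text \<open>The chain lies in \<open>M\<close> by \<open>no_new\<close>, and by \<open>G_all\<close>
  one condition \<open>p\<close> in \<open>G\<close> puts all its nodes on the tree. Nodes determine
  their states, so these form a chain as well, and closure of \<open>RS\<close> puts the union on
  the tree by the same \<open>p\<close>.\<close>

lemma TT_chains: assumes d: "d el lam" and c: "c : N" "N.increasing_seq c (j d) TT"
 shows "EX t:N.elts TT. ALL b:N.elts (j d). ALL s:N. N.pair_in c b s --> N.elts s <= N.elts t"
proof -
 have dM: "d : M" "ordinal d" using d ordl ord_el by auto
 have f: "N.func c (j d)" and v: "!!u y. u : N ==> y : N ==> N.pair_in c u y ==> y : N.elts TT"
  using c(2) unfolding N.increasing_seq_def N.func_into_def by blast+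
 obtain C where C: "C : M" "func C d" "c = j C" by (rule no_new[OF c(1) f d]) (use v on_treeD(1) in \<open>unfold elts_TT, blast\<close>)
 note P = N_func_j[OF C(1) dM(1) C(2)]
 have y: "on_tree (app C i)" if i: "i el d" for i
  using v[of "j i" "j (app C i)"] P(2)[OF i] C(3) TT_iff by simp
 have inc: "elts (app C i) < elts (app C k)" if k: "k el d" "i el k" for i k
 proof -
  have i: "i el d" using ord_tr[OF dM(2)] k by blast
  have "j k : N.elts (j d)" "j i : N.elts (j k)" using k by (auto simp: N_elts_j dM)
  then have "N.elts (j (app C i)) < N.elts (j (app C k))"
  proof (rule conjunct2[OF c(2)[unfolded N.increasing_seq_def], rule_format, OF _ _ j_N j_N])
   show "N.pair_in c (j i) (j (app C i)) & N.pair_in c (j k) (j (app C k))"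
    unfolding C(3) using P(2)[OF k(1) j_N] P(2)[OF i j_N] by simp
  qed
  then show ?thesis using j_psub by simp
 qed
 let ?S = "%i p. EX c:M. run p (dm (app C i)) (app C i) c"
 obtain p where p: "p : G" "!!i. i el d ==> ?S i p"
 proof (rule G_all[of ?S, OF _ _ d])
  show "dfn (%e. ?S (e 0) (e 1))" by (intro dfi C)
  show "?S i q" if "?S i p" "p sub q" "p el PC" "q el PC" for i p q using that run_mono by blast
  show "EX p:G. ?S i p" if "i el d" for i using y[OF that] unfolding on_tree_def by blast
 qed blast
 have pM: "p : M" "p el PC" using p(1) G_PP by auto
 define cc where "cc i = the1 (run p (dm (app C i)) (app C i))" for i
 have cd: "dft (%e. cc (e 0))" unfolding cc_def by (intro dft_the1 dfn_run dfi dft_w dft_var C pM)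
 have uq: "app c1 i = app c2 i" if "run p n1 y1 c1" "run p n2 y2 c2" "y1 sub y2" "y1 : M" "y2 : M" "c1 : M" "c2 : M" "i el n1" for y1 y2 n1 n2 c1 c2 i
 proof (rule run_unique[OF that(1,2) pM(2) that(6,7,4,5) _ order_refl _ _ _ that(8)])
  have F: "n1 el lam" "func y1 n1" "func y2 n2" "n2 : M" using that(1,2) by (auto simp: run_def)
  show "n1 : M" "transitive n1" using F ord_el[OF ordl(1) F(1)] by (auto simp: ordinal_def)
  show "n1 sub n2" by (rule func_sub(1)[OF F(2,3) that(3-5)]) (use F in auto)
  show "app y1 i = app y2 i" if "i el n1" for i by (rule func_sub(2)[OF F(2,3) \<open>y1 sub y2\<close> \<open>y1 : M\<close> \<open>y2 : M\<close> _ _ that]) (use F in auto)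
 qed
 have cc: "run p (dm (app C i)) (app C i) (cc i)" "cc i : M" if i: "i el d" for i
 proof -
  obtain c where c: "c : M" "run p (dm (app C i)) (app C i) c" using p(2)[OF i] by blast
  have "cc i = c" unfolding cc_def
  proof (rule the1_eq[of c "run p (dm (app C i)) (app C i)", OF c])
   fix c' assume c': "c' : M" "run p (dm (app C i)) (app C i) c'"
   show "c' = c" by (rule func_eq[of c' "dm (app C i)" c]) (use c c' uq[OF c'(2) c(2) order_refl p12_M(3) p12_M(3)] in \<open>auto simp: run_def\<close>)
  qed
  then show "run p (dm (app C i)) (app C i) (cc i)" "cc i : M" using c by simp_all
 qed
 define X where "X = fn d (%i. tri p (app C i) (cc i))"
 have XM: "X : M" by (simp add: X_def)
 have X: "app X i = tri p (app C i) (cc i)" if "i el d" for i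
  unfolding X_def by (rule app_fn[OF _ that dM(1)]) (intro dfi dft1[OF cd] pM C)
 have Xi: "app X i sub app X k" if "k el d" "i el k" for i k
 proof -
  have i: "i el d" using ord_tr[OF dM(2)] that by blast
  note ri = cc[OF i] and rk = cc[OF that(1)]
  have le: "app C i sub app C k" using inc[OF that] by blast
  have F: "func (cc i) (dm (app C i))" "func (cc k) (dm (app C k))" "func (app C i) (dm (app C i))" "func (app C k) (dm (app C k))"
   using ri(1) rk(1) by (auto simp: run_def)
  have "cc i sub cc k"
   by (rule func_subI[OF F(1,2) ri(2) rk(2) dm_M dm_M func_sub(1)[OF F(3,4) le p12_M(3) p12_M(3) dm_M dm_M]])
    (rule uq[OF ri(1) rk(1) le p12_M(3) p12_M(3) ri(2) rk(2)])
  then show ?thesis unfolding X[OF i] X[OF that(1)] using le ri rk pM by simp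
 qed
 have b: "tri p zero zero el RS" using RS_tri[OF zero(1) zero(1) pM(1)] pM(2) run_zero run_dm[OF run_zero zero(1)] by simp
 define u where "u = supr (tri p zero zero) X d"
 have uR: "u el RS" unfolding u_def
 proof (rule lclD[OF lcl_RS b XM d])
  fix k assume k: "k el d"
  have "app X k el RS" unfolding X[OF k] using RS_tri cc[OF k] pM by simp
  moreover have "tri p zero zero sub app X k" unfolding X[OF k] using cc[OF k] pM by simp
  ultimately show "app X k el RS & supr (tri p zero zero) X k sub app X k"
   using Xi[OF k] XM k by (subst supr_sub_iff) auto
 qed
 obtain q y' c' where t: "u = tri q y' c'" "y' : M" "c' : M" "q el PC" "run q (dm y') y' c'" by (rule RS_E[OF uR])
 have qM: "q : M" using t by auto
 have "elts (pr0 u) = elts p"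
  unfolding u_def pr_supr(1)[OF tg_M(1) XM dM(1)] using X pM cc by auto
 then have "q = p" using t(1) qM pM by (intro zfc_ext) auto
 then have yt: "on_tree y'" unfolding on_tree_def using t p by blast
 have "app C i sub y'" if i: "i el d" for i
 proof -
  have "app X i sub u" unfolding u_def using i XM dM by auto
  then show ?thesis unfolding X[OF i] t(1) using cc[OF i] t qM pM by simp
 qed
 note le = this
 have "N.elts s <= N.elts (j y')" if bs: "b : N.elts (j d)" "s : N" "N.pair_in c b s" for b s
 proof -
  obtain i where i: "i el d" "s = j (app C i)" using P(3)[OF bs(3)[unfolded C(3)] N.el_M[OF bs(1)] bs(2)] by blast
  show ?thesis unfolding i(2) using j_sub[of "app C i" y'] le[OF i(1)] t(2) by simp
 qed
 then show ?thesis using TT_iff t(2) yt by blast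
qed

lemma TT_split: assumes s: "s : N.elts TT" shows "EX t:N.elts TT. N.elts s <= N.elts t & N.splitting_node TT t"
proof -
 obtain y where y: "on_tree y" "s = j y" using s unfolding elts_TT by blast
 obtain p c where p: "p : G" "c : M" "run p (dm y) y c" "y : M" using y(1) unfolding on_tree_def by blast
 obtain p0 where p0: "p0 : G" "p sub p0" "a0 sub p0" using G_dir p(1) a0G by blast
 let ?S = "%q. EX y':M. EX c':M. EX v:M. EX u:M. EX w:M. EX u':M. y sub y' & run q (dm y') y' c' &
  out q (dm y') (supr r1 c' (dm y')) v u & out q (dm y') (supr r1 c' (dm y')) w u' & v ~= w"
 have "dns p0 ?S" unfolding dns_def
 proof (intro ballI impI)
  fix q assume q: "q el PC" "p0 sub q"
  have "run q (dm y) y c" by (rule run_mono[OF p(3) _ G_PP[OF p(1)] q(1)]) (use p0 q in blast)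
  then obtain q' y' c' v u w u' where z: "q' el PC" "y' : M" "c' : M" "q sub q'" "y sub y'" "run q' (dm y') y' c'"
   "out q' (dm y') (supr r1 c' (dm y')) v u" "out q' (dm y') (supr r1 c' (dm y')) w u'" "v ~= w"
   using split[OF q(1) _ _ p(4,2)] p0(3) q(2) by blast
  have "v : M" "u : M" "w : M" "u' : M" using out_facts(1,2)[OF z(7)] out_facts(1,2)[OF z(8)] by auto
  then show "EX r:elts PC. q sub r & ?S r" using z by blast
 qed
 moreover have "dfn (%e. ?S (e 0))" by (intro dfi p al_M)
 ultimately obtain q where q: "q : G" "?S q" using G_meets[OF _ p0(1), of ?S] by blast
 then obtain y' c' v u w u' where z: "y' : M" "c' : M" "v : M" "w : M" "y sub y'" "run q (dm y') y' c'"
  "out q (dm y') (supr r1 c' (dm y')) v u" "out q (dm y') (supr r1 c' (dm y')) w u'" "v ~= w" by blast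
 define n where "n = dm y'"
 have f: "func y' n" "n : M" using z(6) by (auto simp: run_def n_def)
 have yt: "on_tree y'" unfolding on_tree_def using z q by blast
 have nn: "~ x el y'" if "x = opr n t" "t : M" for x t
 proof
  assume "x el y'"
  then have "n el n" using func_elts[OF f(1) z(1) f(2)] that f(2) by (auto dest: el_M)
  then show False using no_cycle(1) f(2) by blast
 qed
 have im: "N.immediate_successor TT (j y') (j (snoc y' n t))" if t: "t : M" and o: "out q (dm y') (supr r1 c' (dm y')) t u" for t u
  unfolding N.immediate_successor_def
 proof (intro conjI notI)
  have r: "run q (suc n) (snoc y' n t) (snoc c' n u)" using run_snoc[OF z(6,1,2) o] by (simp add: n_def)
  have "dm (snoc y' n t) = suc n" by (rule run_dm[OF r rsq_M(2)])
  then have "on_tree (snoc y' n t)" unfolding on_tree_def using r q(1) rsq_M(2) by metis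
  then show "j (snoc y' n t) : N.elts TT" using TT_iff by simp
  have e: "elts (snoc y' n t) = insert (opr n t) (elts y')" using z(1) by (simp add: snoc_def)
  then show "N.elts (j y') < N.elts (j (snoc y' n t))" using nn[OF refl t] j_psub z(1) by auto
  assume "EX x:N.elts TT. N.elts (j y') < N.elts x & N.elts x < N.elts (j (snoc y' n t))"
  then obtain g where "on_tree g" "N.elts (j y') < N.elts (j g)" "N.elts (j g) < N.elts (j (snoc y' n t))" unfolding elts_TT by blast
  then have "elts y' < elts g" "elts g < elts (snoc y' n t)" using j_psub on_treeD(1) z(1) by simp_all
  then show False unfolding e by blast
 qed
 have "snoc y' n v ~= snoc y' n w"
 proof
  assume "snoc y' n v = snoc y' n w"
  then have "app (snoc y' n v) n = app (snoc y' n w) n" by simp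
  then show False using func_snoc(2)[OF f(1) z(1) f(2)] z(3,4,9) by simp
 qed
 then have "j (snoc y' n v) ~= j (snoc y' n w)" using j_inj by simp
 then have "N.splitting_node TT (j y')" unfolding N.splitting_node_def using im[OF z(3,7)] im[OF z(4,8)] yt TT_iff z(1) by blast
 then show ?thesis using yt TT_iff z(1,5) j_sub[OF p(4) z(1)] y(2) by blast
qed

lemma TT_perfect: "N.perfect_tree (j lam) TT"
 unfolding N.perfect_tree_def
proof (intro conjI ballI impI TT_subtree)
 fix b c assume b: "b : N.elts (j lam)" and c: "c : N" "N.increasing_seq c b TT"
 obtain d where d: "d el lam" "b = j d" using b by (auto simp: N_elts_j)
 show "EX t:N.elts TT. ALL b:N.elts b. ALL s:N. N.pair_in c b s --> N.elts s <= N.elts t"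
  using TT_chains[OF d(1) c(1)] c(2) d(2) by simp
qed (rule TT_split)

end

section \<open>All branches belong to the set\<close>

context levy begin

lemma j_eqI: "N.elts x = j ` S ==> x : N ==> y : N ==> (!!k. k : S ==> j k : N.elts y) ==> (!!u. u : N.elts y ==> u : j ` S) ==> y = x"
 by (rule N_ext) auto

text \<open>The name \<open>t\<close> lists check names only, whose values \<open>trn Z\<close>
  preserves. So the value of the transported name is computed from what the partners
  \<open>q\<close> of conditions \<open>p\<close> in \<open>G\<close> decide about
  \<open>t\<close>.\<close>

lemma val_trn: assumes Z: "iso Z" and ex: "!!p. p : G ==> EX p' q'. Z p' q' & p' : G & p sub p'"
 and t: "t : M" "K : M" "!!x s. x : M ==> s : M ==> opr x s el t ==> EX k:elts (times lam K). x = chk k"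
 and g: "good lam t c" "!!p q. Z p q ==> c sub q"
 and x: "x : N" "N.elts x = j ` gr lam X" "!!i. i el lam ==> X i : M"
 and H: "!!i. i el lam ==> EX p q. Z p q & p : G & dec q t (opr i (X i))"
 shows "V (trn Z t) = x"
proof -
 note tM = trn_M[OF Z]
 have c1: "fmem p (chk k) (trn Z t) = dec q t k" if z: "Z p q" and k: "k : M" for p q k
 proof -
  have p: "p el PC" by (rule Z_PP(1)[OF Z z])
  note e = trn_chk[OF Z z k]
  have "feq p (chk k) (trn Z (chk k))" using e feq_sym[OF p] tM by auto
  then have "fmem p (chk k) (trn Z t) = fmem p (trn Z (chk k)) (trn Z t)"
   using feq_fmem[OF e _ p tM[OF chk_M] chk_M tM[OF t(1)]] feq_fmem[OF _ _ p chk_M tM[OF chk_M] tM[OF t(1)]] by blast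
  then show ?thesis using trn_mem[OF Z z chk_M t(1)] by simp
 qed
 have J: "j k : N.elts (V (trn Z t)) <-> (EX p q. Z p q & p : G & dec q t k)" if k: "k : M" for k
 proof
  assume "j k : N.elts (V (trn Z t))"
  then obtain p where p: "p : G" "fmem p (chk k) (trn Z t)" using fmem_j[OF k tM[OF t(1)]] by blast
  obtain p' q' where z: "Z p' q'" "p' : G" "p sub p'" using ex[OF p(1)] by blast
  then show "EX p q. Z p q & p : G & dec q t k" using c1[OF z(1) k] fmem_mono[OF p(2) z(3)] by blast
 next
  assume "EX p q. Z p q & p : G & dec q t k"
  then show "j k : N.elts (V (trn Z t))" using fmem_j[OF k tM[OF t(1)]] c1[OF _ k] by blast
 qed
 have U: "v = X i" if i: "i el lam" "v : M" "j (opr i v) : N.elts (V (trn Z t))" for i v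
 proof -
  obtain p q where z: "Z p q" "p : G" "dec q t (opr i v)" using iffD1[OF J[OF opr_M] i(3)] by blast
  obtain p2 q2 where z2: "Z p2 q2" "p2 : G" "dec q2 t (opr i (X i))" using H[OF i(1)] by blast
  obtain r where r: "r : G" "p sub r" "p2 sub r" using G_dir z(2) z2(2) by blast
  obtain p3 q3 where z3: "Z p3 q3" "p3 : G" "r sub p3" using ex[OF r(1)] by blast
  have "q sub q3" "q2 sub q3" using Z_ord[OF Z z(1) z3(1)] Z_ord[OF Z z2(1) z3(1)] r z3(3) by blast+
  then show ?thesis
   by (intro goodD(2)[OF g(1) Z_PP(2)[OF Z z3(1)] g(2)[OF z3(1)] i(1) dec_mono[OF z(3)] dec_mono[OF z2(3)] i(2) x(3)[OF i(1)]])
 qed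
 obtain p0 q0 where z0: "Z p0 q0" "p0 : G" using ex G_ne by blast
 show ?thesis
 proof (rule j_eqI[OF x(2,1) V_N[OF tM[OF t(1)]]])
  fix k assume "k : gr lam X"
  then obtain i where "i el lam" "k = opr i (X i)" by (auto simp: gr_def)
  then show "j k : N.elts (V (trn Z t))" using J H[of i] by simp
 next
  fix u assume u: "u : N.elts (V (trn Z t))"
  then obtain a s where a: "u = V a" "a : M" "s : G" "opr a s el trn Z t" using N_elts[OF tM[OF t(1)]] by auto
  obtain y t' where y: "y : M" "t' el PC" "a = trn Z y" "opr y t' el t" using opr_trn[OF Z t(1) a(2) G_M[OF a(3)]] a(4) by blast
  obtain k where k: "k el times lam K" "y = chk k" using t(3)[OF y(1) el_M[OF y(2)] y(4)] by blast
  have uj: "u = j k" unfolding j_def a(1) y(3) k(2) V_eq[OF tM[OF chk_M] chk_M] using trn_chk[OF Z z0(1) el_M[OF k(1)]] z0(2) by blast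
  obtain i v where i: "i el lam" "v el K" "k = opr i v" using k(1) t(2) by (auto simp: elts_times)
  have "v = X i" using U[OF i(1) el_M[OF i(2)]] u unfolding uj i(3) by blast
  then show "u : j ` gr lam X" unfolding uj i(3) using i(1) by (auto simp: gr_def)
 qed
qed

end

context tree begin

lemma run_rst: assumes "run p n y c" "al sub de" "gc el de" "de : M" "p : M" shows "run (rst p de) n y c"
proof -
 have "rst (rst p de) al = rst p al" using assms by (intro zfc_ext) auto
 moreover have "opr (opr gc i) z el rst p de <-> opr (opr gc i) z el p" if "z el gc" "i : M" for i z
  using assms that by (auto simp: co_def dest: el_M)
 ultimately have "out (rst p de) i s v u = out p i s v u" if "i : M" for i s v u unfolding out_def using that by simp
 then show ?thesis using assms(1) unfolding run_def by (auto dest: el_M)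
qed

end

context branch begin

text \<open>The state and the second component have no columns in \<open>al\<close>. Since both
  projections agree there, the value of \<open>z\<close> is preserved.\<close>

lemma rst_f: "e el EE ==> rst (f1 e) al = rst (f2 e) al"
proof -
 assume e: "e el EE"
 obtain p y c k where t: "e = tg (tri p y c) k" "y : M" "c : M" "p : M" "tri p y c el D" "k el K2" "k : M" by (rule EE_E[OF e])
 then have tD: "tri p y c el D0" by (simp add: elts_D)
 have "rst (un (un (rst p al) (supr r1 c (dm y))) k) al = rst p al"
 proof -
  have "~ co z el al" if "z el k" for z using t(6) al(4) that unfolding el_K2 by blast
  then show ?thesis using f2_parts(5)[OF tD t(2-4,6)] t(4,7) by (intro zfc_ext) (auto simp: el_R)
 qed
 then show "rst (f1 e) al = rst (f2 e) al" unfolding t(1) f_tg[OF t(2-4,7) tD] by simp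
qed

text \<open>By \<open>fre\<close>, an entry of \<open>f1 e\<close> in row \<open>i\<close> of column
  \<open>gc\<close> means that the node is longer than \<open>i\<close>. Then \<open>yd\<close>
  agrees with the node at \<open>i\<close>, and the state inside \<open>f2 e\<close> decides
  \<open>tx\<close> in the same way.\<close>

lemma f2_dec: assumes e: "e el EE" and z: "opr (opr gc i) z el f1 e" "z : M" "i : M" and f: "f1 e sub p" "p el PC" "i el lam"
 and v: "v : M" "dec p yd (opr i v)" shows "dec (f2 e) tx (opr i v)"
proof -
 obtain q y c k where t: "e = tg (tri q y c) k" "y : M" "c : M" "q : M" "tri q y c el D" "k el K2" "k : M" by (rule EE_E[OF e])
 then have tD: "tri q y c el D0" and fr: "fre q (dm y)" by (auto simp: D_tri)
 have T: "q el cs de" "run q (dm y) y c" "d0 sub q" "!!i. i el dm y ==> dec q yd (opr i (app y i))" using tD t by (auto simp: D0_tri)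
 note F = f_tg[OF t(2-4,7) tD]
 have i: "i el dm y" using fr z unfolding t(1) F(1) fre_def by (auto simp: co_def)
 have qp: "q sub p" using f(1) unfolding t(1) F(1) .
 have "app y i = v"
  by (rule goodD(2)[OF d0(2) f(2) _ f(3) dec_mono[OF T(4)[OF i] qp] v(2) p12_M(3) v(1)]) (use T(3) qp in blast)
 moreover have "dec (un (rst q al) (supr r1 c (dm y))) tx (opr i (app y i))"
  by (rule run_dec[OF T(2) t(3) cs_PC[OF de_M(1) T(1)] i])
 ultimately show ?thesis unfolding t(1) F(2) using t(7) by (auto intro: dec_mono)
qed

end

locale levy_branch = levy_tree M E lam mu G al be gc tx b0 dW + branch M E lam mu al be gc tx b0 dW yd de d0
 for M E lam mu G al be gc tx b0 dW yd de d0 +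
 assumes d0G: "d0 : G"
begin

lemma absorb_ex: obtains ka w io e0 where "absorb M E lam mu EE de ka w io e0 (%b. if b then f1 else f2)" "f1 e0 : G"
proof -
 have "dns d0 (%r. EX e:elts EE. f1 e sub r)" unfolding dns_def
 proof (intro ballI impI)
  fix q assume q: "q el PC" "d0 sub q"
  have "rst q de el cs de" "d0 sub rst q de" using rst_cs[OF q(1) de_M(1)] cs_rst[OF de_M(1) d0(1) el_M[OF q(1)] q(2)] by auto
  then obtain e where e: "e el EE" "rst q de sub f1 e" by (rule EE_ne)
  have "un q (f1 e) el PC" using amal(1)[OF q(1) _ de_M(1) e(2)] f_cs[OF e(1)] by blast
  then show "EX r:elts PC. q sub r & (EX e:elts EE. f1 e sub r)" using e(1) el_M[OF q(1)]
   by (intro bexI[of _ "un q (f1 e)"]) auto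
 qed
 moreover have "dfn (%e. EX x:elts EE. f1 x sub e 0)" by (intro dfi K2_M)
 ultimately obtain g where "g : G" "EX e:elts EE. f1 e sub g" using G_meets[OF _ d0G, of "%r. EX e:elts EE. f1 e sub r"] by blast
 then obtain e0 where e0: "e0 el EE" "f1 e0 sub g" "g : G" by blast
 have f1G: "f1 e0 : G" by (rule G_up[OF e0(3) _ e0(2)]) (use f_cs[OF e0(1)] cs_PC[OF de_M(1)] in blast)
 obtain w where w: "w el lam" "is_omega w" by (rule reg_omega[OF lam])
 have wM: "w : M" "w el mu" using w ord_tr[OF ordl(2) lam_mu] by auto
 have "bs mu (times w EE)" by (intro bs_times mu_reg bs_EE bs_el[OF mu_reg wM(2)])
 then obtain a io where a: "a el mu" "io : M" "bijection io (times w EE) a" by (rule bs_bij[OF mu_reg])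
 \<comment> \<open>The column has to lie above \<open>de\<close> and above the set \<open>a\<close>
   of codes for pairs of a number and an element of \<open>EE\<close>.\<close>
 obtain ka where ka: "ka el mu" "a sub ka" "de sub ka" by (rule reg_join[OF mu_reg a(1) de(1)])
 have io: "func_into io (times w EE) a" "!!x y. x el times w EE ==> y el times w EE ==> app io x = app io y ==> x = y"
  using a(3) bijection_iff[OF a(2) fn_M(2) el_M[OF a(1)]] by blast+
 have ioa: "x el times w EE ==> app io x el a" for x using io(1) func_into_iff[OF a(2) fn_M(2) el_M[OF a(1)]] by blast
 have "absorb M E lam mu EE de ka w io e0 (%b. if b then f1 else f2)"
 proof unfold_locales
  show "dft (%e. (if b then f1 else f2) (e 0))" for b by (cases b) (simp_all, (intro dfi)+)
  show "(if b then f1 else f2) e el cs de" if "e el EE" for b e using f_cs[OF that] by simp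
  show "(if b then f1 else f2) e sub (if b then f1 else f2) e'" if "e el EE" "e' el EE" "e sub e'" for b e e'
   using f_mono[OF el_M[OF that(1)] el_M[OF that(2)] that(3)] by simp
  show "elts ((if b then f1 else f2) (supr e C i)) = elts ((if b then f1 else f2) e) Un (UN k:elts i. elts ((if b then f1 else f2) (app C k)))"
   if "e el EE" "C : M" "i : M" for b e C i using f_cont[OF el_M[OF that(1)] that(2,3)] by simp
  show "EX e':elts EE. e sub e' & q sub (if b then f1 else f2) e'" if "e el EE" "q el cs de" "(if b then f1 else f2) e sub q" for b e q
   using f1_lift[OF that(1,2)] f2_lift[OF that(1,2)] that(3) by (cases b) simp_all
  show "app io (opr n x) el ka" if "n el w" "x el EE" for n x using ioa[of "opr n x"] ka(2) that wM by auto
  show "n = n' & x = x'" if "n el w" "x el EE" "n' el w" "x' el EE" "app io (opr n x) = app io (opr n' x')" for n n' x x'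
   using io(2)[of "opr n x" "opr n' x'"] that wM by (auto dest: el_M)
 qed (use lcl_EE e0 de ka w wM a in blast)+
 then show thesis using that f1G by blast
qed

text \<open>\<open>Z\<close> matches the two images of the same path with the same remaining
  columns. Order is preserved by \<open>img_refl\<close> on one side followed by
  \<open>img_mono\<close> on the other, and \<open>dense\<close> gives density on both.\<close>

lemma Z_ex: obtains Z where "iso Z" "!!p. p : G ==> EX p' q'. Z p' q' & p' : G & p sub p'"
 "!!p q. Z p q ==> EX e:elts EE. rst p de = f1 e & rst q de = f2 e"
proof -
 obtain ka w io e0 where ab: "absorb M E lam mu EE de ka w io e0 (%b. if b then f1 else f2)" "f1 e0 : G" by (rule absorb_ex)
 interpret ab: absorb M E lam mu EE de ka w io e0 "%b. if b then f1 else f2" by (rule ab(1))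
 define Z where "Z p q = (EX m:M. EX n:M. EX u:elts ab.U. ab.gd m n & p = ab.img True m n u & q = ab.img False m n u)" for p q
 have st: "ab.st m n el EE" if "ab.gd m n" "m : M" for m n
  using ab.st_EE[of m n n] ab.gd_M[OF that(1)] that by (simp add: ab.gd_def)
 have F: "EX m:M. EX n:M. EX u:elts ab.U. ab.gd m n & r sub ab.img b m n u"
  if "r el PC" "(if b then f1 else f2) e0 sub r" for r b
  by (rule ab.dense[OF that]) (use ab.gd_M in blast)
 have FZ: "EX p' q'. Z p' q' & r sub (if b then p' else q')" if r: "r el PC" "(if b then f1 else f2) e0 sub r" for r b
 proof -
  obtain m n u where z: "m : M" "n : M" "u el ab.U" "ab.gd m n" "r sub ab.img b m n u" using F[OF r] by blast
  then have "Z (ab.img True m n u) (ab.img False m n u)" unfolding Z_def by blast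
  then show ?thesis using z(5) by (cases b) auto
 qed
 have sub: "(if b then f1 else f2) e0 sub ab.img b m n u" if "ab.gd m n" "m : M" "n : M" "u el ab.U" for b m n u
 proof -
  have "(if b then f1 else f2) e0 sub (if b then f1 else f2) (ab.st m n)"
   by (rule ab.f_mono[OF ab.E(2) st[OF that(1,2)]]) (simp add: ab.elts_st[OF that(2,3)])
  then show ?thesis unfolding ab.img_def using that(4) by auto
 qed
 have "iso Z" unfolding iso_def
 proof (intro conjI allI impI ballI)
  show "dfn (%e. Z (e 0) (e 1))" unfolding Z_def by (intro dfi ab.dfn_gd ab.dft_img ab.M2)
 next
  fix p q assume "Z p q"
  then show "p el PC" "q el PC" unfolding Z_def using ab.img_facts(1) by blast+
 next
  fix p q p' q' assume "Z p q" "Z p' q'"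
  then obtain m n u m' n' u' where z: "m : M" "ab.gd m n" "u el ab.U" "p = ab.img True m n u" "q = ab.img False m n u"
   "m' : M" "ab.gd m' n'" "u' el ab.U" "p' = ab.img True m' n' u'" "q' = ab.img False m' n' u'" unfolding Z_def by blast
  have "ab.img b' m n u sub ab.img b' m' n' u'" if "ab.img b m n u sub ab.img b m' n' u'" for b b'
   by (rule ab.img_mono[OF z(2,1,3,7,6,8) ab.img_refl[OF z(2,1,3,7,6,8) that]])
  then show "(p sub p') = (q sub q')" unfolding z(4,5,9,10) by blast
 next
  fix p q r assume z: "Z p q" and r: "r el PC"
  obtain m n u where z: "m : M" "n : M" "ab.gd m n" "u el ab.U" "p = ab.img True m n u" "q = ab.img False m n u" using z unfolding Z_def by blast
  { assume "p sub r"
   then have "f1 e0 sub r" using sub[OF z(3,1,2,4), of True] unfolding z(5) by simp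
   then show "EX p' q'. Z p' q' & r sub p'" using FZ[OF r, of True] by simp }
  { assume "q sub r"
   then have "f2 e0 sub r" using sub[OF z(3,1,2,4), of False] unfolding z(6) by simp
   then show "EX p' q'. Z p' q' & r sub q'" using FZ[OF r, of False] by simp }
 qed
 moreover have "EX p' q'. Z p' q' & p' : G & p sub p'" if p: "p : G" for p
 proof -
  obtain r where r: "r : G" "p sub r" "f1 e0 sub r" using G_dir p ab(2) by blast
  let ?S = "%p'. EX m:M. EX n:M. EX u:elts ab.U. ab.gd m n & p' = ab.img True m n u"
  have "dns r ?S" unfolding dns_def
  proof (intro ballI impI)
   fix q assume q: "q el PC" "r sub q"
   have "(if True then f1 else f2) e0 sub q" using q(2) r(3) by simp
   then obtain m n u where z: "m : M" "n : M" "u el ab.U" "ab.gd m n" "q sub ab.img True m n u" using F[OF q(1)] by blast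
   then show "EX s:elts PC. q sub s & ?S s" using ab.img_facts(1)[OF z(4,1,3)] by blast
  qed
  moreover have "dfn (%e. ?S (e 0))" by (intro dfi ab.dfn_gd ab.dft_img ab.M2)
  ultimately obtain p' where "p' : G" "r sub p'" "?S p'" using G_meets[OF _ r(1), of ?S] by blast
  then show ?thesis using r(2) unfolding Z_def by blast
 qed
 moreover have "EX e:elts EE. rst p de = f1 e & rst q de = f2 e" if z: "Z p q" for p q
 proof -
  obtain m n u where z: "m : M" "ab.gd m n" "u el ab.U" "p = ab.img True m n u" "q = ab.img False m n u" using z unfolding Z_def by blast
  show ?thesis using ab.img_facts(2)[OF z(2,1,3), of True] ab.img_facts(2)[OF z(2,1,3), of False] st[OF z(2,1)] z(4,5) by auto
 qed
 ultimately show thesis using that by blast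
qed

end

context levy_tree begin

lemma branch_nodes: assumes y: "y : N" "N.elts y = j ` gr lam X" "!!i. i el lam ==> X i : M" and a: "a el lam"
 and s: "s : N.elts TT" "N.func s (j a)" "N.elts s <= N.elts y"
 obtains g where "on_tree g" "dm g = a" "!!i. i el a ==> app g i = X i"
proof -
 obtain g where g: "on_tree g" "s = j g" using s(1) unfolding elts_TT by blast
 note Y = on_treeD[OF g(1)]
 have aM: "a : M" using a by auto
 have "w : j ` M" if "u : N" "w : N" "N.pair_in (j g) u w" for u w
  using N_func_j(3)[OF Y(1) dm_M Y(3) that(3,1,2)] by auto
 then obtain g' where g': "g' : M" "func g' a" "j g = j g'" using no_new[OF j_N s(2)[unfolded g(2)] a] by blast
 then have f: "func g a" using j_inj[OF Y(1) g'(1)] by simp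
 have da: "dm g = a" by (rule dm_func[OF f Y(1) aM])
 have "app g i = X i" if i: "i el a" for i
 proof -
  have "opr i (app g i) el g" using func_elts[OF f Y(1) aM] i by auto
  then have "j (opr i (app g i)) : N.elts y" using s(3) Y(1) unfolding g(2) N_elts_j[OF Y(1)] by blast
  then obtain k where k: "k el lam" "j (opr i (app g i)) = j (opr k (X k))" unfolding y(2) gr_def by blast
  then have "opr i (app g i) = opr k (X k)" using j_inj[OF opr_M opr_M] by blast
  then show ?thesis using opr_inj[OF el_M[OF i] p12_M(3) el_M[OF k(1)] y(3)[OF k(1)]] by metis
 qed
 then show thesis by (rule that[OF g(1) da])
qed

text \<open>Since \<open>y\<close> is a branch, some condition in \<open>G\<close> forces that nodes
  of every length below \<open>lam\<close> agree with \<open>yd\<close>. A bound \<open>de\<close>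
  for \<open>yd\<close> beyond \<open>be\<close> and \<open>gc\<close> allows the witnesses to be
  restricted to the columns \<open>de\<close>, which gives \<open>H1\<close>.\<close>

lemma branch_ex: assumes y: "y : N.branches (j lam) TT"
 obtains X yd de d0 where "y = V yd" "N.elts y = j ` gr lam X" "!!i. i el lam ==> X i el lam"
  "levy_branch M E lam mu G al be gc tx b0 dW yd de d0"
proof -
 have yN: "y : N" "N.func_into y (j lam) (j lam)" and nodes: "!!a. a el lam ==> EX s:N.elts TT. N.func s (j a) & N.elts s <= N.elts y"
  using y unfolding N.branches_def N_elts_j[OF lam_M(1)] by blast+
 obtain X where X: "!!i. i el lam ==> X i el lam" "N.elts y = j ` gr lam X" by (rule N_func_intoE[OF yN lam_M(1) lam_M(1)]) blast
 have XM: "X i : M" if "i el lam" for i using X(1)[OF that] by auto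
 obtain yd where yd: "yd : M" "y = V yd" using yN(1) by (auto simp: N_V)
 have ex: "EX g. on_tree g & dm g = a & (ALL i:elts a. app g i = X i)" if a: "a el lam" for a
 proof -
  obtain s where s: "s : N.elts TT" "N.func s (j a)" "N.elts s <= N.elts y" using nodes[OF a] by blast
  show ?thesis by (rule branch_nodes[OF yN(1) X(2) _ a s]) (use XM in blast)+
 qed
 have J: "(EX p:G. dec p yd (opr i v)) <-> v = X i" if "i el lam" "v : M" for i v
 proof -
  have "(EX p:G. dec p yd (opr i v)) <-> j (opr i v) : j ` gr lam X" unfolding X(2)[symmetric] yd(2) using fmem_j[OF opr_M yd(1)] by simp
  also have "\<dots> <-> v = X i"
  proof
   assume "j (opr i v) : j ` gr lam X"
   then obtain k where k: "k el lam" "j (opr i v) = j (opr k (X k))" unfolding gr_def by blast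
   then show "v = X i" using j_inj[OF opr_M opr_M] opr_inj[OF el_M[OF that(1)] that(2) el_M[OF k(1)] XM[OF k(1)]] by simp
  qed (use that in \<open>auto simp: gr_def\<close>)
  finally show ?thesis .
 qed
 obtain p0 where p0: "p0 : G" "good lam yd p0"
 proof (rule good_ex[OF yd(1) lam_M(1)])
  show "EX! v. v : M & j (opr i v) : N.elts (V yd)" if "i el lam" for i
   using J[OF that] fmem_j[OF opr_M yd(1)] XM[OF that] by (intro ex1I[of _ "X i"]) auto
 qed blast
 let ?P = "%th r. EX y:M. EX c:M. run r th y c & (ALL i:elts th. dec r yd (opr i (app y i)))"
 let ?S = "%q. EX th:elts lam. ALL r:elts PC. q sub r --> ~ ?P th r"
 have "dfn (%e. ?S (e 0))" by (intro dfi yd lam_M PC_M)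
 then obtain p1 where p1: "p1 : G" "!!r th. r el PC ==> p1 sub r ==> th el lam ==> EX s:elts PC. r sub s & ?P th s"
 proof (rule dich[OF _ p0(1)])
  fix q assume q: "q : G" "?S q"
  then obtain th where th: "th el lam" "!!r. r el PC ==> q sub r ==> ~ ?P th r" by blast
  obtain g where g: "on_tree g" "dm g = th" "!!i. i el th ==> app g i = X i" using ex[OF th(1)] by blast
  obtain p c where p: "p : G" "c : M" "run p th g c" "g : M" using g unfolding on_tree_def by blast
  obtain p' where p': "p' : G" "!!i. i el th ==> dec p' yd (opr i (app g i))"
  proof (rule G_all[of "%i p. dec p yd (opr i (app g i))", OF _ _ th(1)])
   show "dfn (%e. dec (e 1) yd (opr (e 0) (app g (e 0))))" by (intro dfi p yd)
   show "EX p:G. dec p yd (opr i (app g i))" if "i el th" for i using iffD2[OF J[OF lam_tr[OF th(1) that] p12_M(3)] g(3)[OF that]] .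
  qed (use dec_mono in blast)+
  obtain r0 where r0: "r0 : G" "p sub r0" "p' sub r0" using G_dir p p' by blast
  obtain r where r: "r : G" "q sub r" "r0 sub r" using G_dir q r0 by blast
  have "run r th g c" by (rule run_mono[OF p(3) _ G_PP[OF p(1)] G_PP[OF r(1)]]) (use r r0 in blast)
  moreover have "dec r yd (opr i (app g i))" if "i el th" for i using dec_mono[OF p'(2)[OF that], of r] r r0 by blast
  ultimately show thesis using th(2)[OF G_PP[OF r(1)] r(2)] p by blast
 next
  fix q assume q: "q : G" "ALL r:elts PC. q sub r --> ~ ?S r"
  show thesis by (rule that[OF q(1)]) (use q(2) in blast)
 qed
 obtain r0 where r0: "r0 : G" "p0 sub r0" "p1 sub r0" using G_dir p0 p1 by blast
 obtain d0 where d0: "d0 : G" "r0 sub d0" "a0 sub d0" using G_dir r0 a0G by blast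
 obtain m where m: "m el mu" "be sub m" "gc sub m" "be el m" "gc el m" by (rule reg_join[OF mu_reg al(2,3)])
 have gd: "good lam yd d0" by (rule good_mono[OF p0(2)]) (use d0 r0 in blast)
 obtain de where de: "de el mu" "m el de" "bd yd d0 de" by (rule bound_ex[OF yd(1) gd G_PP[OF d0(1)] m(1)])
 have tr: "x el de" if "x el m" for x using ord_tr[OF ord_el[OF ordl(2) de(1)] de(2) that] .
 have deM: "de : M" using de by auto
 have ad: "al sub de" using al(4) m(2) tr by blast
 have "levy_branch M E lam mu G al be gc tx b0 dW yd de d0"
 proof unfold_locales
  show "de el mu" "be sub de" "gc el de" "yd : M" "bd yd d0 de" "a0 sub d0" "d0 : G" using de m tr yd d0 by auto
  fix d th assume d: "d el cs de" "d0 sub d" and th: "th el lam"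
  obtain s where s: "s el PC" "d sub s" "?P th s" using p1(2)[OF cs_PC[OF deM d(1)] _ th] d(2) d0 r0 by blast
  obtain y' c where y': "y' : M" "c : M" "run s th y' c" "ALL i:elts th. dec s yd (opr i (app y' i))" using s(3) by blast
  have "run (rst s de) th y' c" by (rule run_rst[OF y'(3) ad tr[OF m(5)] deM el_M[OF s(1)]])
  moreover have "dec (rst s de) yd (opr i (app y' i))" if "i el th" for i
   by (rule dec_rst[OF de(3) deM s(1) _ lam_tr[OF th that] p12_M(3)]) (use d(2) s(2) y'(4) that in blast)+
  moreover have "d sub rst s de" by (rule cs_rst[OF deM d(1) el_M[OF s(1)] s(2)])
  ultimately show "EX d':elts (cs de). d sub d' & (EX y:M. EX c:M. run d' th y c & (ALL i:elts th. dec d' yd (opr i (app y i))))"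
   using rst_cs[OF s(1) deM] y'(1,2) by blast
 qed
 then show thesis using that yd(2) X by blast
qed

text \<open>Every right partner under \<open>Z\<close> extends \<open>b0\<close> and hence forces
  the formula of \<open>tx\<close> and \<open>tz\<close>. So conditions in \<open>G\<close> force it
  of the transported names, whose values are the branch \<open>y\<close> and the old
  \<open>z\<close>.\<close>

theorem branch_sat:
 assumes txn: "!!x s. x : M ==> s : M ==> opr x s el tx ==> EX k:elts (times lam lam). x = chk k"
 and tz: "tz : M" "bd tz c0 al" "c0 sub b0" "K : M" "!!x s. x : M ==> s : M ==> opr x s el tz ==> EX k:elts (times lam K). x = chk k"
  "N.elts (V tz) = j ` gr lam Xz" "!!i. i el lam ==> Xz i : M"
 and phi: "forces phi b0 (%i. if i = 0 then tx else tz)"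
 and y: "y : N.branches (j lam) TT"
 shows "sat N EN phi (%i. if i = 0 then y else V tz)"
proof -
 obtain X yd de d0 where br: "y = V yd" "N.elts y = j ` gr lam X" "!!i. i el lam ==> X i el lam"
  "levy_branch M E lam mu G al be gc tx b0 dW yd de d0" by (rule branch_ex[OF y]) (rule that)
 interpret br: levy_branch M E lam mu G al be gc tx b0 dW yd de d0 by (rule br(4))
 have deM: "de : M" "yd : M" by simp_all
 obtain Z where Z: "iso Z" "!!p. p : G ==> EX p' q'. Z p' q' & p' : G & p sub p'"
  "!!p q. Z p q ==> EX e:elts br.EE. rst p de = br.f1 e & rst q de = br.f2 e" by (rule br.Z_ex) blast
 have b0q: "b0 sub q" if z: "Z p q" for p q
 proof -
  obtain e where e: "e el br.EE" "rst q de = br.f2 e" using Z(3)[OF z] by blast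
  have "b0 sub rst q de" unfolding e(2) using br.f_cs[OF e(1)] by blast
  then show ?thesis using Z_M[OF Z(1) z] deM by auto
 qed
 have c0: "good lam tz c0" "c0 : M" using tz(2) by (auto simp: bd_def)
 have vy: "V (trn Z tx) = y"
 proof (rule val_trn[OF Z(1,2) al_M(9) lam_M(1) txn b0(2) b0q])
  show "y : N" using br(1) by simp
  show "N.elts y = j ` gr lam X" by (rule br(2))
  show XM: "X i : M" if "i el lam" for i using br(3)[OF that] by auto
  fix i assume i: "i el lam"
  have "j (opr i (X i)) : N.elts (V yd)" using br(1,2) i by (auto simp: gr_def)
  then obtain p where p: "p : G" "dec p yd (opr i (X i))" using fmem_j[OF opr_M deM(2)] by blast
  obtain z0 where z0: "z0 el gc" using code[of zero] by auto
  \<comment> \<open>Once row \<open>i\<close> of column \<open>gc\<close> is written,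
    \<open>f2_dec\<close> applies at \<open>i\<close>; by density this happens in
    \<open>G\<close>.\<close>
  let ?S = "%q. EX z:elts gc. opr (opr gc i) z el q"
  have "dns p ?S" unfolding dns_def
  proof (intro ballI impI)
   fix q assume q: "q el PC" "p sub q"
   have qM: "q : M" using q by auto
   show "EX r:elts PC. q sub r & ?S r"
   proof (cases "?S q")
    case False
    let ?s = "sing (opr (opr gc i) z0)"
    have "un q ?s el PC"
    proof (rule PC_un[OF q(1) single[OF al(3) i z0]])
     fix z w assume z: "z el q" "w el ?s" "p1 z = p1 w"
     have "p1 z = opr gc i" using z(2,3) by (simp add: el_M[OF i] el_M[OF z0])
     moreover obtain a k b where "b el a" "z = opr (opr a k) b" "p1 z = opr a k" "a el mu" "k el lam" by (rule PC_z[OF q(1) z(1)])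
     ultimately have "b el gc" "z = opr (opr gc i) b" using el_M[OF i] by (auto dest: el_M)
     then show "z = w" using False z(1) by blast
    qed
    then show ?thesis using z0 qM by (intro bexI[of _ "un q ?s"]) auto
   qed (use q in blast)
  qed
  moreover have "dfn (%e. ?S (e 0))" by (intro dfi al_M) (use i in auto)
  ultimately obtain r where r: "r : G" "p sub r" "?S r" using G_meets[OF _ p(1), of ?S] by blast
  obtain z where z: "z el gc" "opr (opr gc i) z el r" using r(3) by blast
  obtain p' q' where p': "Z p' q'" "p' : G" "r sub p'" using Z(2)[OF r(1)] by blast
  obtain e where e: "e el br.EE" "rst p' de = br.f1 e" "rst q' de = br.f2 e" using Z(3)[OF p'(1)] by blast
  have M: "p' : M" "q' : M" "z : M" "i : M" using Z_M[OF Z(1) p'(1)] z i by auto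
  have zz: "opr (opr gc i) z el br.f1 e" unfolding e(2)[symmetric] using z(2) p'(3) M deM br.de(3) by (auto simp: co_def)
  have fp: "br.f1 e sub p'" unfolding e(2)[symmetric] using M deM by auto
  have "dec (br.f2 e) tx (opr i (X i))"
   by (rule br.f2_dec[OF e(1) zz M(3,4) fp Z_PP(1)[OF Z(1) p'(1)] i XM[OF i] dec_mono[OF p(2)]]) (use r(2) p'(3) in blast)
  then have "dec q' tx (opr i (X i))" by (rule dec_mono) (unfold e(3)[symmetric], use M deM in auto)
  then show "EX p q. Z p q & p : G & dec q tx (opr i (X i))" using p' by blast
 qed
 have vz: "V (trn Z tz) = V tz"
 proof (rule val_trn[OF Z(1,2) tz(1,4,5) c0(1) _ V_N[OF tz(1)] tz(6,7)])
  show "c0 sub q" if "Z p q" for p q using b0q[OF that] tz(3) by blast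
  fix i assume i: "i el lam"
  have "j (opr i (Xz i)) : N.elts (V tz)" using tz(6) i by (auto simp: gr_def)
  then obtain p where p: "p : G" "dec p tz (opr i (Xz i))" using fmem_j[OF opr_M tz(1)] by blast
  obtain r where r: "r : G" "p sub r" "b0 sub r" using G_dir p b0G by blast
  obtain p' q' where p': "Z p' q'" "p' : G" "r sub p'" using Z(2)[OF r(1)] by blast
  obtain e where e: "e el br.EE" "rst p' de = br.f1 e" "rst q' de = br.f2 e" using Z(3)[OF p'(1)] by blast
  have M: "p' : M" "q' : M" using Z_M[OF Z(1) p'(1)] by auto
  have "rst (rst p' de) al = rst p' al" "rst (rst q' de) al = rst q' al" using M deM br.al_de by (auto intro!: zfc_ext)
  then have eq: "rst p' al = rst q' al" using br.rst_f[OF e(1)] e(2,3) by simp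
  have "dec p' tz (opr i (Xz i))" using dec_mono[OF p(2)] r(2) p'(3) by blast
  then have "dec (rst p' al) tz (opr i (Xz i))"
   by (intro dec_rst[OF tz(2) al_M(1) Z_PP(1)[OF Z(1) p'(1)] _ i tz(7)[OF i]]) (use tz(3) r(3) p'(3) in blast)
  then have "dec q' tz (opr i (Xz i))" unfolding eq by (rule dec_mono) (use M in auto)
  then show "EX p q. Z p q & p : G & dec q tz (opr i (Xz i))" using p' by blast
 qed
 obtain p q where z: "Z p q" "p : G" using Z(2)[OF b0G] by blast
 let ?e = "%i::nat. if i = 0 then tx else tz"
 have eM: "ALL i. ?e i : M" using tz(1) by simp
 have "forces phi q ?e" by (rule forces_mono[OF phi b0q[OF z(1)] G_PP[OF b0G] Z_PP(2)[OF Z(1) z(1)] eM])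
 then have "forces phi p (%i. trn Z (?e i))" using trn_forces[OF Z(1) z(1) eM] by blast
 then have "sat N EN phi (%i. V (trn Z (?e i)))" using truth[of "%i. trn Z (?e i)" phi] z(2) trn_M[OF Z(1)] eM by blast
 moreover have "(%i. V (trn Z (?e i))) = (%i. if i = 0 then y else V tz)" by (rule ext) (simp add: vy vz)
 ultimately show ?thesis by simp
qed

end

section \<open>The two cases\<close>

context levy begin

lemma dec_cn: assumes d: "fmem q (chk k) (cn K S)" "q el PC" "k : M" and S: "dfn (%e. S (e 0) (e 1))" "K : M" shows "k el K"
proof -
 obtain r y s where r: "r el PC" "y : M" "s el PC" "opr y s el cn K S" "feq r (chk k) y" by (rule fmemE[OF d(1,2)])
 obtain k' where "k' el K" "y = chk k'" using opr_cn[OF S r(2) el_M[OF r(3)]] r(4) by blast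
 then show ?thesis using chk_feq[of r k k'] r(1,5) d(3) el_M by metis
qed

text \<open>Listing check names only makes the name fit for \<open>val_trn\<close>. It also limits
  what an arbitrary condition, in \<open>G\<close> or not, can decide about the name.\<close>

lemma nice_name: assumes t: "t : M" "K : M" "N.elts (V t) <= j ` elts K"
 shows "V (cn K (%k p. dec p t k)) = V t"
  "!!x s. x : M ==> s : M ==> opr x s el cn K (%k p. dec p t k) ==> EX k:elts K. x = chk k"
  "!!q k. dec q (cn K (%k p. dec p t k)) k ==> q el PC ==> k : M ==> k el K"
proof -
 have d: "dfn (%e. dec (e 1) t (e 0))" by (intro dfi t)
 show "V (cn K (%k p. dec p t k)) = V t"
 proof (rule N_ext[OF V_N[OF nm_M(2)] V_N[OF t(1)]])
  show "N.elts (V (cn K (%k p. dec p t k))) = N.elts (V t)" unfolding N_elts_cn[OF d t(2)]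
  proof (intro equalityI subsetI)
   fix u assume "u : {j k |k s. k el K & s : G & dec s t k}"
   then show "u : N.elts (V t)" using fmem_j[OF _ t(1)] by blast
  next
   fix u assume u: "u : N.elts (V t)"
   then obtain k where "k el K" "u = j k" using t(3) by blast
   then show "u : {j k |k s. k el K & s : G & dec s t k}" using u fmem_j[OF _ t(1), of k] by auto
  qed
 qed
 show "EX k:elts K. x = chk k" if "x : M" "s : M" "opr x s el cn K (%k p. dec p t k)" for x s
  using opr_cn[OF d t(2) that(1,2)] that(3) by blast
 show "k el K" if "dec q (cn K (%k p. dec p t k)) k" "q el PC" "k : M" for q k
  by (rule dec_cn[OF that d t(2)])
qed

text \<open>Each value is determined by a condition and a name occurring in \<open>t\<close>. So
  replacement in \<open>M\<close> bounds the range even if the function is not in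
  \<open>M\<close>.\<close>

lemma range_bound: assumes t: "t : M" "N.elts (V t) = j ` gr lam X" "!!i. i el lam ==> X i : M"
 obtains K where "K : M" "!!i. i el lam ==> X i el K"
proof -
 define n where "n w = p2 (the1 (%k. feq (p1 w) (chk k) (p2 w)))" for w
 have nd: "dft (%e. n (e 0))" unfolding n_def by (intro dfi PC_M)
 define K where "K = rep (times PC (rep t p1)) n"
 have e1: "elts (rep t p1) = p1 ` elts t" by (rule elts_rep) (intro dfi t)+
 have K: "elts K = n ` elts (times PC (rep t p1))" unfolding K_def by (rule elts_rep[OF nd]) (simp add: fn_M)
 have "X i el K" if i: "i el lam" for i
 proof -
  have "j (opr i (X i)) : N.elts (V t)" using t(2) i by (auto simp: gr_def)
  then obtain y s where y: "j (opr i (X i)) = V y" "y : M" "s : G" "opr y s el t" using N_elts[OF t(1)] by auto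
  then obtain p where p: "p : G" "feq p (chk (opr i (X i))) y" unfolding j_def using V_eq[OF chk_M] by blast
  have pP: "p el PC" by (rule G_PP[OF p(1)])
  have "y el rep t p1" unfolding e1 by (rule image_eqI[of _ _ "opr y s"]) (use y in auto)
  then have w: "opr p y el times PC (rep t p1)" using pP by auto
  have "the1 (%k. feq p (chk k) y) = opr i (X i)"
  proof (rule the1_eq[of "opr i (X i)" "%k. feq p (chk k) y", OF opr_M p(2)])
   fix k assume k: "k : M" "feq p (chk k) y"
   have "feq p y (chk (opr i (X i)))" using feq_sym[OF pP chk_M y(2)] p(2) by blast
   then have "feq p (chk k) (chk (opr i (X i)))" by (rule feq_trans[OF k(2) _ pP chk_M y(2) chk_M])
   then show "k = opr i (X i)" by (rule chk_feq[OF _ pP k(1) opr_M])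
  qed
  then have "X i = n (opr p y)" unfolding n_def using pP y(2) t(3)[OF i] i by (simp add: el_M)
  then show ?thesis unfolding K using w by blast
 qed
 moreover have "K : M" by (simp add: K_def)
 ultimately show thesis using that by blast
qed

text \<open>As \<open>E\<close> may be ill-founded, a least element cannot be chosen from outside.
  Instead it is dense to decide some \<open>i\<close> into \<open>B\<close> such that no smaller
  index can be decided into \<open>B\<close> any more.\<close>

lemma N_least: assumes B: "B : N" "N.elts B <= j ` elts lam" "N.elts B ~= {}"
 obtains i where "i el lam" "j i : N.elts B" "!!k. k el i ==> j k ~: N.elts B"
proof -
 obtain t where t: "t : M" "B = V t" using B(1) by (auto simp: N_V)
 obtain i0 where i0: "i0 el lam" "j i0 : N.elts B" using B by blast
 obtain p where p: "p : G" "dec p t i0" using fmem_j[OF el_M[OF i0(1)] t(1)] i0(2) t(2) by blast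
 let ?S = "%q. EX i:elts lam. dec q t i & (ALL k:elts i. ALL r:elts PC. q sub r --> ~ dec r t k)"
 have "dns p ?S" unfolding dns_def
 proof (intro ballI impI)
  fix q assume q: "q el PC" "p sub q"
  let ?Q = "%i. i el lam & (EX r:elts PC. q sub r & dec r t i)"
  have dQ: "dfn (%e. ?Q (e 0))" by (intro dfi t lam_M PC_M) (use q in auto)
  have q0: "?Q i0" using i0(1) q dec_mono[OF p(2) q(2)] by blast
  obtain i where i: "i : M" "?Q i" "!!k. k el i ==> ~ ?Q k" by (rule minimal[of ?Q i0, OF dQ el_M[OF i0(1)] q0]) (rule that)
  obtain r where r: "r el PC" "q sub r" "dec r t i" using i(2) by blast
  have "~ dec s t k" if "k el i" "s el PC" "r sub s" for k s
   using i(3)[OF that(1)] lam_tr[OF _ that(1)] i(2) that r(2) by blast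
  then show "EX r:elts PC. q sub r & ?S r" using r i(2) by blast
 qed
 moreover have "dfn (%e. ?S (e 0))" by (intro dfi t lam_M PC_M)
 ultimately obtain q where q: "q : G" "?S q" using G_meets[OF _ p(1), of ?S] by blast
 then obtain i where i: "i el lam" "dec q t i" "!!k r. k el i ==> r el PC ==> q sub r ==> ~ dec r t k" by blast
 have "j k ~: N.elts B" if k: "k el i" for k
 proof
  assume "j k : N.elts B"
  then obtain s where s: "s : G" "dec s t k" using fmem_j[OF el_M[OF k] t(1)] t(2) by blast
  obtain r where "r : G" "s sub r" "q sub r" using G_dir s q(1) by blast
  then show False using i(3)[OF k] dec_mono[OF s(2)] G_PP by blast
 qed
 moreover have "j i : N.elts B" using fmem_j[OF el_M[OF i(1)] t(1)] q(1) i(2) t(2) by blast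
 ultimately show thesis using that i(1) by blast
qed

text \<open>Names for pairs of named sets. In \<open>few\<close> the first components of the pairs
  are not in the ground model, so \<open>j\<close> of a pair does not suffice.\<close>

definition upn where "upn s t = mk {opr s zero, opr t zero}"
definition opn where "opn s t = upn (upn s s) (upn s t)"

lemma upn_M [simp]: "upn s t : M" "opn s t : M" by (simp_all add: upn_def opn_def)
lemma upn_un: "upn s t = un (sing (opr s zero)) (sing (opr t zero))"
 by (rule zfc_ext) (auto simp: upn_def elts_mk)
lemma dft_opn: "dft A ==> dft B ==> dft (%e. opn (A e) (B e))" unfolding opn_def upn_un by (intro dfi zero)

lemma V_upn: "s : M ==> t : M ==> N.elts (V (upn s t)) = {V s, V t}"
proof -
 assume M: "s : M" "t : M"
 have 1: "opr y u el upn s t <-> (y = s | y = t) & u = zero" if "y : M" "u : M" for y u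
  using that M by (auto simp: upn_def elts_mk)
 have "(y : M & u : G & opr y u el upn s t) <-> (y = s | y = t) & u = zero" for y u
  using 1[of y u] M zero_G zero(1) G_M[of u] by blast
 then show ?thesis unfolding N_elts[OF upn_M(1)] by auto
qed

lemma V_opn: "s : M ==> t : M ==> N.opair (V (opn s t)) (V s) (V t)"
 unfolding N.opair_def opn_def by (intro bexI[of _ "V (upn s s)"] bexI[of _ "V (upn s t)"]) (simp_all add: V_upn)

text \<open>Every member of \<open>A\<close> is read off the generic below \<open>al\<close> by some \<open>Y\<close> in the ground model. The sets \<open>Y\<close> are
 enumerated by a column of the collapse in type \<open>lam\<close>.\<close>

definition rd where "rd Y = V (cn (times lam lam) (%k p. opr p k el Y))"

lemma few: assumes al: "al el mu" and A: "A : N" and s: "!!x. x : N.elts A ==> EX Y:elts (pow (times (cs al) (times lam lam))). x = rd Y"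
 shows "N.card_le A (j lam)"
proof -
 define P where "P = pow (times (cs al) (times lam lam))"
 have "bs mu P" unfolding P_def by (intro mu_pow bs_times mu_reg cs_bs al bs_el[OF mu_reg lam_mu])
 then obtain a F where a: "a el mu" "F : M" "bijection F P a" by (rule bs_bij[OF mu_reg])
 have PM: "P : M" "a : M" using a by (auto simp: P_def)
 have F: "!!Y. Y el P ==> app F Y el a" "!!Y Y'. Y el P ==> Y' el P ==> app F Y = app F Y' ==> Y = Y'"
  using a(3) bijection_iff[OF a(2) PM] func_into_iff[OF a(2) PM] by blast+
 define t where "t Y = cn (times lam lam) (%k p. opr p k el Y)" for Y
 have td: "dft (%e. t (e 0))" unfolding t_def cn_def by (intro dfi lam_M PC_M)
 have tM: "t Y : M" for Y by (simp add: t_def)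
 \<comment> \<open>If row \<open>i\<close> of column \<open>a\<close> holds the code of
   \<open>Y\<close>, then \<open>W\<close> relates the set that \<open>Y\<close> reads off to
   \<open>i\<close>.\<close>
 define S where "S n p = (EX Y:elts P. EX i:elts lam. n = opn (t Y) (chk i) & opr (opr a i) (app F Y) el p)" for n p
 have Sd: "dfn (%e. S (e 0) (e 1))" unfolding S_def by (intro dfi dft_opn dft1[OF td] PM lam_M a)
 define A0 where "A0 = rep (times P lam) (%w. opn (t (p1 w)) (chk (p2 w)))"
 have A0: "A0 : M" "elts A0 = (%w. opn (t (p1 w)) (chk (p2 w))) ` elts (times P lam)"
  unfolding A0_def by (simp, rule elts_rep) (intro dfi dft_opn dft1[OF td] fn_M)+
 define W where "W = V (nm A0 S)"
 have WN: "W : N" by (simp add: W_def)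
 define L where "L Y i = (Y el P & i el lam & (EX s:G. opr (opr a i) (app F Y) el s))" for Y i
 have W: "N.elts W = {V (opn (t Y) (chk i)) |Y i. L Y i}" unfolding W_def N_elts_nm[OF Sd A0(1)]
 proof (intro equalityI subsetI)
  fix u assume "u : {V x |x s. x el A0 & s : G & S x s}"
  then show "u : {V (opn (t Y) (chk i)) |Y i. L Y i}" unfolding S_def L_def by blast
 next
  fix u assume "u : {V (opn (t Y) (chk i)) |Y i. L Y i}"
  then obtain Y i s where u: "u = V (opn (t Y) (chk i))" "Y el P" "i el lam" "s : G" "opr (opr a i) (app F Y) el s" unfolding L_def by blast
  have "opn (t Y) (chk i) el A0" unfolding A0(2)
   by (rule image_eqI[of _ _ "opr Y i"]) (use u PM in \<open>auto simp: el_M\<close>)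
  then show "u : {V x |x s. x el A0 & s : G & S x s}" using u unfolding S_def by blast
 qed
 have pW: "N.pair_in W x y <-> (EX Y i. L Y i & x = rd Y & y = j i)" for x y
 proof
  assume "N.pair_in W x y"
  then obtain Y i where Y: "L Y i" "N.opair (V (opn (t Y) (chk i))) x y" unfolding N.pair_in_def W by blast
  have "x = V (t Y) & y = V (chk i)" by (rule N.opair_inj[OF Y(2) V_opn[OF tM chk_M]])
  then show "EX Y i. L Y i & x = rd Y & y = j i" using Y(1) unfolding rd_def t_def j_def by blast
 next
  assume "EX Y i. L Y i & x = rd Y & y = j i"
  then obtain Y i where "L Y i" "x = V (t Y)" "y = V (chk i)" unfolding rd_def t_def j_def by blast
  then show "N.pair_in W x y" unfolding N.pair_in_def W using V_opn[OF tM chk_M] by blast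
 qed
 \<comment> \<open>The rows used by a condition are bounded in \<open>lam\<close>, so the code of
   \<open>Y\<close> can be put in a fresh row; by density it occurs in \<open>G\<close>.\<close>
 have Lex: "EX i. L Y i" if Y: "Y el P" for Y
 proof -
  obtain p where p: "p : G" using G_ne by blast
  let ?T = "%q. EX i:elts lam. opr (opr a i) (app F Y) el q"
  have "dns p ?T" unfolding dns_def
  proof (intro ballI impI)
   fix q assume q: "q el PC"
   have qM: "q : M" using q by auto
   obtain i where i: "i el lam" "!!z. z el q ==> p2 (p1 z) el i" by (rule PC_rows[OF q]) blast
   let ?s = "sing (opr (opr a i) (app F Y))"
   have "un q ?s el PC"
   proof (rule PC_un[OF q single[OF a(1) i(1) F(1)[OF Y]]])
    fix z w assume z: "z el q" "w el ?s" "p1 z = p1 w"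
    then have "p2 (p1 z) = i" using PM el_M[OF i(1)] by simp
    then show "z = w" using i(2)[OF z(1)] no_cycle(1)[of i] by (auto dest: el_M)
   qed
   then show "EX r:elts PC. q sub r & ?T r" using i(1) qM by (intro bexI[of _ "un q ?s"]) auto
  qed
  moreover have "dfn (%e. ?T (e 0))" by (intro dfi PM a lam_M) (use Y in auto)
  ultimately obtain q where "q : G" "?T q" using G_meets[OF _ p, of ?T] by blast
  then show ?thesis unfolding L_def using Y by blast
 qed
 have Linj: "Y = Y'" if L: "L Y i" "L Y' i" for Y Y' i
 proof -
  obtain q q' where q: "q : G" "q' : G" "opr (opr a i) (app F Y) el q" "opr (opr a i) (app F Y') el q'" using L unfolding L_def by blast
  obtain r where r: "r : G" "q sub r" "q' sub r" using G_dir q by blast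
  have "i : M" using L(1) unfolding L_def by auto
  then have "opr (opr a i) (app F Y) = opr (opr a i) (app F Y')"
   using PC_inj[OF G_PP[OF r(1)], of "opr (opr a i) (app F Y)" "opr (opr a i) (app F Y')"] q(3,4) r(2,3) PM(2)
   by (metis p12(1) opr_M p12_M(3) subsetD)
  then show ?thesis using F(2)[of Y Y'] L \<open>i : M\<close> PM unfolding L_def by simp
 qed
 \<comment> \<open>\<open>W\<close> may relate one member of \<open>A\<close> to many rows; the
   injection \<open>f\<close> takes the least of them.\<close>
 let ?Q = "%z. EX x:N. EX i:N. N.opair z x i & x : N.elts A & (ALL k:N.elts i. ~ N.pair_in W x k)"
 have "N.dfn (%e. ?Q (e 0))" by (intro dfi WN A)
 from N_sep[of ?Q W, OF this WN] obtain f where f: "f : N" "N.elts f = {z : N.elts W. ?Q z}" by (elim bexE) (rule that)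
 have pf: "N.pair_in f x y <-> N.pair_in W x y & x : N.elts A & (ALL k:N.elts y. ~ N.pair_in W x k)" if xy: "x : N" "y : N" for x y
 proof
  assume "N.pair_in f x y"
  then obtain z x' i where z: "z : N.elts W" "N.opair z x y" "N.opair z x' i" "x' : N.elts A" "ALL k:N.elts i. ~ N.pair_in W x' k"
   unfolding N.pair_in_def f by blast
  then have "x = x' & y = i" using N.opair_inj by blast
  then show "N.pair_in W x y & x : N.elts A & (ALL k:N.elts y. ~ N.pair_in W x k)" using z unfolding N.pair_in_def by blast
 next
  assume h: "N.pair_in W x y & x : N.elts A & (ALL k:N.elts y. ~ N.pair_in W x k)"
  then obtain z where z: "z : N.elts W" "N.opair z x y" unfolding N.pair_in_def by blast
  have "?Q z" by (rule bexI[of _ x], rule bexI[of _ y]) (use z(2) h xy in simp_all)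
  then have "z : N.elts f" using z(1) unfolding f(2) by blast
  then show "N.pair_in f x y" unfolding N.pair_in_def using z(2) by blast
 qed
 have uq: "y = y'" if y: "y : N" "y' : N" "N.pair_in f x y" "N.pair_in f x y'" "x : N" for x y y'
 proof -
  have h: "N.pair_in W x y" "ALL k:N.elts y. ~ N.pair_in W x k" "N.pair_in W x y'" "ALL k:N.elts y'. ~ N.pair_in W x k"
   using y pf by blast+
  obtain i i' where i: "y = j i" "y' = j i'" "i el lam" "i' el lam" using h(1,3) unfolding pW L_def by blast
  have M: "i : M" "i' : M" "ordinal i" "ordinal i'" using i ord_el[OF ordl(1)] by auto
  have "~ i el i'" "~ i' el i" using h j_el[OF M(1,2)] j_el[OF M(2,1)] unfolding i(1,2) by blast+
  then show ?thesis using ord_tri[OF M(3,4,1,2)] i(1,2) by blast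
 qed
 have ex: "EX y:N. N.pair_in f x y" if x: "x : N.elts A" for x
 proof -
  have xN: "x : N" using x by (rule N.el_M)
  obtain Y where Y: "Y el P" "x = rd Y" using s[OF x] unfolding P_def by blast
  obtain i where i: "L Y i" using Lex[OF Y(1)] by blast
  have dB: "N.dfn (%e. N.pair_in W x (e 0))" by (intro dfi WN xN)
  obtain B where B: "B : N" "N.elts B = {u : N.elts (j lam). N.pair_in W x u}" using N_sep[of "N.pair_in W x" "j lam", OF dB j_N] by (elim bexE) (rule that)
  have "j i : N.elts B" unfolding B(2) N_elts_j[OF lam_M(1)] using i Y pW unfolding L_def by blast
  then obtain k where k: "k el lam" "j k : N.elts B" "!!l. l el k ==> j l ~: N.elts B"
   using N_least[OF B(1)] B(2) N_elts_j[OF lam_M(1)] by blast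
  have "~ N.pair_in W x u" if u: "u : N.elts (j k)" for u
  proof -
   obtain l where l: "l el k" "u = j l" using u[unfolded N_elts_j[OF el_M[OF k(1)]]] by blast
   have "j l : N.elts (j lam)" unfolding N_elts_j[OF lam_M(1)] using lam_tr[OF k(1) l(1)] by blast
   then show ?thesis using k(3)[OF l(1)] unfolding B(2) l(2) by blast
  qed
  then have "N.pair_in f x (j k)" using pf[OF xN j_N] k(2) x unfolding B(2) by blast
  then show ?thesis using j_N by blast
 qed
 have "N.injection f A (j lam)" unfolding N.injection_def N.func_into_def N.func_def
 proof (intro conjI ballI impI)
  show "EX x:N.elts A. EX y:N. N.opair z x y" if "z : N.elts f" for z using that unfolding f(2) by blast
  show "EX! y. y : N & N.pair_in f x y" if "x : N.elts A" for x using ex[OF that] uq N.el_M[OF that] by blast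
  show "y : N.elts (j lam)" if "x : N" "y : N" "N.pair_in f x y" for x y
   using pf[OF that(1,2)] that(3) unfolding pW L_def N_elts_j[OF lam_M(1)] by blast
  show "x = x'" if N: "x : N" "x' : N" "y : N" and h: "N.pair_in f x y & N.pair_in f x' y" for x x' y
  proof -
   have "N.pair_in W x y" "N.pair_in W x' y" using pf N h by blast+
   then obtain Y i Y' i' where L: "L Y i" "x = rd Y" "y = j i" "L Y' i'" "x' = rd Y'" "y = j i'" unfolding pW by blast
   have "i = i'" using j_inj[of i i'] L unfolding L_def by (metis el_M)
   then show ?thesis using Linj[OF L(1)] L by blast
  qed
 qed
 then show ?thesis unfolding N.card_le_def using f(1) by blast
qed

text \<open>An element that is not read off the generic below \<open>al\<close> has a name \<open>tx\<close> below some condition of which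
 the quotient over \<open>al\<close> always splits; otherwise the values decided by extensions in the columns \<open>[al, be)\<close>
 would be determined by the generic below \<open>al\<close>.\<close>

lemma many: assumes al: "al el mu" and x: "x = V tx" "tx : M" "N.elts x = j ` gr lam X" "!!i. i el lam ==> X i el lam"
 and dlam: "!!q i v. q el PC ==> i el lam ==> v : M ==> dec q tx (opr i v) ==> v el lam"
 and nr: "!!Y. Y el pow (times (cs al) (times lam lam)) ==> x ~= rd Y" and p: "p : G"
 obtains be gc b0 dW where "levy_tree M E lam mu G al be gc tx b0 dW" "p sub b0"
proof -
 have alM: "al : M" using al by auto
 have XM: "X i : M" if "i el lam" for i using x(4)[OF that] by auto
 have J: "(EX p:G. dec p tx k) <-> (EX i:elts lam. k = opr i (X i))" if k: "k : M" for k
 proof -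
  have "(EX p:G. dec p tx k) <-> j k : j ` gr lam X" unfolding x(3)[symmetric] x(1) using fmem_j[OF k x(2)] by simp
  also have "\<dots> <-> (EX i:elts lam. k = opr i (X i))" unfolding gr_def using j_inj[OF k opr_M] by blast
  finally show ?thesis .
 qed
 have J2: "(EX p:G. dec p tx (opr i v)) <-> v = X i" if i: "i el lam" "v : M" for i v
  unfolding J[OF opr_M] using opr_inj[OF el_M[OF i(1)] i(2)] XM i by (metis el_M)
 obtain p0 where p0: "p0 : G" "good lam tx p0"
 proof (rule good_ex[OF x(2) lam_M(1)])
  show "EX! v. v : M & j (opr i v) : N.elts (V tx)" if "i el lam" for i
   using J2[OF that] fmem_j[OF opr_M x(2)] XM[OF that] by (intro ex1I[of _ "X i"]) auto
 qed blast
 obtain q1 where q1: "q1 : G" "p0 sub q1" "p sub q1" using G_dir p0 p by blast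
 have q1P: "q1 el PC" by (rule G_PP[OF q1(1)])
 obtain be where be: "be el mu" "al el be" "bd tx q1 be" by (rule bound_ex[OF x(2) good_mono[OF p0(2) q1(2)] q1P al])
 have beM: "be : M" using be by auto
 have ab: "al sub be" using ord_tr[OF ord_el[OF ordl(2) be(1)] be(2)] by blast
 have q1b: "q1 el cs be" using be(3) by (simp add: bd_def)
 define R where "R = sep (cs be) (%r. ALL z:elts r. ~ co z el al)"
 have RM: "R : M" by (simp add: R_def)
 have el_R: "r el R <-> r el cs be & (ALL z:elts r. ~ co z el al)" for r
  unfolding R_def by (subst elts_sep, intro dfi alM) simp_all
 have RbsM: "bs mu R" by (rule bs_sub[OF mu_reg cs_bs[OF be(1)] RM]) (simp add: el_R subset_iff)
 define Kp where "Kp = pow (times R (times lam R))"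
 have "bs mu Kp" unfolding Kp_def by (intro mu_pow bs_times mu_reg RbsM bs_el[OF mu_reg lam_mu])
 then obtain g0 F where g0: "g0 el mu" "F : M" "bijection F Kp g0" by (rule bs_bij[OF mu_reg])
 have KM: "Kp : M" "g0 : M" using g0 by (auto simp: Kp_def)
 have F: "!!W. W el Kp ==> app F W el g0" "!!W W'. W el Kp ==> W' el Kp ==> app F W = app F W' ==> W = W'"
  using g0(3) bijection_iff[OF g0(2) KM] func_into_iff[OF g0(2) KM] by blast+
 obtain gc where gc: "gc el mu" "be sub gc" "g0 sub gc" by (rule reg_join[OF mu_reg be(1) g0(1)])
 \<comment> \<open>The inverse of the bijection \<open>F\<close>, as a function on
   \<open>gc\<close>. The column \<open>gc\<close> was chosen to contain \<open>be\<close> and the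
   set \<open>g0\<close> of all codes.\<close>
 define dW where "dW = fn gc (%z. the1 (%W. W el Kp & app F W = z))"
 have dd: "dft (%e. the1 (%W. W el Kp & app F W = e 0))" by (intro dfi KM g0)
 have dW: "EX z:elts gc. app dW z = W" if W: "W : M" "W sub times R (times lam R)" for W
 proof -
  have WK: "W el Kp" unfolding Kp_def using W by simp
  have z: "app F W el gc" using F(1)[OF WK] gc(3) by blast
  have "app dW (app F W) = the1 (%W'. W' el Kp & app F W' = app F W)" unfolding dW_def by (rule app_fn[OF dd z el_M[OF gc(1)]])
  also have "\<dots> = W" by (rule the1_eq[of W "%W'. W' el Kp & app F W' = app F W", OF W(1)]) (use WK F(2) in blast)+
  finally show ?thesis using z by blast
 qed
 have tree: "tree M E lam mu al be gc tx b dW" if "bd tx b be" for b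
 proof unfold_locales
  show "al el mu" "be el mu" "gc el mu" "al sub be" "be sub gc" "tx : M" "bd tx b be" "dW : M"
   using al be gc ab x(2) that by (auto simp: dW_def)
  show "v el lam" if "q el PC" "b sub q" "i el lam" "v : M" "dec q tx (opr i v)" for q i v using dlam that by blast
  show "EX z:elts gc. app dW z = W" if "W : M" "W sub times (sep (cs be) (%r. ALL z:elts r. ~ co z el al)) (times lam (sep (cs be) (%r. ALL z:elts r. ~ co z el al)))" for W
   using dW[unfolded R_def, OF that] .
 qed
 interpret tq: tree M E lam mu al be gc tx q1 dW by (rule tree[OF be(3)])
 let ?rs = tq.rs
 have R: "tq.R = R" unfolding tq.R_def R_def by (rule refl)
 have sp: "rst r al el cs al" "?rs r el R" "un (rst r al) (?rs r) = r" if "r el cs be" for r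
  using tq.split_be[OF that] unfolding R by blast+
 define SS where "SS a s = (EX a':elts (cs al). a sub a' & (EX u:elts R. EX u':elts R.
  s sub u & s sub u' & (EX i:elts lam. EX v:M. EX w:M. v ~= w & dec (un a' u) tx (opr i v) & dec (un a' u') tx (opr i w))))" for a s
 have SSd: "dft A ==> dft B ==> dfn (%e. SS (A e) (B e))" for A B :: "(nat => 'a) => 'a"
  by (rule dfn2[of SS]) (unfold SS_def, intro dfi alM RM x(2) lam_M)
 \<comment> \<open>Densely below \<open>q1\<close>, either all pairs above the two parts of
   \<open>r\<close> split, or \<open>r\<close> contains a pair that does not. The second alternative
   is refuted for a condition in \<open>G\<close> by \<open>nB\<close>.\<close>
 let ?G = "%r. ALL a:elts (cs al). ALL s:elts R. rst r al sub a --> ?rs (rst r be) sub s --> SS a s"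
 let ?B = "%r. EX a:elts (cs al). EX s:elts R. un a s sub r & ~ SS a s"
 have "dns q1 (%r. ?G r | ?B r)" unfolding dns_def
 proof (intro ballI impI)
  fix q assume q: "q el PC" "q1 sub q"
  show "EX r:elts PC. q sub r & (?G r | ?B r)"
  proof (cases "?G q")
   case False
   then obtain a s where a: "a el cs al" "s el R" "rst q al sub a" "?rs (rst q be) sub s" "~ SS a s" by blast
   have M: "a : M" "s : M" "q : M" using a q by auto
   have asb: "un a s el cs be" by (rule tq.un_aR(1)[OF a(1)]) (use a(2) R in simp)
   have sub: "rst q be sub un a s"
   proof
    fix z assume z: "z el rst q be"
    have "z el rst q al | z el ?rs (rst q be)" using z M alM beM by auto
    then show "z el un a s" using a(3,4) M by auto
   qed
   have "un q (un a s) el PC" by (rule amal(1)[OF q(1) asb beM sub])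
   then show ?thesis using a M by (intro bexI[of _ "un q (un a s)"]) auto
  qed (use q in blast)
 qed
 moreover have "dfn (%e. ?G (e 0) | ?B (e 0))" by (intro dfi SSd tq.dft_rs alM RM beM)
 ultimately obtain r where r: "r : G" "q1 sub r" "?G r | ?B r" using G_meets[OF _ q1(1), of "%r. ?G r | ?B r"] by blast
 have rP: "r el PC" "r : M" using G_PP[OF r(1)] by auto
 have nB: "~ ?B r"
 proof
  assume "?B r"
  then obtain a s where a: "a el cs al" "s el R" "un a s sub r" "~ SS a s" by blast
  have M: "a : M" "s : M" using a by auto
  \<comment> \<open>\<open>Y\<close> collects the decisions about \<open>tx\<close> that
    \<open>a'\<close> makes with the help of some extension of \<open>s\<close>. As
    \<open>a\<close>, \<open>s\<close> do not split, the conditions in \<open>G\<close> below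
    \<open>al\<close> yield only correct values.\<close>
  define Y where "Y = sep (times (cs al) (times lam lam)) (%w. a sub p1 w & (EX u:elts R. s sub u & dec (un (p1 w) u) tx (p2 w)))"
  have Y: "opr a' k el Y <-> a' el cs al & k el times lam lam & a sub a' & (EX u:elts R. s sub u & dec (un a' u) tx k)" if "a' : M" "k : M" for a' k
   unfolding Y_def by (subst elts_sep, intro dfi M RM x(2)) (use that in simp_all)
  have YP: "Y el pow (times (cs al) (times lam lam))" unfolding Y_def by (simp, subst elts_sep, intro dfi M RM x(2)) auto
  have A: "EX a':G. a' el cs al & a sub a' & (EX u:elts R. s sub u & dec (un a' u) tx (opr i (X i)))" if i: "i el lam" for i
  proof -
   obtain p where p: "p : G" "dec p tx (opr i (X i))" using J2[OF i XM[OF i]] by blast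
   obtain w where w: "w : G" "p sub w" "r sub w" using G_dir p r by blast
   have wM: "w : M" "w el PC" using G_PP[OF w(1)] by auto
   have "q1 sub w" using r w by blast
   then have d: "dec (rst w be) tx (opr i (X i))" by (rule dec_rst[OF be(3) beM wM(2) _ i XM[OF i] dec_mono[OF p(2) w(2)]])
   have wb: "rst w be el cs be" by (rule rst_cs[OF wM(2) beM])
   note S = sp[OF wb]
   have aw: "a sub rst (rst w be) al" "s sub ?rs (rst w be)"
   proof -
    have "a sub w" "s sub w" using a(3) w(3) M by auto
    then show "a sub rst (rst w be) al" "s sub ?rs (rst w be)" using a(1,2) wM M ab alM beM by (auto simp: el_cs el_R)
   qed
   have "rst (rst w be) al : G" by (rule G_up[OF w(1) cs_PC[OF alM S(1)]]) (use wM alM beM in auto)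
   moreover have "dec (un (rst (rst w be) al) (?rs (rst w be))) tx (opr i (X i))" unfolding S(3) by (rule d)
   ultimately show ?thesis using S(1,2) aw by blast
  qed
  have "x = rd Y"
  proof (rule N_ext)
   show "x : N" "rd Y : N" by (simp_all add: x(1,2) rd_def)
   have dY: "dfn (%e. opr (e 1) (e 0) el Y)" unfolding Y_def by (intro dfi) simp
   show "N.elts x = N.elts (rd Y)" unfolding x(3) rd_def N_elts_cn[OF dY fn_M(2)]
   proof (intro equalityI subsetI)
    fix u assume "u : j ` gr lam X"
    then obtain i where i: "i el lam" "u = j (opr i (X i))" by (auto simp: gr_def)
    obtain a' u' where a': "a' : G" "a' el cs al" "a sub a'" "u' el R" "s sub u'" "dec (un a' u') tx (opr i (X i))" using A[OF i(1)] by blast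
    have "opr i (X i) el times lam lam" using el_M[OF i(1)] el_M[OF x(4)[OF i(1)]] i(1) x(4)[OF i(1)] by simp
    then show "u : {j k |k p. k el times lam lam & p : G & opr p k el Y}" using i(2) a' Y[OF G_M[OF a'(1)] opr_M] by blast
   next
    fix u assume "u : {j k |k p. k el times lam lam & p : G & opr p k el Y}"
    then obtain k a' where k: "u = j k" "k el times lam lam" "a' : G" "opr a' k el Y" by blast
    then obtain i v where iv: "i el lam" "v el lam" "k = opr i v" by (auto simp: elts_times)
    obtain u1 where u1: "a' el cs al" "a sub a'" "u1 el R" "s sub u1" "dec (un a' u1) tx (opr i v)"
     using Y[OF G_M[OF k(3)] el_M[OF k(2)]] k(4) iv(3) by blast
    obtain a2 u2 where u2: "a2 : G" "a2 el cs al" "u2 el R" "s sub u2" "dec (un a2 u2) tx (opr i (X i))" using A[OF iv(1)] by blast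
    obtain w where w: "w : G" "a' sub w" "a2 sub w" using G_dir k(3) u2(1) by blast
    have wP: "w el PC" "w : M" using G_PP[OF w(1)] by auto
    have a3: "rst w al el cs al" "a' sub rst w al" "a2 sub rst w al"
     using rst_cs[OF wP(1) alM] cs_rst[OF alM u1(1) wP(2) w(2)] cs_rst[OF alM u2(2) wP(2) w(3)] by auto
    have uM: "u1 : M" "u2 : M" "a' : M" "a2 : M" using u1 u2 by auto
    have "dec (un (rst w al) u1) tx (opr i v)" "dec (un (rst w al) u2) tx (opr i (X i))"
     by (rule dec_mono[OF u1(5)], use a3 uM in auto)(rule dec_mono[OF u2(5)], use a3 uM in auto)
    moreover have "a sub rst w al" using u1(2) a3(2) by blast
    ultimately have "v = X i" using a(4) a3(1) u1(3,4) u2(3,4) iv(1) el_M[OF iv(2)] XM[OF iv(1)] unfolding SS_def by blast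
    then show "u : j ` gr lam X" using k(1) iv by (auto simp: gr_def)
   qed
  qed
  then show False using nr YP by blast
 qed
 then have Gr: "?G r" using r(3) by blast
 define b0 where "b0 = rst r be"
 have b0: "b0 el cs be" "q1 sub b0" "b0 : M" unfolding b0_def using rst_cs[OF rP(1) beM] cs_rst[OF beM q1b rP(2) r(2)] by auto
 have b0G: "b0 : G" by (rule G_up[OF r(1) cs_PC[OF beM b0(1)]]) (use rP beM in \<open>auto simp: b0_def\<close>)
 have bdb: "bd tx b0 be" unfolding bd_def
 proof (intro conjI ballI impI b0(1))
  show "good lam tx b0" by (rule good_mono[OF _ b0(2)]) (use be(3) in \<open>simp add: bd_def\<close>)
  show "EX r:elts (cs be). q sub r & (EX v:M. dec r tx (opr i v))" if "q el cs be" "b0 sub q" "i el lam" for q i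
   by (rule bdD[OF be(3) that(1) _ that(3)]) (use that(2) b0(2) in blast)
 qed
 interpret tr: tree M E lam mu al be gc tx b0 dW by (rule tree[OF bdb])
 have eq: "tr.R = R" "tr.r1 = ?rs b0" unfolding tr.R_def R_def tr.r1_def by (rule refl)+
 have "rst r al = rst b0 al" unfolding b0_def using rP ab alM beM by (intro zfc_ext) auto
 then have a0: "rst r al = tr.a0" unfolding tr.a0_def .
 have "levy_tree M E lam mu G al be gc tx b0 dW"
 proof unfold_locales
  show "b0 : G" by (rule b0G)
  fix a s assume a: "a el cs al" "tr.a0 sub a" "s el tr.R" "tr.r1 sub s"
  have h: "rst r al sub a" "s el R" "?rs b0 sub s" using a(2-4) by (simp_all only: eq a0)
  have "SS a s" using Gr a(1) h(1,2) h(3)[unfolded b0_def] by blast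
  then show "EX a':elts (cs al). a sub a' & (EX u:elts tr.R. EX u':elts tr.R. s sub u & s sub u' &
   (EX i:elts lam. EX v:M. EX w:M. v ~= w & dec (un a' u) tx (opr i v) & dec (un a' u') tx (opr i w)))"
   unfolding SS_def eq .
 qed
 then show thesis using that q1 b0(2) by blast
qed

theorem psp: assumes fv: "fv phi <= {0, 1}" and z: "z : N" "N.func z (j lam)" "!!u y. u : N ==> y : N ==> N.pair_in z u y ==> y : j ` M"
 shows "EX A:N. N.elts A = {x : N. N.func_into x (j lam) (j lam) & sat N EN phi (%i. if i = 0 then x else z)} &
  N.perfect_set_property (j lam) A"
proof -
 let ?Q = "%x. N.func_into x (j lam) (j lam) & sat N EN phi (%i. if i = 0 then x else z)"
 have jl: "j lam : N" by simp
 \<comment> \<open>The substitution rule replaces the first two variables and keeps the others. By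
   the hypothesis on \<open>fv phi\<close>, the others can then be exchanged for
   \<open>z\<close>.\<close>
 have "N.dfn (%e. sat N EN phi (%i. if i < 2 then (if i = 0 then e 0 else z) else e (i - 2)))"
 proof (rule N.dfn_many[OF N.dfn_sat[OF jl]])
  show "N.dft (%e. if i = 0 then e 0 else z)" for i :: nat by (cases "i = 0") (simp_all add: N.dft_var N.dft_const z(1))
 qed
 moreover have "sat N EN phi (%i. if i < 2 then (if i = 0 then e 0 else z) else e (i - 2)) = sat N EN phi (%i. if i = 0 then e 0 else z)" for e
  by (rule sat_fv) (use fv in auto)
 ultimately have "N.dfn (%e. sat N EN phi (%i. if i = 0 then e 0 else z))" by simp
 then have Qd: "N.dfn (%e. ?Q (e 0))" by (intro dfi jl)
 obtain b where b: "b : N" "N.elts b = {x : N. N.elts x <= N.elts (j (times lam lam))}" using N_pow[OF j_N] by blast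
 from N_sep[of ?Q b, OF Qd b(1)] obtain A where A: "A : N" "N.elts A = {x : N.elts b. ?Q x}" by (elim bexE) (rule that)
 have grl: "gr lam X <= elts (times lam lam)" if "!!i. i el lam ==> X i el lam" for X using that by (auto simp: gr_def elts_times)
 have A': "N.elts A = {x : N. ?Q x}"
 proof -
  have "x : N.elts b" if xx: "x : N" "N.func_into x (j lam) (j lam)" for x
  proof -
   obtain X where X: "!!i. i el lam ==> X i el lam" "N.elts x = j ` gr lam X" by (rule N_func_intoE[OF xx lam_M(1) lam_M(1)]) blast
   have "gr lam X <= elts (times lam lam)" by (rule grl) (rule X(1))
   then have "N.elts x <= N.elts (j (times lam lam))" unfolding X(2) N_elts_j[OF fn_M(2)] by (rule image_mono)
   then show ?thesis unfolding b(2) using xx(1) by simp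
  qed
  then show ?thesis unfolding A(2) using b(2) by blast
 qed
 obtain Xz where Xz: "!!i. i el lam ==> Xz i : M" "N.elts z = j ` gr lam Xz" by (rule N_funcE[OF z(1,2) lam_M(1) z(3)]) blast+
 obtain t0 where t0: "t0 : M" "z = V t0" using z(1) by (auto simp: N_V)
 obtain K where K: "K : M" "!!i. i el lam ==> Xz i el K" by (rule range_bound[OF t0(1) Xz(2)[unfolded t0(2)] Xz(1)]) blast+
 define tz where "tz = cn (times lam K) (%k p. dec p t0 k)"
 have "gr lam Xz <= elts (times lam K)" using K by (auto simp: gr_def elts_times)
 then have "N.elts (V t0) <= j ` elts (times lam K)" unfolding t0(2)[symmetric] Xz(2) by (rule image_mono)
 note nz = nice_name[OF t0(1) fn_M(2) this, folded tz_def]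
 have tz: "tz : M" "V tz = z" using nz(1) t0(2) by (simp_all add: tz_def)
 obtain p0 where p0: "p0 : G" "good lam tz p0"
 proof (rule good_ex[OF tz(1) lam_M(1)])
  show "EX! v. v : M & j (opr i v) : N.elts (V tz)" if i: "i el lam" for i
  proof (rule ex1I[of _ "Xz i"])
   show "Xz i : M & j (opr i (Xz i)) : N.elts (V tz)" unfolding tz(2) Xz(2) using Xz(1) i by (auto simp: gr_def)
   fix v assume v: "v : M & j (opr i v) : N.elts (V tz)"
   then obtain k where k: "k el lam" "j (opr i v) = j (opr k (Xz k))" unfolding tz(2) Xz(2) gr_def by blast
   then have "opr i v = opr k (Xz k)" using j_inj[OF opr_M opr_M] by blast
   then show "v = Xz i" using opr_inj[OF el_M[OF i] conjunct1[OF v] el_M[OF k(1)] Xz(1)[OF k(1)]] by metis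
  qed
 qed blast
 \<comment> \<open>\<open>al\<close> is chosen for a nice name of the parameter, before any element
   of \<open>A\<close> is considered, so the case distinction depends on \<open>z\<close> only
   through \<open>tz\<close> and \<open>al\<close>.\<close>
 obtain al where al: "al el mu" "bd tz p0 al" by (rule bound_ex[OF tz(1) p0(2) G_PP[OF p0(1)] reg_zero[OF mu_reg]])
 have "N.perfect_set_property (j lam) A"
 proof (cases "ALL x:N.elts A. EX Y:elts (pow (times (cs al) (times lam lam))). x = rd Y")
  case True
  then have "N.card_le A (j lam)" by (intro few[OF al(1) A(1)]) blast
  then show ?thesis unfolding N.perfect_set_property_def by blast
 next
  case False
  then obtain x where x: "x : N.elts A" "!!Y. Y el pow (times (cs al) (times lam lam)) ==> x ~= rd Y" by blast
  have xN: "x : N" "?Q x" using x(1) unfolding A' by blast+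
  obtain X where X: "!!i. i el lam ==> X i el lam" "N.elts x = j ` gr lam X"
   by (rule N_func_intoE[OF xN(1) conjunct1[OF xN(2)] lam_M(1) lam_M(1)]) blast
  obtain t1 where t1: "t1 : M" "x = V t1" using xN(1) by (auto simp: N_V)
  define tx where "tx = cn (times lam lam) (%k p. dec p t1 k)"
  have "gr lam X <= elts (times lam lam)" by (rule grl) (rule X(1))
  then have "N.elts (V t1) <= j ` elts (times lam lam)" unfolding t1(2)[symmetric] X(2) by (rule image_mono)
  note nx = nice_name[OF t1(1) fn_M(2) this, folded tx_def]
  have tx: "tx : M" "V tx = x" using nx(1) t1(2) by (simp_all add: tx_def)
  let ?e = "%i::nat. if i = 0 then tx else tz"
  have eM: "ALL i. ?e i : M" using tx(1) tz(1) by simp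
  have "(%i. V (?e i)) = (%i. if i = 0 then x else z)" by (rule ext) (simp add: tx tz)
  then have "sat N EN phi (%i. V (?e i))" using xN(2) by simp
  then obtain p1 where p1: "p1 : G" "forces phi p1 ?e" using truth[OF eM] by blast
  obtain p where p: "p : G" "p0 sub p" "p1 sub p" using G_dir p0(1) p1(1) by blast
  have dl: "v el lam" if "q el PC" "i el lam" "v : M" "dec q tx (opr i v)" for q i v
   using nx(3)[OF that(4,1) opr_M] el_M[OF that(2)] that(3) by simp
  obtain be gc b0 dW where lt: "levy_tree M E lam mu G al be gc tx b0 dW" "p sub b0"
   by (rule many[OF al(1) tx(2)[symmetric] tx(1) X(2,1) dl x(2) p(1)])
  interpret lt: levy_tree M E lam mu G al be gc tx b0 dW by (rule lt(1))
  have ph: "forces phi b0 ?e" by (rule forces_mono[OF p1(2) _ G_PP[OF p1(1)] G_PP[OF lt.b0G] eM]) (use p(3) lt(2) in blast)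
  have "sat N EN phi (%i. if i = 0 then y else V tz)" if "y : N.branches (j lam) lt.TT" for y
   by (rule lt.branch_sat[OF nx(2) tz(1) al(2) _ K(1) nz(2) _ Xz(1) ph that]) (use p(2) lt(2) tz(2) Xz(2) in auto)
  then have BA: "N.branches (j lam) lt.TT <= N.elts A" unfolding A' tz(2) N.branches_def by blast
  have "N.dfn (%e. e 0 : N)" by (rule N.dfn_cong[OF _ N.dfn_const[of True]]) simp
  then have "N.dfn (%e. e 0 : N.branches (j lam) lt.TT)" unfolding N.branches_def mem_Collect_eq by (intro dfi jl lt.TT_N)
  from N_sep[of "%y. y : N.branches (j lam) lt.TT" A, OF this A(1)]
  obtain B where B: "B : N" "N.elts B = {y : N.elts A. y : N.branches (j lam) lt.TT}" by (elim bexE) (rule that)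
  have eB: "N.elts B = N.branches (j lam) lt.TT" using B(2) BA by blast
  then have "N.perfect_set (j lam) B" unfolding N.perfect_set_def using lt.TT_N lt.TT_perfect by blast
  then show ?thesis unfolding N.perfect_set_property_def using B(1) BA eB by blast
 qed
 then show ?thesis using A(1) A' by blast
qed

end

theorem theorem2p19:
  fixes M :: "'a set" and E :: "'a \<Rightarrow> 'a \<Rightarrow> bool"
    and lam mu :: 'a and G :: "'a set"
    and N :: "'a set set" and EN :: "'a set \<Rightarrow> 'a set \<Rightarrow> bool" and j :: "'a \<Rightarrow> 'a set"
    and \<phi> :: fm and z :: "'a set"
  assumes "membership.ZFC M E"
    and "lam \<in> M" and "membership.uncountable_regular_cardinal M E lam"
    and "mu \<in> M" and "membership.inaccessible M E mu" and "E lam mu"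
    and "membership.generic M E (membership.Col M E lam mu) (membership.Col_le M E) G"
    and N_def: "N = membership.ext_carrier M E (membership.Col M E lam mu) (membership.Col_le M E) G"
    and EN_def: "EN = membership.ext_mem M E (membership.Col M E lam mu) (membership.Col_le M E) G"
    and j_def: "j = membership.ext_embed M E (membership.Col M E lam mu) (membership.Col_le M E)
                      (membership.Col_one M E) G"
    and "fv \<phi> \<subseteq> {0, 1}"
    and "z \<in> N" and "membership.func N EN z (j lam)"
    and "\<forall>\<xi>\<in>N. \<forall>y\<in>N. membership.pair_in N EN z \<xi> y \<longrightarrow> y \<in> j ` M"
  shows "\<exists>A\<in>N.
    membership.elts N EN A =
      {x \<in> N. membership.func_into N EN x (j lam) (j lam) \<and>
              sat N EN \<phi> (\<lambda>i. if i = 0 then x else z)} \<and>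
    membership.perfect_set_property N EN (j lam) A"
proof -
 interpret zfc M E by unfold_locales (rule assms(1))
 interpret l: levy M E lam mu G
 proof unfold_locales
  show "reg lam" unfolding reg_def using assms(2,3) by blast
  show "lam el mu" using assms(2,6) unfolding elts_def by blast
 qed (use assms in blast)+
 have PC: "Col lam mu = elts l.PC" by (rule l.elts_PC[symmetric])
 have N: "N = l.N" and EN: "EN = l.EN" unfolding N_def EN_def l.N_def l.EN_def PC by (rule refl)+
 have j: "j x = l.j x" if "x : M" for x unfolding j_def l.Col_one_zero PC by (rule l.ext_embed_j[OF that])
 have jl: "j lam = l.j lam" and jM: "j ` M = l.j ` M" using j assms(2) by auto
 show ?thesis unfolding N EN jl by (rule l.psp[OF assms(11)]) (use assms(12-14) in \<open>unfold N EN jl jM, blast+\<close>)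
qed

end
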